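(* Let $1\leq p<\infty$. Then there exist positive constants $\delta=\delta(p)$ and $\eta=\eta(p)$ such that if $f\in\dot{B}_{p,1}^{2/p-1}(\mathbb{R}^2)$ satisfies $\|f\|_{\dot{B}_{p,1}^{2/p-1}}\leq\delta$, then the stationary quasi-geostrophic equation with critical dissipation ($\alpha=1/2$) $$(-\Delta)^{1/2}\theta+v\cdot\nabla\theta=f,\qquad v=\nabla^{\perp}(-\Delta)^{-1/2}\theta,\qquad x\in\mathbb{R}^2,$$ admits a unique solution $\theta\in\dot{B}_{p,1}^{2/p}(\mathbb{R}^2)$ with $\|\theta\|_{\dot{B}_{p,1}^{2/p}}\leq\eta$. Moreover, the data-to-solution map $S:f\mapsto\theta$ (defined for such small $f$) is Lipschitz continuous from $\dot{B}_{p,1}^{2/p-1}(\mathbb{R}^2)$ to $\dot{B}_{p,1}^{2/p}(\mathbb{R}^2)$.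
   Context: Notation. $(-\Delta)^{s}:=\mathscr{F}^{-1}|\xi|^{2s}\mathscr{F}$ for $s\in\mathbb{R}$, where $\mathscr F$ is the Fourier transform, and $\nabla^{\perp}:=(\partial_{x_2},-\partial_{x_1})$. $\dot{B}_{p,q}^{s}(\mathbb{R}^2)$ denotes the usual homogeneous Besov space with norm $\|f\|_{\dot{B}^s_{p,q}}=\big\|\{2^{sj}\|\phi_j*f\|_{L^p}\}_{j\in\mathbb{Z}}\big\|_{\ell^q}$, where $\{\phi_j\}_{j\in\mathbb{Z}}$ are the Littlewood–Paley frequency cut-off functions (a homogeneous dyadic partition of unity in frequency). For the exponents used here ($s\leq 2/p$, $q=1$), its elements are regarded as tempered distributions $f$ with $f=\sum_{j\in\mathbb{Z}}\phi_j*f$ in $\mathscr{S}'(\mathbb{R}^2)$. The equation is understood in the sense of distributions; since $\operatorname{div}v=0$, $v\cdot\nabla\theta=\operatorname{div}(v\theta)$. *)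

theory Defs
  imports "HOL-Analysis.Analysis"
begin

type_synonym plane = "real ^ 2"
type_synonym distr = "(plane \<Rightarrow> complex) \<Rightarrow> complex"

section \<open>Schwartz functions and tempered distributions\<close>

definition pd :: "2 \<Rightarrow> (plane \<Rightarrow> complex) \<Rightarrow> plane \<Rightarrow> complex" where
  "pd k g x = frechet_derivative g (at x) (axis k 1)"

text \<open>The list \<open>ks\<close> plays the role of a multi-index. Frechet differentiability of all iterated
  partial derivatives is equivalent to smoothness.\<close>

definition schwartz :: "(plane \<Rightarrow> complex) \<Rightarrow> bool" where
  "schwartz g \<longleftrightarrow>
     (\<forall>ks. (\<forall>x. fold pd ks g differentiable (at x)) \<and>
           (\<forall>N::nat. bounded (range (\<lambda>x. (1 + norm x) ^ N * cmod (fold pd ks g x)))))"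

definition schwartz_seminorm :: "nat \<Rightarrow> (plane \<Rightarrow> complex) \<Rightarrow> real" where
  "schwartz_seminorm N g =
     (SUP (ks, x) \<in> {ks. length ks \<le> N} \<times> UNIV. (1 + norm x) ^ N * cmod (fold pd ks g x))"

text \<open>A distribution is a function on all functions \<open>plane \<Rightarrow> complex\<close> of which only the values on
  Schwartz functions matter. It is normalized to vanish elsewhere, so that HOL equality of tempered
  distributions is equality as functionals on the Schwartz space.\<close>

definition tempered :: "distr \<Rightarrow> bool" where
  "tempered u \<longleftrightarrow>
     (\<forall>g h. schwartz g \<longrightarrow> schwartz h \<longrightarrow> u (\<lambda>x. g x + h x) = u g + u h) \<and>
     (\<forall>c g. schwartz g \<longrightarrow> u (\<lambda>x. c * g x) = c * u g) \<and>
     (\<exists>C N. \<forall>g. schwartz g \<longrightarrow> cmod (u g) \<le> C * schwartz_seminorm N g) \<and>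
     (\<forall>g. \<not> schwartz g \<longrightarrow> u g = 0)"

definition pairing :: "(plane \<Rightarrow> complex) \<Rightarrow> (plane \<Rightarrow> complex) \<Rightarrow> complex" where
  "pairing h g = (\<integral>x. h x * g x \<partial>lborel)"

definition represents :: "(plane \<Rightarrow> complex) \<Rightarrow> distr \<Rightarrow> bool" where
  "represents h u \<longleftrightarrow>
     h \<in> borel_measurable borel \<and> bounded (range h) \<and> (\<forall>g. schwartz g \<longrightarrow> u g = pairing h g)"

definition conv :: "(plane \<Rightarrow> complex) \<Rightarrow> distr \<Rightarrow> plane \<Rightarrow> complex" where
  "conv h u x = u (\<lambda>y. h (x - y))"

section \<open>Fourier transform and Fourier multipliers\<close>

definition fourier :: "(plane \<Rightarrow> complex) \<Rightarrow> plane \<Rightarrow> complex" where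
  "fourier g \<xi> = (\<integral>x. cis (- (x \<bullet> \<xi>)) * g x \<partial>lborel)"

definition inv_fourier :: "(plane \<Rightarrow> complex) \<Rightarrow> plane \<Rightarrow> complex" where
  "inv_fourier g x = 1 / (2 * of_real pi)\<^sup>2 * (\<integral>\<xi>. cis (x \<bullet> \<xi>) * g \<xi> \<partial>lborel)"

text \<open>The operator \<open>(-\<Delta>)\<^sup>s\<close> on functions. The value \<open>0 powr _ = 0\<close> at the origin is irrelevant.\<close>

definition frac_lap :: "real \<Rightarrow> (plane \<Rightarrow> complex) \<Rightarrow> plane \<Rightarrow> complex" where
  "frac_lap s g = inv_fourier (\<lambda>\<xi>. of_real (norm \<xi> powr (2 * s)) * fourier g \<xi>)"

text \<open>Component \<open>k\<close> of \<open>\<nabla>\<^sup>\<bottom> = (\<partial>\<^sub>2, -\<partial>\<^sub>1)\<close>.\<close>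

definition perp_grad :: "2 \<Rightarrow> (plane \<Rightarrow> complex) \<Rightarrow> plane \<Rightarrow> complex" where
  "perp_grad k g = (if k = 1 then pd 2 g else (\<lambda>x. - pd 1 g x))"

section \<open>Littlewood--Paley decomposition and homogeneous Besov spaces\<close>

definition littlewood_paley :: "(plane \<Rightarrow> complex) \<Rightarrow> bool" where
  "littlewood_paley \<phi> \<longleftrightarrow>
     schwartz \<phi> \<and>
     (\<forall>\<xi>. fourier \<phi> \<xi> \<in> \<real> \<and> 0 \<le> Re (fourier \<phi> \<xi>) \<and> Re (fourier \<phi> \<xi>) \<le> 1) \<and>
     (\<forall>\<xi>. fourier \<phi> \<xi> \<noteq> 0 \<longrightarrow> 1 / 2 \<le> norm \<xi> \<and> norm \<xi> \<le> 2) \<and>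
     (\<forall>\<xi>. \<xi> \<noteq> 0 \<longrightarrow> ((\<lambda>j::int. fourier \<phi> (2 powi (- j) *\<^sub>R \<xi>)) has_sum 1) UNIV)"

text \<open>The function \<open>\<phi>\<^sub>j(x) = 2\<^bsup>2j\<^esup> \<phi>(2\<^sup>j x)\<close>, whose Fourier transform is that of \<open>\<phi>\<close> at \<open>2\<^bsup>-j\<^esup> \<xi>\<close>.\<close>

definition lp_block :: "(plane \<Rightarrow> complex) \<Rightarrow> int \<Rightarrow> plane \<Rightarrow> complex" where
  "lp_block \<phi> j x = of_real ((2 powi j)\<^sup>2) * \<phi> (2 powi j *\<^sub>R x)"

definition in_Lp :: "real \<Rightarrow> (plane \<Rightarrow> complex) \<Rightarrow> bool" where
  "in_Lp p g \<longleftrightarrow> g \<in> borel_measurable borel \<and> integrable lborel (\<lambda>x. cmod (g x) powr p)"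

definition Lp_norm :: "real \<Rightarrow> (plane \<Rightarrow> complex) \<Rightarrow> real" where
  "Lp_norm p g = (\<integral>x. cmod (g x) powr p \<partial>lborel) powr (1 / p)"

text \<open>Third index \<open>q = 1\<close> and \<open>1 \<le> p < \<infinity>\<close>; the realization by distributions with
  \<open>u = \<Sum>\<^sub>j \<phi>\<^sub>j * u\<close> is the appropriate one for \<open>s \<le> 2/p\<close>, where the series converges absolutely
  against every Schwartz function. The real number \<open>besov_norm\<close> is meaningful only on members of
  \<open>besov\<close>.\<close>

definition besov_norm :: "(plane \<Rightarrow> complex) \<Rightarrow> real \<Rightarrow> real \<Rightarrow> distr \<Rightarrow> real" where
  "besov_norm \<phi> p s u = (\<Sum>\<^sub>\<infinity>j::int. 2 powr (s * of_int j) * Lp_norm p (conv (lp_block \<phi> j) u))"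

definition besov :: "(plane \<Rightarrow> complex) \<Rightarrow> real \<Rightarrow> real \<Rightarrow> distr set" where
  "besov \<phi> p s = {u. tempered u \<and>
     (\<forall>j. in_Lp p (conv (lp_block \<phi> j) u)) \<and>
     (\<lambda>j::int. 2 powr (s * of_int j) * Lp_norm p (conv (lp_block \<phi> j) u)) summable_on UNIV \<and>
     (\<forall>g. schwartz g \<longrightarrow> ((\<lambda>j. pairing (conv (lp_block \<phi> j) u) g) has_sum u g) UNIV)}"

text \<open>A translation invariant operator \<open>A\<close> whose symbol may be singular at frequency \<open>0\<close> acts on
  \<open>u = \<Sum>\<^sub>j \<phi>\<^sub>j * u\<close> by \<open>A u = \<Sum>\<^sub>j (A \<phi>\<^sub>j) * u\<close>, the series being taken in the sense of tempered
  distributions.\<close>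

definition hom_op ::
    "(plane \<Rightarrow> complex) \<Rightarrow> ((plane \<Rightarrow> complex) \<Rightarrow> plane \<Rightarrow> complex) \<Rightarrow> distr \<Rightarrow> distr" where
  "hom_op \<phi> A u = (\<lambda>g. \<Sum>\<^sub>\<infinity>j::int. pairing (conv (A (lp_block \<phi> j)) u) g)"

section \<open>The stationary critical quasi-geostrophic equation\<close>

text \<open>The operator \<open>\<nabla>\<^sup>\<bottom>(-\<Delta>)\<^bsup>-1/2\<^esup>\<close> has to be applied as one multiplier of degree \<open>0\<close>: for \<open>\<theta>\<close> of
  regularity \<open>2/p\<close> the low frequency part of the series for \<open>(-\<Delta>)\<^bsup>-1/2\<^esup>\<theta>\<close> alone need not converge.\<close>

definition velocity :: "(plane \<Rightarrow> complex) \<Rightarrow> distr \<Rightarrow> 2 \<Rightarrow> distr" where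
  "velocity \<phi> \<theta> k = hom_op \<phi> (\<lambda>g. perp_grad k (frac_lap (-1/2) g)) \<theta>"

text \<open>The identity \<open>(-\<Delta>)\<^bsup>1/2\<^esup>\<theta> + div(v\<theta>) = f\<close> of distributions. The product \<open>v\<theta>\<close> is the pointwise
  product of the bounded functions \<open>V\<close> and \<open>\<Theta>\<close> representing \<open>v\<close> and \<open>\<theta>\<close>; these are unique up to null
  sets and exist for every \<open>\<theta>\<close> of regularity \<open>2/p\<close>, because this Besov space embeds into the bounded
  continuous functions.\<close>

definition qg_solution :: "(plane \<Rightarrow> complex) \<Rightarrow> distr \<Rightarrow> distr \<Rightarrow> bool" where
  "qg_solution \<phi> f \<theta> \<longleftrightarrow>
     (\<exists>\<Theta> V. represents \<Theta> \<theta> \<and> (\<forall>k. represents (V k) (velocity \<phi> \<theta> k)) \<and>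
        (\<forall>g. schwartz g \<longrightarrow>
           hom_op \<phi> (frac_lap (1/2)) \<theta> g - (\<Sum>k\<in>UNIV. pairing (\<lambda>x. V k x * \<Theta> x) (pd k g)) = f g))"

definition small_solution :: "(plane \<Rightarrow> complex) \<Rightarrow> real \<Rightarrow> real \<Rightarrow> distr \<Rightarrow> distr \<Rightarrow> bool" where
  "small_solution \<phi> p \<eta> f \<theta> \<longleftrightarrow>
     \<theta> \<in> besov \<phi> p (2 / p) \<and> besov_norm \<phi> p (2 / p) \<theta> \<le> \<eta> \<and> qg_solution \<phi> f \<theta>"

definition data_to_solution :: "(plane \<Rightarrow> complex) \<Rightarrow> real \<Rightarrow> real \<Rightarrow> distr \<Rightarrow> distr" where
  "data_to_solution \<phi> p \<eta> f = (THE \<theta>. small_solution \<phi> p \<eta> f \<theta>)"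

end

theory Submission
  imports Defs "HOL-Probability.Characteristic_Functions"
begin

text \<open>Applying \<open>(-\<Delta>)\<^bsup>-1/2\<^esup>\<close>, the equation becomes the fixed point equation
  \<open>\<theta> = (-\<Delta>)\<^bsup>-1/2\<^esup> f - (-\<Delta>)\<^bsup>-1/2\<^esup> div (v \<theta>)\<close> in the Besov space of regularity \<open>2/p\<close>. The operators
  \<open>\<nabla>\<^sup>\<bottom> (-\<Delta>)\<^bsup>-1/2\<^esup>\<close> and \<open>(-\<Delta>)\<^bsup>-1/2\<^esup> div\<close> have symbols that are homogeneous of degree \<open>0\<close> and smooth away from the
  origin, and \<open>(-\<Delta>)\<^bsup>-1/2\<^esup>\<close> maps regularity \<open>2/p - 1\<close> to \<open>2/p\<close>. All of them are bounded, because on a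
  Littlewood--Paley block they act as convolutions with rescaled copies of a fixed Schwartz function
  (\<open>block_estimates\<close>). The space of regularity \<open>2/p\<close> with third index \<open>1\<close> consists of bounded continuous
  functions and is closed under products (\<open>product_estimate\<close>), since \<open>2/p > 0\<close>. Hence the quadratic term is a
  bounded bilinear map of the space into itself. For small \<open>\<eta>\<close> it is a contraction on the ball of radius
  \<open>\<eta>\<close>, which yields the unique small solution and its Lipschitz dependence on \<open>f\<close>.

  The product estimate needs no paraproducts. The product of two blocks of frequencies \<open>2\<^sup>i\<close> and \<open>2\<^sup>k\<close> has
  frequencies at most of order \<open>2\<^bsup>max i k\<^esup>\<close>, and the weights \<open>2\<^bsup>2l/p\<^esup>\<close> of all blocks \<open>l\<close> up to \<open>max i k\<close> have a sum
  dominated by the last one. So it suffices to estimate each product by one factor in \<open>L\<^sup>p\<close> and the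
  other one in \<open>L\<^sup>\<infinity>\<close>.

  Two facts connect distributions with this calculus of functions. A tempered distribution commutes
  with the integral that defines a convolution of Schwartz functions (\<open>sconv_conv\<close>), so multipliers can be
  composed on the side of the kernels, where Fourier inversion and the convolution theorem apply. And
  the derivatives of a bounded function are the sum of their Littlewood--Paley blocks
  (\<open>divergence_pairing\<close>), so a fixed point satisfies the equation against every Schwartz function and not
  only against band-limited ones (\<open>weak_eq_iff_fixed_point\<close>).\<close>

section \<open>Calculus of Schwartz functions\<close>

lemma pd_eq: "(g has_derivative D) (at x) \<Longrightarrow> pd k g x = D (axis k 1)"
  using frechet_derivative_at[of g D x] by (simp add: pd_def)

lemma has_derivative_pd:
  assumes "g differentiable (at x)"
  shows "(g has_derivative (\<lambda>h. \<Sum>k\<in>UNIV. h $ k *\<^sub>R pd k g x)) (at x)"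
proof -
  let ?D = "frechet_derivative g (at x)"
  have D: "(g has_derivative ?D) (at x)"
    using assms frechet_derivative_works by blast
  have inv_half_lap: "linear ?D"
    using D has_derivative_linear by blast
  have "?D h = (\<Sum>k\<in>UNIV. h $ k *\<^sub>R pd k g x)" for h
  proof -
    have "h = (\<Sum>k\<in>UNIV. h $ k *\<^sub>R axis k 1)"
      using basis_expansion[of h] by (simp add: scalar_mult_eq_scaleR)
    then have "?D h = ?D (\<Sum>k\<in>UNIV. h $ k *\<^sub>R axis k 1)" by simp
    also have "\<dots> = (\<Sum>k\<in>UNIV. ?D (h $ k *\<^sub>R axis k 1))"
      by (rule linear_sum[OF inv_half_lap])
    also have "\<dots> = (\<Sum>k\<in>UNIV. h $ k *\<^sub>R pd k g x)"
      by (simp add: linear_cmul[OF inv_half_lap] pd_def)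
    finally show ?thesis .
  qed
  then have "?D = (\<lambda>h. \<Sum>k\<in>UNIV. h $ k *\<^sub>R pd k g x)" by (rule ext)
  then show ?thesis using D by simp
qed

lemma differentiableE:
  assumes "g differentiable (at x)"
  shows "(g has_derivative frechet_derivative g (at x)) (at x)"
  using assms frechet_derivative_works by blast

lemma pd_add:
  assumes "g differentiable (at x)" "h differentiable (at x)"
  shows "pd k (\<lambda>x. g x + h x) x = pd k g x + pd k h x"
  by (subst pd_eq[OF has_derivative_add[OF assms[THEN differentiableE]]]) (simp add: pd_def)

lemma pd_mult:
  assumes "g differentiable (at x)" "h differentiable (at x)"
  shows "pd k (\<lambda>x. g x * h x) x = g x * pd k h x + pd k g x * h x"
  by (subst pd_eq[OF has_derivative_mult[OF assms[THEN differentiableE]]]) (simp add: pd_def)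

lemma has_derivative_coord: "((\<lambda>x::plane. complex_of_real (x $ j)) has_derivative (\<lambda>h. of_real (h $ j))) (at x)"
  by (rule bounded_linear.has_derivative[OF bounded_linear_of_real])
     (rule bounded_linear.has_derivative[OF bounded_linear_vec_nth has_derivative_ident])

lemma pd_coord: "pd k (\<lambda>x. of_real (x $ j)) x = (if j = k then 1 else 0)"
  by (subst pd_eq[OF has_derivative_coord]) (simp add: axis_def)

lemma pd_const: "pd k (\<lambda>x. c) x = 0"
  by (subst pd_eq[OF has_derivative_const]) simp

lemma pd_cmult:
  assumes "g differentiable (at x)"
  shows "pd k (\<lambda>x. c * g x) x = c * pd k g x"
  by (subst pd_mult) (use assms in \<open>auto simp: pd_const\<close>)

definition rapid :: "(plane \<Rightarrow> complex) \<Rightarrow> bool" where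
  "rapid g \<longleftrightarrow> (\<forall>N::nat. \<exists>C. \<forall>x. (1 + norm x) ^ N * cmod (g x) \<le> C)"

lemma rapid_add:
  assumes "rapid g" "rapid h"
  shows "rapid (\<lambda>x. g x + h x)"
  unfolding rapid_def
proof
  fix N :: nat
  obtain A B where A: "\<And>x. (1 + norm x) ^ N * cmod (g x) \<le> A" and B: "\<And>x. (1 + norm x) ^ N * cmod (h x) \<le> B"
    using assms unfolding rapid_def by metis
  have "(1 + norm x) ^ N * cmod (g x + h x) \<le> A + B" for x
  proof -
    have "(1 + norm x) ^ N * cmod (g x + h x) \<le> (1 + norm x) ^ N * (cmod (g x) + cmod (h x))"
      by (intro mult_left_mono norm_triangle_ineq) auto
    then show ?thesis using A[of x] B[of x] by (simp add: distrib_left)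
  qed
  then show "\<exists>C. \<forall>x. (1 + norm x) ^ N * cmod (g x + h x) \<le> C" by blast
qed

lemma rapid_mult_bounded:
  assumes "rapid g" "\<And>x. cmod (h x) \<le> B"
  shows "rapid (\<lambda>x. h x * g x)"
  unfolding rapid_def
proof
  fix N :: nat
  obtain A where A: "\<And>x. (1 + norm x) ^ N * cmod (g x) \<le> A" using assms(1) unfolding rapid_def by metis
  have "(1 + norm x) ^ N * cmod (h x * g x) \<le> B * A" for x
  proof -
    have "cmod (h x) * ((1 + norm x) ^ N * cmod (g x)) \<le> B * A"
      by (intro mult_mono assms(2) A order_trans[OF norm_ge_zero assms(2)[of x]]) simp
    then show ?thesis by (simp add: norm_mult mult_ac)
  qed
  then show "\<exists>C. \<forall>x. (1 + norm x) ^ N * cmod (h x * g x) \<le> C" by blast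
qed

lemma rapid_coord:
  assumes "rapid g"
  shows "rapid (\<lambda>x. of_real (x $ j) * g x)"
  unfolding rapid_def
proof
  fix N :: nat
  obtain A where A: "\<And>x. (1 + norm x) ^ Suc N * cmod (g x) \<le> A" using assms unfolding rapid_def by metis
  have "(1 + norm x) ^ N * cmod (of_real (x $ j) * g x) \<le> A" for x
  proof -
    have "\<bar>x $ j\<bar> * cmod (g x) \<le> (1 + norm x) * cmod (g x)"
      using component_le_norm_cart[of x j] by (intro mult_right_mono) auto
    then have "(1 + norm x) ^ N * (\<bar>x $ j\<bar> * cmod (g x)) \<le> (1 + norm x) ^ N * ((1 + norm x) * cmod (g x))"
      by (intro mult_left_mono) auto
    then show ?thesis using A[of x] by (simp add: norm_mult mult_ac)
  qed
  then show "\<exists>C. \<forall>x. (1 + norm x) ^ N * cmod (of_real (x $ j) * g x) \<le> C" by blast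
qed

text \<open>The Schwartz condition speaks about all iterated derivatives. A class \<open>X\<close> that is closed under
  partial derivatives reduces it to the functions in \<open>X\<close> themselves, so that closure properties of
  the Schwartz space need no Leibniz formulas: it suffices to guess \<open>X\<close>.\<close>

lemma schwartz_class:
  assumes "g \<in> X"
    and "\<And>g x. g \<in> X \<Longrightarrow> g differentiable (at x)"
    and "\<And>g k. g \<in> X \<Longrightarrow> pd k g \<in> X"
    and "\<And>g. g \<in> X \<Longrightarrow> rapid g"
  shows "schwartz g"
proof -
  have "fold pd ks g \<in> X" for ks
    using assms(1) by (induction ks arbitrary: g) (auto intro: assms(3))
  moreover have "bounded (range (\<lambda>x. (1 + norm x) ^ N * cmod (g x)))" if gX: "g \<in> X" for g N
  proof -
    obtain C where C: "\<forall>x. (1 + norm x) ^ N * cmod (g x) \<le> C"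
      using assms(4)[OF gX] unfolding rapid_def by blast
    show ?thesis
      by (rule boundedI[where B=C]) (use C in \<open>auto simp: abs_mult\<close>)
  qed
  ultimately show ?thesis
    unfolding schwartz_def using assms(2) by blast
qed

lemma schwartz_pd: "schwartz g \<Longrightarrow> schwartz (pd k g)"
  unfolding schwartz_def
proof (intro allI)
  fix ks
  assume "\<forall>ks. (\<forall>x. fold pd ks g differentiable (at x)) \<and>
           (\<forall>N::nat. bounded (range (\<lambda>x. (1 + norm x) ^ N * cmod (fold pd ks g x))))"
  from this[rule_format, of "k # ks"]
  show "(\<forall>x. fold pd ks (pd k g) differentiable (at x)) \<and>
           (\<forall>N::nat. bounded (range (\<lambda>x. (1 + norm x) ^ N * cmod (fold pd ks (pd k g) x))))"
    by simp
qed

lemma schwartz_fold_pd: "schwartz g \<Longrightarrow> schwartz (fold pd ks g)"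
  by (induction ks arbitrary: g) (auto intro: schwartz_pd)

lemma schwartz_differentiable: "schwartz g \<Longrightarrow> g differentiable (at x)"
  unfolding schwartz_def by (drule_tac x="[]" in spec) simp

lemma schwartz_decay:
  assumes "schwartz g"
  obtains C where "C \<ge> 0" "\<And>x. (1 + norm x) ^ N * cmod (g x) \<le> C"
proof -
  have "bounded (range (\<lambda>x. (1 + norm x) ^ N * cmod (g x)))"
    using assms unfolding schwartz_def by (drule_tac x="[]" in spec) simp
  then obtain C where C: "\<And>x. \<bar>(1 + norm x) ^ N * cmod (g x)\<bar> \<le> C"
    unfolding bounded_iff by auto
  show ?thesis
    by (rule that[of C]) (use order_trans[OF abs_ge_zero C[of 0]] order_trans[OF abs_ge_self C] in auto)
qed

lemma schwartz_rapid: "schwartz g \<Longrightarrow> rapid g"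
  unfolding rapid_def using schwartz_decay by metis

lemma schwartz_continuous: "schwartz g \<Longrightarrow> continuous_on A g"
  by (meson continuous_at_imp_continuous_on differentiable_imp_continuous_within schwartz_differentiable)

lemma schwartz_measurable [measurable_dest]: "schwartz g \<Longrightarrow> g \<in> borel_measurable borel"
  by (simp add: borel_measurable_continuous_onI schwartz_continuous)

lemma schwartz_add:
  assumes "schwartz g" "schwartz h"
  shows "schwartz (\<lambda>x. g x + h x)"
proof (rule schwartz_class[where X="{\<lambda>x. g x + h x | g h. schwartz g \<and> schwartz h}"])
  fix f assume "f \<in> {\<lambda>x. g x + h x | g h. schwartz g \<and> schwartz h}"
  then obtain g h where f: "f = (\<lambda>x. g x + h x)" and gh: "schwartz g" "schwartz h" by auto
  note d = gh[THEN schwartz_differentiable]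
  show "f differentiable (at x)" for x unfolding f using d by simp
  show "pd k f \<in> {\<lambda>x. g x + h x | g h. schwartz g \<and> schwartz h}" for k
  proof -
    have "pd k f = (\<lambda>x. pd k g x + pd k h x)" unfolding f by (rule ext) (simp only: pd_add d)
    then show ?thesis using gh schwartz_pd by blast
  qed
  show "rapid f" unfolding f by (intro rapid_add schwartz_rapid gh)
qed (use assms in blast)

lemma schwartz_cmult:
  assumes "schwartz g"
  shows "schwartz (\<lambda>x. c * g x)"
proof (rule schwartz_class[where X="{\<lambda>x. c * g x | g. schwartz g}"])
  fix f assume "f \<in> {\<lambda>x. c * g x | g. schwartz g}"
  then obtain g where f: "f = (\<lambda>x. c * g x)" and g: "schwartz g" by auto
  note d = g[THEN schwartz_differentiable]
  show "f differentiable (at x)" for x unfolding f using d by simp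
  show "pd k f \<in> {\<lambda>x. c * g x | g. schwartz g}" for k
  proof -
    have "pd k f = (\<lambda>x. c * pd k g x)" unfolding f by (rule ext) (simp only: pd_cmult d)
    then show ?thesis using g schwartz_pd by blast
  qed
  show "rapid f" unfolding f by (rule rapid_mult_bounded[OF schwartz_rapid[OF g] order_refl])
qed (use assms in blast)

lemma schwartz_0: "schwartz (\<lambda>x. 0)"
  proof -
  have "pd k (\<lambda>x. 0) = (\<lambda>x. 0)" for k by (rule ext) (rule pd_const)
  then show ?thesis by (intro schwartz_class[where X="{\<lambda>x. 0}"]) (auto simp: rapid_def)
qed

lemma schwartz_minus: "schwartz g \<Longrightarrow> schwartz (\<lambda>x. - g x)"
  using schwartz_cmult[of g "-1"] by simp

lemma schwartz_diff: "schwartz g \<Longrightarrow> schwartz h \<Longrightarrow> schwartz (\<lambda>x. g x - h x)"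
  using schwartz_add[of g "\<lambda>x. - h x"] schwartz_minus[of h] by simp

lemma schwartz_sum:
  "(\<And>i. i \<in> I \<Longrightarrow> schwartz (g i)) \<Longrightarrow> schwartz (\<lambda>x. \<Sum>i\<in>I. g i x)"
  by (induction I rule: infinite_finite_induct) (auto simp: schwartz_0 intro: schwartz_add)

text \<open>The class of products alone is not closed under the Leibniz rule.\<close>

inductive_set product_span :: "(plane \<Rightarrow> complex) set" where
  prod: "schwartz g \<Longrightarrow> schwartz h \<Longrightarrow> (\<lambda>x. g x * h x) \<in> product_span"
| plus: "f \<in> product_span \<Longrightarrow> f' \<in> product_span \<Longrightarrow> (\<lambda>x. f x + f' x) \<in> product_span"

lemma product_span_differentiable: "f \<in> product_span \<Longrightarrow> f differentiable (at x)"
  by (induction rule: product_span.induct) (auto intro: differentiable_mult schwartz_differentiable)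

lemma schwartz_mult:
  assumes "schwartz g" "schwartz h"
  shows "schwartz (\<lambda>x. g x * h x)"
proof (rule schwartz_class[where X=product_span])
  fix f assume f: "f \<in> product_span"
  show "f differentiable (at x)" for x using product_span_differentiable[OF f] .
  show "pd k f \<in> product_span" for k
    using f
  proof induction
    case (prod g h)
    have "pd k (\<lambda>x. g x * h x) = (\<lambda>x. g x * pd k h x + pd k g x * h x)"
      by (rule ext) (simp only: pd_mult schwartz_differentiable prod)
    then show ?case using prod by (auto intro!: product_span.intros schwartz_pd)
  next
    case (plus f f')
    have "pd k (\<lambda>x. f x + f' x) = (\<lambda>x. pd k f x + pd k f' x)"
      by (rule ext) (simp only: pd_add product_span_differentiable[OF plus(1)] product_span_differentiable[OF plus(2)])
    then show ?case using plus by (auto intro!: product_span.intros)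
  qed
  show "rapid f"
    using f
  proof induction
    case (prod g h)
    obtain B where "\<And>x. (1 + norm x) ^ 0 * cmod (g x) \<le> B" using schwartz_decay[OF prod(1)] by metis
    then show ?case by (intro rapid_mult_bounded[OF schwartz_rapid[OF prod(2)], of g B]) simp
  qed (rule rapid_add)
qed (use assms in \<open>auto intro: product_span.intros\<close>)

lemma schwartz_coord:
  assumes "schwartz g"
  shows "schwartz (\<lambda>x. of_real (x $ j) * g x)"
proof (rule schwartz_class[where X="{\<lambda>x. of_real (x $ j) * g x + h x | g h. schwartz g \<and> schwartz h}"])
  fix f assume "f \<in> {\<lambda>x. of_real (x $ j) * g x + h x | g h. schwartz g \<and> schwartz h}"
  then obtain g h where f: "f = (\<lambda>x. of_real (x $ j) * g x + h x)" and gh: "schwartz g" "schwartz h" by auto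
  note d = gh[THEN schwartz_differentiable]
  have c: "(\<lambda>x::plane. complex_of_real (x $ j)) differentiable (at x)" for x
    using has_derivative_coord unfolding differentiable_def by blast
  have dd: "(\<lambda>x. of_real (x $ j) * g x) differentiable (at x)" for x
    using c d by (intro differentiable_mult)
  show "f differentiable (at x)" for x unfolding f using dd d by simp
  show "pd k f \<in> {\<lambda>x. of_real (x $ j) * g x + h x | g h. schwartz g \<and> schwartz h}" for k
  proof -
    have "pd k f = (\<lambda>x. of_real (x $ j) * pd k g x + ((if j = k then 1 else 0) * g x + pd k h x))"
      unfolding f by (rule ext) (simp only: pd_add[OF dd d(2)] pd_mult[OF c d(1)] pd_coord add.assoc)
    moreover have "schwartz (\<lambda>x. (if j = k then 1 else 0) * g x + pd k h x)"
      by (intro schwartz_add schwartz_cmult schwartz_pd gh)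
    moreover have "schwartz (pd k g)" using gh schwartz_pd by blast
    ultimately show ?thesis
      unfolding mem_Collect_eq by (intro exI[of _ "pd k g"] exI[of _ "\<lambda>x. (if j = k then 1 else 0) * g x + pd k h x"] conjI)
  qed
  show "rapid f" unfolding f by (intro rapid_add rapid_coord schwartz_rapid gh)
next
  have "(\<lambda>x. of_real (x $ j) * g x) = (\<lambda>x. of_real (x $ j) * g x + 0)" by simp
  then show "(\<lambda>x. of_real (x $ j) * g x) \<in> {\<lambda>x. of_real (x $ j) * g x + h x | g h. schwartz g \<and> schwartz h}"
    unfolding mem_Collect_eq by (intro exI[of _ g] exI[of _ "\<lambda>x. 0"] conjI assms schwartz_0)
qed

lemma one_plus_affine_bound:
  fixes a x :: "'a::real_normed_vector"
  assumes "c \<noteq> 0"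
  shows "1 + norm x \<le> (1 + (1 + norm a) / \<bar>c\<bar>) * (1 + norm (c *\<^sub>R x + a))"
proof -
  have "\<bar>c\<bar> * norm x = norm ((c *\<^sub>R x + a) - a)" by simp
  also have "\<dots> \<le> norm (c *\<^sub>R x + a) + norm a" by (rule norm_triangle_ineq4)
  finally have "norm x \<le> (norm (c *\<^sub>R x + a) + norm a) / \<bar>c\<bar>"
    using assms by (simp add: field_simps)
  also have "\<dots> \<le> (1 + norm a) / \<bar>c\<bar> * (1 + norm (c *\<^sub>R x + a))"
    using assms by (simp add: field_simps)
  also have "\<dots> \<le> (1 + (1 + norm a) / \<bar>c\<bar>) * (1 + norm (c *\<^sub>R x + a)) - 1"
    by (simp add: distrib_right)
  finally show ?thesis by simp
qed

lemma has_derivative_affine: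
  assumes "(g has_derivative D) (at (c *\<^sub>R x + a))"
  shows "((\<lambda>x. g (c *\<^sub>R x + a)) has_derivative (\<lambda>h. D (c *\<^sub>R h))) (at x)"
proof -
  have "((\<lambda>x. c *\<^sub>R x + a) has_derivative (\<lambda>h. c *\<^sub>R h)) (at x)"
    by (auto intro!: derivative_eq_intros)
  from has_derivative_compose[OF this assms] show ?thesis .
qed

lemma pd_affine:
  assumes "g differentiable (at (c *\<^sub>R x + a))"
  shows "pd k (\<lambda>x. g (c *\<^sub>R x + a)) x = of_real c * pd k g (c *\<^sub>R x + a)"
proof -
  have D: "(g has_derivative frechet_derivative g (at (c *\<^sub>R x + a))) (at (c *\<^sub>R x + a))"
    using assms differentiableE by blast
  show ?thesis
    unfolding pd_eq[OF has_derivative_affine[OF D]]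
    by (simp only: pd_def linear_cmul[OF has_derivative_linear[OF D]]) (rule scaleR_conv_of_real)
qed

lemma schwartz_affine:
  assumes "schwartz g" and c: "c \<noteq> 0"
  shows "schwartz (\<lambda>x. g (c *\<^sub>R x + a))"
proof (rule schwartz_class[where X="{\<lambda>x. g (c *\<^sub>R x + a) | g. schwartz g}"])
  fix f assume "f \<in> {\<lambda>x. g (c *\<^sub>R x + a) | g. schwartz g}"
  then obtain g where f: "f = (\<lambda>x. g (c *\<^sub>R x + a))" and g: "schwartz g" by auto
  note d = g[THEN schwartz_differentiable]
  show "f differentiable (at x)" for x
    unfolding f using has_derivative_affine[OF differentiableE[OF d]] unfolding differentiable_def by blast
  show "pd k f \<in> {\<lambda>x. g (c *\<^sub>R x + a) | g. schwartz g}" for k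
  proof -
    have "pd k f = (\<lambda>x. (\<lambda>y. of_real c * pd k g y) (c *\<^sub>R x + a))" unfolding f by (rule ext) (simp only: pd_affine d)
    moreover have "schwartz (\<lambda>y. of_real c * pd k g y)" using schwartz_cmult[OF schwartz_pd[OF g]] .
    ultimately show ?thesis unfolding mem_Collect_eq by (intro exI[of _ "\<lambda>y. of_real c * pd k g y"] conjI)
  qed
  show "rapid f"
    unfolding rapid_def
  proof
    fix N :: nat
    obtain A where A: "\<And>x. (1 + norm x) ^ N * cmod (g x) \<le> A" using schwartz_decay[OF g] by metis
    let ?K = "1 + (1 + norm a) / \<bar>c\<bar>"
    have "(1 + norm x) ^ N * cmod (f x) \<le> ?K ^ N * A" for x
    proof -
      have "(1 + norm x) ^ N \<le> ?K ^ N * (1 + norm (c *\<^sub>R x + a)) ^ N"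
        unfolding power_mult_distrib[symmetric]
        by (rule power_mono) (use one_plus_affine_bound[OF c] in auto)
      then have "(1 + norm x) ^ N * cmod (f x) \<le> (?K ^ N * (1 + norm (c *\<^sub>R x + a)) ^ N) * cmod (f x)"
        by (rule mult_right_mono) auto
      also have "\<dots> = ?K ^ N * ((1 + norm (c *\<^sub>R x + a)) ^ N * cmod (f x))" by simp
      also have "\<dots> \<le> ?K ^ N * A"
        unfolding f by (intro mult_left_mono A) (auto intro!: zero_le_power add_nonneg_nonneg)
      finally show ?thesis .
    qed
    then show "\<exists>C. \<forall>x. (1 + norm x) ^ N * cmod (f x) \<le> C" by blast
  qed
qed (use assms in blast)

lemma schwartz_reflect: "schwartz g \<Longrightarrow> schwartz (\<lambda>y. g (x - y))"
  using schwartz_affine[of g "-1" x] by simp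

lemma schwartz_scale: "schwartz g \<Longrightarrow> c \<noteq> 0 \<Longrightarrow> schwartz (\<lambda>y. g (c *\<^sub>R y))"
  using schwartz_affine[of g c 0] by simp

lemma fold_pd_cmult:
  assumes "schwartz g"
  shows "fold pd ks (\<lambda>x. b * g x) z = b * fold pd ks g z"
  using assms
proof (induction ks arbitrary: g)
  case (Cons k ks)
  have "pd k (\<lambda>x. b * g x) = (\<lambda>x. b * pd k g x)"
    by (rule ext) (simp only: pd_cmult schwartz_differentiable Cons.prems)
  then show ?case using Cons.IH[OF schwartz_pd[OF Cons.prems]] by simp
qed simp

lemma fold_pd_affine:
  assumes "schwartz g"
  shows "fold pd ks (\<lambda>x. g (c *\<^sub>R x + a)) z = of_real c ^ length ks * fold pd ks g (c *\<^sub>R z + a)"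
  using assms
proof (induction ks arbitrary: g)
  case (Cons k ks)
  have "pd k (\<lambda>x. g (c *\<^sub>R x + a)) = (\<lambda>x. (\<lambda>y. of_real c * pd k g y) (c *\<^sub>R x + a))"
    by (rule ext) (simp only: pd_affine schwartz_differentiable Cons.prems)
  then show ?case
    using Cons.IH[OF schwartz_cmult[OF schwartz_pd[OF Cons.prems]]] Cons.prems
    by (simp add: schwartz_pd fold_pd_cmult)
qed simp

lemma fold_pd_add:
  assumes "schwartz g" "schwartz h"
  shows "fold pd ks (\<lambda>x. g x + h x) z = fold pd ks g z + fold pd ks h z"
  using assms
proof (induction ks arbitrary: g h)
  case (Cons k ks)
  have "pd k (\<lambda>x. g x + h x) = (\<lambda>x. pd k g x + pd k h x)"
    by (rule ext) (simp only: pd_add schwartz_differentiable Cons.prems)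
  then show ?case using Cons.IH Cons.prems schwartz_pd by simp
qed simp

lemma fold_pd_diff:
  assumes "schwartz g" "schwartz h"
  shows "fold pd ks (\<lambda>x. g x - h x) z = fold pd ks g z - fold pd ks h z"
  using fold_pd_add[OF assms(1) schwartz_cmult[OF assms(2), of "-1"], of ks z]
    fold_pd_cmult[OF assms(2), of ks "-1" z] by simp

lemma fold_pd_sum:
  assumes "finite I" "\<And>i. i \<in> I \<Longrightarrow> schwartz (g i)"
  shows "fold pd ks (\<lambda>x. \<Sum>i\<in>I. g i x) z = (\<Sum>i\<in>I. fold pd ks (g i) z)"
  using assms
proof (induction I)
  case empty
  show ?case using fold_pd_cmult[OF schwartz_0, of ks 0 z] by simp
next
  case (insert i I)
  then show ?case by (simp add: fold_pd_add schwartz_sum)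
qed

section \<open>Integration over the plane\<close>

text \<open>An integrable weight that dominates every Schwartz function.\<close>

definition \<omega> :: "plane \<Rightarrow> real" where "\<omega> x = 1 / (1 + norm x) ^ 4"

lemma one_plus_norm_pos: "1 + norm x > 0"
  using norm_ge_zero[of x] by linarith

lemma one_plus_norm_neq_0 [simp]: "1 + norm x \<noteq> 0"
  using one_plus_norm_pos[of x] by simp

lemma omega_pos: "\<omega> x > 0"
  by (simp add: \<omega>_def one_plus_norm_pos)

lemma omega_nonneg [simp]: "\<omega> x \<ge> 0"
  using omega_pos[of x] by simp

lemma omega_measurable [measurable]: "\<omega> \<in> borel_measurable borel"
  unfolding \<omega>_def by measurable

lemma nn_integral_inverse_square: "(\<integral>\<^sup>+x. ennreal (1 / (1 + x\<^sup>2)) \<partial>lborel) < \<infinity>"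
proof -
  let ?f = "\<lambda>x::real. 1 / (1 + x\<^sup>2)"
  have pos: "1 + x\<^sup>2 > 0" for x :: real by (simp add: add_pos_nonneg)
  have half: "(\<integral>\<^sup>+x. ennreal (?f x) * indicator {0..} x \<partial>lborel) = ennreal (pi / 2 - arctan 0)"
    by (rule nn_integral_FTC_atLeast)
       (use pos in \<open>auto intro!: derivative_eq_intros tendsto_arctan_at_top simp: inverse_eq_divide\<close>)
  have half': "(\<integral>\<^sup>+x. ennreal (?f x) * indicator {..0} x \<partial>lborel) = (\<integral>\<^sup>+x. ennreal (?f x) * indicator {0..} x \<partial>lborel)"
    by (subst nn_integral_real_affine[where c="-1" and t=0])
       (auto intro!: nn_integral_cong split: split_indicator)
  have "(\<integral>\<^sup>+x. ennreal (?f x) \<partial>lborel)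
     \<le> (\<integral>\<^sup>+x. ennreal (?f x) * indicator {0..} x + ennreal (?f x) * indicator {..0} x \<partial>lborel)"
    by (intro nn_integral_mono) (auto split: split_indicator)
  also have "\<dots> = (\<integral>\<^sup>+x. ennreal (?f x) * indicator {0..} x \<partial>lborel) + (\<integral>\<^sup>+x. ennreal (?f x) * indicator {..0} x \<partial>lborel)"
    by (rule nn_integral_add) auto
  also have "\<dots> < \<infinity>"
    unfolding half' half by (simp add: ennreal_plus[symmetric] del: ennreal_plus)
  finally show ?thesis .
qed

text \<open>The weight is at most the product of \<open>1 / (1 + x\<^sub>b\<^sup>2)\<close> over the two coordinates.\<close>

lemma omega_integrable: "integrable lborel \<omega>"
proof (rule integrableI_bounded)
  have le: "\<omega> x \<le> (\<Prod>b\<in>Basis. 1 / (1 + (x \<bullet> b)\<^sup>2))" for x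
  proof -
    have "(\<Prod>b\<in>(Basis::plane set). 1 + (x \<bullet> b)\<^sup>2) \<le> (\<Prod>b\<in>(Basis::plane set). (1 + norm x)\<^sup>2)"
    proof (rule prod_mono, intro conjI)
      fix b :: plane assume "b \<in> Basis"
      then have "\<bar>x \<bullet> b\<bar> \<le> norm x" by (rule Basis_le_norm)
      then have "(x \<bullet> b)\<^sup>2 \<le> (norm x)\<^sup>2" by (simp add: power2_le_iff_abs_le)
      then show "1 + (x \<bullet> b)\<^sup>2 \<le> (1 + norm x)\<^sup>2" using norm_ge_zero[of x] using mult_nonneg_nonneg[of 2 "norm x"] norm_ge_zero[of x]
        unfolding power2_sum by (simp add: add_increasing2)
    qed auto
    also have "\<dots> = (1 + norm x) ^ 4" by (simp add: power_mult[symmetric])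
    finally have "1 / (1 + norm x) ^ 4 \<le> 1 / (\<Prod>b\<in>(Basis::plane set). 1 + (x \<bullet> b)\<^sup>2)"
      by (intro divide_left_mono mult_pos_pos prod_pos) (auto simp: add_pos_nonneg)
    then show ?thesis by (simp add: \<omega>_def prod_dividef)
  qed
  have "(\<integral>\<^sup>+x. ennreal (norm (\<omega> x)) \<partial>lborel) \<le> (\<integral>\<^sup>+x. (\<Prod>b\<in>Basis. ennreal (1 / (1 + (x \<bullet> b)\<^sup>2))) \<partial>(lborel::plane measure))"
    using le by (intro nn_integral_mono) (auto simp: prod_ennreal intro!: ennreal_leI)
  also have "\<dots> = (\<Prod>b\<in>(Basis::plane set). (\<integral>\<^sup>+x. ennreal (1 / (1 + x\<^sup>2)) \<partial>lborel))"
    by (rule nn_integral_lborel_prod) auto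
  also have "\<dots> < \<infinity>"
    using nn_integral_inverse_square by (simp add: power_less_top_ennreal)
  finally show "(\<integral>\<^sup>+x. ennreal (norm (\<omega> x)) \<partial>lborel) < \<infinity>" .
qed measurable

lemma schwartz_omega_bound:
  assumes "schwartz g"
  obtains C where "C \<ge> 0" "\<And>x. (1 + norm x) ^ N * cmod (g x) \<le> C * \<omega> x"
proof -
  obtain C where C: "C \<ge> 0" "\<And>x. (1 + norm x) ^ (N + 4) * cmod (g x) \<le> C"
    using schwartz_decay[OF assms] by metis
  have "(1 + norm x) ^ N * cmod (g x) \<le> C * \<omega> x" for x
  proof -
    have "(1 + norm x) ^ 4 > 0" by (simp add: one_plus_norm_pos)
    then show ?thesis using C(2)[of x] by (simp add: \<omega>_def field_simps power_add)
  qed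
  with C(1) show ?thesis using that by blast
qed

lemma schwartz_poly_integrable:
  assumes "schwartz g"
  shows "integrable lborel (\<lambda>x. (1 + norm x) ^ N * cmod (g x))"
proof -
  obtain C where C: "C \<ge> 0" "\<And>x. (1 + norm x) ^ N * cmod (g x) \<le> C * \<omega> x"
    using schwartz_omega_bound[OF assms] by metis
  note [measurable] = schwartz_measurable[OF assms]
  show ?thesis
    by (rule Bochner_Integration.integrable_bound[OF integrable_mult_right[OF omega_integrable, of C]])
       (use C in \<open>auto simp: abs_mult\<close>)
qed

lemma schwartz_integrable:
  assumes "schwartz g"
  shows "integrable lborel g"
proof -
  note [measurable] = schwartz_measurable[OF assms]
  show ?thesis
    by (rule Bochner_Integration.integrable_bound[OF schwartz_poly_integrable[OF assms, of 0]]) auto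
qed

lemma schwartz_bounded:
  assumes "schwartz g"
  obtains C where "C \<ge> 0" "\<And>x. cmod (g x) \<le> C"
  using schwartz_decay[OF assms, of 0] by auto

section \<open>Affine changes of variables\<close>

lemma nn_integral_plane_affine:
  assumes [measurable]: "f \<in> borel_measurable borel" and c: "c \<noteq> 0"
  shows "(\<integral>\<^sup>+x. f x \<partial>lborel) = ennreal (c\<^sup>2) * (\<integral>\<^sup>+x. f (t + c *\<^sub>R (x::plane)) \<partial>lborel)"
  by (subst lborel_affine[OF c, of t])
     (simp add: nn_integral_density nn_integral_distr nn_integral_cmult)

lemma integral_plane_affine:
  fixes f :: "plane \<Rightarrow> complex"
  assumes [measurable]: "f \<in> borel_measurable borel" and c: "c \<noteq> 0"
  shows "(\<integral>x. f x \<partial>lborel) = of_real (c\<^sup>2) * (\<integral>x. f (t + c *\<^sub>R x) \<partial>lborel)"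
  by (subst lborel_affine[OF c, of t])
     (simp add: integral_density integral_distr scaleR_conv_of_real[where 'a=complex])

lemma integrable_plane_affine:
  fixes f :: "plane \<Rightarrow> complex"
  assumes [measurable]: "f \<in> borel_measurable borel" and c: "c \<noteq> 0" and i: "integrable lborel f"
  shows "integrable lborel (\<lambda>x. f (t + c *\<^sub>R x))"
proof -
  have "(\<integral>\<^sup>+x. ennreal (norm (f x)) \<partial>lborel) < \<infinity>"
    using i by (simp add: integrable_iff_bounded)
  then have "ennreal (c\<^sup>2) * (\<integral>\<^sup>+x. ennreal (norm (f (t + c *\<^sub>R x))) \<partial>lborel) < \<infinity>"
    by (subst (asm) nn_integral_plane_affine[OF _ c, of _ t]) auto
  then have "(\<integral>\<^sup>+x. ennreal (norm (f (t + c *\<^sub>R x))) \<partial>lborel) < \<infinity>"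
    using c by (auto simp: ennreal_mult_less_top)
  then show ?thesis by (intro integrableI_bounded) auto
qed

lemma integral_reflect:
  fixes f :: "plane \<Rightarrow> complex"
  assumes "f \<in> borel_measurable borel"
  shows "(\<integral>y. f (x - y) \<partial>lborel) = (\<integral>y. f y \<partial>lborel)"
  using integral_plane_affine[OF assms, of "-1" x] by simp

lemma integral_translate:
  fixes f :: "plane \<Rightarrow> complex"
  assumes "f \<in> borel_measurable borel"
  shows "(\<integral>y. f (y - x) \<partial>lborel) = (\<integral>y. f y \<partial>lborel)"
  using integral_plane_affine[OF assms, of "1" "-x"] by simp

lemma integral_norm_reflect:
  fixes f :: "plane \<Rightarrow> complex"
  assumes [measurable]: "f \<in> borel_measurable borel"
  shows "(\<integral>\<^sup>+y. ennreal (cmod (f (x - y))) \<partial>lborel) = (\<integral>\<^sup>+y. ennreal (cmod (f y)) \<partial>lborel)"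
  using nn_integral_plane_affine[of "\<lambda>y. ennreal (cmod (f y))" "-1" x] by simp

lemma integrable_reflect:
  fixes f :: "plane \<Rightarrow> complex"
  assumes "integrable lborel f"
  shows "integrable lborel (\<lambda>y. f (x - y))"
  using integrable_plane_affine[of f "-1" x] assms by (simp add: borel_measurable_integrable)

section \<open>Integration by parts\<close>

lemma segment_derivative_bound:
  fixes f :: "real \<Rightarrow> complex"
  assumes "\<And>s. \<bar>s\<bar> \<le> \<bar>t\<bar> \<Longrightarrow> (f has_derivative (\<lambda>h. h *\<^sub>R f' s)) (at s)"
    and "\<And>s. \<bar>s\<bar> \<le> \<bar>t\<bar> \<Longrightarrow> cmod (f' s) \<le> B"
  shows "cmod (f t - f 0) \<le> B * \<bar>t\<bar>"
proof -
  have "norm (f t - f 0) \<le> B * norm (t - 0)"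
  proof (rule differentiable_bound[where S="{-\<bar>t\<bar>..\<bar>t\<bar>}" and f'="\<lambda>s h. h *\<^sub>R f' s"])
    fix s assume s: "s \<in> {-\<bar>t\<bar>..\<bar>t\<bar>}"
    show "(f has_derivative (\<lambda>h. h *\<^sub>R f' s)) (at s within {- \<bar>t\<bar>..\<bar>t\<bar>})"
      by (rule has_derivative_at_withinI, rule assms(1)) (use s in auto)
    show "onorm (\<lambda>h. h *\<^sub>R f' s) \<le> B"
      using assms(2)[of s] s
      by (intro onorm_le) (auto simp: mult.commute[of B] intro!: mult_left_mono)
  qed auto
  then show ?thesis by simp
qed

lemma has_derivative_line:
  fixes g :: "plane \<Rightarrow> complex"
  assumes "g differentiable (at (x + s *\<^sub>R axis k 1))"
  shows "((\<lambda>s. g (x + s *\<^sub>R axis k 1)) has_derivative (\<lambda>h. h *\<^sub>R pd k g (x + s *\<^sub>R axis k 1))) (at s)"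
proof -
  have D: "(g has_derivative frechet_derivative g (at (x + s *\<^sub>R axis k 1))) (at (x + s *\<^sub>R axis k 1))"
    using assms by (rule differentiableE)
  have "((\<lambda>s. x + s *\<^sub>R axis k 1) has_derivative (\<lambda>h. h *\<^sub>R axis k 1)) (at s)"
    by (auto intro!: derivative_eq_intros)
  from has_derivative_compose[OF this D]
  show ?thesis
    by (simp only: pd_def linear_cmul[OF has_derivative_linear[OF D]])
qed

lemma omega_shift:
  assumes "norm v \<le> 1"
  shows "\<omega> (x + v) \<le> 16 * \<omega> x"
proof -
  have "1 + norm x \<le> 2 * (1 + norm (x + v))"
    using norm_triangle_ineq4[of "x + v" v] assms norm_ge_zero[of "x + v"] unfolding add_diff_cancel_right' by argo
  then have "(1 + norm x) ^ 4 \<le> (2 * (1 + norm (x + v))) ^ 4"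
    by (intro power_mono) auto
  then have le: "(1 + norm x) ^ 4 \<le> 16 * (1 + norm (x + v)) ^ 4"
    by (simp only: power_mult_distrib) simp
  have "(1 + norm (x + v)) ^ 4 > 0" "(1 + norm x) ^ 4 > 0"
    by (auto simp: one_plus_norm_pos)
  then show ?thesis using le unfolding \<omega>_def by (simp add: divide_simps mult_ac)
qed

lemma schwartz_increment_bound:
  assumes "schwartz g"
  obtains C where "C \<ge> 0" "\<And>x t. \<bar>t\<bar> \<le> 1 \<Longrightarrow> cmod (g (x + t *\<^sub>R axis k 1) - g x) \<le> C * \<omega> x * \<bar>t\<bar>"
proof -
  obtain C where C: "C \<ge> 0" "\<And>x. cmod (pd k g x) \<le> C * \<omega> x"
    using schwartz_omega_bound[OF schwartz_pd[OF assms], of 0] by auto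
  have "cmod (g (x + t *\<^sub>R axis k 1) - g x) \<le> (16 * C) * \<omega> x * \<bar>t\<bar>" if t: "\<bar>t\<bar> \<le> 1" for x t
  proof -
    have "cmod (g (x + t *\<^sub>R axis k 1) - g (x + 0 *\<^sub>R axis k 1)) \<le> (16 * C * \<omega> x) * \<bar>t\<bar>"
    proof (rule segment_derivative_bound)
      fix s assume s: "\<bar>s\<bar> \<le> \<bar>t\<bar>"
      show "((\<lambda>s. g (x + s *\<^sub>R axis k 1)) has_derivative (\<lambda>h. h *\<^sub>R pd k g (x + s *\<^sub>R axis k 1))) (at s)"
        by (rule has_derivative_line[OF schwartz_differentiable[OF assms]])
      have "norm (s *\<^sub>R (axis k 1 :: plane)) \<le> 1" using s t by simp
      from omega_shift[OF this, of x] C(1)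
      have "C * \<omega> (x + s *\<^sub>R axis k 1) \<le> C * (16 * \<omega> x)" by (rule mult_left_mono)
      then show "cmod (pd k g (x + s *\<^sub>R axis k 1)) \<le> 16 * C * \<omega> x"
        using C(2)[of "x + s *\<^sub>R axis k 1"] by simp
    qed
    then show ?thesis by simp
  qed
  then show ?thesis using that[of "16 * C"] C(1) by simp
qed

text \<open>The integral of \<open>g (x + t e\<^sub>k) - g x\<close> vanishes by translation invariance, while its first order
  part in \<open>t\<close> is \<open>t\<close> times the integral of the derivative.\<close>

lemma integral_pd:
  assumes "schwartz g"
  shows "(\<integral>x. pd k g x \<partial>lborel) = 0"
proof -
  obtain C where C: "C \<ge> 0" "\<And>x t. \<bar>t\<bar> \<le> 1 \<Longrightarrow> cmod (pd k g (x + t *\<^sub>R axis k 1) - pd k g x) \<le> C * \<omega> x * \<bar>t\<bar>"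
    using schwartz_increment_bound[OF schwartz_pd[OF assms]] by metis
  note [measurable] = schwartz_measurable[OF assms] schwartz_measurable[OF schwartz_pd[OF assms]]
  note int = schwartz_integrable[OF assms] schwartz_integrable[OF schwartz_pd[OF assms, of k]]
  let ?I = "\<integral>x. pd k g x \<partial>lborel"
  let ?W = "\<integral>x. \<omega> x \<partial>lborel"
  have rem: "cmod (g (x + t *\<^sub>R axis k 1) - g x - t *\<^sub>R pd k g x) \<le> C * \<omega> x * t\<^sup>2" if t: "\<bar>t\<bar> \<le> 1" for x t
  proof -
    define f where "f = (\<lambda>s. g (x + s *\<^sub>R axis k 1) - s *\<^sub>R pd k g x)"
    have "cmod (f t - f 0) \<le> (C * \<omega> x * \<bar>t\<bar>) * \<bar>t\<bar>"
    proof (rule segment_derivative_bound)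
      fix s assume s: "\<bar>s\<bar> \<le> \<bar>t\<bar>"
      have "(f has_derivative (\<lambda>h. h *\<^sub>R pd k g (x + s *\<^sub>R axis k 1) - h *\<^sub>R pd k g x)) (at s)"
        unfolding f_def
        by (intro has_derivative_diff has_derivative_line[OF schwartz_differentiable[OF assms]] has_derivative_scaleR_left has_derivative_ident)
      then show "(f has_derivative (\<lambda>h. h *\<^sub>R (pd k g (x + s *\<^sub>R axis k 1) - pd k g x))) (at s)"
        by (simp add: scaleR_diff_right)
      have "cmod (pd k g (x + s *\<^sub>R axis k 1) - pd k g x) \<le> C * \<omega> x * \<bar>s\<bar>" using C(2)[of s x] s t by simp
      also have "\<dots> \<le> C * \<omega> x * \<bar>t\<bar>" using s C(1) by (intro mult_left_mono) auto
      finally show "cmod (pd k g (x + s *\<^sub>R axis k 1) - pd k g x) \<le> C * \<omega> x * \<bar>t\<bar>" .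
    qed
    also have "(C * \<omega> x * \<bar>t\<bar>) * \<bar>t\<bar> = C * \<omega> x * t\<^sup>2" by (simp add: power2_eq_square)
    finally show ?thesis by (simp add: f_def diff_diff_eq add.commute)
  qed
  have small: "cmod ?I \<le> C * ?W * t" if t: "0 < t" "t \<le> 1" for t
  proof -
    have i1: "integrable lborel (\<lambda>x. g (x + t *\<^sub>R axis k 1))"
      using integrable_plane_affine[of g 1 "t *\<^sub>R axis k 1"] int by (simp add: add.commute)
    have e1: "(\<integral>x. g (x + t *\<^sub>R axis k 1) \<partial>lborel) = (\<integral>x. g x \<partial>lborel)"
      using integral_plane_affine[of g 1 "t *\<^sub>R axis k 1"] by (simp add: add.commute)
    have "(\<integral>x. g (x + t *\<^sub>R axis k 1) - g x - t *\<^sub>R pd k g x \<partial>lborel) = - (t *\<^sub>R ?I)"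
      using i1 int e1 by simp
    then have "t * cmod ?I = cmod (\<integral>x. g (x + t *\<^sub>R axis k 1) - g x - t *\<^sub>R pd k g x \<partial>lborel)"
      using t by simp
    also have "\<dots> \<le> (\<integral>x. C * \<omega> x * t\<^sup>2 \<partial>lborel)"
      by (rule Bochner_Integration.integral_norm_bound_integral)
         (use i1 int omega_integrable rem t in auto)
    also have "\<dots> = t * (C * ?W * t)" by (simp add: power2_eq_square)
    finally show ?thesis using t by simp
  qed
  have "cmod ?I \<le> 0"
  proof (rule field_le_epsilon)
    fix e :: real assume e: "e > 0"
    have W: "?W \<ge> 0" by simp
    define t where "t = min 1 (e / (C * ?W + 1))"
    have pos: "C * ?W + 1 > 0" using C(1) W by (simp add: add_nonneg_pos)
    have t: "0 < t" "t \<le> 1" using e pos by (auto simp: t_def)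
    have "C * ?W * t \<le> C * ?W * (e / (C * ?W + 1))"
      using C(1) W by (intro mult_left_mono) (auto simp: t_def)
    also have "\<dots> \<le> e"
      using e pos by (simp add: field_simps)
    finally show "cmod ?I \<le> 0 + e" using small[OF t] by simp
  qed
  then show ?thesis by simp
qed

section \<open>Double integrals\<close>

text \<open>Tonelli applies to \<open>f x * g y\<close>; the bounded kernels \<open>k\<close> in use are characters.\<close>

lemma pair_integrable_mult:
  fixes f g :: "plane \<Rightarrow> complex" and k :: "plane \<Rightarrow> plane \<Rightarrow> complex"
  assumes f: "integrable lborel f" and g: "integrable lborel g"
    and [measurable]: "(\<lambda>(x, y). k x y) \<in> borel_measurable (borel \<Otimes>\<^sub>M borel)"
    and k: "\<And>x y. cmod (k x y) \<le> B"
  shows "integrable (lborel \<Otimes>\<^sub>M lborel) (\<lambda>(x, y). k x y * f x * g y)"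
proof -
  note [measurable] = borel_measurable_integrable[OF f] borel_measurable_integrable[OF g]
  have B: "B \<ge> 0" using k[of undefined undefined] order_trans[OF norm_ge_zero] by blast
  have fg: "integrable (lborel \<Otimes>\<^sub>M lborel) (\<lambda>(x, y). f x * g y)"
  proof (rule lborel_pair.Fubini_integrable)
    have "(\<lambda>x. \<integral>y. norm (f x * g y) \<partial>lborel) = (\<lambda>x. cmod (f x) * (\<integral>y. norm (g y) \<partial>lborel))"
      by (simp add: norm_mult)
    then show "integrable lborel (\<lambda>x. \<integral>y. norm (case (x, y) of (x, y) \<Rightarrow> f x * g y) \<partial>lborel)"
      using f by simp
  qed (use g in \<open>auto simp: split_beta'\<close>)
  then have "integrable (lborel \<Otimes>\<^sub>M lborel) (\<lambda>z. B * norm (case z of (x, y) \<Rightarrow> f x * g y))"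
    by (intro integrable_mult_right integrable_norm)
  then show ?thesis
  proof (rule Bochner_Integration.integrable_bound)
    show "(\<lambda>(x, y). k x y * f x * g y) \<in> borel_measurable (lborel \<Otimes>\<^sub>M lborel)"
      by measurable
    show "AE z in lborel \<Otimes>\<^sub>M lborel. norm (case z of (x, y) \<Rightarrow> k x y * f x * g y)
            \<le> norm (B * norm (case z of (x, y) \<Rightarrow> f x * g y))"
      using k B by (auto simp: norm_mult abs_mult mult.assoc intro!: AE_I2 mult_right_mono)
  qed
qed

lemma Fubini_mult:
  fixes f g :: "plane \<Rightarrow> complex"
  assumes "integrable lborel f" "integrable lborel g"
    "(\<lambda>(x, y). k x y) \<in> borel_measurable (borel \<Otimes>\<^sub>M borel)"
    "\<And>x y. cmod (k x y) \<le> B"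
  shows "(\<integral>x. f x * (\<integral>y. k x y * g y \<partial>lborel) \<partial>lborel) = (\<integral>y. (\<integral>x. k x y * f x \<partial>lborel) * g y \<partial>lborel)"
proof -
  note i = pair_integrable_mult[OF assms]
  have "(\<integral>x. f x * (\<integral>y. k x y * g y \<partial>lborel) \<partial>lborel) = (\<integral>x. (\<integral>y. k x y * f x * g y \<partial>lborel) \<partial>lborel)"
    by (simp add: mult_ac flip: integral_mult_right_zero)
  also have "\<dots> = (\<integral>y. (\<integral>x. k x y * f x * g y \<partial>lborel) \<partial>lborel)"
    using lborel_pair.Fubini_integral[OF i] by simp
  also have "\<dots> = (\<integral>y. (\<integral>x. k x y * f x \<partial>lborel) * g y \<partial>lborel)"
    by (simp flip: integral_mult_left_zero)
  finally show ?thesis .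
qed

text \<open>Here the kernel \<open>L (y - z)\<close> is integrable along diagonals only, and \<open>a\<close> is merely bounded.\<close>

lemma Fubini_conv:
  fixes q L a :: "plane \<Rightarrow> complex"
  assumes q: "integrable lborel q" and L: "integrable lborel L"
    and [measurable]: "a \<in> borel_measurable borel" and a: "\<And>x. cmod (a x) \<le> B"
  shows "(\<integral>y. q y * (\<integral>z. L (y - z) * a z \<partial>lborel) \<partial>lborel) = (\<integral>z. (\<integral>y. q y * L (y - z) \<partial>lborel) * a z \<partial>lborel)"
    and "integrable lborel (\<lambda>y. q y * (\<integral>z. L (y - z) * a z \<partial>lborel))"
proof -
  note [measurable] = borel_measurable_integrable[OF q] borel_measurable_integrable[OF L]
  have B: "B \<ge> 0" using a[of undefined] order_trans[OF norm_ge_zero] by blast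
  have i: "integrable (lborel \<Otimes>\<^sub>M lborel) (\<lambda>(y, z). q y * L (y - z) * a z)"
  proof -
    have "integrable (lborel \<Otimes>\<^sub>M lborel) (\<lambda>(y, z). q y * L (y - z))"
    proof (rule lborel_pair.Fubini_integrable)
      have "(\<lambda>y. \<integral>z. norm (q y * L (y - z)) \<partial>lborel) = (\<lambda>y. norm (q y) * (\<integral>z. norm (L z) \<partial>lborel))"
      proof
        fix y
        have "(\<integral>z. norm (L (y - z)) \<partial>lborel) = (\<integral>z. norm (L z) \<partial>lborel)"
          using integral_reflect[of "\<lambda>z. of_real (norm (L z))" y] by simp
        then show "(\<integral>z. norm (q y * L (y - z)) \<partial>lborel) = norm (q y) * (\<integral>z. norm (L z) \<partial>lborel)"
          by (simp add: norm_mult)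
      qed
      then show "integrable lborel (\<lambda>y. \<integral>z. norm (case (y, z) of (y, z) \<Rightarrow> q y * L (y - z)) \<partial>lborel)"
        using q by simp
      show "AE y in lborel. integrable lborel (\<lambda>z. case (y, z) of (y, z) \<Rightarrow> q y * L (y - z))"
        using integrable_reflect[OF L] by auto
    qed measurable
    then have "integrable (lborel \<Otimes>\<^sub>M lborel) (\<lambda>w. B * norm (case w of (y, z) \<Rightarrow> q y * L (y - z)))"
      by (intro integrable_mult_right integrable_norm)
    then show ?thesis
    proof (rule Bochner_Integration.integrable_bound)
      show "(\<lambda>(y, z). q y * L (y - z) * a z) \<in> borel_measurable (lborel \<Otimes>\<^sub>M lborel)"
        by measurable
      show "AE w in lborel \<Otimes>\<^sub>M lborel. norm (case w of (y, z) \<Rightarrow> q y * L (y - z) * a z)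
              \<le> norm (B * norm (case w of (y, z) \<Rightarrow> q y * L (y - z)))"
        using a B by (auto simp: norm_mult abs_mult intro!: AE_I2 mult_right_mono mult_left_mono
            simp: mult.commute[of B])
    qed
  qed
  have e: "(\<integral>z. q y * L (y - z) * a z \<partial>lborel) = q y * (\<integral>z. L (y - z) * a z \<partial>lborel)" for y
    by (simp add: mult.assoc)
  show "integrable lborel (\<lambda>y. q y * (\<integral>z. L (y - z) * a z \<partial>lborel))"
    using lborel_pair.integrable_fst'[OF i] by (simp add: e)
  show "(\<integral>y. q y * (\<integral>z. L (y - z) * a z \<partial>lborel) \<partial>lborel) = (\<integral>z. (\<integral>y. q y * L (y - z) \<partial>lborel) * a z \<partial>lborel)"
    using lborel_pair.Fubini_integral[OF i] by (simp add: e)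
qed

lemma has_derivative_quadratic:
  assumes "bounded_linear D" "\<And>h. norm (f (x + h) - f x - D h) \<le> C * (norm h)\<^sup>2"
  shows "(f has_derivative D) (at x)"
  unfolding has_derivative_at
proof (intro conjI assms(1))
  have "((\<lambda>h::'a. C * norm h) \<longlongrightarrow> C * norm (0::'a)) (at 0)" by (intro tendsto_intros)
  then have lim: "((\<lambda>h::'a. C * norm h) \<longlongrightarrow> 0) (at 0)" by simp
  show "((\<lambda>h. norm (f (x + h) - f x - D h) / norm h) \<longlongrightarrow> 0) (at 0)"
  proof (rule tendsto_sandwich[OF _ _ tendsto_const lim])
    show "\<forall>\<^sub>F h in at 0. norm (f (x + h) - f x - D h) / norm h \<le> C * norm h"
      unfolding eventually_at_filter
      by (intro always_eventually allI impI)
         (use assms(2) in \<open>simp add: divide_le_eq power2_eq_square mult.assoc\<close>)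
  qed auto
qed

section \<open>Fourier transform on Schwartz functions\<close>

lemma has_derivative_cis_inner:
  "((\<lambda>x. cis (- (x \<bullet> \<xi>))) has_derivative (\<lambda>h. (\<i> * of_real (- (h \<bullet> \<xi>))) * cis (- (x \<bullet> \<xi>)))) (at x)"
proof -
  have 1: "((\<lambda>x. \<i> * complex_of_real (- (x \<bullet> \<xi>))) has_derivative (\<lambda>h. \<i> * of_real (- (h \<bullet> \<xi>)))) (at x)"
    by (auto intro!: derivative_eq_intros)
  have 2: "(exp has_derivative (\<lambda>z. exp (\<i> * complex_of_real (- (x \<bullet> \<xi>))) * z)) (at (\<i> * complex_of_real (- (x \<bullet> \<xi>))))"
    using DERIV_exp unfolding has_field_derivative_def by blast
  from has_derivative_compose[OF 1 2] show ?thesis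
    by (simp add: cis_conv_exp mult_ac)
qed

lemma pd_cis_inner: "pd k (\<lambda>x. cis (- (x \<bullet> \<xi>))) x = - \<i> * of_real (\<xi> $ k) * cis (- (x \<bullet> \<xi>))"
  by (subst pd_eq[OF has_derivative_cis_inner]) (simp add: inner_axis')

lemma cis_inner_measurable [measurable]: "(\<lambda>x::plane. cis (- (x \<bullet> \<xi>))) \<in> borel_measurable borel"
  "(\<lambda>x::plane. cis (x \<bullet> \<xi>)) \<in> borel_measurable borel"
  "(\<lambda>x::plane. cis (\<xi> \<bullet> x)) \<in> borel_measurable borel"
  "(\<lambda>x::plane. cis (- (\<xi> \<bullet> x))) \<in> borel_measurable borel"
  by (auto intro!: borel_measurable_continuous_onI continuous_intros)

lemma cis_inner_differentiable: "(\<lambda>x. cis (- (x \<bullet> \<xi>))) differentiable (at x)"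
  using has_derivative_cis_inner unfolding differentiable_def by blast

lemma schwartz_cis:
  assumes "schwartz g"
  shows "schwartz (\<lambda>x. cis (- (x \<bullet> \<xi>)) * g x)"
proof (rule schwartz_class[where X="{\<lambda>x. cis (- (x \<bullet> \<xi>)) * g x | g. schwartz g}"])
  fix f assume "f \<in> {\<lambda>x. cis (- (x \<bullet> \<xi>)) * g x | g. schwartz g}"
  then obtain g where f: "f = (\<lambda>x. cis (- (x \<bullet> \<xi>)) * g x)" and g: "schwartz g" by auto
  note d = g[THEN schwartz_differentiable]
  show "f differentiable (at x)" for x
    unfolding f by (intro differentiable_mult cis_inner_differentiable d)
  show "pd k f \<in> {\<lambda>x. cis (- (x \<bullet> \<xi>)) * g x | g. schwartz g}" for k
  proof -
    have "pd k f = (\<lambda>x. cis (- (x \<bullet> \<xi>)) * (pd k g x + (- \<i> * of_real (\<xi> $ k)) * g x))"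
      unfolding f by (rule ext) (simp only: pd_mult[OF cis_inner_differentiable d] pd_cis_inner, simp add: algebra_simps)
    moreover have "schwartz (\<lambda>x. pd k g x + (- \<i> * of_real (\<xi> $ k)) * g x)"
      by (intro schwartz_add schwartz_pd schwartz_cmult g)
    ultimately show ?thesis
      unfolding mem_Collect_eq by (intro exI[of _ "\<lambda>x. pd k g x + (- \<i> * of_real (\<xi> $ k)) * g x"] conjI)
  qed
  show "rapid f" unfolding f by (rule rapid_mult_bounded[OF schwartz_rapid[OF g], of _ 1]) simp
qed (use assms in blast)

lemma fourier_integrand_integrable: "schwartz g \<Longrightarrow> integrable lborel (\<lambda>x. cis (- (x \<bullet> \<xi>)) * g x)"
  by (intro schwartz_integrable schwartz_cis)

lemma fourier_bound:
  assumes "schwartz g"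
  shows "cmod (fourier g \<xi>) \<le> (\<integral>x. cmod (g x) \<partial>lborel)"
  unfolding fourier_def
  using integral_norm_bound[of lborel "\<lambda>x. cis (- (x \<bullet> \<xi>)) * g x"] by (simp add: norm_mult)

lemma fourier_cmult: "fourier (\<lambda>x. c * g x) \<xi> = c * fourier g \<xi>"
  unfolding fourier_def by (simp add: mult.left_commute)

lemma fourier_pd:
  assumes "schwartz g"
  shows "fourier (pd k g) \<xi> = \<i> * of_real (\<xi> $ k) * fourier g \<xi>"
proof -
  have "pd k (\<lambda>x. cis (- (x \<bullet> \<xi>)) * g x) = (\<lambda>x. cis (- (x \<bullet> \<xi>)) * pd k g x - \<i> * of_real (\<xi> $ k) * (cis (- (x \<bullet> \<xi>)) * g x))"
    by (rule ext) (simp only: pd_mult[OF cis_inner_differentiable schwartz_differentiable[OF assms]] pd_cis_inner, simp add: algebra_simps)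
  with integral_pd[OF schwartz_cis[OF assms], of k \<xi>]
  have "(\<integral>x. cis (- (x \<bullet> \<xi>)) * pd k g x - \<i> * of_real (\<xi> $ k) * (cis (- (x \<bullet> \<xi>)) * g x) \<partial>lborel) = 0"
    by simp
  then show ?thesis
    unfolding fourier_def
    by (simp add: fourier_integrand_integrable assms schwartz_pd)
qed

lemma cis_remainder: "cmod (cis (a + b) - cis a - \<i> * of_real b * cis a) \<le> b\<^sup>2"
proof -
  have "cis (a + b) - cis a - \<i> * of_real b * cis a = cis a * (cis b - 1 - \<i> * of_real b)"
    by (simp add: cis_mult[symmetric] algebra_simps)
  then have "cmod (cis (a + b) - cis a - \<i> * of_real b * cis a) = cmod (cis b - 1 - \<i> * of_real b)"
    by (simp add: norm_mult)
  also have "\<dots> \<le> b\<^sup>2 / 2"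
    using iexp_approx1[of b 1] by (simp add: cis_conv_exp power2_eq_square diff_diff_eq)
  also have "\<dots> \<le> b\<^sup>2" by simp
  finally show ?thesis .
qed

lemma schwartz_coord_cmult: "schwartz g \<Longrightarrow> schwartz (\<lambda>x. c * (of_real (x $ k) * g x))"
  by (intro schwartz_cmult schwartz_coord)

text \<open>Instead of differentiating under the integral, the remainder of the first order expansion of the
  character \<open>cis (- (x \<bullet> \<xi>))\<close> in \<open>\<xi>\<close> is bounded by a quadratic term, whose integral against \<open>g\<close> is finite.\<close>

lemma fourier_has_derivative:
  assumes "schwartz g"
  shows "(fourier g has_derivative (\<lambda>h. \<Sum>k\<in>UNIV. h $ k *\<^sub>R fourier (\<lambda>x. - \<i> * (of_real (x $ k) * g x)) \<xi>)) (at \<xi>)"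
proof (rule has_derivative_quadratic)
  let ?D = "\<lambda>h. \<Sum>k\<in>UNIV. h $ k *\<^sub>R fourier (\<lambda>x. - \<i> * (of_real (x $ k) * g x)) \<xi>"
  let ?C = "\<integral>x. (1 + norm x) ^ 2 * cmod (g x) \<partial>lborel"
  show "bounded_linear ?D"
    by (intro bounded_linear_sum bounded_linear_scaleR_left bounded_linear_compose[OF _ bounded_linear_vec_nth, unfolded o_def] bounded_linear_compose[OF bounded_linear_scaleR_left bounded_linear_vec_nth])
  fix h :: plane
  note i = fourier_integrand_integrable[OF assms] fourier_integrand_integrable[OF schwartz_coord_cmult[OF assms]]
  have D: "?D h = (\<integral>x. \<i> * of_real (- (x \<bullet> h)) * cis (- (x \<bullet> \<xi>)) * g x \<partial>lborel)"
  proof -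
    have "?D h = (\<Sum>k\<in>UNIV. (\<integral>x. h $ k *\<^sub>R (cis (- (x \<bullet> \<xi>)) * (- \<i> * (of_real (x $ k) * g x))) \<partial>lborel))"
      unfolding fourier_def by simp
    also have "\<dots> = (\<integral>x. (\<Sum>k\<in>UNIV. h $ k *\<^sub>R (cis (- (x \<bullet> \<xi>)) * (- \<i> * (of_real (x $ k) * g x)))) \<partial>lborel)"
      by (rule Bochner_Integration.integral_sum[symmetric]) (intro integrable_scaleR_right i)
    also have "\<dots> = (\<integral>x. \<i> * of_real (- (x \<bullet> h)) * cis (- (x \<bullet> \<xi>)) * g x \<partial>lborel)"
      by (intro Bochner_Integration.integral_cong refl)
         (simp add: inner_vec_def scaleR_conv_of_real sum_distrib_left sum_distrib_right sum_negf[symmetric] mult_ac)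
    finally show ?thesis .
  qed
  have iD: "integrable lborel (\<lambda>x. \<i> * of_real (- (x \<bullet> h)) * cis (- (x \<bullet> \<xi>)) * g x)"
  proof -
    have "integrable lborel (\<lambda>x. (\<Sum>k\<in>UNIV. h $ k *\<^sub>R (cis (- (x \<bullet> \<xi>)) * (- \<i> * (of_real (x $ k) * g x)))))"
      by (intro Bochner_Integration.integrable_sum integrable_scaleR_right i)
    then show ?thesis
      by (rule Bochner_Integration.integrable_cong[THEN iffD1, rotated 2])
         (simp_all add: inner_vec_def scaleR_conv_of_real sum_distrib_left sum_distrib_right sum_negf[symmetric] mult_ac)
  qed
  have "fourier g (\<xi> + h) - fourier g \<xi> - ?D h
      = (\<integral>x. cis (- (x \<bullet> (\<xi> + h))) * g x - cis (- (x \<bullet> \<xi>)) * g x - \<i> * of_real (- (x \<bullet> h)) * cis (- (x \<bullet> \<xi>)) * g x \<partial>lborel)"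
    unfolding D unfolding fourier_def using i(1)[of "\<xi> + h"] i(1)[of \<xi>] iD by simp
  also have "cmod \<dots> \<le> (\<integral>x. (norm h)\<^sup>2 * ((1 + norm x) ^ 2 * cmod (g x)) \<partial>lborel)"
  proof (rule Bochner_Integration.integral_norm_bound_integral)
    show "integrable lborel (\<lambda>x. (norm h)\<^sup>2 * ((1 + norm x) ^ 2 * cmod (g x)))"
      by (intro integrable_mult_right schwartz_poly_integrable assms)
    show "integrable lborel (\<lambda>x. cis (- (x \<bullet> (\<xi> + h))) * g x - cis (- (x \<bullet> \<xi>)) * g x - \<i> * of_real (- (x \<bullet> h)) * cis (- (x \<bullet> \<xi>)) * g x)"
      by (intro Bochner_Integration.integrable_diff i iD)
    fix x :: plane
    have "cis (- (x \<bullet> (\<xi> + h))) * g x - cis (- (x \<bullet> \<xi>)) * g x - \<i> * of_real (- (x \<bullet> h)) * cis (- (x \<bullet> \<xi>)) * g x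
        = (cis (- (x \<bullet> \<xi>) + - (x \<bullet> h)) - cis (- (x \<bullet> \<xi>)) - \<i> * of_real (- (x \<bullet> h)) * cis (- (x \<bullet> \<xi>))) * g x"
      by (simp add: inner_add_right algebra_simps)
    then have "cmod (cis (- (x \<bullet> (\<xi> + h))) * g x - cis (- (x \<bullet> \<xi>)) * g x - \<i> * of_real (- (x \<bullet> h)) * cis (- (x \<bullet> \<xi>)) * g x)
        \<le> (- (x \<bullet> h))\<^sup>2 * cmod (g x)"
      by (simp only: norm_mult) (intro mult_right_mono cis_remainder norm_ge_zero)
    also have "\<dots> \<le> ((norm h)\<^sup>2 * (1 + norm x)\<^sup>2) * cmod (g x)"
    proof (intro mult_right_mono norm_ge_zero)
      have "\<bar>x \<bullet> h\<bar> \<le> norm h * (1 + norm x)"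
        using add_mono[OF norm_ge_zero[of h] Cauchy_Schwarz_ineq2[of x h]] by (simp add: algebra_simps)
      then show "(- (x \<bullet> h))\<^sup>2 \<le> (norm h)\<^sup>2 * (1 + norm x)\<^sup>2"
        unfolding power_mult_distrib[symmetric] by (intro power2_le_iff_abs_le[THEN iffD2]) auto
    qed
    finally show "cmod (cis (- (x \<bullet> (\<xi> + h))) * g x - cis (- (x \<bullet> \<xi>)) * g x - \<i> * of_real (- (x \<bullet> h)) * cis (- (x \<bullet> \<xi>)) * g x)
        \<le> (norm h)\<^sup>2 * ((1 + norm x)\<^sup>2 * cmod (g x))" by (simp add: mult.assoc)
  qed
  finally show "norm (fourier g (\<xi> + h) - fourier g \<xi> - ?D h) \<le> ?C * (norm h)\<^sup>2"
    by (simp add: mult.commute)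
qed

lemma pd_fourier:
  assumes "schwartz g"
  shows "pd k (fourier g) \<xi> = fourier (\<lambda>x. - \<i> * (of_real (x $ k) * g x)) \<xi>"
proof -
  have "pd k (fourier g) \<xi> = (\<Sum>j\<in>UNIV. (axis k 1 :: plane) $ j *\<^sub>R fourier (\<lambda>x. - \<i> * (of_real (x $ j) * g x)) \<xi>)"
    by (rule pd_eq[OF fourier_has_derivative[OF assms]])
  also have "\<dots> = (\<Sum>j\<in>UNIV. if j = k then fourier (\<lambda>x. - \<i> * (of_real (x $ k) * g x)) \<xi> else 0)"
    by (intro sum.cong) (auto simp: axis_def)
  finally show ?thesis by simp
qed

text \<open>Derivatives of the transform multiply \<open>g\<close> by coordinates, and powers of \<open>\<xi>\<close> turn into derivatives
  of \<open>g\<close>, by induction on the exponent of the weight.\<close>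

lemma schwartz_fourier:
  assumes "schwartz g"
  shows "schwartz (fourier g)"
proof (rule schwartz_class[where X="fourier ` {g. schwartz g}"])
  fix f assume "f \<in> fourier ` {g. schwartz g}"
  then obtain g where f: "f = fourier g" and g: "schwartz g" by auto
  show "f differentiable (at x)" for x
    unfolding f using fourier_has_derivative[OF g] unfolding differentiable_def by blast
  show "pd k f \<in> fourier ` {g. schwartz g}" for k
  proof -
    have "pd k f = fourier (\<lambda>x. - \<i> * (of_real (x $ k) * g x))"
      unfolding f by (rule ext) (rule pd_fourier[OF g])
    then show ?thesis using schwartz_coord_cmult[OF g, of "- \<i>" k] by blast
  qed
  have "\<exists>C. \<forall>\<xi>. (1 + norm \<xi>) ^ N * cmod (fourier g \<xi>) \<le> C" for N
    using g
  proof (induction N arbitrary: g)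
    case 0
    then show ?case using fourier_bound by auto
  next
    case (Suc N)
    obtain A where A: "\<And>\<xi>. (1 + norm \<xi>) ^ N * cmod (fourier g \<xi>) \<le> A" using Suc by blast
    obtain A1 where A1: "\<And>\<xi>. (1 + norm \<xi>) ^ N * cmod (fourier (pd 1 g) \<xi>) \<le> A1"
      using Suc.IH[OF schwartz_pd[OF Suc.prems]] by blast
    obtain A2 where A2: "\<And>\<xi>. (1 + norm \<xi>) ^ N * cmod (fourier (pd 2 g) \<xi>) \<le> A2"
      using Suc.IH[OF schwartz_pd[OF Suc.prems]] by blast
    have "(1 + norm \<xi>) ^ Suc N * cmod (fourier g \<xi>) \<le> A + (A1 + A2)" for \<xi> :: plane
    proof -
      have n: "norm \<xi> \<le> \<bar>\<xi> $ 1\<bar> + \<bar>\<xi> $ 2\<bar>"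
        using norm_le_l1_cart[of \<xi>] by (simp add: sum_2)
      have "(1 + norm \<xi>) ^ Suc N * cmod (fourier g \<xi>) = (1 + norm \<xi>) ^ N * ((1 + norm \<xi>) * cmod (fourier g \<xi>))"
        by simp
      also have "\<dots> \<le> (1 + norm \<xi>) ^ N * ((1 + (\<bar>\<xi> $ 1\<bar> + \<bar>\<xi> $ 2\<bar>)) * cmod (fourier g \<xi>))"
        using n by (intro mult_left_mono mult_right_mono) auto
      also have "\<dots> = (1 + norm \<xi>) ^ N * cmod (fourier g \<xi>) + ((1 + norm \<xi>) ^ N * cmod (fourier (pd 1 g) \<xi>)
          + (1 + norm \<xi>) ^ N * cmod (fourier (pd 2 g) \<xi>))"
        by (simp add: fourier_pd[OF Suc.prems] norm_mult algebra_simps)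
      also have "\<dots> \<le> A + (A1 + A2)" by (intro add_mono A A1 A2)
      finally show ?thesis .
    qed
    then show ?case by blast
  qed
  then show "rapid f" unfolding f rapid_def by blast
qed (use assms in blast)

section \<open>The Gaussian\<close>

definition gauss :: "plane \<Rightarrow> complex" where "gauss x = of_real (exp (- (x \<bullet> x) / 2))"

lemma gauss_has_derivative: "(gauss has_derivative (\<lambda>h. of_real (- (x \<bullet> h)) * gauss x)) (at x)"
  unfolding gauss_def
  by (auto intro!: derivative_eq_intros simp: inner_commute)

inductive_set gauss_span :: "(plane \<Rightarrow> complex) set" where
  gauss: "gauss \<in> gauss_span"
| coord: "f \<in> gauss_span \<Longrightarrow> (\<lambda>x. of_real (x $ j) * f x) \<in> gauss_span"
| cmult: "f \<in> gauss_span \<Longrightarrow> (\<lambda>x. c * f x) \<in> gauss_span"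
| plus: "f \<in> gauss_span \<Longrightarrow> f' \<in> gauss_span \<Longrightarrow> (\<lambda>x. f x + f' x) \<in> gauss_span"

lemma coord_differentiable: "(\<lambda>x::plane. complex_of_real (x $ j)) differentiable (at x)"
  using has_derivative_coord unfolding differentiable_def by blast

lemma gauss_span_differentiable: "f \<in> gauss_span \<Longrightarrow> f differentiable (at x)"
proof (induction rule: gauss_span.induct)
  case gauss
  show ?case using gauss_has_derivative unfolding differentiable_def by blast
qed (auto intro!: differentiable_mult coord_differentiable)

lemma pd_gauss: "pd k gauss = (\<lambda>x. - 1 * (of_real (x $ k) * gauss x))"
  by (rule ext, subst pd_eq[OF gauss_has_derivative]) (simp add: inner_axis)

lemma schwartz_gauss: "schwartz gauss"
proof (rule schwartz_class[where X=gauss_span])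
  show "pd k f \<in> gauss_span" if "f \<in> gauss_span" for f k
    using that
  proof induction
    case gauss
    show ?case unfolding pd_gauss by (intro gauss_span.intros)
  next
    case (coord f j)
    have "pd k (\<lambda>x. of_real (x $ j) * f x) = (\<lambda>x. of_real (x $ j) * pd k f x + (if j = k then 1 else 0) * f x)"
      by (rule ext) (simp only: pd_mult[OF coord_differentiable gauss_span_differentiable[OF coord(1)]] pd_coord)
    then show ?case using coord by (simp only:) (intro gauss_span.intros)
  next
    case (cmult f c)
    have "pd k (\<lambda>x. c * f x) = (\<lambda>x. c * pd k f x)"
      by (rule ext) (simp only: pd_cmult[OF gauss_span_differentiable[OF cmult(1)]])
    then show ?case using cmult by (simp only:) (intro gauss_span.intros)
  next
    case (plus f f')
    have "pd k (\<lambda>x. f x + f' x) = (\<lambda>x. pd k f x + pd k f' x)"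
      by (rule ext) (simp only: pd_add[OF plus(1,2)[THEN gauss_span_differentiable]])
    then show ?case using plus by (simp only:) (intro gauss_span.intros)
  qed
  show "rapid f" if "f \<in> gauss_span" for f
    using that
  proof induction
    case gauss
    \<comment> \<open>From \<open>(1 + t / n)\<^sup>n \<le> exp t\<close> at \<open>t = 1 + norm x\<close>, and \<open>- r\<^sup>2 / 2 \<le> 1 / 2 - r\<close>.\<close>
    have "(1 + norm x) ^ N * cmod (gauss x) \<le> real (Suc N) ^ Suc N * exp (3 / 2)" for N x
    proof -
      let ?r = "norm x"
      have "((1 + ?r) / Suc N) ^ Suc N \<le> (1 + (1 + ?r) / Suc N) ^ Suc N"
        by (intro power_mono) auto
      also have "\<dots> \<le> exp (1 + ?r)"
        by (rule exp_ge_one_plus_x_over_n_power_n) (use norm_ge_zero[of x] in linarith)+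
      finally have le: "((1 + ?r) / Suc N) ^ Suc N \<le> exp (1 + ?r)" .
      have pos: "0 < real (Suc N) ^ Suc N" by simp
      have "(1 + ?r) ^ Suc N \<le> real (Suc N) ^ Suc N * exp (1 + ?r)"
        using le unfolding power_divide pos_divide_le_eq[OF pos] by (simp only: mult.commute)
      moreover have "(1 + ?r) ^ N \<le> (1 + ?r) ^ Suc N"
        by (rule power_increasing) auto
      ultimately have 1: "(1 + ?r) ^ N \<le> real (Suc N) ^ Suc N * exp (1 + ?r)" by linarith
      have "0 \<le> (?r - 1)\<^sup>2" by simp
      then have "- (x \<bullet> x) / 2 \<le> 1 / 2 - ?r"
        by (simp add: power2_diff dot_square_norm)
      then have 2: "cmod (gauss x) \<le> exp (1 / 2 - ?r)" unfolding gauss_def by simp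
      have "(1 + ?r) ^ N * cmod (gauss x) \<le> (real (Suc N) ^ Suc N * exp (1 + ?r)) * exp (1 / 2 - ?r)"
        by (intro mult_mono 1 2) auto
      also have "\<dots> = real (Suc N) ^ Suc N * (exp (1 + ?r) * exp (1 / 2 - ?r))" by (simp only: mult.assoc)
      also have "exp (1 + ?r) * exp (1 / 2 - ?r) = exp (3 / 2)"
        unfolding exp_add[symmetric] by (rule arg_cong[where f=exp]) simp
      finally show ?thesis .
    qed
    then show ?case unfolding rapid_def by blast
  next
    case (cmult f c)
    show ?case by (rule rapid_mult_bounded[OF cmult(2) order_refl])
  qed (auto intro: rapid_coord rapid_add)
qed (auto intro: gauss_span.intros gauss_span_differentiable)

lemma integral_gauss: "(\<integral>x. gauss x \<partial>lborel) = 2 * of_real pi"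
proof -
  have "(\<integral>\<^sup>+x. ennreal (exp (- (x \<bullet> x) / 2)) \<partial>(lborel::plane measure))
      = (\<integral>\<^sup>+x. (\<Prod>b\<in>Basis. ennreal (exp (- (x \<bullet> b)\<^sup>2 / 2))) \<partial>(lborel::plane measure))"
  proof (rule nn_integral_cong)
    fix x :: plane
    have "- (x \<bullet> x) / 2 = (\<Sum>b\<in>Basis. - (x \<bullet> b)\<^sup>2 / 2)"
      by (subst euclidean_inner) (simp add: power2_eq_square sum_negf sum_divide_distrib)
    then show "ennreal (exp (- (x \<bullet> x) / 2)) = (\<Prod>b\<in>Basis. ennreal (exp (- (x \<bullet> b)\<^sup>2 / 2)))"
      by (simp add: exp_sum prod_ennreal)
  qed
  also have "\<dots> = (\<Prod>b\<in>(Basis::plane set). (\<integral>\<^sup>+x. ennreal (exp (- x\<^sup>2 / 2)) \<partial>lborel))"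
    by (rule nn_integral_lborel_prod) auto
  also have "(\<integral>\<^sup>+x. ennreal (exp (- x\<^sup>2 / 2)) \<partial>lborel) = ennreal (sqrt (2 * pi))"
  proof -
    have "(\<integral>\<^sup>+x. ennreal (exp (- x\<^sup>2 / 2)) \<partial>lborel) = (\<integral>\<^sup>+x. ennreal (sqrt (2 * pi)) * ennreal (std_normal_density x) \<partial>lborel)"
      by (intro nn_integral_cong) (simp add: std_normal_density_def ennreal_mult[symmetric])
    also have "\<dots> = ennreal (sqrt (2 * pi)) * (\<integral>\<^sup>+x. ennreal (std_normal_density x) \<partial>lborel)"
      by (rule nn_integral_cmult) auto
    also have "(\<integral>\<^sup>+x. ennreal (std_normal_density x) \<partial>lborel) = 1"
      using prob_space.emeasure_space_1[OF prob_space_normal_density[of 1 0]]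
      by (simp add: emeasure_density)
    finally show ?thesis by simp
  qed
  also have "(\<Prod>b\<in>(Basis::plane set). ennreal (sqrt (2 * pi))) = ennreal (2 * pi)"
    by (simp add: power2_eq_square ennreal_mult[symmetric])
  finally have "(\<integral>x. exp (- (x \<bullet> x) / 2) \<partial>(lborel::plane measure)) = 2 * pi"
    by (subst integral_eq_nn_integral) auto
  then have "complex_of_real (\<integral>x. exp (- (x \<bullet> x) / 2) \<partial>(lborel::plane measure)) = 2 * of_real pi" by simp
  then show ?thesis unfolding gauss_def by simp
qed

text \<open>The transform \<open>F\<close> solves \<open>\<partial>\<^sub>k F = - \<xi>\<^sub>k F\<close> because \<open>gauss\<close> solves \<open>\<partial>\<^sub>k gauss = - x\<^sub>k gauss\<close>; hence
  \<open>F \<xi> * exp (\<bar>\<xi>\<bar>\<^sup>2 / 2)\<close> is constant, with the value of the Gaussian integral at \<open>\<xi> = 0\<close>.\<close>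

lemma fourier_gauss: "fourier gauss \<xi> = 2 * of_real pi * gauss \<xi>"
proof -
  let ?F = "fourier gauss"
  have F: "schwartz ?F" by (intro schwartz_fourier schwartz_gauss)
  have pdF: "pd k ?F \<eta> = - of_real (\<eta> $ k) * ?F \<eta>" for k \<eta>
  proof -
    have "pd k ?F \<eta> = fourier (\<lambda>x. \<i> * pd k gauss x) \<eta>"
      unfolding pd_gauss using pd_fourier[OF schwartz_gauss] by simp
    also have "\<dots> = \<i> * (\<i> * of_real (\<eta> $ k) * ?F \<eta>)"
      by (simp only: fourier_cmult fourier_pd[OF schwartz_gauss])
    finally show ?thesis by (simp add: mult.assoc[symmetric])
  qed
  let ?E = "\<lambda>\<xi>::plane. complex_of_real (exp ((\<xi> \<bullet> \<xi>) / 2))"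
  have deriv: "((\<lambda>\<xi>. ?F \<xi> * ?E \<xi>) has_derivative (\<lambda>h. 0)) (at \<eta> within UNIV)" for \<eta>
  proof -
    have 1: "(?F has_derivative (\<lambda>h. - (of_real (h \<bullet> \<eta>) * ?F \<eta>))) (at \<eta>)"
      using has_derivative_pd[OF schwartz_differentiable[OF F], of \<eta>]
      by (simp add: pdF scaleR_conv_of_real inner_vec_def sum_distrib_right sum_negf mult.assoc)
    have 2: "(?E has_derivative (\<lambda>h. of_real (\<eta> \<bullet> h) * ?E \<eta>)) (at \<eta>)"
      by (auto intro!: derivative_eq_intros simp: inner_commute)
    from has_derivative_mult[OF 1 2] show ?thesis
      by (simp add: inner_commute mult_ac)
  qed
  then obtain c where c: "\<And>\<xi>. ?F \<xi> * ?E \<xi> = c"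
    using has_derivative_zero_constant[OF convex_UNIV deriv] by auto
  have "c = 2 * of_real pi"
    using c[of 0] integral_gauss by (simp add: fourier_def)
  moreover have "?E \<xi> * gauss \<xi> = 1"
    unfolding gauss_def of_real_mult[symmetric] exp_add[symmetric] by simp
  ultimately show ?thesis
    using c[of \<xi>] by (metis mult.assoc mult.right_neutral)
qed

lemma gauss_mollify:
  assumes [measurable]: "w \<in> borel_measurable borel" and B: "\<And>x. cmod (w x) \<le> B"
    and cont: "isCont w x"
  shows "(\<lambda>n. \<integral>z. gauss z * w (x + (1 / real (Suc n)) *\<^sub>R z) \<partial>lborel) \<longlonglongrightarrow> 2 * of_real pi * w x"
proof -
  note [measurable] = schwartz_measurable[OF schwartz_gauss]
  have "(\<lambda>n. \<integral>z. gauss z * w (x + (1 / real (Suc n)) *\<^sub>R z) \<partial>lborel) \<longlonglongrightarrow> (\<integral>z. gauss z * w x \<partial>lborel)"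
  proof (rule integral_dominated_convergence[where w="\<lambda>z. B * cmod (gauss z)"])
    show "integrable lborel (\<lambda>z. B * cmod (gauss z))"
      by (intro integrable_mult_right integrable_norm schwartz_integrable schwartz_gauss)
    show "AE z in lborel. (\<lambda>n. gauss z * w (x + (1 / real (Suc n)) *\<^sub>R z)) \<longlonglongrightarrow> gauss z * w x"
    proof (intro AE_I2 tendsto_mult tendsto_const)
      fix z :: plane
      have "(\<lambda>n. x + (1 / real (Suc n)) *\<^sub>R z) \<longlonglongrightarrow> x + 0 *\<^sub>R z"
        by (intro tendsto_intros LIMSEQ_Suc[OF lim_1_over_n])
      then have "(\<lambda>n. x + (1 / real (Suc n)) *\<^sub>R z) \<longlonglongrightarrow> x" by simp
      then show "(\<lambda>n. w (x + (1 / real (Suc n)) *\<^sub>R z)) \<longlonglongrightarrow> w x"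
        by (rule isCont_tendsto_compose[OF cont])
    qed
    show "\<And>n. AE z in lborel. norm (gauss z * w (x + (1 / real (Suc n)) *\<^sub>R z)) \<le> B * cmod (gauss z)"
      by (intro AE_I2) (simp add: norm_mult mult.commute[of B] mult_left_mono B)
  qed measurable
  then show ?thesis by (simp add: integral_gauss)
qed

lemma gauss_dilation_integral:
  fixes q :: "plane \<Rightarrow> complex"
  assumes [measurable]: "q \<in> borel_measurable borel" and e: "e > 0"
  shows "(\<integral>y. of_real ((1 / e)\<^sup>2) * gauss ((1 / e) *\<^sub>R (y - x)) * q y \<partial>lborel)
    = (\<integral>z. gauss z * q (x + e *\<^sub>R z) \<partial>lborel)"
proof -
  note [measurable] = schwartz_measurable[OF schwartz_gauss]
  have "(\<integral>y. of_real ((1 / e)\<^sup>2) * gauss ((1 / e) *\<^sub>R (y - x)) * q y \<partial>lborel)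
      = of_real (e\<^sup>2) * (\<integral>z. of_real ((1 / e)\<^sup>2) * gauss ((1 / e) *\<^sub>R (x + e *\<^sub>R z - x)) * q (x + e *\<^sub>R z) \<partial>lborel)"
    by (rule integral_plane_affine) (use e in auto)
  also have "\<dots> = (of_real (e\<^sup>2) * of_real ((1 / e)\<^sup>2)) * (\<integral>z. gauss z * q (x + e *\<^sub>R z) \<partial>lborel)"
    using e by (simp add: mult.assoc)
  also have "complex_of_real (e\<^sup>2) * of_real ((1 / e)\<^sup>2) = 1"
    unfolding of_real_mult[symmetric] power_mult_distrib[symmetric] using e by simp
  finally show ?thesis by simp
qed

text \<open>Inserting a factor \<open>gauss (\<epsilon> \<xi>)\<close> makes Fubini applicable and turns the double integral into the
  average of \<open>g\<close> around \<open>x\<close> against a Gaussian of width \<open>\<epsilon>\<close>; then \<open>\<epsilon>\<close> tends to \<open>0\<close> on both sides.\<close>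

lemma fourier_inversion_integral:
  assumes g: "schwartz g"
  shows "(\<integral>\<xi>. cis (x \<bullet> \<xi>) * fourier g \<xi> \<partial>lborel) = (2 * of_real pi)\<^sup>2 * g x"
proof -
  note [measurable] = schwartz_measurable[OF schwartz_gauss] schwartz_measurable[OF g] schwartz_measurable[OF schwartz_fourier[OF g]]
  let ?I = "\<lambda>n. \<integral>\<xi>. (cis (x \<bullet> \<xi>) * gauss ((1 / real (Suc n)) *\<^sub>R \<xi>)) * fourier g \<xi> \<partial>lborel"
  obtain B where B: "B \<ge> 0" "\<And>x. cmod (g x) \<le> B" using schwartz_bounded[OF g] by blast
  have ev: "?I n = 2 * of_real pi * (\<integral>z. gauss z * g (x + (1 / real (Suc n)) *\<^sub>R z) \<partial>lborel)" for n
  proof -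
    let ?e = "1 / real (Suc n)"
    have e: "?e \<noteq> 0" "?e > 0" by auto
    let ?f = "\<lambda>\<xi>. cis (x \<bullet> \<xi>) * gauss (?e *\<^sub>R \<xi>)"
    have sf: "schwartz ?f"
      using schwartz_cis[OF schwartz_scale[OF schwartz_gauss e(1)], of "- x"] by (simp add: inner_commute)
    have "?I n = (\<integral>\<xi>. ?f \<xi> * (\<integral>y. cis (- (y \<bullet> \<xi>)) * g y \<partial>lborel) \<partial>lborel)"
      unfolding fourier_def ..
    also have "\<dots> = (\<integral>y. (\<integral>\<xi>. cis (- (y \<bullet> \<xi>)) * ?f \<xi> \<partial>lborel) * g y \<partial>lborel)"
    proof (rule Fubini_mult[where B=1])
      have "continuous_on UNIV (\<lambda>z::plane \<times> plane. cis (- (snd z \<bullet> fst z)))"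
        by (intro continuous_intros)
      then show "(\<lambda>(\<xi>, y). cis (- (y \<bullet> \<xi>))) \<in> borel_measurable (borel \<Otimes>\<^sub>M (borel :: plane measure))"
        unfolding borel_prod by (simp add: borel_measurable_continuous_onI split_beta')
    qed (use schwartz_integrable[OF sf] schwartz_integrable[OF g] in simp_all)
    also have "\<dots> = (\<integral>y. (of_real ((1 / ?e)\<^sup>2) * (2 * of_real pi * gauss ((1 / ?e) *\<^sub>R (y - x)))) * g y \<partial>lborel)"
    proof (intro Bochner_Integration.integral_cong refl arg_cong2[where f="(*)"])
      fix y
      have "(\<integral>\<xi>. cis (- (y \<bullet> \<xi>)) * ?f \<xi> \<partial>lborel)
          = of_real ((1 / ?e)\<^sup>2) * (\<integral>\<xi>. cis (- (y \<bullet> (0 + (1 / ?e) *\<^sub>R \<xi>))) * ?f (0 + (1 / ?e) *\<^sub>R \<xi>) \<partial>lborel)"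
        by (rule integral_plane_affine[OF borel_measurable_times[OF cis_inner_measurable(4) schwartz_measurable[OF sf]]]) simp
      also have "(\<lambda>\<xi>. cis (- (y \<bullet> (0 + (1 / ?e) *\<^sub>R \<xi>))) * ?f (0 + (1 / ?e) *\<^sub>R \<xi>))
          = (\<lambda>\<xi>. cis (- (\<xi> \<bullet> ((1 / ?e) *\<^sub>R (y - x)))) * gauss \<xi>)"
      proof
        fix \<xi> :: plane
        have a: "?e *\<^sub>R (0 + (1 / ?e) *\<^sub>R \<xi>) = \<xi>" using e(1) by (simp del: of_nat_Suc)
        have "cis (- (y \<bullet> (0 + (1 / ?e) *\<^sub>R \<xi>))) * ?f (0 + (1 / ?e) *\<^sub>R \<xi>)
            = cis (- (y \<bullet> ((1 / ?e) *\<^sub>R \<xi>)) + x \<bullet> ((1 / ?e) *\<^sub>R \<xi>)) * gauss \<xi>"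
          unfolding a by (simp only: cis_mult[symmetric] mult.assoc add_0)
        also have "- (y \<bullet> ((1 / ?e) *\<^sub>R \<xi>)) + x \<bullet> ((1 / ?e) *\<^sub>R \<xi>) = - (\<xi> \<bullet> ((1 / ?e) *\<^sub>R (y - x)))"
          by (simp add: inner_diff_right inner_commute algebra_simps)
        finally show "cis (- (y \<bullet> (0 + (1 / ?e) *\<^sub>R \<xi>))) * ?f (0 + (1 / ?e) *\<^sub>R \<xi>)
            = cis (- (\<xi> \<bullet> ((1 / ?e) *\<^sub>R (y - x)))) * gauss \<xi>" .
      qed
      also have "(\<integral>\<xi>. cis (- (\<xi> \<bullet> ((1 / ?e) *\<^sub>R (y - x)))) * gauss \<xi> \<partial>lborel) = 2 * of_real pi * gauss ((1 / ?e) *\<^sub>R (y - x))"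
        using fourier_gauss unfolding fourier_def .
      finally show "(\<integral>\<xi>. cis (- (y \<bullet> \<xi>)) * ?f \<xi> \<partial>lborel) = of_real ((1 / ?e)\<^sup>2) * (2 * of_real pi * gauss ((1 / ?e) *\<^sub>R (y - x)))" .
    qed
    also have "\<dots> = 2 * of_real pi * (\<integral>y. of_real ((1 / ?e)\<^sup>2) * gauss ((1 / ?e) *\<^sub>R (y - x)) * g y \<partial>lborel)"
      unfolding integral_mult_right_zero[symmetric] by (simp only: mult_ac)
    finally show ?thesis unfolding gauss_dilation_integral[OF schwartz_measurable[OF g] e(2)] .
  qed
  have "(\<lambda>n. 2 * of_real pi * (\<integral>z. gauss z * g (x + (1 / real (Suc n)) *\<^sub>R z) \<partial>lborel)) \<longlonglongrightarrow> 2 * of_real pi * (2 * of_real pi * g x)"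
    by (intro tendsto_mult tendsto_const gauss_mollify[where B=B])
       (use B schwartz_continuous[OF g, of UNIV] in \<open>auto simp: continuous_on_eq_continuous_at\<close>)
  then have lim1: "?I \<longlonglongrightarrow> (2 * of_real pi)\<^sup>2 * g x" unfolding ev by (simp add: power2_eq_square mult.assoc)
  have lim2: "?I \<longlonglongrightarrow> (\<integral>\<xi>. cis (x \<bullet> \<xi>) * fourier g \<xi> \<partial>lborel)"
  proof (rule integral_dominated_convergence[where w="\<lambda>\<xi>. cmod (fourier g \<xi>)"])
    show "integrable lborel (\<lambda>\<xi>. cmod (fourier g \<xi>))"
      by (intro integrable_norm schwartz_integrable schwartz_fourier g)
    show "AE \<xi> in lborel. (\<lambda>n. (cis (x \<bullet> \<xi>) * gauss ((1 / real (Suc n)) *\<^sub>R \<xi>)) * fourier g \<xi>) \<longlonglongrightarrow> cis (x \<bullet> \<xi>) * fourier g \<xi>"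
    proof (rule AE_I2)
      fix \<xi> :: plane
      have ct: "isCont gauss (0 *\<^sub>R \<xi>)"
        using schwartz_continuous[OF schwartz_gauss, of UNIV] by (simp add: continuous_on_eq_continuous_at)
      have "(\<lambda>n. gauss ((1 / real (Suc n)) *\<^sub>R \<xi>)) \<longlonglongrightarrow> gauss (0 *\<^sub>R \<xi>)"
        by (rule isCont_tendsto_compose[OF ct]) (intro tendsto_intros LIMSEQ_Suc[OF lim_1_over_n])
      then have "(\<lambda>n. (cis (x \<bullet> \<xi>) * gauss ((1 / real (Suc n)) *\<^sub>R \<xi>)) * fourier g \<xi>) \<longlonglongrightarrow> (cis (x \<bullet> \<xi>) * gauss (0 *\<^sub>R \<xi>)) * fourier g \<xi>"
        by (intro tendsto_intros)
      then show "(\<lambda>n. (cis (x \<bullet> \<xi>) * gauss ((1 / real (Suc n)) *\<^sub>R \<xi>)) * fourier g \<xi>) \<longlonglongrightarrow> cis (x \<bullet> \<xi>) * fourier g \<xi>"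
        by (simp add: gauss_def)
    qed
    show "\<And>n. AE \<xi> in lborel. norm ((cis (x \<bullet> \<xi>) * gauss ((1 / real (Suc n)) *\<^sub>R \<xi>)) * fourier g \<xi>) \<le> cmod (fourier g \<xi>)"
      by (intro AE_I2) (auto simp: norm_mult gauss_def intro!: mult_left_le_one_le)
  qed measurable
  from LIMSEQ_unique[OF lim2 lim1] show ?thesis .
qed

lemma fourier_inversion: "schwartz g \<Longrightarrow> inv_fourier (fourier g) = g"
  by (rule ext) (simp add: inv_fourier_def fourier_inversion_integral)

lemma inv_fourier_conv_fourier: "inv_fourier g x = 1 / (2 * of_real pi)\<^sup>2 * fourier g (- x)"
  by (simp add: inv_fourier_def fourier_def inner_commute)

lemma schwartz_inv_fourier:
  assumes "schwartz g"
  shows "schwartz (inv_fourier g)"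
proof -
  have "schwartz (\<lambda>x. 1 / (2 * of_real pi)\<^sup>2 * fourier g (- 1 *\<^sub>R x))"
    by (intro schwartz_cmult schwartz_scale schwartz_fourier assms) simp
  moreover have "inv_fourier g = (\<lambda>x. 1 / (2 * of_real pi)\<^sup>2 * fourier g (- 1 *\<^sub>R x))"
    by (rule ext) (simp add: inv_fourier_conv_fourier)
  ultimately show ?thesis by simp
qed

lemma fourier_inv_fourier:
  assumes "schwartz g"
  shows "fourier (inv_fourier g) = g"
proof
  fix \<xi>
  note [measurable] = schwartz_measurable[OF schwartz_fourier[OF assms]]
  have "fourier (inv_fourier g) \<xi> = (\<integral>x. 1 / (2 * of_real pi)\<^sup>2 * (cis (- (x \<bullet> \<xi>)) * fourier g (- x)) \<partial>lborel)"
    unfolding fourier_def[of "inv_fourier g"] inv_fourier_conv_fourier by (simp add: mult_ac)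
  also have "\<dots> = 1 / (2 * of_real pi)\<^sup>2 * (\<integral>x. cis (\<xi> \<bullet> (0 - x)) * fourier g (0 - x) \<partial>lborel)"
    by (simp add: inner_commute)
  also have "(\<integral>x. cis (\<xi> \<bullet> (0 - x)) * fourier g (0 - x) \<partial>lborel) = (\<integral>x. cis (\<xi> \<bullet> x) * fourier g x \<partial>lborel)"
    by (rule integral_reflect[of "\<lambda>x. cis (\<xi> \<bullet> x) * fourier g x"]) measurable
  finally show "fourier (inv_fourier g) \<xi> = g \<xi>"
    using fourier_inversion_integral[OF assms, of \<xi>] by simp
qed

lemma fourier_scale:
  assumes "schwartz g" and c: "c \<noteq> 0"
  shows "fourier (\<lambda>x. of_real (c\<^sup>2) * g (c *\<^sub>R x)) \<xi> = fourier g ((1 / c) *\<^sub>R \<xi>)"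
proof -
  note [measurable] = schwartz_measurable[OF assms(1)]
  have "fourier g ((1 / c) *\<^sub>R \<xi>) = of_real (c\<^sup>2) * (\<integral>x. cis (- ((0 + c *\<^sub>R x) \<bullet> ((1 / c) *\<^sub>R \<xi>))) * g (0 + c *\<^sub>R x) \<partial>lborel)"
    unfolding fourier_def by (rule integral_plane_affine[OF _ c]) measurable
  also have "\<dots> = (\<integral>x. of_real (c\<^sup>2) * (cis (- (x \<bullet> \<xi>)) * g (c *\<^sub>R x)) \<partial>lborel)"
    using c by (simp only: integral_mult_right_zero) simp
  also have "\<dots> = fourier (\<lambda>x. of_real (c\<^sup>2) * g (c *\<^sub>R x)) \<xi>"
    unfolding fourier_def by (simp only: mult.left_commute)
  finally show ?thesis ..
qed

section \<open>Convolution\<close>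

definition sconv :: "(plane \<Rightarrow> complex) \<Rightarrow> (plane \<Rightarrow> complex) \<Rightarrow> plane \<Rightarrow> complex" where
  "sconv K h x = (\<integral>y. K (x - y) * h y \<partial>lborel)"

text \<open>Writing \<open>K\<close> by the inversion formula and exchanging the integrals yields at once that a convolution
  of Schwartz functions is again one, and the convolution theorem.\<close>

lemma sconv_eq:
  assumes K: "schwartz K" and h: "schwartz h"
  shows "sconv K h = inv_fourier (\<lambda>\<xi>. fourier K \<xi> * fourier h \<xi>)"
proof
  fix x
  note [measurable] = schwartz_measurable[OF schwartz_fourier[OF K]]
  have sf: "schwartz (\<lambda>\<xi>. cis (x \<bullet> \<xi>) * fourier K \<xi>)"
    using schwartz_cis[OF schwartz_fourier[OF K], of "- x"] by (simp add: inner_commute)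
  have "(\<integral>\<xi>. cis (x \<bullet> \<xi>) * (fourier K \<xi> * fourier h \<xi>) \<partial>lborel)
      = (\<integral>\<xi>. (cis (x \<bullet> \<xi>) * fourier K \<xi>) * (\<integral>y. cis (- (y \<bullet> \<xi>)) * h y \<partial>lborel) \<partial>lborel)"
    unfolding fourier_def[of h] by (simp add: mult.assoc)
  also have "\<dots> = (\<integral>y. (\<integral>\<xi>. cis (- (y \<bullet> \<xi>)) * (cis (x \<bullet> \<xi>) * fourier K \<xi>) \<partial>lborel) * h y \<partial>lborel)"
  proof (rule Fubini_mult[where B=1])
    have "continuous_on UNIV (\<lambda>z::plane \<times> plane. cis (- (snd z \<bullet> fst z)))"
      by (intro continuous_intros)
    then show "(\<lambda>(\<xi>, y). cis (- (y \<bullet> \<xi>))) \<in> borel_measurable (borel \<Otimes>\<^sub>M (borel :: plane measure))"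
      unfolding borel_prod by (simp add: borel_measurable_continuous_onI split_beta')
  qed (auto intro: schwartz_integrable sf h)
  also have "\<dots> = (\<integral>y. (2 * of_real pi)\<^sup>2 * K (x - y) * h y \<partial>lborel)"
  proof (intro Bochner_Integration.integral_cong refl arg_cong2[where f="(*)"])
    fix y
    have "(\<integral>\<xi>. cis (- (y \<bullet> \<xi>)) * (cis (x \<bullet> \<xi>) * fourier K \<xi>) \<partial>lborel) = (\<integral>\<xi>. cis ((x - y) \<bullet> \<xi>) * fourier K \<xi> \<partial>lborel)"
      by (intro Bochner_Integration.integral_cong refl)
         (simp add: mult.assoc[symmetric] cis_mult inner_diff_left)
    also have "\<dots> = (2 * of_real pi)\<^sup>2 * K (x - y)" by (rule fourier_inversion_integral[OF K])
    finally show "(\<integral>\<xi>. cis (- (y \<bullet> \<xi>)) * (cis (x \<bullet> \<xi>) * fourier K \<xi>) \<partial>lborel) = (2 * of_real pi)\<^sup>2 * K (x - y)" .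
  qed
  also have "\<dots> = (2 * of_real pi)\<^sup>2 * sconv K h x"
    unfolding sconv_def by (simp add: mult.assoc)
  finally show "sconv K h x = inv_fourier (\<lambda>\<xi>. fourier K \<xi> * fourier h \<xi>) x"
    unfolding inv_fourier_def by simp
qed

lemma schwartz_sconv: "schwartz K \<Longrightarrow> schwartz h \<Longrightarrow> schwartz (sconv K h)"
  unfolding sconv_eq by (intro schwartz_inv_fourier schwartz_mult schwartz_fourier)

lemma fourier_sconv: "schwartz K \<Longrightarrow> schwartz h \<Longrightarrow> fourier (sconv K h) \<xi> = fourier K \<xi> * fourier h \<xi>"
  unfolding sconv_eq by (subst fourier_inv_fourier) (auto intro: schwartz_mult schwartz_fourier)

lemma fourier_inj:
  assumes "schwartz g" "schwartz h" "\<And>\<xi>. fourier g \<xi> = fourier h \<xi>"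
  shows "g = h"
  using fourier_inversion[OF assms(1)] fourier_inversion[OF assms(2)] assms(3) by (metis ext)

lemma pd_sconv: "schwartz K \<Longrightarrow> schwartz h \<Longrightarrow> pd k (sconv K h) = sconv K (pd k h)"
  by (rule fourier_inj) (auto simp: fourier_sconv fourier_pd schwartz_pd schwartz_sconv)

lemma fold_pd_sconv: "schwartz K \<Longrightarrow> schwartz h \<Longrightarrow> fold pd ks (sconv K h) = sconv K (fold pd ks h)"
  by (induction ks arbitrary: h) (auto simp: pd_sconv schwartz_pd)

section \<open>Tempered distributions\<close>

lemma finite_pd_lists: "finite {ks :: 2 list. length ks \<le> N}"
  using finite_lists_length_le[of "UNIV :: 2 set" N] by simp

lemma pd_lists_bound:
  assumes "schwartz g"
  obtains B where "\<And>ks x. length ks \<le> N \<Longrightarrow> (1 + norm x) ^ N * cmod (fold pd ks g x) \<le> B"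
proof -
  have "\<exists>b. \<forall>x. (1 + norm x) ^ N * cmod (fold pd ks g x) \<le> b" for ks
    using schwartz_decay[OF schwartz_fold_pd[OF assms], of N] by metis
  then obtain b where b: "\<And>ks x. (1 + norm x) ^ N * cmod (fold pd ks g x) \<le> b ks" by metis
  have "b ks \<le> Max (b ` {ks. length ks \<le> N})" if "length ks \<le> N" for ks
    using that finite_pd_lists[of N] by (intro Max_ge) auto
  then show ?thesis using b that order_trans by metis
qed

lemma schwartz_seminorm_upper:
  assumes g: "schwartz g" and ks: "length ks \<le> N"
  shows "(1 + norm x) ^ N * cmod (fold pd ks g x) \<le> schwartz_seminorm N g"
proof -
  obtain B where B: "\<And>ks x. length ks \<le> N \<Longrightarrow> (1 + norm x) ^ N * cmod (fold pd ks g x) \<le> B"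
    using pd_lists_bound[OF g] by metis
  have "(case (ks, x) of (ks, x) \<Rightarrow> (1 + norm x) ^ N * cmod (fold pd ks g x)) \<le> schwartz_seminorm N g"
    unfolding schwartz_seminorm_def
    by (rule cSUP_upper) (use ks B in \<open>auto intro!: bdd_aboveI2[where M=B]\<close>)
  then show ?thesis by simp
qed

lemma schwartz_seminorm_least:
  assumes "\<And>ks x. length ks \<le> N \<Longrightarrow> (1 + norm x) ^ N * cmod (fold pd ks g x) \<le> B"
  shows "schwartz_seminorm N g \<le> B"
  unfolding schwartz_seminorm_def
  by (rule cSUP_least) (use assms in \<open>auto intro: exI[of _ "[]"]\<close>)

text \<open>Continuity of \<open>u\<close> in a form that needs only pointwise bounds of the test function and provides a
  nonnegative constant.\<close>

lemma tempered_bound: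
  assumes "tempered u"
  obtains C N where "C \<ge> 0"
    "\<And>g B. schwartz g \<Longrightarrow> (\<And>ks x. length ks \<le> N \<Longrightarrow> (1 + norm x) ^ N * cmod (fold pd ks g x) \<le> B) \<Longrightarrow> cmod (u g) \<le> C * B"
proof -
  obtain C N where CN: "\<And>g. schwartz g \<Longrightarrow> cmod (u g) \<le> C * schwartz_seminorm N g"
    using assms unfolding tempered_def by blast
  show ?thesis
  proof (rule that[of "\<bar>C\<bar>" N])
    fix g B
    assume g: "schwartz g" and B: "\<And>ks x. length ks \<le> N \<Longrightarrow> (1 + norm x) ^ N * cmod (fold pd ks g x) \<le> B"
    have s0: "0 \<le> schwartz_seminorm N g"
      using schwartz_seminorm_upper[OF g, of "[]" N 0] order_trans[OF norm_ge_zero] by (simp add: order_trans[OF norm_ge_zero])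
    have "cmod (u g) \<le> C * schwartz_seminorm N g" by (rule CN[OF g])
    also have "\<dots> \<le> \<bar>C\<bar> * B"
      using schwartz_seminorm_least[OF B] s0 by (intro mult_mono) auto
    finally show "cmod (u g) \<le> \<bar>C\<bar> * B" .
  qed auto
qed

lemma tempered_add: "tempered u \<Longrightarrow> schwartz g \<Longrightarrow> schwartz h \<Longrightarrow> u (\<lambda>x. g x + h x) = u g + u h"
  unfolding tempered_def by blast

lemma tempered_cmult: "tempered u \<Longrightarrow> schwartz g \<Longrightarrow> u (\<lambda>x. c * g x) = c * u g"
  unfolding tempered_def by blast

lemma tempered_diff: "tempered u \<Longrightarrow> schwartz g \<Longrightarrow> schwartz h \<Longrightarrow> u (\<lambda>x. g x - h x) = u g - u h"
  using tempered_add[of u g "\<lambda>x. -1 * h x"] tempered_cmult[of u h "-1"] schwartz_cmult[of h "-1"] by simp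

lemma tempered_0: "tempered u \<Longrightarrow> u (\<lambda>x. 0) = 0"
  using tempered_cmult[OF _ schwartz_0, of u 0] by simp

lemma tempered_sum:
  assumes "tempered u" "\<And>i. i \<in> I \<Longrightarrow> schwartz (g i)"
  shows "u (\<lambda>x. \<Sum>i\<in>I. g i x) = (\<Sum>i\<in>I. u (g i))"
  using assms(2)
proof (induction I rule: infinite_finite_induct)
  case (insert i I)
  then have "u (\<lambda>x. g i x + (\<Sum>i\<in>I. g i x)) = u (g i) + u (\<lambda>x. \<Sum>i\<in>I. g i x)"
    by (intro tempered_add assms(1) schwartz_sum) auto
  then show ?case using insert by simp
qed (auto simp: tempered_0 assms(1))

lemma tempered_non_schwartz: "tempered u \<Longrightarrow> \<not> schwartz g \<Longrightarrow> u g = 0"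
  unfolding tempered_def by blast

lemma fold_pd_reflect:
  assumes "schwartz h"
  shows "fold pd ks (\<lambda>z. h (y - z)) z = (-1) ^ length ks * fold pd ks h (y - z)"
  using fold_pd_affine[OF assms, of ks "-1" y z] by simp

text \<open>The mean value inequality on the segment from \<open>y - z\<close> to \<open>y' - z\<close>. The weight in \<open>z\<close> is paid for by
  the decay of the gradient, up to a power of the size of the segment.\<close>

lemma schwartz_lipschitz_weighted:
  assumes g: "schwartz g"
  shows "\<exists>C\<ge>0. \<forall>y y' z. (1 + norm z) ^ N * cmod (g (y' - z) - g (y - z)) \<le> C * (norm (y' - y) * (1 + norm y + norm y') ^ N)"
proof -
  have "\<exists>A\<ge>0. \<forall>w. (1 + norm w) ^ N * cmod (pd k g w) \<le> A" for k
    using schwartz_decay[OF schwartz_pd[OF g], of N] by metis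
  then obtain A where A0: "\<And>k. A k \<ge> 0" and A: "\<And>k w. (1 + norm w) ^ N * cmod (pd k g w) \<le> A k" by metis
  define S where "S = (\<Sum>k\<in>UNIV. A k)"
  have S0: "S \<ge> 0" unfolding S_def by (simp add: A0 sum_nonneg)
  have "(1 + norm z) ^ N * cmod (g (y' - z) - g (y - z)) \<le> S * (norm (y' - y) * (1 + norm y + norm y') ^ N)" for y y' z
  proof -
    define R where "R = 1 + norm y + norm y'"
    define B where "B = R ^ N * S / (1 + norm z) ^ N"
    have z: "(1 + norm z) ^ N > 0" by (simp add: one_plus_norm_pos)
    have R: "R \<ge> 0" unfolding R_def by simp
    have "norm (g (y' - z) - g (y - z)) \<le> B * norm ((y' - z) - (y - z))"
    proof (rule differentiable_bound[where S="closed_segment (y - z) (y' - z)" and f'="\<lambda>w h. \<Sum>k\<in>UNIV. h $ k *\<^sub>R pd k g w"])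
      fix w assume "w \<in> closed_segment (y - z) (y' - z)"
      then obtain t where t: "0 \<le> t" "t \<le> 1" and w: "w = (1 - t) *\<^sub>R (y - z) + t *\<^sub>R (y' - z)"
        unfolding closed_segment_def by auto
      show "(g has_derivative (\<lambda>h. \<Sum>k\<in>UNIV. h $ k *\<^sub>R pd k g w)) (at w within closed_segment (y - z) (y' - z))"
        by (rule has_derivative_at_withinI, rule has_derivative_pd, rule schwartz_differentiable[OF g])
      have "w + z = (1 - t) *\<^sub>R y + t *\<^sub>R y'" unfolding w by (simp add: algebra_simps)
      then have "norm (w + z) \<le> norm ((1 - t) *\<^sub>R y) + norm (t *\<^sub>R y')"
        using norm_triangle_ineq by metis
      also have "\<dots> \<le> norm y + norm y'"
        using t by (intro add_mono) (auto intro: mult_left_le_one_le)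
      finally have wz: "1 + norm (w + z) \<le> R" unfolding R_def by simp
      have "1 + norm z \<le> (1 + norm (w + z)) * (1 + norm w)"
      proof -
        have "norm z \<le> norm (w + z) + norm w" using norm_triangle_ineq4[of "w + z" w] by simp
        moreover have "0 \<le> norm (w + z) * norm w" by simp
        ultimately show ?thesis unfolding distrib_left distrib_right by linarith
      qed
      also have "\<dots> \<le> R * (1 + norm w)" using wz by (intro mult_right_mono) auto
      finally have "(1 + norm z) ^ N \<le> R ^ N * (1 + norm w) ^ N"
        unfolding power_mult_distrib[symmetric] by (intro power_mono) auto
      then have pdw: "(1 + norm z) ^ N * cmod (pd k g w) \<le> R ^ N * A k" for k
      proof -
        assume le: "(1 + norm z) ^ N \<le> R ^ N * (1 + norm w) ^ N"
        have "(1 + norm z) ^ N * cmod (pd k g w) \<le> R ^ N * (1 + norm w) ^ N * cmod (pd k g w)"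
          using le by (rule mult_right_mono) simp
        also have "\<dots> \<le> R ^ N * A k"
          unfolding mult.assoc using A R by (intro mult_left_mono) auto
        finally show ?thesis .
      qed
      show "onorm (\<lambda>h. \<Sum>k\<in>UNIV. h $ k *\<^sub>R pd k g w) \<le> B"
      proof (rule onorm_le)
        fix h :: plane
        have "norm (\<Sum>k\<in>UNIV. h $ k *\<^sub>R pd k g w) \<le> (\<Sum>k\<in>UNIV. norm h * (R ^ N * A k / (1 + norm z) ^ N))"
        proof (rule sum_norm_le)
          fix k :: 2
          have "cmod (pd k g w) \<le> R ^ N * A k / (1 + norm z) ^ N"
            using pdw[of k] z by (simp add: pos_le_divide_eq mult.commute)
          then show "norm (h $ k *\<^sub>R pd k g w) \<le> norm h * (R ^ N * A k / (1 + norm z) ^ N)"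
            using component_le_norm_cart[of h k] unfolding norm_scaleR real_norm_def by (intro mult_mono) auto
        qed
        also have "\<dots> = B * norm h"
          unfolding B_def S_def by (simp add: sum_distrib_left sum_distrib_right sum_divide_distrib mult_ac)
        finally show "norm (\<Sum>k\<in>UNIV. h $ k *\<^sub>R pd k g w) \<le> B * norm h" .
      qed
    qed auto
    then have "(1 + norm z) ^ N * cmod (g (y' - z) - g (y - z)) \<le> (1 + norm z) ^ N * (B * norm (y' - y))"
      using z by (intro mult_left_mono) auto
    also have "\<dots> = S * (norm (y' - y) * R ^ N)" unfolding B_def using z by simp
    finally show ?thesis unfolding R_def .
  qed
  then show ?thesis using S0 by blast
qed

lemma pd_lists_lipschitz:
  assumes h: "schwartz h"
  obtains C where "C \<ge> 0"
    "\<And>ks y y' z. length ks \<le> N \<Longrightarrow> (1 + norm z) ^ N * cmod (fold pd ks h (y' - z) - fold pd ks h (y - z))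
        \<le> C * (norm (y' - y) * (1 + norm y + norm y') ^ N)"
proof -
  obtain b where b0: "\<And>ks. b ks \<ge> 0" and b: "\<And>ks y y' z. (1 + norm z) ^ N * cmod (fold pd ks h (y' - z) - fold pd ks h (y - z))
        \<le> b ks * (norm (y' - y) * (1 + norm y + norm y') ^ N)"
    using schwartz_lipschitz_weighted[OF schwartz_fold_pd[OF h], of N] by metis
  let ?M = "Max (b ` {ks. length ks \<le> N})"
  have M: "b ks \<le> ?M" if "length ks \<le> N" for ks
    using that finite_pd_lists[of N] by (intro Max_ge) auto
  show ?thesis
  proof (rule that[of ?M])
    show "?M \<ge> 0" using order_trans[OF b0 M[of "[]"]] by simp
    fix ks :: "2 list" and y y' z :: plane assume ks: "length ks \<le> N"
    have "b ks * (norm (y' - y) * (1 + norm y + norm y') ^ N) \<le> ?M * (norm (y' - y) * (1 + norm y + norm y') ^ N)"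
      using M[OF ks] by (intro mult_right_mono) auto
    then show "(1 + norm z) ^ N * cmod (fold pd ks h (y' - z) - fold pd ks h (y - z))
        \<le> ?M * (norm (y' - y) * (1 + norm y + norm y') ^ N)"
      using b order_trans by blast
  qed
qed

lemma conv_lipschitz:
  assumes u: "tempered u" and h: "schwartz h"
  obtains C N where "C \<ge> 0" "\<And>y y'. cmod (conv h u y' - conv h u y) \<le> C * (norm (y' - y) * (1 + norm y + norm y') ^ N)"
proof -
  obtain A N where A: "A \<ge> 0" "\<And>g B. schwartz g \<Longrightarrow> (\<And>ks x. length ks \<le> N \<Longrightarrow> (1 + norm x) ^ N * cmod (fold pd ks g x) \<le> B) \<Longrightarrow> cmod (u g) \<le> A * B"
    using tempered_bound[OF u] by blast
  obtain C where C: "C \<ge> 0" "\<And>ks y y' z. length ks \<le> N \<Longrightarrow> (1 + norm z) ^ N * cmod (fold pd ks h (y' - z) - fold pd ks h (y - z))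
        \<le> C * (norm (y' - y) * (1 + norm y + norm y') ^ N)"
    using pd_lists_lipschitz[OF h] by metis
  have "cmod (conv h u y' - conv h u y) \<le> (A * C) * (norm (y' - y) * (1 + norm y + norm y') ^ N)" for y y'
  proof -
    note s = schwartz_reflect[OF h, of y'] schwartz_reflect[OF h, of y]
    have "conv h u y' - conv h u y = u (\<lambda>z. h (y' - z) - h (y - z))"
      unfolding conv_def by (rule tempered_diff[OF u s, symmetric])
    also have "cmod \<dots> \<le> A * (C * (norm (y' - y) * (1 + norm y + norm y') ^ N))"
    proof (rule A(2)[OF schwartz_diff[OF s]])
      fix ks and z :: plane assume ks: "length (ks :: 2 list) \<le> N"
      have "cmod (fold pd ks (\<lambda>z. h (y' - z) - h (y - z)) z) = cmod (fold pd ks h (y' - z) - fold pd ks h (y - z))"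
        by (simp add: fold_pd_diff[OF s] fold_pd_reflect[OF h] norm_mult norm_power flip: right_diff_distrib)
      then show "(1 + norm z) ^ N * cmod (fold pd ks (\<lambda>z. h (y' - z) - h (y - z)) z) \<le> C * (norm (y' - y) * (1 + norm y + norm y') ^ N)"
        using C(2)[OF ks] by simp
    qed
    finally show ?thesis by (simp add: mult.assoc)
  qed
  then show ?thesis using that[of "A * C" N] A(1) C(1) by simp
qed

lemma conv_growth:
  assumes u: "tempered u" and h: "schwartz h"
  obtains C N where "C \<ge> 0" "\<And>y. cmod (conv h u y) \<le> C * (1 + norm y) ^ N"
proof -
  obtain C N where C: "C \<ge> 0" "\<And>y y'. cmod (conv h u y' - conv h u y) \<le> C * (norm (y' - y) * (1 + norm y + norm y') ^ N)"
    using conv_lipschitz[OF assms] by metis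
  have "cmod (conv h u y) \<le> (cmod (conv h u 0) + C) * (1 + norm y) ^ Suc N" for y
  proof -
    have "cmod (conv h u y) \<le> cmod (conv h u 0) + cmod (conv h u y - conv h u 0)"
      using norm_triangle_sub by blast
    also have "\<dots> \<le> cmod (conv h u 0) * 1 + C * (norm y * (1 + norm y) ^ N)" using C(2)[where y=0 and y'=y] by simp
    also have "\<dots> \<le> cmod (conv h u 0) * (1 + norm y) ^ Suc N + C * (1 + norm y) ^ Suc N"
    proof (intro add_mono mult_left_mono C(1) norm_ge_zero)
      show "1 \<le> (1 + norm y) ^ Suc N" by (rule one_le_power) simp
      show "norm y * (1 + norm y) ^ N \<le> (1 + norm y) ^ Suc N"
        unfolding power_Suc by (intro mult_right_mono) auto
    qed
    finally show ?thesis by (simp add: distrib_right)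
  qed
  then show ?thesis using that[of "cmod (conv h u 0) + C" "Suc N"] C(1) by simp
qed

lemma conv_continuous:
  assumes "tempered u" "schwartz h"
  shows "isCont (conv h u) y"
proof -
  obtain C N where C: "C \<ge> 0" "\<And>y y'. cmod (conv h u y' - conv h u y) \<le> C * (norm (y' - y) * (1 + norm y + norm y') ^ N)"
    using conv_lipschitz[OF assms] by metis
  have "((\<lambda>y'. C * (norm (y' - y) * (1 + norm y + norm y') ^ N)) \<longlongrightarrow> C * (norm (y - y) * (1 + norm y + norm y) ^ N)) (at y)"
    by (intro tendsto_intros)
  then have lim: "((\<lambda>y'. C * (norm (y' - y) * (1 + norm y + norm y') ^ N)) \<longlongrightarrow> 0) (at y)" by simp
  have "((\<lambda>y'. conv h u y' - conv h u y) \<longlongrightarrow> 0) (at y)"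
    by (rule Lim_null_comparison[OF _ lim]) (use C(2) in \<open>auto intro!: always_eventually\<close>)
  then show ?thesis unfolding isCont_def by (simp add: LIM_zero_iff)
qed

lemma conv_measurable:
  assumes "tempered u" "schwartz h"
  shows "conv h u \<in> borel_measurable borel"
  by (rule borel_measurable_continuous_onI) (use conv_continuous[OF assms] in \<open>auto simp: continuous_on_eq_continuous_at\<close>)

text \<open>A tempered distribution commutes with the integral defining a convolution: the integral is a
  limit of sums over the values of simple functions \<open>s n\<close> converging to the identity, and this limit
  holds in every Schwartz seminorm.\<close>

lemma sconv_conv:
  assumes u: "tempered u" and K: "schwartz K" and h: "schwartz h"
  shows "sconv K (conv h u) x = conv (sconv K h) u x"
proof -
  let ?w = "conv h u"
  have Kx: "schwartz (\<lambda>y. K (x - y))" by (rule schwartz_reflect[OF K])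
  note [measurable] = schwartz_measurable[OF Kx] conv_measurable[OF u h]
  have "\<exists>s. (\<forall>i. simple_function lborel (s i)) \<and> (\<forall>y\<in>space (lborel::plane measure). (\<lambda>i. s i y) \<longlonglongrightarrow> y) \<and>
          (\<forall>i. \<forall>y\<in>space (lborel::plane measure). dist (s i y) (0::plane) \<le> 2 * dist y 0)"
    by (rule borel_measurable_implies_sequence_metric) measurable
  then obtain s :: "nat \<Rightarrow> plane \<Rightarrow> plane" where simple: "\<And>n. simple_function lborel (s n)"
    and lim: "\<And>y. (\<lambda>n. s n y) \<longlonglongrightarrow> y" and s2: "\<And>n y. norm (s n y) \<le> 2 * norm y" by auto
  have fin: "finite (range (s n))" for n using simple[of n] unfolding simple_function_def by simp
  have sm [measurable]: "s n \<in> borel_measurable borel" for n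
    using borel_measurable_simple_function[OF simple[of n]] by simp
  have iK: "integrable lborel (\<lambda>y. K (x - y))" by (rule schwartz_integrable[OF Kx])
  define c where "c n q = (\<integral>y. K (x - y) * indicator (s n -` {q}) y \<partial>lborel)" for n q
  have ic: "integrable lborel (\<lambda>y. K (x - y) * indicator (s n -` {q}) y)" for n q
  proof (rule Bochner_Integration.integrable_bound[OF iK])
    have "s n -` {q} \<in> sets borel" using measurable_sets[OF sm, of "{q}" n] by simp
    then show "(\<lambda>y. K (x - y) * indicator (s n -` {q}) y) \<in> borel_measurable lborel" by measurable
  qed (auto simp: indicator_def)
  have discr: "(\<Sum>q\<in>range (s n). c n q * F q) = (\<integral>y. K (x - y) * F (s n y) \<partial>lborel)" for n and F :: "plane \<Rightarrow> complex"
  proof -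
    have "(\<Sum>q\<in>range (s n). c n q * F q) = (\<integral>y. (\<Sum>q\<in>range (s n). K (x - y) * indicator (s n -` {q}) y * F q) \<partial>lborel)"
      unfolding c_def by (subst Bochner_Integration.integral_sum) (auto intro: integrable_mult_left ic)
    also have "\<dots> = (\<integral>y. K (x - y) * F (s n y) \<partial>lborel)"
    proof (intro Bochner_Integration.integral_cong refl)
      fix y
      have "(\<Sum>q\<in>range (s n). K (x - y) * indicator (s n -` {q}) y * F q) = (\<Sum>q\<in>range (s n). if q = s n y then K (x - y) * F q else 0)"
        by (intro sum.cong) (auto simp: indicator_def)
      then show "(\<Sum>q\<in>range (s n). K (x - y) * indicator (s n -` {q}) y * F q) = K (x - y) * F (s n y)"
        using fin by simp
    qed
    finally show ?thesis .
  qed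
  define A where "A n = (\<lambda>z. \<Sum>q\<in>range (s n). c n q * h (q - z))" for n
  have sA: "schwartz (A n)" for n unfolding A_def by (intro schwartz_sum schwartz_cmult schwartz_reflect h)
  have uA: "u (A n) = (\<integral>y. K (x - y) * ?w (s n y) \<partial>lborel)" for n
  proof -
    have "u (A n) = (\<Sum>q\<in>range (s n). u (\<lambda>z. c n q * h (q - z)))"
      unfolding A_def by (rule tempered_sum[OF u]) (intro schwartz_cmult schwartz_reflect h)
    also have "\<dots> = (\<Sum>q\<in>range (s n). c n q * ?w q)"
      unfolding conv_def by (intro sum.cong refl tempered_cmult[OF u] schwartz_reflect h)
    finally show ?thesis unfolding discr .
  qed
  let ?A = "\<lambda>z. sconv K h (x - z)"
  have sA': "schwartz ?A" by (intro schwartz_reflect schwartz_sconv K h)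
  obtain C N where C: "C \<ge> 0" "\<And>g B. schwartz g \<Longrightarrow> (\<And>ks x. length ks \<le> N \<Longrightarrow> (1 + norm x) ^ N * cmod (fold pd ks g x) \<le> B) \<Longrightarrow> cmod (u g) \<le> C * B"
    using tempered_bound[OF u] by blast
  obtain D where D: "D \<ge> 0" "\<And>ks y y' z. length ks \<le> N \<Longrightarrow> (1 + norm z) ^ N * cmod (fold pd ks h (y' - z) - fold pd ks h (y - z))
        \<le> D * (norm (y' - y) * (1 + norm y + norm y') ^ N)"
    using pd_lists_lipschitz[OF h] by metis
  define e where "e n y = cmod (K (x - y)) * (D * (norm (s n y - y) * (1 + norm y + norm (s n y)) ^ N))" for n y
  have em [measurable]: "e n \<in> borel_measurable borel" for n unfolding e_def by measurable
  let ?dom = "\<lambda>y. D * 3 ^ Suc N * ((1 + norm y) ^ Suc N * cmod (K (x - y)))"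
  have dom: "integrable lborel ?dom"
    by (intro integrable_mult_right schwartz_poly_integrable Kx)
  have e_le: "norm (e n y) \<le> ?dom y" for n y
  proof -
    have "norm (s n y - y) \<le> 3 * norm y"
      using norm_triangle_ineq4[of "s n y" y] s2[of n y] by linarith
    moreover have "3 * norm y \<le> 3 * (1 + norm y)" by simp
    ultimately have 1: "norm (s n y - y) \<le> 3 * (1 + norm y)" by linarith
    have 2: "(1 + norm y + norm (s n y)) ^ N \<le> (3 * (1 + norm y)) ^ N"
      using s2[of n y] by (intro power_mono) (auto simp: distrib_left)
    have "norm (s n y - y) * (1 + norm y + norm (s n y)) ^ N \<le> (3 * (1 + norm y)) * (3 * (1 + norm y)) ^ N"
      by (rule mult_mono[OF 1 2]) auto
    also have "\<dots> = 3 ^ Suc N * (1 + norm y) ^ Suc N" by (simp only: power_Suc power_mult_distrib mult_ac)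
    finally have "D * (norm (s n y - y) * (1 + norm y + norm (s n y)) ^ N) \<le> D * (3 ^ Suc N * (1 + norm y) ^ Suc N)"
      using D(1) by (rule mult_left_mono)
    then have "e n y \<le> cmod (K (x - y)) * (D * (3 ^ Suc N * (1 + norm y) ^ Suc N))"
      unfolding e_def by (rule mult_left_mono) simp
    moreover have "e n y \<ge> 0" unfolding e_def using D(1) by simp
    ultimately show ?thesis by (simp only: real_norm_def abs_of_nonneg mult_ac)
  qed
  have ie: "integrable lborel (e n)" for n
    by (rule Bochner_Integration.integrable_bound[OF dom]) (auto intro!: AE_I2 order_trans[OF e_le[unfolded real_norm_def] abs_ge_self] simp del: power_Suc)
  have e_lim: "(\<lambda>n. \<integral>y. e n y \<partial>lborel) \<longlonglongrightarrow> (\<integral>y. 0 \<partial>(lborel::plane measure))"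
  proof (rule integral_dominated_convergence[OF _ _ dom])
    show "AE y in lborel. (\<lambda>n. e n y) \<longlonglongrightarrow> 0"
    proof (rule AE_I2)
      fix y
      have "(\<lambda>n. e n y) \<longlonglongrightarrow> cmod (K (x - y)) * (D * (norm (y - y) * (1 + norm y + norm y) ^ N))"
        unfolding e_def by (intro tendsto_intros lim)
      then show "(\<lambda>n. e n y) \<longlonglongrightarrow> 0" by simp
    qed
  qed (use e_le in auto)
  have close: "cmod (u (A n) - u ?A) \<le> C * (\<integral>y. e n y \<partial>lborel)" for n
  proof -
    have "u (A n) - u ?A = u (\<lambda>z. A n z - ?A z)" by (rule tempered_diff[OF u sA sA', symmetric])
    also have "cmod \<dots> \<le> C * (\<integral>y. e n y \<partial>lborel)"
    proof (rule C(2)[OF schwartz_diff[OF sA sA']])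
      fix ks and z :: plane assume ks: "length (ks :: 2 list) \<le> N"
      let ?H = "fold pd ks h"
      note sH = schwartz_fold_pd[OF h, of ks]
      note [measurable] = schwartz_measurable[OF sH] schwartz_measurable[OF K]
      obtain M where M: "M \<ge> 0" "\<And>y. cmod (?H y) \<le> M" using schwartz_bounded[OF sH] by blast
      have i1: "integrable lborel (\<lambda>y. K (x - y) * ?H (f y - z))" if [measurable]: "f \<in> borel_measurable borel" for f
        by (rule Bochner_Integration.integrable_bound[OF integrable_mult_right[OF iK, of "of_real M"]])
           (use M in \<open>auto simp: norm_mult mult.commute[of M] intro!: mult_left_mono\<close>)
      have 1: "fold pd ks (A n) z = (-1) ^ length ks * (\<integral>y. K (x - y) * ?H (s n y - z) \<partial>lborel)"
      proof -
        have "fold pd ks (A n) z = (\<Sum>q\<in>range (s n). c n q * ((-1) ^ length ks * ?H (q - z)))"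
          unfolding A_def
          by (subst fold_pd_sum) (auto simp: fin fold_pd_cmult schwartz_reflect h fold_pd_reflect intro!: schwartz_cmult)
        also have "\<dots> = (-1) ^ length ks * (\<Sum>q\<in>range (s n). c n q * ?H (q - z))"
          by (simp add: sum_distrib_left mult.left_commute)
        finally show ?thesis unfolding discr .
      qed
      have 2: "fold pd ks ?A z = (-1) ^ length ks * (\<integral>y. K (x - y) * ?H (y - z) \<partial>lborel)"
      proof -
        have "fold pd ks ?A z = (-1) ^ length ks * sconv K ?H (x - z)"
          using fold_pd_reflect[OF schwartz_sconv[OF K h], of ks x z] fold_pd_sconv[OF K h] by simp
        also have "sconv K ?H (x - z) = (\<integral>y. K (x - y) * ?H (y - z) \<partial>lborel)"
        proof -
          have "sconv K ?H (x - z) = (\<integral>y. (\<lambda>y. K (x - z - y) * ?H y) y \<partial>lborel)" unfolding sconv_def ..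
          also have "\<dots> = (\<integral>y. (\<lambda>y. K (x - z - y) * ?H y) (y - z) \<partial>lborel)"
            by (rule integral_translate[symmetric]) measurable
          finally show ?thesis by simp
        qed
        finally show ?thesis .
      qed
      have "fold pd ks (\<lambda>z. A n z - ?A z) z = (-1) ^ length ks * (\<integral>y. K (x - y) * ?H (s n y - z) - K (x - y) * ?H (y - z) \<partial>lborel)"
        unfolding fold_pd_diff[OF sA sA'] 1 2 using i1[of "s n"] i1[of "\<lambda>y. y"] by (simp add: right_diff_distrib)
      then have "(1 + norm z) ^ N * cmod (fold pd ks (\<lambda>z. A n z - ?A z) z)
          = cmod (\<integral>y. of_real ((1 + norm z) ^ N) * (K (x - y) * ?H (s n y - z) - K (x - y) * ?H (y - z)) \<partial>lborel)"
        by (simp only: integral_mult_right_zero norm_mult norm_of_real norm_power norm_minus_cancel norm_one power_one mult_1 abs_of_nonneg[OF zero_le_power[OF less_imp_le[OF one_plus_norm_pos]]])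
      also have "\<dots> \<le> (\<integral>y. e n y \<partial>lborel)"
      proof (rule Bochner_Integration.integral_norm_bound_integral[OF _ ie])
        show "integrable lborel (\<lambda>y. of_real ((1 + norm z) ^ N) * (K (x - y) * ?H (s n y - z) - K (x - y) * ?H (y - z)))"
          using i1[of "s n"] i1[of "\<lambda>y. y"] by simp
        fix y
        have "cmod (of_real ((1 + norm z) ^ N) * (K (x - y) * ?H (s n y - z) - K (x - y) * ?H (y - z)))
            = (1 + norm z) ^ N * (cmod (K (x - y)) * cmod (?H (s n y - z) - ?H (y - z)))"
          by (simp only: right_diff_distrib[symmetric] norm_mult norm_of_real) simp
        also have "\<dots> = cmod (K (x - y)) * ((1 + norm z) ^ N * cmod (?H (s n y - z) - ?H (y - z)))" by simp
        also have "\<dots> \<le> e n y"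
          unfolding e_def by (intro mult_left_mono D(2)[OF ks] norm_ge_zero)
        finally show "cmod (of_real ((1 + norm z) ^ N) * (K (x - y) * ?H (s n y - z) - K (x - y) * ?H (y - z))) \<le> e n y" .
      qed
      finally show "(1 + norm z) ^ N * cmod (fold pd ks (\<lambda>z. A n z - ?A z) z) \<le> (\<integral>y. e n y \<partial>lborel)" .
    qed
    finally show ?thesis .
  qed
  have "(\<lambda>n. C * (\<integral>y. e n y \<partial>lborel)) \<longlonglongrightarrow> C * 0"
    using e_lim by (intro tendsto_intros) simp
  then have e0: "(\<lambda>n. C * (\<integral>y. e n y \<partial>lborel)) \<longlonglongrightarrow> 0" by simp
  have "(\<lambda>n. u (A n) - u ?A) \<longlonglongrightarrow> 0"
    by (rule Lim_null_comparison[OF _ e0]) (intro always_eventually allI close)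
  then have lim1: "(\<lambda>n. u (A n)) \<longlonglongrightarrow> u ?A" by (simp add: LIM_zero_iff)
  obtain G M where G: "G \<ge> 0" "\<And>y. cmod (?w y) \<le> G * (1 + norm y) ^ M"
    using conv_growth[OF u h] by blast
  have lim2: "(\<lambda>n. \<integral>y. K (x - y) * ?w (s n y) \<partial>lborel) \<longlonglongrightarrow> (\<integral>y. K (x - y) * ?w y \<partial>lborel)"
  proof (rule integral_dominated_convergence[where w="\<lambda>y. G * 2 ^ M * ((1 + norm y) ^ M * cmod (K (x - y)))"])
    show "integrable lborel (\<lambda>y. G * 2 ^ M * ((1 + norm y) ^ M * cmod (K (x - y))))"
      by (intro integrable_mult_right schwartz_poly_integrable Kx)
    show "AE y in lborel. (\<lambda>n. K (x - y) * ?w (s n y)) \<longlonglongrightarrow> K (x - y) * ?w y"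
      by (intro AE_I2 tendsto_intros isCont_tendsto_compose[OF conv_continuous[OF u h]] lim)
    show "AE y in lborel. norm (K (x - y) * ?w (s n y)) \<le> G * 2 ^ M * ((1 + norm y) ^ M * cmod (K (x - y)))" for n
    proof (rule AE_I2)
      fix y
      have "(1 + norm (s n y)) ^ M \<le> (2 * (1 + norm y)) ^ M"
        using s2[of n y] by (intro power_mono) auto
      then have "G * (1 + norm (s n y)) ^ M \<le> G * (2 ^ M * (1 + norm y) ^ M)"
        using G(1) unfolding power_mult_distrib by (rule mult_left_mono)
      with G(2)[of "s n y"] have "cmod (?w (s n y)) \<le> G * (2 ^ M * (1 + norm y) ^ M)" by linarith
      then have "cmod (K (x - y)) * cmod (?w (s n y)) \<le> cmod (K (x - y)) * (G * (2 ^ M * (1 + norm y) ^ M))"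
        by (rule mult_left_mono) simp
      then show "norm (K (x - y) * ?w (s n y)) \<le> G * 2 ^ M * ((1 + norm y) ^ M * cmod (K (x - y)))"
        by (simp only: norm_mult mult_ac)
    qed
  qed measurable
  have "u ?A = (\<integral>y. K (x - y) * ?w y \<partial>lborel)"
    using LIMSEQ_unique[OF lim1] lim2 unfolding uA by blast
  then show ?thesis unfolding sconv_def[of K ?w] conv_def[of "sconv K h"] by simp
qed

section \<open>Fourier multipliers supported away from the origin\<close>

definition vanishes_near_0 :: "(plane \<Rightarrow> complex) \<Rightarrow> bool" where
  "vanishes_near_0 G \<longleftrightarrow> (\<exists>r>0. \<forall>\<xi>. norm \<xi> < r \<longrightarrow> G \<xi> = 0)"

lemma has_derivative_locally_0:
  assumes "\<And>y. norm y < r \<Longrightarrow> f y = 0" "norm x < r"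
  shows "(f has_derivative (\<lambda>h. 0)) (at x)"
  by (rule has_derivative_transform_within_open[OF has_derivative_const, of "ball 0 r" x 0])
     (use assms in auto)

lemma pd_locally_0:
  assumes "\<And>y. norm y < r \<Longrightarrow> f y = 0" "norm x < r"
  shows "pd k f x = 0"
  using pd_eq[OF has_derivative_locally_0[OF assms]] by simp

abbreviation normpow :: "real \<Rightarrow> plane \<Rightarrow> complex" where
  "normpow c \<xi> \<equiv> of_real (norm \<xi> powr c)"

lemma normpow_has_derivative:
  assumes "\<xi> \<noteq> 0"
  shows "(normpow c has_derivative (\<lambda>h. of_real (c * (\<xi> \<bullet> h)) * normpow (c - 2) \<xi>)) (at \<xi>)"
proof -
  have e: "norm \<eta> powr c = (\<eta> \<bullet> \<eta>) powr (c / 2)" for \<eta> :: plane and c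
  proof -
    have "norm \<eta> powr c = ((\<eta> \<bullet> \<eta>) powr (1 / 2)) powr c"
      by (simp add: powr_half_sqrt norm_eq_sqrt_inner)
    then show ?thesis by (simp add: powr_powr)
  qed
  have pos: "\<xi> \<bullet> \<xi> > 0" using assms by simp
  have 1: "((\<lambda>z. z powr (c / 2)) has_derivative (*) (c / 2 * (\<xi> \<bullet> \<xi>) powr (c / 2 - 1))) (at (\<xi> \<bullet> \<xi>))"
    using has_real_derivative_powr[OF pos, of "c / 2"] unfolding has_field_derivative_def .
  have 2: "((\<lambda>\<eta>. \<eta> \<bullet> \<eta>) has_derivative (\<lambda>h. \<xi> \<bullet> h + h \<bullet> \<xi>)) (at \<xi>)"
    by (rule has_derivative_inner[OF has_derivative_ident has_derivative_ident])
  have 3: "((\<lambda>\<eta>. (\<eta> \<bullet> \<eta>) powr (c / 2)) has_derivative (\<lambda>h. (c / 2 * (\<xi> \<bullet> \<xi>) powr (c / 2 - 1)) * (\<xi> \<bullet> h + h \<bullet> \<xi>))) (at \<xi>)"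
    by (rule has_derivative_compose[OF 2 1])
  have 4: "(c / 2 * (\<xi> \<bullet> \<xi>) powr (c / 2 - 1)) * (\<xi> \<bullet> h + h \<bullet> \<xi>) = c * (\<xi> \<bullet> h) * norm \<xi> powr (c - 2)" for h
    unfolding e[of \<xi> "c - 2"] by (simp add: inner_commute diff_divide_distrib)
  have "(normpow c has_derivative (\<lambda>h. of_real ((c / 2 * (\<xi> \<bullet> \<xi>) powr (c / 2 - 1)) * (\<xi> \<bullet> h + h \<bullet> \<xi>)))) (at \<xi>)"
    unfolding e by (rule has_derivative_of_real[OF 3])
  then show ?thesis unfolding 4 by simp
qed

lemma normpow_step:
  assumes "\<xi> \<noteq> 0"
  shows "normpow c \<xi> = normpow (c - 2) \<xi> * of_real (\<xi> \<bullet> \<xi>)"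
proof -
  have "norm \<xi> powr c = norm \<xi> powr (c - 2) * norm \<xi> powr 2"
    using powr_add[of "norm \<xi>" "c - 2" 2] by (simp del: powr_numeral)
  also have "norm \<xi> powr 2 = \<xi> \<bullet> \<xi>"
    using assms by (simp add: power2_norm_eq_inner)
  finally show ?thesis by simp
qed

text \<open>The class of all \<open>\<bar>\<xi>\<bar>\<^sup>c G\<close> with \<open>G\<close> vanishing near the origin is closed under derivatives, as
  \<open>\<partial>\<^sub>k (\<bar>\<xi>\<bar>\<^sup>c G) = \<bar>\<xi>\<bar>\<^bsup>c-2\<^esup> (c \<xi>\<^sub>k G + \<bar>\<xi>\<bar>\<^sup>2 \<partial>\<^sub>k G)\<close>.\<close>

lemma schwartz_normpow:
  assumes "schwartz G" "vanishes_near_0 G"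
  shows "schwartz (\<lambda>\<xi>. normpow c \<xi> * G \<xi>)"
proof (rule schwartz_class[where X="{\<lambda>\<xi>. normpow c \<xi> * G \<xi> | c G. schwartz G \<and> vanishes_near_0 G}"])
  fix f assume "f \<in> {\<lambda>\<xi>. normpow c \<xi> * G \<xi> | c G. schwartz G \<and> vanishes_near_0 G}"
  then obtain c G where f: "f = (\<lambda>\<xi>. normpow c \<xi> * G \<xi>)" and G: "schwartz G" and v: "vanishes_near_0 G" by auto
  from v obtain r where r: "r > 0" "\<And>\<xi>. norm \<xi> < r \<Longrightarrow> G \<xi> = 0" unfolding vanishes_near_0_def by blast
  have f0: "norm y < r \<Longrightarrow> f y = 0" for y unfolding f using r(2) by simp
  have nd: "normpow c differentiable (at \<xi>)" if "\<xi> \<noteq> 0" for \<xi>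
    using normpow_has_derivative[OF that] unfolding differentiable_def by blast
  show "f differentiable (at \<xi>)" for \<xi>
  proof (cases "\<xi> = 0")
    case True
    then show ?thesis using has_derivative_locally_0[of r f \<xi>] f0 r(1) unfolding differentiable_def by auto
  next
    case False
    then show ?thesis unfolding f by (intro differentiable_mult nd schwartz_differentiable[OF G])
  qed
  show "pd k f \<in> {\<lambda>\<xi>. normpow c \<xi> * G \<xi> | c G. schwartz G \<and> vanishes_near_0 G}" for k
  proof -
    let ?G' = "\<lambda>\<xi>. of_real c * (of_real (\<xi> $ k) * G \<xi>) + (\<Sum>j\<in>UNIV. of_real (\<xi> $ j) * (of_real (\<xi> $ j) * pd k G \<xi>))"
    have "schwartz ?G'"
      by (intro schwartz_add schwartz_cmult schwartz_sum schwartz_coord schwartz_pd G)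
    moreover have "vanishes_near_0 ?G'"
      unfolding vanishes_near_0_def using r pd_locally_0[of r G] by (intro exI[of _ r]) auto
    moreover have "pd k f = (\<lambda>\<xi>. normpow (c - 2) \<xi> * ?G' \<xi>)"
    proof
      fix \<xi>
      show "pd k f \<xi> = normpow (c - 2) \<xi> * ?G' \<xi>"
      proof (cases "\<xi> = 0")
        case True
        then show ?thesis using pd_locally_0[of r f \<xi>] pd_locally_0[of r G \<xi>] f0 r by simp
      next
        case False
        have "pd k f \<xi> = normpow c \<xi> * pd k G \<xi> + pd k (normpow c) \<xi> * G \<xi>"
          unfolding f by (rule pd_mult[OF nd[OF False] schwartz_differentiable[OF G]])
        also have "pd k (normpow c) \<xi> = of_real (c * \<xi> $ k) * normpow (c - 2) \<xi>"
          by (subst pd_eq[OF normpow_has_derivative[OF False]]) (simp add: inner_axis)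
        also have "normpow c \<xi> = normpow (c - 2) \<xi> * of_real (\<xi> \<bullet> \<xi>)"
          by (rule normpow_step[OF False])
        finally show ?thesis
          by (simp add: inner_vec_def sum_distrib_left sum_distrib_right algebra_simps)
      qed
    qed
    ultimately show ?thesis
      unfolding mem_Collect_eq by (intro exI[of _ "c - 2"] exI[of _ ?G'] conjI)
  qed
  show "rapid f"
    unfolding rapid_def
  proof
    fix N :: nat
    define M where "M = nat \<lceil>\<bar>c\<bar>\<rceil>"
    define K where "K = 1 + r powr c"
    have K: "K \<ge> 0" unfolding K_def by simp
    have le: "norm x powr c \<le> K * (1 + norm x) ^ M" if x: "norm x \<ge> r" for x :: plane
    proof -
      have one: "1 \<le> (1 + norm x) ^ M" by (rule one_le_power) simp
      have "norm x powr c \<le> (1 + norm x) ^ M + r powr c"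
      proof (cases "c \<ge> 0")
        case True
        have "norm x powr c \<le> (1 + norm x) powr c" using True by (intro powr_mono2) auto
        also have "\<dots> \<le> (1 + norm x) powr real M"
          using order_trans[OF abs_ge_self le_of_int_ceiling] by (intro powr_mono) (auto simp: M_def)
        also have "\<dots> = (1 + norm x) ^ M" by (rule powr_realpow) (rule one_plus_norm_pos)
        finally show ?thesis by (simp add: add_increasing2)
      next
        case False
        then have "norm x powr c \<le> r powr c" using x r(1) by (intro powr_mono2') auto
        then show ?thesis by (simp add: add_increasing)
      qed
      also have "\<dots> \<le> (1 + norm x) ^ M + r powr c * (1 + norm x) ^ M"
        using mult_left_mono[OF one, of "r powr c"] by simp
      finally show ?thesis unfolding K_def by (simp add: distrib_right)
    qed
    obtain A where A: "\<And>x. (1 + norm x) ^ (N + M) * cmod (G x) \<le> A" using schwartz_decay[OF G] by metis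
    have "(1 + norm x) ^ N * cmod (f x) \<le> K * A" for x
    proof (cases "norm x < r")
      case True
      have "0 \<le> A" using A[of x] order_trans[OF _ A[of x]] by (meson mult_nonneg_nonneg norm_ge_zero one_plus_norm_pos order_trans zero_le_power less_imp_le)
      then show ?thesis using f0[OF True] K by simp
    next
      case False
      have "(1 + norm x) ^ N * cmod (f x) = (1 + norm x) ^ N * (norm x powr c * cmod (G x))"
        unfolding f by (simp add: norm_mult)
      also have "\<dots> \<le> (1 + norm x) ^ N * (K * (1 + norm x) ^ M * cmod (G x))"
        using False by (intro mult_left_mono mult_right_mono le) auto
      also have "\<dots> = K * ((1 + norm x) ^ (N + M) * cmod (G x))" by (simp add: power_add)
      also have "\<dots> \<le> K * A" by (intro mult_left_mono A K)
      finally show ?thesis .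
    qed
    then show "\<exists>C. \<forall>x. (1 + norm x) ^ N * cmod (f x) \<le> C" by blast
  qed
qed (use assms in blast)

text \<open>Admissible symbols: those smooth enough away from the origin to preserve Schwartz functions
  vanishing near the origin.\<close>

definition admissible :: "(plane \<Rightarrow> complex) \<Rightarrow> bool" where
  "admissible m \<longleftrightarrow> (\<forall>G. schwartz G \<longrightarrow> vanishes_near_0 G \<longrightarrow> schwartz (\<lambda>\<xi>. m \<xi> * G \<xi>))"

lemma admissible_mult:
  assumes "admissible m" "admissible n"
  shows "admissible (\<lambda>\<xi>. m \<xi> * n \<xi>)"
  unfolding admissible_def
proof (intro allI impI)
  fix G assume G: "schwartz G" "vanishes_near_0 G"
  then have "schwartz (\<lambda>\<xi>. n \<xi> * G \<xi>)" using assms(2) unfolding admissible_def by blast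
  moreover have "vanishes_near_0 (\<lambda>\<xi>. n \<xi> * G \<xi>)" using G(2) unfolding vanishes_near_0_def by auto
  ultimately have "schwartz (\<lambda>\<xi>. m \<xi> * (n \<xi> * G \<xi>))" using assms(1) unfolding admissible_def by blast
  then show "schwartz (\<lambda>\<xi>. m \<xi> * n \<xi> * G \<xi>)" by (simp add: mult.assoc)
qed

lemma admissible_const: "admissible (\<lambda>\<xi>. c)"
  unfolding admissible_def by (simp add: schwartz_cmult)

lemma admissible_coord: "admissible (\<lambda>\<xi>. of_real (\<xi> $ k))"
  unfolding admissible_def by (simp add: schwartz_coord)

lemma admissible_normpow: "admissible (normpow c)"
  unfolding admissible_def by (simp add: schwartz_normpow)

text \<open>The degree of homogeneity governs how the kernels below scale with the frequency.\<close>

definition homogeneous :: "real \<Rightarrow> (plane \<Rightarrow> complex) \<Rightarrow> bool" where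
  "homogeneous d m \<longleftrightarrow> (\<forall>t>0. \<forall>\<xi>. m (t *\<^sub>R \<xi>) = of_real (t powr d) * m \<xi>)"

lemma homogeneous_mult: "homogeneous d m \<Longrightarrow> homogeneous e n \<Longrightarrow> homogeneous (d + e) (\<lambda>\<xi>. m \<xi> * n \<xi>)"
  unfolding homogeneous_def by (simp add: powr_add)

lemma homogeneous_const: "homogeneous 0 (\<lambda>\<xi>. c)"
  unfolding homogeneous_def by simp

lemma homogeneous_coord: "homogeneous 1 (\<lambda>\<xi>. of_real (\<xi> $ k))"
  unfolding homogeneous_def by simp

lemma homogeneous_normpow: "homogeneous c (normpow c)"
  unfolding homogeneous_def by (simp add: powr_mult)

section \<open>Littlewood--Paley kernels\<close>

lemma two_powi: "(2::real) powi j = 2 powr of_int j"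
  by (simp add: powr_real_of_int')

locale littlewood_paley_function =
  fixes \<phi> :: "plane \<Rightarrow> complex"
  assumes lp: "littlewood_paley \<phi>"
begin

text \<open>The transform of \<open>lp_block \<phi> j\<close>, see lemma \<open>fourier_lp_block\<close>.\<close>

definition hat :: "int \<Rightarrow> plane \<Rightarrow> complex" where
  "hat j \<xi> = fourier \<phi> ((2 powr - of_int j) *\<^sub>R \<xi>)"

text \<open>The convolution kernel of the multiplier with symbol \<open>m\<close> cut off to frequencies of size \<open>2\<^sup>j\<close>. All
  operators of the equation, applied to a Littlewood--Paley block, are of this form.\<close>

definition ker :: "(plane \<Rightarrow> complex) \<Rightarrow> int \<Rightarrow> plane \<Rightarrow> complex" where
  "ker m j = inv_fourier (\<lambda>\<xi>. m \<xi> * hat j \<xi>)"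

lemma schwartz_phi: "schwartz \<phi>"
  using lp unfolding littlewood_paley_def by blast

lemma schwartz_hat: "schwartz (hat j)"
proof -
  have "schwartz (\<lambda>\<xi>. fourier \<phi> ((2 powr - of_int j) *\<^sub>R \<xi>))"
    by (intro schwartz_scale schwartz_fourier schwartz_phi) simp
  then show ?thesis unfolding hat_def[abs_def] .
qed

lemma hat_support:
  assumes "hat j \<xi> \<noteq> 0"
  shows "2 powr (of_int j - 1) \<le> norm \<xi>" "norm \<xi> \<le> 2 powr (of_int j + 1)"
proof -
  have *: "1 / 2 \<le> norm ((2 powr - real_of_int j) *\<^sub>R \<xi>) \<and> norm ((2 powr - real_of_int j) *\<^sub>R \<xi>) \<le> 2"
    using assms lp unfolding hat_def littlewood_paley_def by blast
  show "2 powr (of_int j - 1) \<le> norm \<xi>" "norm \<xi> \<le> 2 powr (of_int j + 1)"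
    using * by (auto simp: powr_minus powr_diff powr_add field_simps)
qed

lemma hat_range: "cmod (hat j \<xi>) \<le> 1" "hat j \<xi> = of_real (Re (hat j \<xi>))" "Re (hat j \<xi>) \<ge> 0"
proof -
  have *: "fourier \<phi> \<eta> \<in> \<real>" "0 \<le> Re (fourier \<phi> \<eta>)" "Re (fourier \<phi> \<eta>) \<le> 1" for \<eta>
    using lp unfolding littlewood_paley_def by blast+
  show 1: "hat j \<xi> = of_real (Re (hat j \<xi>))" "Re (hat j \<xi>) \<ge> 0"
    using * unfolding hat_def by (auto simp: of_real_Re)
  show "cmod (hat j \<xi>) \<le> 1" by (subst 1(1)) (use 1(2) * in \<open>simp add: hat_def del: of_real_Re\<close>)
qed

lemma hat_vanishes_near_0: "vanishes_near_0 (hat j)"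
  unfolding vanishes_near_0_def using hat_support(1)[of j]
  by (intro exI[of _ "2 powr (of_int j - 1)"]) (auto simp: not_less[symmetric])

lemma hat_has_sum:
  assumes "\<xi> \<noteq> 0"
  shows "((\<lambda>j. hat j \<xi>) has_sum 1) UNIV"
proof -
  have "((\<lambda>j::int. fourier \<phi> (2 powi (- j) *\<^sub>R \<xi>)) has_sum 1) UNIV"
    using lp assms unfolding littlewood_paley_def by blast
  then show ?thesis unfolding hat_def two_powi by simp
qed

lemma hat_disjoint:
  assumes "\<bar>j - k\<bar> \<ge> 3"
  shows "hat j \<xi> * hat k \<xi> = 0"
proof (rule ccontr)
  assume "hat j \<xi> * hat k \<xi> \<noteq> 0"
  then have nz: "hat j \<xi> \<noteq> 0" "hat k \<xi> \<noteq> 0" by auto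
  have "2 powr (real_of_int j - 1) \<le> 2 powr (real_of_int k + 1)" "2 powr (real_of_int k - 1) \<le> 2 powr (real_of_int j + 1)"
    using hat_support[OF nz(1)] hat_support[OF nz(2)] by linarith+
  then show False using assms by (simp add: abs_if split: if_splits)
qed

text \<open>Two frequency annuli at distance \<open>2\<close> may still touch in a circle, so that distance \<open>3\<close> is the
  convenient threshold for disjointness.\<close>

abbreviation near :: "int \<Rightarrow> int set" where "near j \<equiv> {j - 2..j + 2}"

lemma hat_near_sum:
  assumes "hat j \<xi> \<noteq> 0"
  shows "(\<Sum>k\<in>near j. hat k \<xi>) = 1"
proof -
  have "norm \<xi> > 0" using hat_support(1)[OF assms] by (rule less_le_trans[rotated]) simp
  then have "((\<lambda>j. hat j \<xi>) has_sum 1) UNIV" by (intro hat_has_sum) auto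
  moreover have "hat k \<xi> = 0" if "k \<in> UNIV - near j" for k
  proof -
    have "\<bar>j - k\<bar> \<ge> 3" using that by auto
    from hat_disjoint[OF this, of \<xi>] assms show ?thesis by simp
  qed
  ultimately have "((\<lambda>j. hat j \<xi>) has_sum 1) (near j)"
    by (subst has_sum_cong_neutral[of UNIV "near j" "\<lambda>j. hat j \<xi>" "\<lambda>j. hat j \<xi>"]) auto
  then show ?thesis by (simp add: has_sum_finite_iff)
qed

lemma schwartz_symbol_hat: "admissible m \<Longrightarrow> schwartz (\<lambda>\<xi>. m \<xi> * hat j \<xi>)"
  unfolding admissible_def using schwartz_hat hat_vanishes_near_0 by blast

lemma schwartz_ker: "admissible m \<Longrightarrow> schwartz (ker m j)"
  unfolding ker_def by (intro schwartz_inv_fourier schwartz_symbol_hat)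

lemma fourier_ker: "admissible m \<Longrightarrow> fourier (ker m j) = (\<lambda>\<xi>. m \<xi> * hat j \<xi>)"
  unfolding ker_def by (intro fourier_inv_fourier schwartz_symbol_hat)

lemma fourier_lp_block: "fourier (lp_block \<phi> j) = hat j"
proof
  fix \<xi>
  have "fourier (\<lambda>x. of_real ((2 powi j)\<^sup>2) * \<phi> (2 powi j *\<^sub>R x)) \<xi> = fourier \<phi> ((1 / 2 powi j) *\<^sub>R \<xi>)"
    by (rule fourier_scale[OF schwartz_phi]) simp
  then show "fourier (lp_block \<phi> j) \<xi> = hat j \<xi>"
    unfolding lp_block_def[abs_def] hat_def two_powi by (simp add: powr_minus_divide)
qed

lemma schwartz_lp_block: "schwartz (lp_block \<phi> j)"
  unfolding lp_block_def[abs_def] by (intro schwartz_cmult schwartz_scale schwartz_phi) simp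

lemma lp_block_eq_ker: "lp_block \<phi> j = ker (\<lambda>\<xi>. 1) j"
  by (rule fourier_inj) (auto simp: fourier_lp_block fourier_ker[OF admissible_const] schwartz_lp_block intro: schwartz_ker admissible_const)

lemma frac_lap_lp_block: "frac_lap s (lp_block \<phi> j) = ker (normpow (2 * s)) j"
  unfolding frac_lap_def ker_def fourier_lp_block ..

lemma pd_ker:
  assumes "admissible m"
  shows "pd k (ker m j) = ker (\<lambda>\<xi>. (\<i> * of_real (\<xi> $ k)) * m \<xi>) j"
proof -
  have "admissible (\<lambda>\<xi>. (\<i> * of_real (\<xi> $ k)) * m \<xi>)"
    by (intro admissible_mult admissible_const admissible_coord assms)
  then show ?thesis
    by (intro fourier_inj) (auto simp: fourier_pd fourier_ker assms schwartz_ker mult.assoc intro!: schwartz_pd schwartz_ker)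
qed

lemma ker_cmult: "ker (\<lambda>\<xi>. c * m \<xi>) j x = c * ker m j x"
  unfolding ker_def inv_fourier_def by (simp add: mult_ac flip: integral_mult_right_zero)

section \<open>Composition of blocks\<close>

lemma sconv_ker:
  assumes m: "admissible m" and n: "admissible n"
  shows "sconv (ker m j) (ker n k) = inv_fourier (\<lambda>\<xi>. m \<xi> * n \<xi> * (hat j \<xi> * hat k \<xi>))"
  unfolding sconv_eq[OF schwartz_ker[OF m] schwartz_ker[OF n]] fourier_ker[OF m] fourier_ker[OF n]
  by (simp add: mult_ac)

lemma conv_0: "tempered u \<Longrightarrow> conv (\<lambda>x. 0) u x = 0"
  unfolding conv_def by (rule tempered_0)

lemma conv_sum:
  assumes "tempered u" "\<And>i. i \<in> I \<Longrightarrow> schwartz (g i)"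
  shows "conv (\<lambda>x. \<Sum>i\<in>I. g i x) u x = (\<Sum>i\<in>I. conv (g i) u x)"
  unfolding conv_def by (rule tempered_sum[OF assms(1)]) (intro schwartz_reflect assms(2))

lemma ker_conv_far:
  assumes u: "tempered u" and m: "admissible m" and n: "admissible n" and jk: "\<bar>j - k\<bar> \<ge> 3"
  shows "sconv (ker m j) (conv (ker n k) u) x = 0"
proof -
  have "sconv (ker m j) (ker n k) = (\<lambda>x. 0)"
    unfolding sconv_ker[OF m n] hat_disjoint[OF jk] inv_fourier_def by simp
  then show ?thesis
    unfolding sconv_conv[OF u schwartz_ker[OF m] schwartz_ker[OF n]] by (simp add: conv_0[OF u])
qed

lemma sum_sconv_ker:
  assumes m: "admissible m" and n: "admissible n"
  shows "(\<Sum>k\<in>near j. sconv (ker m k) (ker n j) x) = ker (\<lambda>\<xi>. m \<xi> * n \<xi>) j x"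
proof -
  have mn: "admissible (\<lambda>\<xi>. m \<xi> * n \<xi>)" by (rule admissible_mult[OF m n])
  have s1: "schwartz (sconv (ker m k) (ker n l))" for k l
    by (intro schwartz_sconv schwartz_ker m n)
  have near_one: "(\<Sum>k\<in>near j. hat k \<xi>) * hat j \<xi> = hat j \<xi>" for \<xi>
    using hat_near_sum[of j \<xi>] by (cases "hat j \<xi> = 0") auto
  have "(\<lambda>x. \<Sum>k\<in>near j. sconv (ker m k) (ker n j) x) = ker (\<lambda>\<xi>. m \<xi> * n \<xi>) j"
  proof (rule fourier_inj)
    fix \<xi>
    have "fourier (\<lambda>x. \<Sum>k\<in>near j. sconv (ker m k) (ker n j) x) \<xi> = (\<Sum>k\<in>near j. fourier (sconv (ker m k) (ker n j)) \<xi>)"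
      unfolding fourier_def using s1 by (simp add: sum_distrib_left fourier_integrand_integrable)
    also have "\<dots> = m \<xi> * n \<xi> * ((\<Sum>k\<in>near j. hat k \<xi>) * hat j \<xi>)"
      by (simp add: fourier_sconv schwartz_ker m n fourier_ker sum_distrib_left sum_distrib_right mult_ac)
    finally show "fourier (\<lambda>x. \<Sum>k\<in>near j. sconv (ker m k) (ker n j) x) \<xi> = fourier (ker (\<lambda>\<xi>. m \<xi> * n \<xi>) j) \<xi>"
      by (simp add: mn fourier_ker near_one)
  qed (auto intro!: schwartz_sum s1 schwartz_ker mn)
  then show ?thesis by (rule fun_cong)
qed

lemma sconv_ker_commute:
  assumes "admissible m" "admissible n"
  shows "sconv (ker m j) (ker n k) = sconv (ker n k) (ker m j)"
  unfolding sconv_ker[OF assms] sconv_ker[OF assms(2,1)] by (simp add: mult_ac)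

lemma ker_conv_sum:
  assumes u: "tempered u" and m: "admissible m" and n: "admissible n"
  shows "(\<Sum>k\<in>near j. sconv (ker m k) (conv (ker n j) u) x) = conv (ker (\<lambda>\<xi>. m \<xi> * n \<xi>) j) u x"
    and "(\<Sum>k\<in>near j. sconv (ker m j) (conv (ker n k) u) x) = conv (ker (\<lambda>\<xi>. m \<xi> * n \<xi>) j) u x"
  unfolding sconv_conv[OF u schwartz_ker[OF m] schwartz_ker[OF n]]
  by (simp_all add: conv_sum[OF u, symmetric] schwartz_sconv schwartz_ker m n sum_sconv_ker[OF m n]
      sconv_ker_commute[OF m n, of j] sum_sconv_ker[OF n m] mult.commute[of "n _"])

text \<open>Composition of multipliers. As the annuli around \<open>2\<^sup>j\<close> and \<open>2\<^sup>k\<close> are disjoint unless \<open>k\<close> is near \<open>j\<close>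
  and the cut-offs near \<open>j\<close> add up to \<open>1\<close> on the support of the \<open>j\<close>-th one, summation over either
  index removes one of the two cut-offs. Only finitely many summands are nonzero.\<close>

lemma ker_conv_has_sum:
  assumes u: "tempered u" and m: "admissible m" and n: "admissible n"
  shows "((\<lambda>k. sconv (ker m k) (conv (ker n j) u) x) has_sum conv (ker (\<lambda>\<xi>. m \<xi> * n \<xi>) j) u x) UNIV"
    and "((\<lambda>k. sconv (ker m j) (conv (ker n k) u) x) has_sum conv (ker (\<lambda>\<xi>. m \<xi> * n \<xi>) j) u x) UNIV"
proof -
  have z: "\<bar>k - j\<bar> \<ge> 3 \<and> \<bar>j - k\<bar> \<ge> 3" if "k \<notin> near j" for k using that by auto
  show "((\<lambda>k. sconv (ker m k) (conv (ker n j) u) x) has_sum conv (ker (\<lambda>\<xi>. m \<xi> * n \<xi>) j) u x) UNIV"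
    by (rule has_sum_cong_neutral[of UNIV "near j", THEN iffD1, rotated 3, OF has_sum_finiteI[OF _ ker_conv_sum(1)[OF assms, symmetric]]])
       (use z in \<open>auto simp: ker_conv_far[OF assms]\<close>)
  show "((\<lambda>k. sconv (ker m j) (conv (ker n k) u) x) has_sum conv (ker (\<lambda>\<xi>. m \<xi> * n \<xi>) j) u x) UNIV"
    by (rule has_sum_cong_neutral[of UNIV "near j", THEN iffD1, rotated 3, OF has_sum_finiteI[OF _ ker_conv_sum(2)[OF assms, symmetric]]])
       (use z in \<open>auto simp: ker_conv_far[OF assms]\<close>)
qed

section \<open>Scaling\<close>

lemma ker_scaling:
  assumes m: "admissible m" and d: "homogeneous d m"
  shows "ker m j x = of_real (2 powr (d * of_int j) * (2 powr of_int j)\<^sup>2) * ker m 0 ((2 powr of_int j) *\<^sub>R x)"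
proof -
  let ?t = "2 powr real_of_int j"
  note [measurable] = schwartz_measurable[OF schwartz_symbol_hat[OF m]]
  have s: "m (?t *\<^sub>R \<xi>) * hat j (?t *\<^sub>R \<xi>) = of_real (2 powr (d * of_int j)) * (m \<xi> * hat 0 \<xi>)" for \<xi>
  proof -
    have "m (?t *\<^sub>R \<xi>) = of_real (?t powr d) * m \<xi>" using d unfolding homogeneous_def by simp
    also have "?t powr d = 2 powr (d * of_int j)" by (simp add: powr_powr mult.commute)
    finally have "m (?t *\<^sub>R \<xi>) = of_real (2 powr (d * of_int j)) * m \<xi>" .
    moreover have "hat j (?t *\<^sub>R \<xi>) = hat 0 \<xi>"
      unfolding hat_def by (simp add: powr_add[symmetric])
    ultimately show ?thesis by simp
  qed
  have "(\<integral>\<xi>. cis (x \<bullet> \<xi>) * (m \<xi> * hat j \<xi>) \<partial>lborel)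
      = of_real (?t\<^sup>2) * (\<integral>\<xi>. cis (x \<bullet> (0 + ?t *\<^sub>R \<xi>)) * (m (0 + ?t *\<^sub>R \<xi>) * hat j (0 + ?t *\<^sub>R \<xi>)) \<partial>lborel)"
    by (rule integral_plane_affine[OF borel_measurable_times[OF cis_inner_measurable(3) schwartz_measurable[OF schwartz_symbol_hat[OF m]]]]) simp
  also have "\<dots> = of_real (?t\<^sup>2) * (\<integral>\<xi>. of_real (2 powr (d * of_int j)) * (cis ((?t *\<^sub>R x) \<bullet> \<xi>) * (m \<xi> * hat 0 \<xi>)) \<partial>lborel)"
    by (simp only: add_0 s inner_scaleR_left inner_scaleR_right mult.left_commute)
  finally show ?thesis unfolding ker_def inv_fourier_def by simp
qed

definition L1 :: "(plane \<Rightarrow> complex) \<Rightarrow> real" where "L1 f = (\<integral>x. cmod (f x) \<partial>lborel)"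

lemma L1_nonneg: "L1 f \<ge> 0" unfolding L1_def by simp

lemma ker_L1:
  assumes m: "admissible m" and d: "homogeneous d m"
  shows "L1 (ker m j) = 2 powr (d * of_int j) * L1 (ker m 0)"
proof -
  let ?t = "2 powr real_of_int j"
  note [measurable] = schwartz_measurable[OF schwartz_ker[OF m]]
  have "complex_of_real (L1 (ker m 0)) = (\<integral>x. of_real (cmod (ker m 0 x)) \<partial>lborel)"
    unfolding L1_def by simp
  also have "\<dots> = of_real (?t\<^sup>2) * (\<integral>x. of_real (cmod (ker m 0 (0 + ?t *\<^sub>R x))) \<partial>lborel)"
    by (rule integral_plane_affine) auto
  also have "\<dots> = of_real (?t\<^sup>2 * (\<integral>x. cmod (ker m 0 (?t *\<^sub>R x)) \<partial>lborel))" by simp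
  finally have e: "L1 (ker m 0) = ?t\<^sup>2 * (\<integral>x. cmod (ker m 0 (?t *\<^sub>R x)) \<partial>lborel)"
    using of_real_eq_iff by blast
  have "L1 (ker m j) = (\<integral>x. (2 powr (d * of_int j) * ?t\<^sup>2) * cmod (ker m 0 (?t *\<^sub>R x)) \<partial>lborel)"
    unfolding L1_def by (subst ker_scaling[OF m d]) (simp only: norm_mult norm_of_real, simp add: abs_mult)
  then show ?thesis unfolding e by simp
qed

lemma ker_sup:
  assumes m: "admissible m" and d: "homogeneous d m"
  obtains C where "C \<ge> 0" "\<And>j x. cmod (ker m j x) \<le> C * 2 powr ((d + 2) * of_int j)"
proof -
  obtain C where C: "C \<ge> 0" "\<And>x. cmod (ker m 0 x) \<le> C"
    using schwartz_bounded[OF schwartz_ker[OF m]] by metis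
  have "cmod (ker m j x) \<le> C * 2 powr ((d + 2) * of_int j)" for j x
  proof -
    have "2 powr ((d + 2) * real_of_int j) = 2 powr (d * of_int j) * (2 powr of_int j)\<^sup>2"
      by (simp add: powr_add[symmetric] power2_eq_square distrib_right)
    moreover have "cmod (ker m j x) = (2 powr (d * of_int j) * (2 powr of_int j)\<^sup>2) * cmod (ker m 0 ((2 powr of_int j) *\<^sub>R x))"
      by (subst ker_scaling[OF m d]) (simp only: norm_mult norm_of_real, simp add: abs_mult)
    moreover have "\<dots> \<le> (2 powr (d * of_int j) * (2 powr of_int j)\<^sup>2) * C"
      by (intro mult_left_mono C) auto
    ultimately show ?thesis by (simp add: mult.commute)
  qed
  with C(1) that show ?thesis by blast
qed

end

section \<open>Countable sums as integrals\<close>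

text \<open>Double series of nonnegative reals are exchanged as integrals over counting measures; this lemma
  and the next one translate between the two.\<close>

lemma nn_count_le_imp_summable:
  fixes a :: "'i \<Rightarrow> real"
  assumes "\<And>i. a i \<ge> 0" "(\<integral>\<^sup>+i. ennreal (a i) \<partial>count_space UNIV) \<le> ennreal B" "B \<ge> 0"
  shows "a summable_on UNIV" "infsum a UNIV \<le> B"
proof -
  have fin: "sum a F \<le> B" if "finite F" for F
  proof -
    have "ennreal (sum a F) = (\<integral>\<^sup>+i. ennreal (a i) \<partial>count_space F)"
      using that assms(1) by (simp add: nn_integral_count_space_finite)
    also have "\<dots> = (\<integral>\<^sup>+i. ennreal (a i) * indicator F i \<partial>count_space UNIV)"
      by (rule nn_integral_count_space_indicator) simp
    also have "\<dots> \<le> (\<integral>\<^sup>+i. ennreal (a i) \<partial>count_space UNIV)"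
      by (intro nn_integral_mono) (auto simp: indicator_def)
    finally show ?thesis using assms(2,3) by (meson ennreal_le_iff order_trans)
  qed
  show "a summable_on UNIV"
    by (rule nonneg_bdd_above_summable_on) (use assms(1) fin in \<open>auto intro!: bdd_aboveI2[where M=B]\<close>)
  then show "infsum a UNIV \<le> B" using fin by (intro infsum_le_finite_sums) auto
qed

lemma nn_count_infsum:
  fixes a :: "'i \<Rightarrow> real"
  assumes "\<And>i. a i \<ge> 0" "a summable_on UNIV"
  shows "(\<integral>\<^sup>+i. ennreal (a i) \<partial>count_space UNIV) = ennreal (infsum a UNIV)"
proof -
  have "(\<lambda>i. norm (a i)) summable_on UNIV" using assms by simp
  then have s: "Infinite_Set_Sum.abs_summable_on a UNIV"
    by (simp only: abs_summable_equivalent[symmetric])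
  then show ?thesis
    using nn_integral_conv_infsetsum[OF s] infsetsum_infsum[OF s] assms(1) by simp
qed

lemma has_sum_norm_le_nn_count:
  fixes F :: "'i \<Rightarrow> complex"
  assumes "(F has_sum G) UNIV"
  shows "ennreal (cmod G) \<le> (\<integral>\<^sup>+i. ennreal (cmod (F i)) \<partial>count_space UNIV)"
proof -
  have s: "(\<lambda>i. cmod (F i)) summable_on UNIV"
    using has_sum_imp_summable[OF assms, unfolded summable_on_iff_abs_summable_on_complex] .
  then have "(\<integral>\<^sup>+i. ennreal (cmod (F i)) \<partial>count_space UNIV) = ennreal (infsum (\<lambda>i. cmod (F i)) UNIV)"
    by (intro nn_count_infsum) auto
  moreover have "cmod G \<le> infsum (\<lambda>i. cmod (F i)) UNIV"
    using norm_infsum_bound[OF s] infsumI[OF assms] by simp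
  ultimately show ?thesis by (simp add: ennreal_leI)
qed

lemma summable_on_le:
  fixes F :: "'i \<Rightarrow> 'b::banach" and c :: "'i \<Rightarrow> real"
  assumes "\<And>i. norm (F i) \<le> c i" "c summable_on UNIV"
  shows "F summable_on UNIV" "norm (infsum F UNIV) \<le> infsum c UNIV" "(\<lambda>i. norm (F i)) summable_on UNIV"
proof -
  have c0: "c i \<ge> 0" for i using assms(1)[of i] norm_ge_zero order_trans by blast
  show s: "(\<lambda>i. norm (F i)) summable_on UNIV"
  proof (rule nonneg_bdd_above_summable_on)
    show "bdd_above (sum (\<lambda>i. norm (F i)) ` {A. A \<subseteq> UNIV \<and> finite A})"
    proof (rule bdd_aboveI2[where M="infsum c UNIV"])
      fix A :: "'i set" assume "A \<in> {A. A \<subseteq> UNIV \<and> finite A}"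
      then have "sum c A \<le> infsum c UNIV" by (intro finite_sum_le_infsum assms(2)) (auto simp: c0)
      moreover have "(\<Sum>i\<in>A. norm (F i)) \<le> sum c A" by (intro sum_mono assms(1))
      ultimately show "(\<Sum>i\<in>A. norm (F i)) \<le> infsum c UNIV" by linarith
    qed
  qed auto
  show "F summable_on UNIV" by (rule abs_summable_summable[OF s])
  show "norm (infsum F UNIV) \<le> infsum c UNIV"
    using norm_infsum_bound[OF s] infsum_mono[OF s assms(2)] assms(1) by (meson order_trans UNIV_I)
qed


lemma has_sum_measurable:
  fixes F :: "'i::countable \<Rightarrow> plane \<Rightarrow> complex"
  assumes F: "\<And>i. F i \<in> borel_measurable borel" and G: "\<And>x. ((\<lambda>i. F i x) has_sum G x) UNIV"
  shows "G \<in> borel_measurable borel"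
proof (rule borel_measurable_LIMSEQ_metric)
  have fl: "filterlim (\<lambda>n. {i::'i. to_nat i < n}) (finite_subsets_at_top UNIV) sequentially"
    unfolding filterlim_finite_subsets_at_top
  proof (intro allI impI)
    fix X :: "'i set" assume X: "finite X \<and> X \<subseteq> UNIV"
    have fin: "finite {i::'i. to_nat i < n}" for n
      by (rule finite_imageD[of to_nat]) (auto intro: finite_subset[of _ "{..<n}"] inj_on_subset[OF inj_to_nat])
    show "\<forall>\<^sub>F n in sequentially. finite {i::'i. to_nat i < n} \<and> X \<subseteq> {i. to_nat i < n} \<and> {i. to_nat i < n} \<subseteq> UNIV"
      unfolding eventually_sequentially
    proof (intro exI[of _ "Suc (Max (to_nat ` X))"] allI impI conjI fin)
      fix n assume n: "Suc (Max (to_nat ` X)) \<le> n"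
      show "X \<subseteq> {i. to_nat i < n}"
      proof
        fix i assume "i \<in> X"
        then have "to_nat i \<le> Max (to_nat ` X)" using X by (intro Max_ge) auto
        then show "i \<in> {i. to_nat i < n}" using n by simp
      qed
    qed auto
  qed
  show "(\<lambda>n. \<Sum>i\<in>{i. to_nat i < n}. F i x) \<longlonglongrightarrow> G x" for x
    using filterlim_compose[OF G[of x, unfolded has_sum_def] fl] .
  show "(\<lambda>x. \<Sum>i\<in>{i. to_nat i < n}. F i x) \<in> borel_measurable borel" for n
    using F by measurable
qed

text \<open>The partial sums converge in \<open>L\<^sup>1\<close>, at the rate of the tails of \<open>c\<close>.\<close>

lemma has_sum_integral_L1:
  fixes F :: "'i::countable \<Rightarrow> plane \<Rightarrow> complex"
  assumes F: "\<And>i. integrable lborel (F i)" and c: "\<And>i. (\<integral>x. cmod (F i x) \<partial>lborel) \<le> c i" "c summable_on UNIV"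
    and G: "\<And>x. ((\<lambda>i. F i x) has_sum G x) UNIV"
  shows "((\<lambda>i. \<integral>x. F i x \<partial>lborel) has_sum (\<integral>x. G x \<partial>lborel)) UNIV"
proof -
  have Fm: "F i \<in> borel_measurable borel" for i using borel_measurable_integrable[OF F] by simp
  note [measurable] = Fm has_sum_measurable[OF Fm G]
  have c0: "c i \<ge> 0" for i using c(1)[of i] order_trans[OF Bochner_Integration.integral_nonneg] by (meson norm_ge_zero)
  have tail: "(\<integral>\<^sup>+x. ennreal (cmod (G x - (\<Sum>i\<in>A. F i x))) \<partial>lborel) \<le> ennreal (infsum c UNIV - sum c A)" if A: "finite A" for A
  proof -
    have pt: "ennreal (cmod (G x - (\<Sum>i\<in>A. F i x))) \<le> (\<integral>\<^sup>+i. ennreal (if i \<in> A then 0 else cmod (F i x)) \<partial>count_space UNIV)" for x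
    proof -
      have "((\<lambda>i. F i x) has_sum (G x - (\<Sum>i\<in>A. F i x))) (UNIV - A)"
        by (rule has_sum_Diff[OF G]) (use A in auto)
      then have "((\<lambda>i. if i \<in> A then 0 else F i x) has_sum (G x - (\<Sum>i\<in>A. F i x))) UNIV"
        by (rule has_sum_cong_neutral[THEN iffD1, rotated 3]) auto
      from has_sum_norm_le_nn_count[OF this] show ?thesis by (simp add: if_distrib cong: if_cong)
    qed
    have cA: "((\<lambda>i. if i \<in> A then 0 else c i) has_sum (infsum c UNIV - sum c A)) UNIV"
    proof -
      have "(c has_sum (infsum c UNIV - sum c A)) (UNIV - A)"
        by (rule has_sum_Diff[OF has_sum_infsum[OF c(2)]]) (use A in auto)
      then show ?thesis by (rule has_sum_cong_neutral[THEN iffD1, rotated 3]) auto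
    qed
    have "(\<integral>\<^sup>+x. ennreal (cmod (G x - (\<Sum>i\<in>A. F i x))) \<partial>lborel)
        \<le> (\<integral>\<^sup>+x. (\<integral>\<^sup>+i. ennreal (if i \<in> A then 0 else cmod (F i x)) \<partial>count_space UNIV) \<partial>lborel)"
      by (intro nn_integral_mono pt)
    also have "\<dots> = (\<integral>\<^sup>+i. (\<integral>\<^sup>+x. ennreal (if i \<in> A then 0 else cmod (F i x)) \<partial>lborel) \<partial>count_space UNIV)"
      by (rule nn_integral_count_space_nn_integral) auto
    also have "\<dots> \<le> (\<integral>\<^sup>+i. ennreal (if i \<in> A then 0 else c i) \<partial>count_space UNIV)"
    proof (rule nn_integral_mono)
      fix i
      have "(\<integral>\<^sup>+x. ennreal (cmod (F i x)) \<partial>lborel) = ennreal (\<integral>x. cmod (F i x) \<partial>lborel)"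
        by (rule nn_integral_eq_integral) (use F in auto)
      then show "(\<integral>\<^sup>+x. ennreal (if i \<in> A then 0 else cmod (F i x)) \<partial>lborel) \<le> ennreal (if i \<in> A then 0 else c i)"
        using c(1)[of i] by (auto intro: ennreal_leI)
    qed
    also have "\<dots> = ennreal (infsum c UNIV - sum c A)"
      using nn_count_infsum[OF _ has_sum_imp_summable[OF cA]] c0 infsumI[OF cA] by simp
    finally show ?thesis .
  qed
  have iG: "integrable lborel G"
    by (rule integrableI_bounded) (use tail[of "{}"] in \<open>auto simp: le_less_trans[OF _ ennreal_less_top]\<close>)
  have bound: "norm ((\<Sum>i\<in>A. \<integral>x. F i x \<partial>lborel) - (\<integral>x. G x \<partial>lborel)) \<le> infsum c UNIV - sum c A" if A: "finite A" for A
  proof -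
    have iD: "integrable lborel (\<lambda>x. G x - (\<Sum>i\<in>A. F i x))" using iG F by simp
    have e: "(\<integral>x. G x \<partial>lborel) - (\<Sum>i\<in>A. \<integral>x. F i x \<partial>lborel) = (\<integral>x. G x - (\<Sum>i\<in>A. F i x) \<partial>lborel)"
      using iG F by simp
    have "ennreal (cmod ((\<integral>x. G x \<partial>lborel) - (\<Sum>i\<in>A. \<integral>x. F i x \<partial>lborel))) \<le> ennreal (infsum c UNIV - sum c A)"
      unfolding e by (rule order_trans[OF integral_norm_bound_ennreal[OF iD] tail[OF A]])
    moreover have "infsum c UNIV - sum c A \<ge> 0"
      using finite_sum_le_infsum[OF c(2) A] c0 by simp
    ultimately show ?thesis by (simp add: norm_minus_commute)
  qed
  have "(sum c \<longlongrightarrow> infsum c UNIV) (finite_subsets_at_top UNIV)"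
    using has_sum_infsum[OF c(2)] unfolding has_sum_def .
  then have "((\<lambda>A. infsum c UNIV - sum c A) \<longlongrightarrow> infsum c UNIV - infsum c UNIV) (finite_subsets_at_top UNIV)"
    by (intro tendsto_intros)
  then have lim: "((\<lambda>A. infsum c UNIV - sum c A) \<longlongrightarrow> 0) (finite_subsets_at_top UNIV)" by simp
  have "((\<lambda>A. (\<Sum>i\<in>A. \<integral>x. F i x \<partial>lborel) - (\<integral>x. G x \<partial>lborel)) \<longlongrightarrow> 0) (finite_subsets_at_top UNIV)"
    by (rule Lim_null_comparison[OF _ lim]) (use bound in \<open>auto intro!: eventually_finite_subsets_at_top_weakI\<close>)
  then show ?thesis unfolding has_sum_def by (simp add: LIM_zero_iff)
qed

lemma has_sum_integral:
  fixes F :: "'i::countable \<Rightarrow> plane \<Rightarrow> complex"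
  assumes F: "\<And>i. F i \<in> borel_measurable borel" and c: "\<And>i x. cmod (F i x) \<le> c i" "c summable_on UNIV"
    and G: "\<And>x. ((\<lambda>i. F i x) has_sum G x) UNIV" and K: "integrable lborel K"
  shows "((\<lambda>i. \<integral>x. K x * F i x \<partial>lborel) has_sum (\<integral>x. K x * G x \<partial>lborel)) UNIV"
proof (rule has_sum_integral_L1)
  note [measurable] = F borel_measurable_integrable[OF K]
  have c0: "c i \<ge> 0" for i using c(1)[of i undefined] norm_ge_zero order_trans by blast
  have le: "cmod (K x * F i x) \<le> c i * cmod (K x)" for i x
    unfolding norm_mult mult.commute[of "c i"] by (intro mult_left_mono c(1)) simp
  have iK: "integrable lborel (\<lambda>x. c i * cmod (K x))" for i using K by simp
  show iF: "integrable lborel (\<lambda>x. K x * F i x)" for i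
    by (rule Bochner_Integration.integrable_bound[OF iK[of i]]) (use le c0 in \<open>auto simp: abs_mult\<close>)
  show "(\<integral>x. cmod (K x * F i x) \<partial>lborel) \<le> (\<integral>x. cmod (K x) \<partial>lborel) * c i" for i
    using integral_mono[OF integrable_norm[OF iF] iK le, of i] by (simp add: mult.commute)
  show "(\<lambda>i. (\<integral>x. cmod (K x) \<partial>lborel) * c i) summable_on UNIV" by (intro summable_on_cmult_right c(2))
  show "((\<lambda>i. K x * F i x) has_sum K x * G x) UNIV" for x by (intro has_sum_cmult_right G)
qed

section \<open>Bounds in \<open>L\<^sup>p\<close>\<close>

lemma young_tangent:
  fixes p c t :: real
  assumes p: "1 \<le> p" and c: "c > 0" and t: "t \<ge> 0"
  shows "t \<le> c * ((t / c) powr p / p + (p - 1) / p)"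
proof (cases "p = 1 \<or> t = 0")
  case True
  then show ?thesis using p c t by auto
next
  case False
  then have p1: "p > 1" and t0: "t / c > 0" using p c t by auto
  have "((t / c) powr p) powr (1 / p) * 1 powr (1 - 1 / p) \<le> 1 / p * (t / c) powr p + (1 - 1 / p) * 1"
    by (rule Youngs_inequality_0) (use p1 t0 in auto)
  then have "t / c \<le> (t / c) powr p / p + (p - 1) / p"
    using p1 t0 t c by (simp add: powr_powr diff_divide_distrib)
  then show ?thesis using c by (simp add: pos_divide_le_eq mult.commute)
qed

text \<open>Jensen's inequality for the finite measure with density \<open>w\<close>. The inequalities of Minkowski, Young
  and Bernstein below are all instances of it.\<close>

lemma jensen_powr:
  fixes w f :: "'a \<Rightarrow> real"
  assumes p: "1 \<le> p" and [measurable]: "w \<in> borel_measurable M" "f \<in> borel_measurable M"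
    and w0: "\<And>y. w y \<ge> 0" and f0: "\<And>y. f y \<ge> 0"
    and W: "W \<ge> 0" "(\<integral>\<^sup>+y. ennreal (w y) \<partial>M) \<le> ennreal W"
    and s: "s \<ge> 0" "ennreal s \<le> (\<integral>\<^sup>+y. ennreal (w y * f y) \<partial>M)"
  shows "ennreal (s powr p) \<le> ennreal (W powr (p - 1)) * (\<integral>\<^sup>+y. ennreal (w y * f y powr p) \<partial>M)"
proof -
  let ?A = "\<integral>\<^sup>+y. ennreal (w y * f y powr p) \<partial>M"
  have zero: ?thesis if "AE y in M. w y * f y = 0"
  proof -
    have "(\<integral>\<^sup>+y. ennreal (w y * f y) \<partial>M) = (\<integral>\<^sup>+y. 0 \<partial>M)"
      by (intro nn_integral_cong_AE) (use that in auto)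
    then have "s = 0" using s by simp
    then show ?thesis by simp
  qed
  consider "W = 0" | "?A = 0" | "W > 0" "?A = \<infinity>" | "W > 0" "?A \<noteq> 0" "?A \<noteq> \<infinity>" using W by force
  then show ?thesis
  proof cases
    case 1
    then have "(\<integral>\<^sup>+y. ennreal (w y) \<partial>M) = 0" using W(2) by simp
    then have "AE y in M. ennreal (w y) = 0" by (subst (asm) nn_integral_0_iff_AE) auto
    then have "AE y in M. w y * f y = 0" using w0 by (auto simp: ennreal_eq_0_iff intro: antisym)
    then show ?thesis by (rule zero)
  next
    case 2
    then have "AE y in M. ennreal (w y * f y powr p) = 0" by (subst (asm) nn_integral_0_iff_AE) auto
    then have "AE y in M. w y * f y = 0"
    proof eventually_elim
      case (elim y)
      then have "w y * f y powr p \<le> 0" by (simp add: ennreal_eq_0_iff)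
      moreover have "w y * f y powr p \<ge> 0" using w0[of y] by simp
      ultimately have "w y * f y powr p = 0" by linarith
      then show ?case by auto
    qed
    then show ?thesis by (rule zero)
  next
    case 3
    then show ?thesis by (simp add: ennreal_mult_top)
  next
    case 4
    obtain a where a: "?A = ennreal a" "a > 0"
      using 4(2,3) by (cases "?A" rule: ennreal_cases) (auto simp: less_le)
    \<comment> \<open>The tangent of \<open>t\<^sup>p\<close> is taken at the point where the resulting bound is optimal.\<close>
    define c where "c = (a / W) powr (1 / p)"
    have c: "c > 0" "c powr p = a / W" using a(2) 4(1) p by (auto simp: c_def powr_powr)
    have "ennreal s \<le> (\<integral>\<^sup>+y. ennreal (w y * f y) \<partial>M)" by (rule s(2))
    also have "\<dots> \<le> (\<integral>\<^sup>+y. ennreal (c / (c powr p * p)) * ennreal (w y * f y powr p) + ennreal (c * (p - 1) / p) * ennreal (w y) \<partial>M)"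
    proof (rule nn_integral_mono)
      fix y
      have "w y * f y \<le> w y * (c * ((f y / c) powr p / p + (p - 1) / p))"
        by (intro mult_left_mono young_tangent p c f0 w0)
      also have "\<dots> = c / (c powr p * p) * (w y * f y powr p) + c * (p - 1) / p * w y"
        using c(1) f0[of y] p by (simp add: powr_divide field_simps)
      finally have "ennreal (w y * f y) \<le> ennreal (c / (c powr p * p) * (w y * f y powr p) + c * (p - 1) / p * w y)"
        by (rule ennreal_leI)
      then show "ennreal (w y * f y) \<le> ennreal (c / (c powr p * p)) * ennreal (w y * f y powr p) + ennreal (c * (p - 1) / p) * ennreal (w y)"
        using c(1) p w0[of y] by (simp add: ennreal_mult[symmetric] ennreal_plus[symmetric] del: ennreal_plus)
    qed
    also have "\<dots> = ennreal (c / (c powr p * p)) * ?A + ennreal (c * (p - 1) / p) * (\<integral>\<^sup>+y. ennreal (w y) \<partial>M)"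
      by (simp add: nn_integral_add nn_integral_cmult)
    also have "\<dots> \<le> ennreal (c / (c powr p * p)) * ennreal a + ennreal (c * (p - 1) / p) * ennreal W"
      unfolding a(1) by (intro add_left_mono mult_left_mono W(2)) auto
    also have "\<dots> = ennreal (c / (c powr p * p) * a + c * (p - 1) / p * W)"
      using c(1) p a(2) W(1) by (simp add: ennreal_mult[symmetric] ennreal_plus[symmetric] del: ennreal_plus)
    also have "c / (c powr p * p) * a + c * (p - 1) / p * W = c * W"
      unfolding c(2) using a(2) 4(1) p by (simp add: field_simps)
    finally have "s \<le> c * W" using c(1) 4(1) by (simp add: ennreal_le_iff)
    then have "s powr p \<le> (c * W) powr p" using s(1) p by (intro powr_mono2) auto
    also have "\<dots> = W powr (p - 1) * a"
      using c 4(1) by (simp add: powr_mult powr_diff)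
    finally show ?thesis unfolding a(1) using a(2) by (simp add: ennreal_mult[symmetric] ennreal_leI)
  qed
qed

text \<open>An upper bound for the norm in \<open>L\<^sup>p\<close> together with measurability: unlike \<open>Lp_norm\<close>, it is meaningful
  without a proof of integrability, and it can be passed through sums and limits.\<close>

definition Lp_le :: "real \<Rightarrow> (plane \<Rightarrow> complex) \<Rightarrow> real \<Rightarrow> bool" where
  "Lp_le p f a \<longleftrightarrow> f \<in> borel_measurable borel \<and> a \<ge> 0 \<and> (\<integral>\<^sup>+x. ennreal (cmod (f x) powr p) \<partial>lborel) \<le> ennreal (a powr p)"

lemma Lp_leD:
  assumes "Lp_le p f a"
  shows "f \<in> borel_measurable borel" "a \<ge> 0" "(\<integral>\<^sup>+x. ennreal (cmod (f x) powr p) \<partial>lborel) \<le> ennreal (a powr p)"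
  using assms unfolding Lp_le_def by auto

lemma Lp_norm_nonneg: "Lp_norm p f \<ge> 0"
  unfolding Lp_norm_def by simp

lemma in_Lp_imp_Lp_le:
  assumes "1 \<le> p" "in_Lp p f"
  shows "Lp_le p f (Lp_norm p f)"
proof -
  have i: "integrable lborel (\<lambda>x. cmod (f x) powr p)" using assms unfolding in_Lp_def by blast
  have "(\<integral>\<^sup>+x. ennreal (cmod (f x) powr p) \<partial>lborel) = ennreal (\<integral>x. cmod (f x) powr p \<partial>lborel)"
    by (rule nn_integral_eq_integral[OF i]) auto
  moreover have "Lp_norm p f powr p = (\<integral>x. cmod (f x) powr p \<partial>lborel)"
    unfolding Lp_norm_def using assms(1) by (simp add: powr_powr)
  ultimately show ?thesis using assms Lp_norm_nonneg unfolding Lp_le_def in_Lp_def by simp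
qed

lemma Lp_le_imp_in_Lp:
  assumes p: "1 \<le> p" and f: "Lp_le p f a"
  shows "in_Lp p f" "Lp_norm p f \<le> a"
proof -
  note [measurable] = Lp_leD(1)[OF f]
  have "integrable lborel (\<lambda>x. cmod (f x) powr p)"
    by (rule integrableI_bounded) (use Lp_leD(3)[OF f] in \<open>auto simp: le_less_trans[OF _ ennreal_less_top]\<close>)
  then show "in_Lp p f" unfolding in_Lp_def using Lp_leD(1)[OF f] by simp
  then have "Lp_le p f (Lp_norm p f)" by (rule in_Lp_imp_Lp_le[OF p])
  have "(\<integral>x. cmod (f x) powr p \<partial>lborel) \<le> a powr p"
  proof -
    have "ennreal (\<integral>x. cmod (f x) powr p \<partial>lborel) \<le> ennreal (a powr p)"
      using Lp_leD(3)[OF f] nn_integral_eq_integral[OF \<open>integrable lborel (\<lambda>x. cmod (f x) powr p)\<close>] by simp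
    then show ?thesis by (simp add: ennreal_le_iff)
  qed
  then have "Lp_norm p f \<le> (a powr p) powr (1 / p)"
    unfolding Lp_norm_def using p by (intro powr_mono2) auto
  then show "Lp_norm p f \<le> a" using p Lp_leD(2)[OF f] by (simp add: powr_powr)
qed

lemma Lp_le_mono:
  assumes "1 \<le> p" "Lp_le p f a" "a \<le> b"
  shows "Lp_le p f b"
proof -
  have "a powr p \<le> b powr p" using assms Lp_leD(2)[OF assms(2)] by (intro powr_mono2) auto
  then show ?thesis
    using assms order_trans[OF Lp_leD(3)[OF assms(2)] ennreal_leI] Lp_leD(1,2)[OF assms(2)]
    unfolding Lp_le_def by (meson order_trans)
qed

lemma Lp_le_bounded_mult:
  assumes p: "1 \<le> p" and f: "Lp_le p f a" and [measurable]: "g \<in> borel_measurable borel"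
    and B: "\<And>x. cmod (g x) \<le> B"
  shows "Lp_le p (\<lambda>x. g x * f x) (B * a)"
proof -
  note [measurable] = Lp_leD(1)[OF f]
  have B0: "B \<ge> 0" using B[of undefined] norm_ge_zero order_trans by blast
  have "(\<integral>\<^sup>+x. ennreal (cmod (g x * f x) powr p) \<partial>lborel) \<le> (\<integral>\<^sup>+x. ennreal (B powr p) * ennreal (cmod (f x) powr p) \<partial>lborel)"
  proof (rule nn_integral_mono)
    fix x
    have "cmod (g x * f x) powr p \<le> (B * cmod (f x)) powr p"
      using p B[of x] unfolding norm_mult by (intro powr_mono2 mult_right_mono) auto
    also have "\<dots> = B powr p * cmod (f x) powr p" using B0 by (simp add: powr_mult)
    finally show "ennreal (cmod (g x * f x) powr p) \<le> ennreal (B powr p) * ennreal (cmod (f x) powr p)"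
      by (simp add: ennreal_mult[symmetric] ennreal_leI)
  qed
  also have "\<dots> = ennreal (B powr p) * (\<integral>\<^sup>+x. ennreal (cmod (f x) powr p) \<partial>lborel)"
    by (rule nn_integral_cmult) measurable
  also have "\<dots> \<le> ennreal (B powr p) * ennreal (a powr p)"
    by (intro mult_left_mono Lp_leD(3)[OF f]) simp
  also have "\<dots> = ennreal ((B * a) powr p)"
    using B0 Lp_leD(2)[OF f] by (simp add: powr_mult ennreal_mult[symmetric])
  finally show ?thesis unfolding Lp_le_def using B0 Lp_leD(2)[OF f] by simp
qed

lemma Lp_le_cmult: "1 \<le> p \<Longrightarrow> Lp_le p f a \<Longrightarrow> Lp_le p (\<lambda>x. c * f x) (cmod c * a)"
  by (rule Lp_le_bounded_mult) auto

lemma borel_measurable_nn_count: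
  fixes f :: "'i::countable \<Rightarrow> 'a \<Rightarrow> ennreal"
  assumes "\<And>i. f i \<in> borel_measurable M"
  shows "(\<lambda>x. \<integral>\<^sup>+i. f i x \<partial>count_space UNIV) \<in> borel_measurable M"
proof -
  have "(\<lambda>z. f (fst z) (snd z)) \<in> borel_measurable (count_space UNIV \<Otimes>\<^sub>M M)"
    by (rule measurable_pair_measure_countable1) (use assms in auto)
  from measurable_pair_swap[OF this]
  have "(\<lambda>(x, i). f i x) \<in> borel_measurable (M \<Otimes>\<^sub>M count_space UNIV)"
    by (simp add: split_beta')
  then show ?thesis
    by (intro sigma_finite_measure.borel_measurable_nn_integral sigma_finite_measure_count_space_countable) auto
qed

text \<open>The triangle inequality for countable sums: Jensen's inequality with the weights \<open>a i\<close>.\<close>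

lemma Lp_le_nn_count:
  fixes F :: "'i::countable \<Rightarrow> plane \<Rightarrow> complex"
  assumes p: "1 \<le> p" and F: "\<And>i. Lp_le p (F i) (a i)" and a: "a summable_on UNIV"
    and [measurable]: "G \<in> borel_measurable borel"
    and G: "\<And>x. ennreal (cmod (G x)) \<le> (\<integral>\<^sup>+i. ennreal (cmod (F i x)) \<partial>count_space UNIV)"
  shows "Lp_le p G (infsum a UNIV)"
proof -
  note [measurable] = Lp_leD(1)[OF F]
  note a0 = Lp_leD(2)[OF F]
  let ?W = "infsum a UNIV"
  have W0: "?W \<ge> 0" by (rule infsum_nonneg) (rule a0)
  have W: "(\<integral>\<^sup>+i. ennreal (a i) \<partial>count_space UNIV) = ennreal ?W" by (rule nn_count_infsum[OF a0 a])
  have "AE x in lborel. \<forall>i. a i = 0 \<longrightarrow> F i x = 0"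
  proof (subst AE_all_countable, rule allI)
    fix i
    show "AE x in lborel. a i = 0 \<longrightarrow> F i x = 0"
    proof (cases "a i = 0")
      case True
      then have "(\<integral>\<^sup>+x. ennreal (cmod (F i x) powr p) \<partial>lborel) = 0" using Lp_leD(3)[OF F[of i]] by simp
      then have "AE x in lborel. ennreal (cmod (F i x) powr p) = 0" by (subst (asm) nn_integral_0_iff_AE) auto
      then show ?thesis by eventually_elim (auto simp: ennreal_eq_0_iff)
    qed auto
  qed
  then have pt: "AE x in lborel. ennreal (cmod (G x) powr p) \<le> ennreal (?W powr (p - 1)) * (\<integral>\<^sup>+i. ennreal (a i * (cmod (F i x) / a i) powr p) \<partial>count_space UNIV)"
  proof eventually_elim
    case (elim x)
    show ?case
    proof (rule jensen_powr[OF p])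
      have "(\<integral>\<^sup>+i. ennreal (cmod (F i x)) \<partial>count_space UNIV) = (\<integral>\<^sup>+i. ennreal (a i * (cmod (F i x) / a i)) \<partial>count_space UNIV)"
        using elim by (intro nn_integral_cong) auto
      then show "ennreal (cmod (G x)) \<le> (\<integral>\<^sup>+i. ennreal (a i * (cmod (F i x) / a i)) \<partial>count_space UNIV)"
        using G[of x] by simp
    qed (use a0 W0 W in auto)
  qed
  have term_le: "(\<integral>\<^sup>+x. ennreal (a i * (cmod (F i x) / a i) powr p) \<partial>lborel) \<le> ennreal (a i)" for i
  proof (cases "a i = 0")
    case False
    then have ai: "a i > 0" using a0[of i] by simp
    have "(\<integral>\<^sup>+x. ennreal (a i * (cmod (F i x) / a i) powr p) \<partial>lborel) = (\<integral>\<^sup>+x. ennreal (a i / a i powr p) * ennreal (cmod (F i x) powr p) \<partial>lborel)"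
      using ai by (intro nn_integral_cong) (simp add: powr_divide ennreal_mult[symmetric])
    also have "\<dots> = ennreal (a i / a i powr p) * (\<integral>\<^sup>+x. ennreal (cmod (F i x) powr p) \<partial>lborel)"
      by (rule nn_integral_cmult) measurable
    also have "\<dots> \<le> ennreal (a i / a i powr p) * ennreal (a i powr p)"
      by (intro mult_left_mono Lp_leD(3)[OF F]) simp
    also have "\<dots> = ennreal (a i)" using ai by (simp add: ennreal_mult[symmetric])
    finally show ?thesis .
  qed simp
  have "(\<integral>\<^sup>+x. ennreal (cmod (G x) powr p) \<partial>lborel)
      \<le> (\<integral>\<^sup>+x. ennreal (?W powr (p - 1)) * (\<integral>\<^sup>+i. ennreal (a i * (cmod (F i x) / a i) powr p) \<partial>count_space UNIV) \<partial>lborel)"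
    by (rule nn_integral_mono_AE[OF pt])
  also have "\<dots> = ennreal (?W powr (p - 1)) * (\<integral>\<^sup>+x. (\<integral>\<^sup>+i. ennreal (a i * (cmod (F i x) / a i) powr p) \<partial>count_space UNIV) \<partial>lborel)"
    by (rule nn_integral_cmult) (rule borel_measurable_nn_count, measurable)
  also have "(\<integral>\<^sup>+x. (\<integral>\<^sup>+i. ennreal (a i * (cmod (F i x) / a i) powr p) \<partial>count_space UNIV) \<partial>lborel)
      = (\<integral>\<^sup>+i. (\<integral>\<^sup>+x. ennreal (a i * (cmod (F i x) / a i) powr p) \<partial>lborel) \<partial>count_space UNIV)"
    by (rule nn_integral_count_space_nn_integral) auto
  also have "\<dots> \<le> (\<integral>\<^sup>+i. ennreal (a i) \<partial>count_space UNIV)"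
    by (intro nn_integral_mono term_le)
  also have "ennreal (?W powr (p - 1)) * (\<integral>\<^sup>+i. ennreal (a i) \<partial>count_space UNIV) = ennreal (?W powr p)"
    unfolding W using W0 by (cases "?W = 0") (auto simp: ennreal_mult[symmetric] powr_diff)
  finally show ?thesis unfolding Lp_le_def using W0 by (simp add: mult_left_mono)
qed

lemma Lp_le_has_sum:
  fixes F :: "'i::countable \<Rightarrow> plane \<Rightarrow> complex"
  assumes "1 \<le> p" "\<And>i. Lp_le p (F i) (a i)" "a summable_on UNIV" "\<And>x. ((\<lambda>i. F i x) has_sum G x) UNIV"
  shows "Lp_le p G (infsum a UNIV)"
  by (rule Lp_le_nn_count[OF assms(1-3) has_sum_measurable[OF Lp_leD(1)[OF assms(2)] assms(4)] has_sum_norm_le_nn_count[OF assms(4)]])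

lemma Lp_le_0: "1 \<le> p \<Longrightarrow> Lp_le p (\<lambda>x. 0) 0"
  unfolding Lp_le_def by simp

lemma Lp_le_sum:
  fixes F :: "'i::countable \<Rightarrow> plane \<Rightarrow> complex"
  assumes p: "1 \<le> p" and F: "\<And>i. i \<in> I \<Longrightarrow> Lp_le p (F i) (a i)" and I: "finite I"
  shows "Lp_le p (\<lambda>x. \<Sum>i\<in>I. F i x) (\<Sum>i\<in>I. a i)"
proof -
  let ?F = "\<lambda>i x. if i \<in> I then F i x else 0" and ?a = "\<lambda>i. if i \<in> I then a i else 0"
  have 1: "Lp_le p (?F i) (?a i)" for i using F[of i] Lp_le_0[OF p] by (cases "i \<in> I") auto
  have 2: "(?a has_sum (\<Sum>i\<in>I. a i)) UNIV"
    by (rule has_sum_finite_neutralI[OF I]) auto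
  have 3: "((\<lambda>i. ?F i x) has_sum (\<Sum>i\<in>I. F i x)) UNIV" for x
    by (rule has_sum_finite_neutralI[OF I]) auto
  have "Lp_le p (\<lambda>x. \<Sum>i\<in>I. F i x) (infsum ?a UNIV)"
    by (rule Lp_le_has_sum[OF p 1 _ 3]) (use 2 summable_on_def in blast)
  then show ?thesis using infsumI[OF 2] by simp
qed

lemma Lp_le_add:
  assumes p: "1 \<le> p" and "Lp_le p f a" "Lp_le p g b"
  shows "Lp_le p (\<lambda>x. f x + g x) (a + b)"
  using Lp_le_sum[OF p, of "UNIV :: bool set" "\<lambda>i. if i then f else g" "\<lambda>i. if i then a else b"] assms
  by (simp add: UNIV_bool add.commute)

lemma Lp_le_diff:
  assumes p: "1 \<le> p" and "Lp_le p f a" "Lp_le p g b"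
  shows "Lp_le p (\<lambda>x. f x - g x) (a + b)"
  using Lp_le_add[OF p assms(2) Lp_le_cmult[OF p assms(3), of "-1"]] by simp

section \<open>The inequalities of Young and Bernstein\<close>

text \<open>Integrating this pointwise bound in \<open>x\<close> gives Young's inequality, bounding the kernel by its supremum
  gives an estimate from \<open>L\<^sup>p\<close> to \<open>L\<^sup>\<infinity>\<close>.\<close>

lemma sconv_jensen:
  assumes p: "1 \<le> p" and K: "integrable lborel K" and [measurable]: "F \<in> borel_measurable borel"
  shows "ennreal (cmod (sconv K F x) powr p)
    \<le> ennreal ((\<integral>y. cmod (K y) \<partial>lborel) powr (p - 1)) * (\<integral>\<^sup>+y. ennreal (cmod (K (x - y)) * cmod (F y) powr p) \<partial>lborel)"
proof (rule jensen_powr[OF p])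
  note [measurable] = borel_measurable_integrable[OF K]
  show "(\<lambda>y. cmod (K (x - y))) \<in> borel_measurable lborel" "(\<lambda>y. cmod (F y)) \<in> borel_measurable lborel" by measurable
  have "(\<integral>\<^sup>+y. ennreal (cmod (K (x - y))) \<partial>lborel) = (\<integral>\<^sup>+y. ennreal (cmod (K y)) \<partial>lborel)"
    by (rule integral_norm_reflect) measurable
  also have "\<dots> = ennreal (\<integral>y. cmod (K y) \<partial>lborel)"
    by (rule nn_integral_eq_integral) (use K in auto)
  finally show "(\<integral>\<^sup>+y. ennreal (cmod (K (x - y))) \<partial>lborel) \<le> ennreal (\<integral>y. cmod (K y) \<partial>lborel)" by simp
  show "ennreal (cmod (sconv K F x)) \<le> (\<integral>\<^sup>+y. ennreal (cmod (K (x - y)) * cmod (F y)) \<partial>lborel)"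
  proof (cases "integrable lborel (\<lambda>y. K (x - y) * F y)")
    case True
    from integral_norm_bound_ennreal[OF this] show ?thesis unfolding sconv_def by (simp add: norm_mult)
  next
    case False
    then have "sconv K F x = 0" unfolding sconv_def by (rule not_integrable_integral_eq)
    then show ?thesis by simp
  qed
qed auto

lemma sconv_measurable:
  assumes [measurable]: "K \<in> borel_measurable borel" "F \<in> borel_measurable borel"
  shows "sconv K F \<in> borel_measurable borel"
proof -
  have "(\<lambda>x. \<integral>y. K (x - y) * F y \<partial>lborel) \<in> borel_measurable borel"
    by (rule lborel.borel_measurable_lebesgue_integral) (simp add: split_beta', measurable)
  then show ?thesis unfolding sconv_def[abs_def] .
qed

lemma Lp_le_sconv:
  assumes p: "1 \<le> p" and K: "integrable lborel K" and F: "Lp_le p F a"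
  shows "Lp_le p (sconv K F) ((\<integral>y. cmod (K y) \<partial>lborel) * a)"
proof -
  note [measurable] = Lp_leD(1)[OF F] borel_measurable_integrable[OF K]
  let ?L = "\<integral>y. cmod (K y) \<partial>lborel"
  have L0: "?L \<ge> 0" by simp
  have L: "(\<integral>\<^sup>+y. ennreal (cmod (K y)) \<partial>lborel) = ennreal ?L"
    by (rule nn_integral_eq_integral) (use K in auto)
  have "(\<integral>\<^sup>+x. ennreal (cmod (sconv K F x) powr p) \<partial>lborel)
     \<le> (\<integral>\<^sup>+x. ennreal (?L powr (p - 1)) * (\<integral>\<^sup>+y. ennreal (cmod (K (x - y)) * cmod (F y) powr p) \<partial>lborel) \<partial>lborel)"
    by (intro nn_integral_mono sconv_jensen p K) measurable
  also have "\<dots> = ennreal (?L powr (p - 1)) * (\<integral>\<^sup>+x. (\<integral>\<^sup>+y. ennreal (cmod (K (x - y)) * cmod (F y) powr p) \<partial>lborel) \<partial>lborel)"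
    by (rule nn_integral_cmult) measurable
  also have "(\<integral>\<^sup>+x. (\<integral>\<^sup>+y. ennreal (cmod (K (x - y)) * cmod (F y) powr p) \<partial>lborel) \<partial>lborel)
     = (\<integral>\<^sup>+y. (\<integral>\<^sup>+x. ennreal (cmod (K (x - y)) * cmod (F y) powr p) \<partial>lborel) \<partial>lborel)"
    by (rule lborel_pair.Fubini') measurable
  also have "\<dots> = (\<integral>\<^sup>+y. ennreal ?L * ennreal (cmod (F y) powr p) \<partial>lborel)"
  proof (rule nn_integral_cong)
    fix y
    have "(\<integral>\<^sup>+x. ennreal (cmod (K (x - y)) * cmod (F y) powr p) \<partial>lborel)
        = (\<integral>\<^sup>+x. ennreal (cmod (K (x - y))) * ennreal (cmod (F y) powr p) \<partial>lborel)"
      by (simp add: ennreal_mult)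
    also have "\<dots> = (\<integral>\<^sup>+x. ennreal (cmod (K (x - y))) \<partial>lborel) * ennreal (cmod (F y) powr p)"
      by (rule nn_integral_multc) measurable
    also have "(\<integral>\<^sup>+x. ennreal (cmod (K (x - y))) \<partial>lborel) = (\<integral>\<^sup>+x. ennreal (cmod (K x)) \<partial>lborel)"
      using nn_integral_plane_affine[of "\<lambda>x. ennreal (cmod (K x))" 1 "- y"] by simp
    finally show "(\<integral>\<^sup>+x. ennreal (cmod (K (x - y)) * cmod (F y) powr p) \<partial>lborel) = ennreal ?L * ennreal (cmod (F y) powr p)"
      unfolding L .
  qed
  also have "\<dots> = ennreal ?L * (\<integral>\<^sup>+y. ennreal (cmod (F y) powr p) \<partial>lborel)"
    by (rule nn_integral_cmult) measurable
  also have "ennreal (?L powr (p - 1)) * (ennreal ?L * (\<integral>\<^sup>+y. ennreal (cmod (F y) powr p) \<partial>lborel))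
      \<le> ennreal (?L powr (p - 1)) * (ennreal ?L * ennreal (a powr p))"
    by (intro mult_left_mono Lp_leD(3)[OF F]) auto
  also have "\<dots> = ennreal ((?L * a) powr p)"
  proof (cases "?L = 0")
    case False
    then show ?thesis
      using L0 Lp_leD(2)[OF F] by (simp add: ennreal_mult[symmetric] powr_mult powr_diff)
  qed simp
  finally show ?thesis unfolding Lp_le_def using L0 Lp_leD(2)[OF F] by (simp add: sconv_measurable)
qed

lemma sconv_sup:
  assumes p: "1 \<le> p" and K: "integrable lborel K" and S: "\<And>y. cmod (K y) \<le> S" and F: "Lp_le p F a"
  shows "cmod (sconv K F x) \<le> ((\<integral>y. cmod (K y) \<partial>lborel) powr (p - 1) * S) powr (1 / p) * a"
proof -
  note [measurable] = Lp_leD(1)[OF F] borel_measurable_integrable[OF K]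
  let ?L = "\<integral>y. cmod (K y) \<partial>lborel"
  have S0: "S \<ge> 0" using S[of undefined] norm_ge_zero order_trans by blast
  have "ennreal (cmod (sconv K F x) powr p)
     \<le> ennreal (?L powr (p - 1)) * (\<integral>\<^sup>+y. ennreal (cmod (K (x - y)) * cmod (F y) powr p) \<partial>lborel)"
    by (intro sconv_jensen p K) measurable
  also have "(\<integral>\<^sup>+y. ennreal (cmod (K (x - y)) * cmod (F y) powr p) \<partial>lborel) \<le> (\<integral>\<^sup>+y. ennreal S * ennreal (cmod (F y) powr p) \<partial>lborel)"
    by (intro nn_integral_mono) (use S S0 in \<open>auto simp: ennreal_mult[symmetric] intro!: ennreal_leI mult_right_mono\<close>)
  also have "\<dots> = ennreal S * (\<integral>\<^sup>+y. ennreal (cmod (F y) powr p) \<partial>lborel)"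
    by (rule nn_integral_cmult) measurable
  also have "\<dots> \<le> ennreal S * ennreal (a powr p)"
    by (intro mult_left_mono Lp_leD(3)[OF F]) auto
  finally have "ennreal (cmod (sconv K F x) powr p) \<le> ennreal (?L powr (p - 1)) * (ennreal S * ennreal (a powr p))"
    by (simp add: mult_left_mono)
  then have "ennreal (cmod (sconv K F x) powr p) \<le> ennreal (?L powr (p - 1) * S * a powr p)"
    using S0 by (simp add: ennreal_mult[symmetric] mult.assoc)
  then have "cmod (sconv K F x) powr p \<le> ?L powr (p - 1) * S * a powr p"
    using S0 by (simp add: ennreal_le_iff)
  then have "(cmod (sconv K F x) powr p) powr (1 / p) \<le> (?L powr (p - 1) * S * a powr p) powr (1 / p)"
    using p by (intro powr_mono2) auto
  then show ?thesis using p S0 Lp_leD(2)[OF F] by (simp add: powr_powr powr_mult)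
qed

section \<open>Bounded functions as distributions\<close>

definition bdd_meas :: "(plane \<Rightarrow> complex) \<Rightarrow> bool" where
  "bdd_meas F \<longleftrightarrow> F \<in> borel_measurable borel \<and> bounded (range F)"

definition distr_of :: "(plane \<Rightarrow> complex) \<Rightarrow> distr" where
  "distr_of F = (\<lambda>g. if schwartz g then pairing F g else 0)"

lemma bdd_measI: "F \<in> borel_measurable borel \<Longrightarrow> (\<And>x. cmod (F x) \<le> B) \<Longrightarrow> bdd_meas F"
  unfolding bdd_meas_def by (auto intro: boundedI)

lemma bdd_measD:
  assumes "bdd_meas F"
  shows "F \<in> borel_measurable borel" "\<exists>B\<ge>0. \<forall>x. cmod (F x) \<le> B"
proof -
  show "F \<in> borel_measurable borel" using assms unfolding bdd_meas_def by blast
  obtain B where B: "\<And>x. cmod (F x) \<le> B" using assms unfolding bdd_meas_def bounded_iff by auto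
  then have "B \<ge> 0" using norm_ge_zero order_trans by blast
  then show "\<exists>B\<ge>0. \<forall>x. cmod (F x) \<le> B" using B by blast
qed

lemma bdd_meas_add: "bdd_meas F \<Longrightarrow> bdd_meas G \<Longrightarrow> bdd_meas (\<lambda>x. F x + G x)"
  unfolding bdd_meas_def by (auto intro: bounded_plus_comp)

lemma bdd_meas_diff: "bdd_meas F \<Longrightarrow> bdd_meas G \<Longrightarrow> bdd_meas (\<lambda>x. F x - G x)"
  unfolding bdd_meas_def by (auto intro: bounded_minus_comp)

lemma bdd_meas_mult:
  assumes "bdd_meas F" "bdd_meas G"
  shows "bdd_meas (\<lambda>x. F x * G x)"
proof -
  obtain A where A: "A \<ge> 0" "\<And>x. cmod (F x) \<le> A" using bdd_measD(2)[OF assms(1)] by blast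
  obtain B where B: "B \<ge> 0" "\<And>x. cmod (G x) \<le> B" using bdd_measD(2)[OF assms(2)] by blast
  note [measurable] = bdd_measD(1)[OF assms(1)] bdd_measD(1)[OF assms(2)]
  show ?thesis
    by (rule bdd_measI[of _ "A * B"]) (auto simp: norm_mult intro!: mult_mono A B)
qed

lemma bdd_meas_integrable:
  assumes F: "bdd_meas F" and K: "integrable lborel K"
  shows "integrable lborel (\<lambda>x. K x * F x)"
proof -
  note [measurable] = bdd_measD(1)[OF F] borel_measurable_integrable[OF K]
  obtain B where B: "B \<ge> 0" "\<And>x. cmod (F x) \<le> B" using bdd_measD(2)[OF F] by blast
  show ?thesis
    by (rule Bochner_Integration.integrable_bound[OF integrable_mult_right[OF K, of "of_real B"]])
       (use B in \<open>auto simp: norm_mult mult.commute[of B] intro!: mult_left_mono\<close>)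
qed

lemma bdd_meas_pairing_integrable: "bdd_meas F \<Longrightarrow> schwartz g \<Longrightarrow> integrable lborel (\<lambda>x. F x * g x)"
  using bdd_meas_integrable[of F g] schwartz_integrable by (simp add: mult.commute)

lemma pairing_add1: "bdd_meas F \<Longrightarrow> bdd_meas G \<Longrightarrow> schwartz g \<Longrightarrow> pairing (\<lambda>x. F x + G x) g = pairing F g + pairing G g"
  unfolding pairing_def by (simp add: distrib_right bdd_meas_pairing_integrable)

lemma pairing_diff1: "bdd_meas F \<Longrightarrow> bdd_meas G \<Longrightarrow> schwartz g \<Longrightarrow> pairing (\<lambda>x. F x - G x) g = pairing F g - pairing G g"
  unfolding pairing_def by (simp add: left_diff_distrib bdd_meas_pairing_integrable)

lemma distr_of_diff: "bdd_meas F \<Longrightarrow> bdd_meas G \<Longrightarrow> distr_of (\<lambda>x. F x - G x) = distr_of F - distr_of G"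
  by (rule ext) (simp add: distr_of_def pairing_diff1)

lemma distr_of_add: "bdd_meas F \<Longrightarrow> bdd_meas G \<Longrightarrow> distr_of (\<lambda>x. F x + G x) = (\<lambda>g. distr_of F g + distr_of G g)"
  by (rule ext) (simp add: distr_of_def pairing_add1)

lemma represents_distr_of: "bdd_meas F \<Longrightarrow> represents F (distr_of F)"
  unfolding represents_def bdd_meas_def distr_of_def by auto

lemma tempered_distr_of:
  assumes F: "bdd_meas F"
  shows "tempered (distr_of F)"
proof -
  obtain B where B: "B \<ge> 0" "\<And>x. cmod (F x) \<le> B" using bdd_measD(2)[OF F] by blast
  have "cmod (distr_of F g) \<le> (B * (\<integral>x. \<omega> x \<partial>lborel)) * schwartz_seminorm 4 g" if g: "schwartz g" for g
  proof -
    have le: "cmod (g x) \<le> schwartz_seminorm 4 g * \<omega> x" for x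
    proof -
      have "(1 + norm x) ^ 4 * cmod (g x) \<le> schwartz_seminorm 4 g"
        using schwartz_seminorm_upper[OF g, of "[]" 4 x] by simp
      moreover have "(1 + norm x) ^ 4 > 0" using one_plus_norm_pos[of x] by (rule zero_less_power)
      ultimately show ?thesis unfolding \<omega>_def by (simp add: field_simps)
    qed
    have "cmod (\<integral>x. F x * g x \<partial>lborel) \<le> (\<integral>x. B * (schwartz_seminorm 4 g * \<omega> x) \<partial>lborel)"
    proof (rule Bochner_Integration.integral_norm_bound_integral)
      show "integrable lborel (\<lambda>x. B * (schwartz_seminorm 4 g * \<omega> x))"
        by (intro integrable_mult_right omega_integrable)
      show "norm (F x * g x) \<le> B * (schwartz_seminorm 4 g * \<omega> x)" for x
        unfolding norm_mult by (intro mult_mono B le) auto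
    qed (rule bdd_meas_pairing_integrable[OF F g])
    then show ?thesis using g by (simp add: distr_of_def pairing_def mult_ac)
  qed
  moreover have "distr_of F (\<lambda>x. g x + h x) = distr_of F g + distr_of F h" if "schwartz g" "schwartz h" for g h
    using that unfolding distr_of_def pairing_def
    by (simp add: schwartz_add distrib_left bdd_meas_pairing_integrable[OF F])
  moreover have "distr_of F (\<lambda>x. c * g x) = c * distr_of F g" if "schwartz g" for c g
    using that unfolding distr_of_def pairing_def
    by (simp add: schwartz_cmult mult.left_commute)
  ultimately show ?thesis unfolding tempered_def by (auto simp: distr_of_def)
qed

lemma conv_distr_of: "schwartz h \<Longrightarrow> conv h (distr_of F) x = sconv h F x"
  unfolding conv_def distr_of_def pairing_def sconv_def by (simp add: schwartz_reflect mult.commute)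

lemma bdd_meas_sconv:
  assumes K: "integrable lborel K" and F: "bdd_meas F"
  shows "bdd_meas (sconv K F)"
proof -
  obtain B where B: "B \<ge> 0" "\<And>x. cmod (F x) \<le> B" using bdd_measD(2)[OF F] by blast
  note [measurable] = bdd_measD(1)[OF F] borel_measurable_integrable[OF K]
  have "cmod (sconv K F x) \<le> (\<integral>y. cmod (K y) \<partial>lborel) * B" for x
  proof -
    have "cmod (sconv K F x) \<le> (\<integral>y. cmod (K (x - y)) * B \<partial>lborel)"
      unfolding sconv_def
    proof (rule Bochner_Integration.integral_norm_bound_integral)
      show "integrable lborel (\<lambda>y. K (x - y) * F y)"
        by (rule bdd_meas_integrable[OF F integrable_reflect[OF K]])
      show "integrable lborel (\<lambda>y. cmod (K (x - y)) * B)"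
        by (intro integrable_mult_left integrable_norm integrable_reflect K)
      show "norm (K (x - y) * F y) \<le> cmod (K (x - y)) * B" for y
        unfolding norm_mult by (intro mult_left_mono B) simp
    qed
    also have "\<dots> = (\<integral>y. cmod (K (x - y)) \<partial>lborel) * B" by simp
    also have "(\<integral>y. cmod (K (x - y)) \<partial>lborel) = (\<integral>y. cmod (K y) \<partial>lborel)"
      using integral_reflect[of "\<lambda>y. of_real (cmod (K y))" x] by simp
    finally show ?thesis .
  qed
  then show ?thesis by (intro bdd_measI sconv_measurable) auto
qed

text \<open>The frequencies of a product lie in the sum of the frequency sets of the factors. This is
  used in the following form: the pairing with \<open>q\<close> of a function with the frequencies of \<open>L\<close>
  vanishes if \<open>q\<close> has none of these frequencies.\<close>

lemma pairing_band_0: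
  assumes q: "integrable lborel q" and L: "schwartz L" and a: "bdd_meas a"
    and 0: "\<And>\<xi>. fourier L \<xi> \<noteq> 0 \<Longrightarrow> (\<integral>y. q y * cis (y \<bullet> \<xi>) \<partial>lborel) = 0"
  shows "(\<integral>y. q y * sconv L a y \<partial>lborel) = 0"
proof -
  obtain B where B: "B \<ge> 0" "\<And>x. cmod (a x) \<le> B" using bdd_measD(2)[OF a] by blast
  note [measurable] = borel_measurable_integrable[OF q]
  have inner: "(\<integral>y. q y * L (y - z) \<partial>lborel) = 0" for z
  proof -
    have "(2 * of_real pi)\<^sup>2 * (\<integral>y. q y * L (y - z) \<partial>lborel) = (\<integral>y. q y * (\<integral>\<xi>. cis ((y - z) \<bullet> \<xi>) * fourier L \<xi> \<partial>lborel) \<partial>lborel)"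
      unfolding fourier_inversion_integral[OF L] by (simp only: mult.left_commute[of "q _"] integral_mult_right_zero)
    also have "\<dots> = (\<integral>\<xi>. (\<integral>y. cis ((y - z) \<bullet> \<xi>) * q y \<partial>lborel) * fourier L \<xi> \<partial>lborel)"
    proof (rule Fubini_mult[where B=1])
      have "continuous_on UNIV (\<lambda>w::plane \<times> plane. cis ((fst w - z) \<bullet> snd w))"
        by (intro continuous_intros)
      then show "(\<lambda>(y, \<xi>). cis ((y - z) \<bullet> \<xi>)) \<in> borel_measurable (borel \<Otimes>\<^sub>M (borel :: plane measure))"
        unfolding borel_prod by (simp add: borel_measurable_continuous_onI split_beta')
    qed (use q schwartz_integrable[OF schwartz_fourier[OF L]] in simp_all)
    also have "\<dots> = (\<integral>\<xi>. 0 \<partial>(lborel :: plane measure))"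
    proof (intro Bochner_Integration.integral_cong refl)
      fix \<xi>
      have "(\<integral>y. cis ((y - z) \<bullet> \<xi>) * q y \<partial>lborel) = (\<integral>y. cis (- (z \<bullet> \<xi>)) * (q y * cis (y \<bullet> \<xi>)) \<partial>lborel)"
      proof (intro Bochner_Integration.integral_cong refl)
        fix y
        have "cis ((y - z) \<bullet> \<xi>) = cis (- (z \<bullet> \<xi>)) * cis (y \<bullet> \<xi>)" by (simp add: cis_mult inner_diff_left)
        then show "cis ((y - z) \<bullet> \<xi>) * q y = cis (- (z \<bullet> \<xi>)) * (q y * cis (y \<bullet> \<xi>))" by (simp only: mult_ac)
      qed
      also have "\<dots> = cis (- (z \<bullet> \<xi>)) * (\<integral>y. q y * cis (y \<bullet> \<xi>) \<partial>lborel)" by simp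
      finally show "(\<integral>y. cis ((y - z) \<bullet> \<xi>) * q y \<partial>lborel) * fourier L \<xi> = 0"
        using 0[of \<xi>] by (cases "fourier L \<xi> = 0") auto
    qed
    finally show ?thesis by simp
  qed
  show ?thesis
    unfolding sconv_def Fubini_conv(1)[OF q schwartz_integrable[OF L] bdd_measD(1)[OF a] B(2)] inner by simp
qed

lemma integral_reflect_cis:
  assumes "schwartz K"
  shows "(\<integral>y. K (x - y) * cis (y \<bullet> \<zeta>) \<partial>lborel) = cis (x \<bullet> \<zeta>) * fourier K \<zeta>"
proof -
  note [measurable] = schwartz_measurable[OF assms]
  have "(\<integral>y. K (x - y) * cis (y \<bullet> \<zeta>) \<partial>lborel) = (\<integral>y. (\<lambda>w. K w * cis ((x - w) \<bullet> \<zeta>)) (x - y) \<partial>lborel)" by simp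
  also have "\<dots> = (\<integral>w. K w * cis ((x - w) \<bullet> \<zeta>) \<partial>lborel)"
    by (rule integral_reflect) (auto intro!: borel_measurable_times borel_measurable_continuous_onI continuous_intros schwartz_continuous assms)
  also have "\<dots> = (\<integral>w. cis (x \<bullet> \<zeta>) * (cis (- (w \<bullet> \<zeta>)) * K w) \<partial>lborel)"
  proof (intro Bochner_Integration.integral_cong refl)
    fix w
    have "cis ((x - w) \<bullet> \<zeta>) = cis (x \<bullet> \<zeta>) * cis (- (w \<bullet> \<zeta>))" by (simp add: cis_mult inner_diff_left)
    then show "K w * cis ((x - w) \<bullet> \<zeta>) = cis (x \<bullet> \<zeta>) * (cis (- (w \<bullet> \<zeta>)) * K w)" by (simp only: mult_ac)
  qed
  finally show ?thesis unfolding fourier_def by simp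
qed

text \<open>If no sum of a frequency of \<open>L\<close> and a frequency of \<open>M\<close> is a frequency of \<open>K\<close>, then \<open>K\<close> annihilates the
  product. Neither \<open>a\<close> nor \<open>b\<close> has a Fourier transform that is a function; the previous lemma is
  applied to one factor at a time, with the other one absorbed into \<open>q\<close>.\<close>

lemma product_band_0:
  assumes K: "schwartz K" and L: "schwartz L" and M: "schwartz M" and a: "bdd_meas a" and b: "bdd_meas b"
    and 0: "\<And>\<xi> \<eta>. fourier L \<xi> \<noteq> 0 \<Longrightarrow> fourier M \<eta> \<noteq> 0 \<Longrightarrow> fourier K (\<xi> + \<eta>) = 0"
  shows "sconv K (\<lambda>y. sconv L a y * sconv M b y) x = 0"
proof -
  have iK: "integrable lborel (\<lambda>y. K (x - y))" by (rule integrable_reflect[OF schwartz_integrable[OF K]])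
  have "(\<integral>y. (K (x - y) * sconv M b y) * sconv L a y \<partial>lborel) = 0"
  proof (rule pairing_band_0[OF _ L a])
    show "integrable lborel (\<lambda>y. K (x - y) * sconv M b y)"
      by (rule bdd_meas_integrable[OF bdd_meas_sconv[OF schwartz_integrable[OF M] b] iK])
    fix \<xi> assume \<xi>: "fourier L \<xi> \<noteq> 0"
    have bc: "bdd_meas (\<lambda>y. cis (y \<bullet> \<xi>))" by (rule bdd_measI[of _ 1]) auto
    have "(\<integral>y. (K (x - y) * cis (y \<bullet> \<xi>)) * sconv M b y \<partial>lborel) = 0"
    proof (rule pairing_band_0[OF _ M b])
      show "integrable lborel (\<lambda>y. K (x - y) * cis (y \<bullet> \<xi>))" by (rule bdd_meas_integrable[OF bc iK])
      fix \<eta> assume "fourier M \<eta> \<noteq> 0"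
      then have "fourier K (\<xi> + \<eta>) = 0" using 0 \<xi> by blast
      then show "(\<integral>y. K (x - y) * cis (y \<bullet> \<xi>) * cis (y \<bullet> \<eta>) \<partial>lborel) = 0"
        using integral_reflect_cis[OF K, of x "\<xi> + \<eta>"] by (simp add: mult.assoc cis_mult inner_add_right)
    qed
    then show "(\<integral>y. K (x - y) * sconv M b y * cis (y \<bullet> \<xi>) \<partial>lborel) = 0" by (simp add: mult_ac)
  qed
  then show ?thesis unfolding sconv_def[of K] by (simp add: mult_ac)
qed

section \<open>Multipliers on Besov spaces\<close>

abbreviation one_symbol :: "plane \<Rightarrow> complex" where "one_symbol \<equiv> \<lambda>\<xi>. 1"

locale besov_setting = littlewood_paley_function \<phi> for \<phi> +
  fixes p :: real
  assumes p1: "1 \<le> p"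
begin

lemma p_pos: "p > 0" using p1 by simp

lemma two_powr_near:
  fixes d :: real
  assumes "k \<in> near j"
  shows "2 powr (d * of_int k) \<le> 2 powr (2 * \<bar>d\<bar>) * 2 powr (d * of_int j)"
proof -
  have "\<bar>real_of_int k - of_int j\<bar> \<le> 2" using assms by (auto simp: abs_le_iff)
  then have "\<bar>d\<bar> * \<bar>real_of_int k - of_int j\<bar> \<le> \<bar>d\<bar> * 2" by (intro mult_left_mono) auto
  then have "d * (of_int k - of_int j) \<le> 2 * \<bar>d\<bar>"
    using abs_ge_self[of "d * (of_int k - of_int j)"] by (simp add: abs_mult)
  then show ?thesis by (simp add: powr_add[symmetric] algebra_simps)
qed

text \<open>The block of \<open>u\<close> at \<open>j\<close> is reproduced by the cut-offs near \<open>j\<close>, so the multiplier acts on it by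
  convolution with kernels of \<open>L\<^sup>1\<close> norm of order \<open>2\<^bsup>dj\<^esup>\<close> and supremum of order \<open>2\<^bsup>(d+2)j\<^esup>\<close>. Young's inequality
  gives the first bound. Raising the two sizes to the powers \<open>1 - 1/p\<close> and \<open>1/p\<close> gives the second one,
  which is Bernstein's inequality.\<close>

lemma block_estimates:
  assumes m: "admissible m" and d: "homogeneous d m"
  shows "\<exists>C\<ge>0. \<forall>u b j. tempered u \<longrightarrow> Lp_le p (conv (ker one_symbol j) u) b \<longrightarrow>
    Lp_le p (conv (ker m j) u) (C * 2 powr (d * of_int j) * b) \<and>
    (\<forall>x. cmod (conv (ker m j) u x) \<le> C * 2 powr ((d + 2 / p) * of_int j) * b)"
proof -
  obtain S where S: "S \<ge> 0" "\<And>j x. cmod (ker m j x) \<le> S * 2 powr ((d + 2) * of_int j)"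
    using ker_sup[OF m d] by metis
  define L where "L = L1 (ker m 0)"
  have L0: "L \<ge> 0" unfolding L_def by (rule L1_nonneg)
  have Lk: "(\<integral>x. cmod (ker m k x) \<partial>lborel) = 2 powr (d * of_int k) * L" for k
    using ker_L1[OF m d, of k] unfolding L_def L1_def .
  define Q where "Q = (L powr (p - 1) * S) powr (1 / p)"
  have Q0: "Q \<ge> 0" unfolding Q_def by simp
  define C1 where "C1 = 5 * (L * 2 powr (2 * \<bar>d\<bar>))"
  define C2 where "C2 = 5 * (Q * 2 powr (2 * \<bar>d + 2 / p\<bar>))"
  have C0: "C1 \<ge> 0" "C2 \<ge> 0" using L0 Q0 by (auto simp: C1_def C2_def)
  have card: "card (near j) = 5" for j by simp
  have well_posedness: "Lp_le p (conv (ker m j) u) (C1 * 2 powr (d * of_int j) * b) \<and>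
    (\<forall>x. cmod (conv (ker m j) u x) \<le> C2 * 2 powr ((d + 2 / p) * of_int j) * b)"
    if u: "tempered u" and b: "Lp_le p (conv (ker one_symbol j) u) b" for u b j
  proof
    note b0 = Lp_leD(2)[OF b]
    have e: "conv (ker m j) u x = (\<Sum>k\<in>near j. sconv (ker m k) (conv (ker one_symbol j) u) x)" for x
      using ker_conv_sum(1)[OF u m admissible_const[of 1], of j x] by simp
    have iK: "integrable lborel (ker m k)" for k by (intro schwartz_integrable schwartz_ker m)
    have "Lp_le p (\<lambda>x. \<Sum>k\<in>near j. sconv (ker m k) (conv (ker one_symbol j) u) x) (\<Sum>k\<in>near j. L * 2 powr (2 * \<bar>d\<bar>) * 2 powr (d * of_int j) * b)"
    proof (rule Lp_le_sum[OF p1])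
      fix k assume k: "k \<in> near j"
      have "Lp_le p (sconv (ker m k) (conv (ker one_symbol j) u)) (2 powr (d * of_int k) * L * b)"
        using Lp_le_sconv[OF p1 iK b, of k] unfolding Lk .
      moreover have "2 powr (d * of_int k) * L * b \<le> (2 powr (2 * \<bar>d\<bar>) * 2 powr (d * of_int j)) * L * b"
        by (intro mult_right_mono two_powr_near[OF k] L0 b0)
      ultimately show "Lp_le p (sconv (ker m k) (conv (ker one_symbol j) u)) (L * 2 powr (2 * \<bar>d\<bar>) * 2 powr (d * of_int j) * b)"
        using Lp_le_mono[OF p1] by (simp add: mult_ac)
    qed simp
    then show "Lp_le p (conv (ker m j) u) (C1 * 2 powr (d * of_int j) * b)"
      unfolding e[abs_def, symmetric] e[symmetric] C1_def by (simp add: mult_ac)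
    show "\<forall>x. cmod (conv (ker m j) u x) \<le> C2 * 2 powr ((d + 2 / p) * of_int j) * b"
    proof
      fix x
      have "cmod (conv (ker m j) u x) \<le> (\<Sum>k\<in>near j. Q * (2 powr (2 * \<bar>d + 2 / p\<bar>) * 2 powr ((d + 2 / p) * of_int j)) * b)"
        unfolding e
      proof (rule sum_norm_le)
        fix k assume k: "k \<in> near j"
        have "cmod (sconv (ker m k) (conv (ker one_symbol j) u) x)
            \<le> ((2 powr (d * of_int k) * L) powr (p - 1) * (S * 2 powr ((d + 2) * of_int k))) powr (1 / p) * b"
          using sconv_sup[OF p1 iK S(2) b, of k x] unfolding Lk .
        also have "((2 powr (d * of_int k) * L) powr (p - 1) * (S * 2 powr ((d + 2) * of_int k))) powr (1 / p)
            = Q * 2 powr ((d + 2 / p) * of_int k)"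
        proof -
          have "(2 powr (d * of_int k) * L) powr (p - 1) * (S * 2 powr ((d + 2) * of_int k))
              = (L powr (p - 1) * S) * 2 powr (d * of_int k * (p - 1) + (d + 2) * of_int k)"
            using L0 by (simp add: powr_mult powr_powr powr_add mult_ac)
          also have "d * of_int k * (p - 1) + (d + 2) * of_int k = (d * p + 2) * of_int k" by (simp add: algebra_simps)
          also have "((L powr (p - 1) * S) * 2 powr ((d * p + 2) * of_int k)) powr (1 / p)
              = Q * 2 powr ((d * p + 2) * of_int k / p)"
            unfolding Q_def using S(1) by (simp add: powr_mult powr_powr)
          also have "(d * p + 2) * real_of_int k / p = (d + 2 / p) * of_int k"
            using p_pos by (simp add: field_simps)
          finally show ?thesis .
        qed
        also have "Q * 2 powr ((d + 2 / p) * of_int k) * b \<le> Q * (2 powr (2 * \<bar>d + 2 / p\<bar>) * 2 powr ((d + 2 / p) * of_int j)) * b"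
          by (intro mult_right_mono mult_left_mono two_powr_near[OF k] Q0 b0)
        finally show "cmod (sconv (ker m k) (conv (ker one_symbol j) u) x) \<le> Q * (2 powr (2 * \<bar>d + 2 / p\<bar>) * 2 powr ((d + 2 / p) * of_int j)) * b" .
      qed
      then show "cmod (conv (ker m j) u x) \<le> C2 * 2 powr ((d + 2 / p) * of_int j) * b"
        unfolding C2_def by (simp add: mult_ac)
    qed
  qed
  have "Lp_le p (conv (ker m j) u) ((C1 + C2) * 2 powr (d * of_int j) * b) \<and>
    (\<forall>x. cmod (conv (ker m j) u x) \<le> (C1 + C2) * 2 powr ((d + 2 / p) * of_int j) * b)"
    if u: "tempered u" and b: "Lp_le p (conv (ker one_symbol j) u) b" for u b j
  proof (intro conjI allI)
    note b0 = Lp_leD(2)[OF b]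
    show "Lp_le p (conv (ker m j) u) ((C1 + C2) * 2 powr (d * of_int j) * b)"
      by (rule Lp_le_mono[OF p1 conjunct1[OF well_posedness[OF u b]]]) (intro mult_right_mono, use C0 b0 in auto)
    show "cmod (conv (ker m j) u x) \<le> (C1 + C2) * 2 powr ((d + 2 / p) * of_int j) * b" for x
      by (rule order_trans[OF spec[OF conjunct2[OF well_posedness[OF u b]]]]) (intro mult_right_mono, use C0 b0 in auto)
  qed
  then show ?thesis using C0 by (intro exI[of _ "C1 + C2"]) auto
qed

text \<open>A constant for the preceding lemma, to be used uniformly in \<open>u\<close> and \<open>j\<close>.\<close>

definition block_const :: "(plane \<Rightarrow> complex) \<Rightarrow> real \<Rightarrow> real" where
  "block_const m d = (SOME C. C \<ge> 0 \<and> (\<forall>u b j. tempered u \<longrightarrow> Lp_le p (conv (ker one_symbol j) u) b \<longrightarrow>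
    Lp_le p (conv (ker m j) u) (C * 2 powr (d * of_int j) * b) \<and>
    (\<forall>x. cmod (conv (ker m j) u x) \<le> C * 2 powr ((d + 2 / p) * of_int j) * b)))"

lemma block_const:
  assumes "admissible m" "homogeneous d m"
  shows "block_const m d \<ge> 0"
    and "tempered u \<Longrightarrow> Lp_le p (conv (ker one_symbol j) u) b \<Longrightarrow> Lp_le p (conv (ker m j) u) (block_const m d * 2 powr (d * of_int j) * b)"
    and "tempered u \<Longrightarrow> Lp_le p (conv (ker one_symbol j) u) b \<Longrightarrow> cmod (conv (ker m j) u x) \<le> block_const m d * 2 powr ((d + 2 / p) * of_int j) * b"
proof -
  from block_estimates[OF assms] have *: "block_const m d \<ge> 0 \<and> (\<forall>u b j. tempered u \<longrightarrow> Lp_le p (conv (ker one_symbol j) u) b \<longrightarrow>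
    Lp_le p (conv (ker m j) u) (block_const m d * 2 powr (d * of_int j) * b) \<and>
    (\<forall>x. cmod (conv (ker m j) u x) \<le> block_const m d * 2 powr ((d + 2 / p) * of_int j) * b))"
    unfolding block_const_def by (rule someI_ex)
  show "block_const m d \<ge> 0" using * by blast
  show "tempered u \<Longrightarrow> Lp_le p (conv (ker one_symbol j) u) b \<Longrightarrow> Lp_le p (conv (ker m j) u) (block_const m d * 2 powr (d * of_int j) * b)" using * by blast
  show "tempered u \<Longrightarrow> Lp_le p (conv (ker one_symbol j) u) b \<Longrightarrow> cmod (conv (ker m j) u x) \<le> block_const m d * 2 powr ((d + 2 / p) * of_int j) * b" using * by blast
qed

text \<open>The sequence \<open>\<beta>\<close> dominates the weighted block norms of \<open>u\<close>, so that its sum bounds the Besov norm. The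
  convergence of the series of blocks to \<open>u\<close> is not included: it is lost under multiplication and
  regained after applying a multiplier.\<close>

definition besov_le :: "real \<Rightarrow> distr \<Rightarrow> (int \<Rightarrow> real) \<Rightarrow> bool" where
  "besov_le \<sigma> u \<beta> \<longleftrightarrow> tempered u \<and> (\<forall>j. Lp_le p (conv (ker one_symbol j) u) (2 powr (- \<sigma> * of_int j) * \<beta> j)) \<and>
     (\<forall>j. \<beta> j \<ge> 0) \<and> \<beta> summable_on UNIV"

lemma besov_leD:
  assumes "besov_le \<sigma> u \<beta>"
  shows "tempered u" "Lp_le p (conv (ker one_symbol j) u) (2 powr (- \<sigma> * of_int j) * \<beta> j)" "\<beta> j \<ge> 0" "\<beta> summable_on UNIV"
  using assms unfolding besov_le_def by auto

lemma besov_imp_besov_le: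
  assumes "u \<in> besov \<phi> p \<sigma>"
  shows "besov_le \<sigma> u (\<lambda>j. 2 powr (\<sigma> * of_int j) * Lp_norm p (conv (lp_block \<phi> j) u))"
  unfolding besov_le_def
proof (intro conjI allI)
  show "tempered u" using assms unfolding besov_def by blast
  show "(\<lambda>j::int. 2 powr (\<sigma> * of_int j) * Lp_norm p (conv (lp_block \<phi> j) u)) summable_on UNIV"
    using assms unfolding besov_def by blast
  fix j :: int
  show "0 \<le> 2 powr (\<sigma> * of_int j) * Lp_norm p (conv (lp_block \<phi> j) u)" by (simp add: Lp_norm_nonneg)
  have "in_Lp p (conv (lp_block \<phi> j) u)" using assms unfolding besov_def by blast
  from in_Lp_imp_Lp_le[OF p1 this]
  show "Lp_le p (conv (ker one_symbol j) u) (2 powr (- \<sigma> * of_int j) * (2 powr (\<sigma> * of_int j) * Lp_norm p (conv (lp_block \<phi> j) u)))"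
    by (simp add: lp_block_eq_ker mult.assoc[symmetric] powr_add[symmetric])
qed

text \<open>The multiplier with symbol \<open>m\<close> applied to \<open>u\<close>, as a function. It is used when the degree of \<open>m\<close> lowers
  the regularity \<open>\<sigma>\<close> of \<open>u\<close> to \<open>2/p\<close>, in which case the series of blocks converges uniformly.\<close>

definition multiplier :: "(plane \<Rightarrow> complex) \<Rightarrow> distr \<Rightarrow> plane \<Rightarrow> complex" where
  "multiplier m u x = (\<Sum>\<^sub>\<infinity>j. conv (ker m j) u x)"

context
  fixes m d \<sigma> u \<beta>
  assumes m: "admissible m" and d: "homogeneous d m" and sd: "\<sigma> = d + 2 / p" and u: "besov_le \<sigma> u \<beta>"
begin

lemma multiplier_block_sup: "cmod (conv (ker m j) u x) \<le> block_const m d * \<beta> j"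
proof -
  have "cmod (conv (ker m j) u x) \<le> block_const m d * 2 powr ((d + 2 / p) * of_int j) * (2 powr (- \<sigma> * of_int j) * \<beta> j)"
    by (rule block_const(3)[OF m d besov_leD(1,2)[OF u]])
  also have "\<dots> = block_const m d * (2 powr (\<sigma> * of_int j) * 2 powr (- \<sigma> * of_int j)) * \<beta> j" unfolding sd by simp
  also have "2 powr (\<sigma> * of_int j) * 2 powr (- \<sigma> * real_of_int j) = 1" by (simp add: powr_add[symmetric])
  finally show ?thesis by simp
qed

lemma multiplier_block_Lp: "Lp_le p (conv (ker m j) u) (2 powr (- (2 / p) * of_int j) * (block_const m d * \<beta> j))"
proof -
  have "Lp_le p (conv (ker m j) u) (block_const m d * 2 powr (d * of_int j) * (2 powr (- \<sigma> * of_int j) * \<beta> j))"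
    by (rule block_const(2)[OF m d besov_leD(1,2)[OF u]])
  moreover have "2 powr (d * of_int j) * 2 powr (- \<sigma> * real_of_int j) = 2 powr (- (2 / p) * of_int j)"
    unfolding sd by (simp add: powr_add[symmetric] algebra_simps)
  ultimately show ?thesis by (simp add: mult_ac)
qed

lemma multiplier_summable: "(\<lambda>j. block_const m d * \<beta> j) summable_on UNIV"
  by (intro summable_on_cmult_right besov_leD(4)[OF u])

lemma multiplier_has_sum: "((\<lambda>j. conv (ker m j) u x) has_sum multiplier m u x) UNIV"
  unfolding multiplier_def by (rule has_sum_infsum) (rule summable_on_le(1)[OF multiplier_block_sup multiplier_summable])

lemma multiplier_sup: "cmod (multiplier m u x) \<le> block_const m d * infsum \<beta> UNIV"
  using summable_on_le(2)[OF multiplier_block_sup[of _ x] multiplier_summable]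
  unfolding multiplier_def by (simp add: infsum_cmult_right[OF besov_leD(4)[OF u]])

lemma block_measurable: "conv (ker m j) u \<in> borel_measurable borel"
  by (intro conv_measurable besov_leD(1)[OF u] schwartz_ker m)

lemma bdd_meas_block: "bdd_meas (conv (ker m j) u)"
  by (rule bdd_measI[OF block_measurable multiplier_block_sup])

lemma bdd_meas_multiplier: "bdd_meas (multiplier m u)"
  by (rule bdd_measI[OF has_sum_measurable[OF block_measurable multiplier_has_sum] multiplier_sup])

text \<open>The sum may be taken out of the convolution by uniform convergence; then only the blocks near \<open>l\<close>
  contribute.\<close>

lemma conv_multiplier:
  assumes n: "admissible n"
  shows "conv (ker n l) (distr_of (multiplier m u)) x = conv (ker (\<lambda>\<xi>. n \<xi> * m \<xi>) l) u x"
proof -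
  have "((\<lambda>j. \<integral>y. ker n l (x - y) * conv (ker m j) u y \<partial>lborel) has_sum (\<integral>y. ker n l (x - y) * multiplier m u y \<partial>lborel)) UNIV"
    by (rule has_sum_integral[OF block_measurable multiplier_block_sup multiplier_summable multiplier_has_sum])
       (intro integrable_reflect schwartz_integrable schwartz_ker n)
  then have "((\<lambda>j. sconv (ker n l) (conv (ker m j) u) x) has_sum conv (ker n l) (distr_of (multiplier m u)) x) UNIV"
    unfolding conv_distr_of[OF schwartz_ker[OF n]] sconv_def .
  then show ?thesis
    using ker_conv_has_sum(2)[OF besov_leD(1)[OF u] n m] has_sum_unique by blast
qed

lemma pairing_multiplier:
  assumes g: "schwartz g"
  shows "((\<lambda>j. pairing (conv (ker m j) u) g) has_sum pairing (multiplier m u) g) UNIV"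
  using has_sum_integral[OF block_measurable multiplier_block_sup multiplier_summable multiplier_has_sum schwartz_integrable[OF g]]
  unfolding pairing_def by (simp add: mult.commute)

lemma besov_le_multiplier: "besov_le (2 / p) (distr_of (multiplier m u)) (\<lambda>j. block_const m d * \<beta> j)"
  unfolding besov_le_def
proof (intro conjI allI)
  show "tempered (distr_of (multiplier m u))" by (rule tempered_distr_of[OF bdd_meas_multiplier])
  have "conv (ker one_symbol j) (distr_of (multiplier m u)) = conv (ker m j) u" for j
    by (rule ext) (simp add: conv_multiplier[OF admissible_const])
  then show "Lp_le p (conv (ker one_symbol j) (distr_of (multiplier m u))) (2 powr (- (2 / p) * of_int j) * (block_const m d * \<beta> j))" for j
    using multiplier_block_Lp by simp
  show "0 \<le> block_const m d * \<beta> j" for j using block_const(1)[OF m d] besov_leD(3)[OF u] by simp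
qed (rule multiplier_summable)

lemma multiplier_one_symbol_multiplier: "multiplier one_symbol (distr_of (multiplier m u)) = multiplier m u"
proof
  fix x
  have "multiplier one_symbol (distr_of (multiplier m u)) x = (\<Sum>\<^sub>\<infinity>j. conv (ker m j) u x)"
    unfolding multiplier_def[of one_symbol] conv_multiplier[OF admissible_const] mult_1 ..
  then show "multiplier one_symbol (distr_of (multiplier m u)) x = multiplier m u x" unfolding multiplier_def[of m] .
qed

end

end

text \<open>The sum does not depend on \<open>M\<close>: this is where positivity of the regularity \<open>2/p\<close> enters the product
  estimate.\<close>

lemma geometric_count:
  fixes s :: real
  assumes s: "s > 0"
  obtains G where "G \<ge> 0"
    "\<And>M::int. (\<integral>\<^sup>+l. ennreal (if l \<le> M + 5 then 2 powr (s * (of_int l - of_int M)) else 0) \<partial>count_space UNIV) \<le> ennreal G"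
proof -
  define c where "c = 2 powr (- s)"
  have c: "0 \<le> c" "c < 1" using s powr_less_mono[of "- s" 0 2] by (auto simp: c_def)
  define G where "G = 2 powr (5 * s) * (1 / (1 - c))"
  have G: "(\<lambda>n. 2 powr (5 * s) * c ^ n) sums G"
    unfolding G_def by (intro sums_mult geometric_sums) (use c in auto)
  have "(\<integral>\<^sup>+l. ennreal (if l \<le> M + 5 then 2 powr (s * (of_int l - of_int M)) else 0) \<partial>count_space UNIV) = ennreal G" for M :: int
  proof -
    have bij: "bij_betw (\<lambda>n::nat. M + 5 - int n) UNIV {..M + 5}"
      by (rule bij_betwI[where g="\<lambda>l. nat (M + 5 - l)"]) auto
    have "(\<integral>\<^sup>+l. ennreal (if l \<le> M + 5 then 2 powr (s * (of_int l - of_int M)) else 0) \<partial>count_space UNIV)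
        = (\<integral>\<^sup>+l. ennreal (if l \<le> M + 5 then 2 powr (s * (of_int l - of_int M)) else 0) \<partial>count_space {..M + 5})"
      by (rule nn_integral_count_space_eq) auto
    also have "\<dots> = (\<integral>\<^sup>+n. ennreal (if M + 5 - int n \<le> M + 5 then 2 powr (s * (of_int (M + 5 - int n) - of_int M)) else 0) \<partial>count_space (UNIV::nat set))"
      by (rule nn_integral_bij_count_space[OF bij, symmetric])
    also have "\<dots> = (\<integral>\<^sup>+n. ennreal (2 powr (5 * s) * c ^ n) \<partial>count_space UNIV)"
    proof (intro nn_integral_cong arg_cong[where f=ennreal])
      fix n :: nat
      have "c ^ n = 2 powr (- s * real n)"
        unfolding c_def by (subst powr_realpow[symmetric]) (simp_all add: powr_powr)
      then show "(if M + 5 - int n \<le> M + 5 then 2 powr (s * (of_int (M + 5 - int n) - of_int M)) else 0) = 2 powr (5 * s) * c ^ n"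
        by (simp add: powr_add[symmetric] algebra_simps)
    qed
    also have "\<dots> = (\<Sum>n. ennreal (2 powr (5 * s) * c ^ n))" by (rule nn_integral_count_space_nat)
    also have "\<dots> = ennreal G" by (rule suminf_ennreal_eq[OF _ G]) (use c in auto)
    finally show ?thesis .
  qed
  moreover have "G \<ge> 0" unfolding G_def using c by simp
  ultimately show ?thesis using that[of G] by simp
qed

lemma nn_count_product:
  fixes \<beta> :: "'i \<Rightarrow> real" and \<beta>' :: "'k \<Rightarrow> real"
  assumes "\<And>i. \<beta> i \<ge> 0" "\<beta> summable_on UNIV" "\<And>i. \<beta>' i \<ge> 0" "\<beta>' summable_on UNIV"
  shows "(\<integral>\<^sup>+z. ennreal (\<beta> (fst z) * \<beta>' (snd z)) \<partial>count_space UNIV) = ennreal (infsum \<beta> UNIV * infsum \<beta>' UNIV)"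
proof -
  have "(\<integral>\<^sup>+z. ennreal (\<beta> (fst z) * \<beta>' (snd z)) \<partial>count_space UNIV)
      = (\<integral>\<^sup>+i. (\<integral>\<^sup>+k. ennreal (\<beta> (fst (i, k)) * \<beta>' (snd (i, k))) \<partial>count_space UNIV) \<partial>count_space UNIV)"
    by (rule nn_integral_fst_count_space[symmetric])
  also have "\<dots> = (\<integral>\<^sup>+i. ennreal (\<beta> i) * ennreal (infsum \<beta>' UNIV) \<partial>count_space UNIV)"
    by (intro nn_integral_cong) (simp add: ennreal_mult assms nn_integral_cmult nn_count_infsum[OF assms(3,4)])
  also have "\<dots> = (\<integral>\<^sup>+i. ennreal (\<beta> i) \<partial>count_space UNIV) * ennreal (infsum \<beta>' UNIV)"
    by (rule nn_integral_multc) simp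
  finally show ?thesis
    unfolding nn_count_infsum[OF assms(1,2)] using assms by (simp add: ennreal_mult infsum_nonneg)
qed

lemma schwartz_seminorm_mono:
  assumes "schwartz g" "N \<le> M"
  shows "schwartz_seminorm N g \<le> schwartz_seminorm M g"
proof (rule schwartz_seminorm_least)
  fix ks :: "2 list" and x :: plane assume ks: "length ks \<le> N"
  have "(1 + norm x) ^ N * cmod (fold pd ks g x) \<le> (1 + norm x) ^ M * cmod (fold pd ks g x)"
    by (intro mult_right_mono power_increasing assms) auto
  also have "\<dots> \<le> schwartz_seminorm M g"
    by (rule schwartz_seminorm_upper) (use assms ks in auto)
  finally show "(1 + norm x) ^ N * cmod (fold pd ks g x) \<le> schwartz_seminorm M g" .
qed

lemma schwartz_seminorm_nonneg: "schwartz g \<Longrightarrow> schwartz_seminorm N g \<ge> 0"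
  using schwartz_seminorm_upper[of g "[]" N 0] order_trans[OF norm_ge_zero] by simp

lemma tempered_minus:
  assumes u: "tempered u" and v: "tempered v"
  shows "tempered (u - v)"
proof -
  obtain C N where C: "\<And>g. schwartz g \<Longrightarrow> cmod (u g) \<le> C * schwartz_seminorm N g"
    using u unfolding tempered_def by blast
  obtain D M where D: "\<And>g. schwartz g \<Longrightarrow> cmod (v g) \<le> D * schwartz_seminorm M g"
    using v unfolding tempered_def by blast
  have "cmod ((u - v) g) \<le> (\<bar>C\<bar> + \<bar>D\<bar>) * schwartz_seminorm (max N M) g" if g: "schwartz g" for g
  proof -
    have "C * schwartz_seminorm N g \<le> \<bar>C\<bar> * schwartz_seminorm (max N M) g"
      by (intro mult_mono schwartz_seminorm_mono schwartz_seminorm_nonneg g) auto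
    moreover have "D * schwartz_seminorm M g \<le> \<bar>D\<bar> * schwartz_seminorm (max N M) g"
      by (intro mult_mono schwartz_seminorm_mono schwartz_seminorm_nonneg g) auto
    moreover have "cmod ((u - v) g) \<le> cmod (u g) + cmod (v g)" by (simp add: norm_triangle_ineq4)
    ultimately show ?thesis using C[OF g] D[OF g] by (simp add: distrib_right)
  qed
  then have "\<exists>C N. \<forall>g. schwartz g \<longrightarrow> cmod ((u - v) g) \<le> C * schwartz_seminorm N g" by blast
  then show ?thesis
    using u v unfolding tempered_def by (auto simp: right_diff_distrib)
qed

lemma conv_minus: "conv h (u - v) x = conv h u x - conv h v x"
  unfolding conv_def by simp

lemma conv_pairing_integrable:
  assumes u: "tempered u" and h: "schwartz h" and g: "schwartz g"
  shows "integrable lborel (\<lambda>x. conv h u x * g x)"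
proof -
  obtain C N where C: "C \<ge> 0" "\<And>y. cmod (conv h u y) \<le> C * (1 + norm y) ^ N"
    using conv_growth[OF u h] by blast
  note [measurable] = conv_measurable[OF u h] schwartz_measurable[OF g]
  show ?thesis
  proof (rule Bochner_Integration.integrable_bound[OF integrable_mult_right[OF schwartz_poly_integrable[OF g, of N], of C]])
    show "AE x in lborel. norm (conv h u x * g x) \<le> norm (C * ((1 + norm x) ^ N * cmod (g x)))"
    proof (rule AE_I2)
      fix x
      have "cmod (conv h u x) * cmod (g x) \<le> C * (1 + norm x) ^ N * cmod (g x)"
        by (intro mult_right_mono C(2)) simp
      also have "\<dots> \<le> norm (C * ((1 + norm x) ^ N * cmod (g x)))" by (simp only: real_norm_def mult.assoc abs_ge_self)
      finally show "norm (conv h u x * g x) \<le> norm (C * ((1 + norm x) ^ N * cmod (g x)))" by (simp only: norm_mult)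
    qed
  qed measurable
qed

context besov_setting
begin

section \<open>The product estimate\<close>

lemma block_product_far:
  assumes u: "tempered u" and v: "tempered v" and a: "admissible a" and b: "admissible b" and c: "admissible c"
    and bu: "bdd_meas (conv (ker a i) u)" and bv: "bdd_meas (conv (ker b k) v)"
    and l: "l \<ge> max i k + 6"
  shows "sconv (ker c l) (\<lambda>y. conv (ker a i) u y * conv (ker b k) v y) x = 0"
proof -
  let ?u = "conv (ker a i) u" and ?v = "conv (ker b k) v"
  have eu: "?u y = (\<Sum>i'\<in>near i. sconv (ker one_symbol i') ?u y)" for y
    using ker_conv_sum(1)[OF u admissible_const[of 1] a, of i y] by simp
  have ev: "?v y = (\<Sum>k'\<in>near k. sconv (ker one_symbol k') ?v y)" for y
    using ker_conv_sum(1)[OF v admissible_const[of 1] b, of k y] by simp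
  have sU: "schwartz (ker one_symbol i)" for i by (intro schwartz_ker admissible_const)
  have sc: "schwartz (ker c l)" by (rule schwartz_ker[OF c])
  have z: "sconv (ker c l) (\<lambda>y. sconv (ker one_symbol i') ?u y * sconv (ker one_symbol k') ?v y) x = 0"
    if i': "i' \<in> near i" and k': "k' \<in> near k" for i' k'
  proof (rule product_band_0[OF sc sU sU bu bv])
    fix \<xi> \<eta> assume "fourier (ker one_symbol i') \<xi> \<noteq> 0" "fourier (ker one_symbol k') \<eta> \<noteq> 0"
    then have "hat i' \<xi> \<noteq> 0" "hat k' \<eta> \<noteq> 0" by (simp_all add: fourier_ker[OF admissible_const])
    then have n: "norm \<xi> \<le> 2 powr (of_int i' + 1)" "norm \<eta> \<le> 2 powr (of_int k' + 1)" by (auto dest: hat_support(2))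
    have le: "real_of_int i' + 1 \<le> of_int l - 3" "real_of_int k' + 1 \<le> of_int l - 3"
      using i' k' l by (simp_all add: max_def split: if_splits)
    have n': "norm \<xi> \<le> 2 powr (of_int l - 3)" "norm \<eta> \<le> 2 powr (of_int l - 3)"
      by (rule order_trans[OF n(1) powr_mono[OF le(1)]], simp) (rule order_trans[OF n(2) powr_mono[OF le(2)]], simp)
    have "norm (\<xi> + \<eta>) \<le> 2 powr (of_int l - 3) + 2 powr (of_int l - 3)"
      using norm_triangle_ineq[of \<xi> \<eta>] n' by linarith
    also have "\<dots> < 2 powr (of_int l - 1)" by (simp add: powr_diff)
    finally have "hat l (\<xi> + \<eta>) = 0" using hat_support(1)[of l "\<xi> + \<eta>"] by fastforce
    then show "fourier (ker c l) (\<xi> + \<eta>) = 0" by (simp add: fourier_ker[OF c])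
  qed
  have "sconv (ker c l) (\<lambda>y. ?u y * ?v y) x
     = sconv (ker c l) (\<lambda>y. (\<Sum>i'\<in>near i. sconv (ker one_symbol i') ?u y) * (\<Sum>k'\<in>near k. sconv (ker one_symbol k') ?v y)) x"
    using eu ev by simp
  also have "\<dots> = (\<Sum>i'\<in>near i. \<Sum>k'\<in>near k. sconv (ker c l) (\<lambda>y. sconv (ker one_symbol i') ?u y * sconv (ker one_symbol k') ?v y) x)"
  proof -
    have int: "integrable lborel (\<lambda>y. ker c l (x - y) * (sconv (ker one_symbol i') ?u y * sconv (ker one_symbol k') ?v y))" for i' k'
      by (intro bdd_meas_integrable bdd_meas_mult bdd_meas_sconv integrable_reflect schwartz_integrable sc sU bu bv)
    let ?f = "\<lambda>i' k' y. ker c l (x - y) * (sconv (ker one_symbol i') ?u y * sconv (ker one_symbol k') ?v y)"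
    have "sconv (ker c l) (\<lambda>y. (\<Sum>i'\<in>near i. sconv (ker one_symbol i') ?u y) * (\<Sum>k'\<in>near k. sconv (ker one_symbol k') ?v y)) x
        = (\<integral>y. (\<Sum>i'\<in>near i. \<Sum>k'\<in>near k. ?f i' k' y) \<partial>lborel)"
      unfolding sconv_def[of "ker c l"] unfolding sum_product by (simp only: sum_distrib_left)
    also have "\<dots> = (\<Sum>i'\<in>near i. (\<integral>y. (\<Sum>k'\<in>near k. ?f i' k' y) \<partial>lborel))"
      by (rule Bochner_Integration.integral_sum) (intro Bochner_Integration.integrable_sum int)
    also have "\<dots> = (\<Sum>i'\<in>near i. \<Sum>k'\<in>near k. (\<integral>y. ?f i' k' y \<partial>lborel))"
      by (intro sum.cong refl Bochner_Integration.integral_sum int)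
    finally show ?thesis unfolding sconv_def[of "ker c l"] .
  qed
  also have "\<dots> = 0" using z by simp
  finally show ?thesis .
qed

text \<open>The product of the blocks at \<open>i\<close> and \<open>k\<close> is bounded in \<open>L\<^sup>p\<close> by \<open>2\<^bsup>-sM\<^esup> \<beta>\<^sub>i \<gamma>\<^sub>k\<close> with \<open>M = max i k\<close> and \<open>s = 2/p\<close>: the
  factor of higher frequency is measured in \<open>L\<^sup>p\<close>, the other one in \<open>L\<^sup>\<infinity>\<close>. Its frequencies do not exceed
  a multiple of \<open>2\<^sup>M\<close>, so only the blocks \<open>l \<le> M + 5\<close> see it, and the sum of \<open>2\<^bsup>sl\<^esup>\<close> over these \<open>l\<close> is of
  order \<open>2\<^bsup>sM\<^esup>\<close>. Summation over \<open>i\<close> and \<open>k\<close> gives the product of the sums of \<open>\<beta>\<close> and \<open>\<gamma>\<close>.\<close>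

lemma product_estimate:
  assumes a: "admissible a" and ha: "homogeneous 0 a"
  shows "\<exists>C\<ge>0. \<forall>u v \<beta> \<gamma>. besov_le (2 / p) u \<beta> \<longrightarrow> besov_le (2 / p) v \<gamma> \<longrightarrow>
    (\<exists>\<kappa>. besov_le (2 / p) (distr_of (\<lambda>x. multiplier a u x * multiplier one_symbol v x)) \<kappa> \<and> infsum \<kappa> UNIV \<le> C * infsum \<beta> UNIV * infsum \<gamma> UNIV)"
proof -
  define s where "s = 2 / p"
  have s: "s > 0" unfolding s_def using p_pos by simp
  obtain G where G: "G \<ge> 0"
    "\<And>M::int. (\<integral>\<^sup>+l. ennreal (if l \<le> M + 5 then 2 powr (s * (of_int l - of_int M)) else 0) \<partial>count_space UNIV) \<le> ennreal G"
    using geometric_count[OF s] by blast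
  define L where "L = L1 (ker one_symbol 0)"
  have L0: "L \<ge> 0" unfolding L_def by (rule L1_nonneg)
  define A where "A = block_const a 0"
  define B where "B = block_const one_symbol 0"
  have hu: "homogeneous 0 one_symbol" by (rule homogeneous_const)
  have au: "admissible one_symbol" by (rule admissible_const)
  have AB: "A \<ge> 0" "B \<ge> 0" unfolding A_def B_def using block_const(1) a ha au hu by auto
  have sd: "2 / p = 0 + 2 / p" by simp
  define Q where "Q = L * A * B"
  have Q0: "Q \<ge> 0" unfolding Q_def using L0 AB by simp
  have "\<exists>\<kappa>. besov_le (2 / p) (distr_of (\<lambda>x. multiplier a u x * multiplier one_symbol v x)) \<kappa> \<and> infsum \<kappa> UNIV \<le> (G * Q) * infsum \<beta> UNIV * infsum \<gamma> UNIV"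
    if u: "besov_le (2 / p) u \<beta>" and v: "besov_le (2 / p) v \<gamma>" for u v \<beta> \<gamma>
  proof -
    note tu = besov_leD(1)[OF u] and tv = besov_leD(1)[OF v]
    note bU = multiplier_block_sup[OF a ha sd u, folded A_def] and bV = multiplier_block_sup[OF au hu sd v, folded B_def]
    note LU = multiplier_block_Lp[OF a ha sd u, folded A_def s_def] and LV = multiplier_block_Lp[OF au hu sd v, folded B_def s_def]
    note bu = bdd_meas_block[OF a ha sd u] and bv = bdd_meas_block[OF au hu sd v]
    note b0 = besov_leD(3)[OF u] besov_leD(3)[OF v]
    let ?U = "\<lambda>i. conv (ker a i) u" and ?V = "\<lambda>k. conv (ker one_symbol k) v"
    define P where "P z x = ?U (fst z) x * ?V (snd z) x" for z x
    define F where "F x = multiplier a u x * multiplier one_symbol v x" for x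
    have bF: "bdd_meas F" unfolding F_def by (intro bdd_meas_mult bdd_meas_multiplier[OF a ha sd u] bdd_meas_multiplier[OF au hu sd v])
    let ?c = "\<lambda>z. (A * \<beta> (fst z)) * (B * \<gamma> (snd z))"
    have Pm: "P z \<in> borel_measurable borel" for z
      unfolding P_def using bdd_measD(1)[OF bu] bdd_measD(1)[OF bv] by measurable
    have Pc: "cmod (P z x) \<le> ?c z" for z x
      unfolding P_def norm_mult using AB b0 by (intro mult_mono bU bV) auto
    have cs: "?c summable_on UNIV"
    proof (rule nn_count_le_imp_summable(1))
      show "(\<integral>\<^sup>+z. ennreal (?c z) \<partial>count_space UNIV) \<le> ennreal (infsum (\<lambda>i. A * \<beta> i) UNIV * infsum (\<lambda>k. B * \<gamma> k) UNIV)"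
        using nn_count_product[of "\<lambda>i. A * \<beta> i" "\<lambda>k. B * \<gamma> k"] AB b0
          multiplier_summable[OF a ha sd u, folded A_def] multiplier_summable[OF au hu sd v, folded B_def] by simp
    qed (use AB b0 in \<open>auto intro!: mult_nonneg_nonneg infsum_nonneg\<close>)
    have PF: "((\<lambda>z. P z x) has_sum F x) UNIV" for x
    proof -
      have sum: "(\<lambda>z. P z x) summable_on UNIV" by (rule summable_on_le(1)[OF Pc cs])
      have inner: "infsum (\<lambda>k. P (i, k) x) UNIV = ?U i x * multiplier one_symbol v x" for i
        unfolding P_def using infsumI[OF has_sum_cmult_right[OF multiplier_has_sum[OF au hu sd v]], of "?U i x" x] by simp
      have "infsum (\<lambda>z. P z x) UNIV = infsum (\<lambda>i. infsum (\<lambda>k. P (i, k) x) UNIV) UNIV"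
        using infsum_Sigma_banach[of "\<lambda>z. P z x" UNIV "\<lambda>_. UNIV"] sum by simp
      also have "\<dots> = F x"
        unfolding inner unfolding F_def using infsumI[OF has_sum_cmult_left[OF multiplier_has_sum[OF a ha sd u]], of x "multiplier one_symbol v x"] by simp
      finally show ?thesis using has_sum_infsum[OF sum] by simp
    qed
    let ?M = "\<lambda>z::int \<times> int. max (fst z) (snd z)"
    define cc where "cc l z = (if l \<le> ?M z + 5 then Q * (2 powr (- s * of_int (?M z)) * (\<beta> (fst z) * \<gamma> (snd z))) else 0)" for l :: int and z
    have cc0: "cc l z \<ge> 0" for l z unfolding cc_def using Q0 b0 by simp
    have LP: "Lp_le p (P z) (A * B * (2 powr (- s * of_int (?M z)) * (\<beta> (fst z) * \<gamma> (snd z))))" for z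
    proof (cases "fst z \<le> snd z")
      case True
      then have "?M z = snd z" by simp
      moreover have "Lp_le p (\<lambda>x. ?U (fst z) x * ?V (snd z) x) ((A * \<beta> (fst z)) * (2 powr (- s * of_int (snd z)) * (B * \<gamma> (snd z))))"
        by (rule Lp_le_bounded_mult[OF p1 LV bdd_measD(1)[OF bu] bU])
      ultimately show ?thesis unfolding P_def[abs_def] by (simp only: mult_ac)
    next
      case False
      then have "?M z = fst z" by simp
      moreover have "Lp_le p (\<lambda>x. ?V (snd z) x * ?U (fst z) x) ((B * \<gamma> (snd z)) * (2 powr (- s * of_int (fst z)) * (A * \<beta> (fst z))))"
        by (rule Lp_le_bounded_mult[OF p1 LU bdd_measD(1)[OF bv] bV])
      ultimately show ?thesis unfolding P_def[abs_def] by (simp only: mult_ac)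
    qed
    have iK: "integrable lborel (ker one_symbol l)" for l by (intro schwartz_integrable schwartz_ker au)
    have LK: "(\<integral>x. cmod (ker one_symbol l x) \<partial>lborel) = L" for l
      using ker_L1[OF au hu, of l] unfolding L_def L1_def by simp
    have Lcc: "Lp_le p (sconv (ker one_symbol l) (P z)) (cc l z)" for l z
    proof (cases "l \<le> ?M z + 5")
      case True
      then show ?thesis using Lp_le_sconv[OF p1 iK LP[of z], of l] unfolding LK cc_def Q_def by (simp add: mult_ac)
    next
      case False
      then have "l \<ge> ?M z + 6" by simp
      then have "sconv (ker one_symbol l) (P z) x = 0" for x
        unfolding P_def[abs_def] by (intro block_product_far tu tv a au bu bv)
      then have "sconv (ker one_symbol l) (P z) = (\<lambda>x. 0)" by (rule ext)
      then show ?thesis using False Lp_le_0[OF p1] by (simp add: cc_def)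
    qed
    have cc_sum: "cc l summable_on UNIV" for l
    proof -
      have "cc l z \<le> Q * 2 powr (s * (5 - of_int l)) * (\<beta> (fst z) * \<gamma> (snd z))" for z
      proof (cases "l \<le> ?M z + 5")
        case True
        then have "- s * of_int (?M z) \<le> s * (5 - of_int l)"
          using s mult_left_mono[of "- of_int (?M z)" "5 - of_int l" s] by simp
        then have "2 powr (- s * of_int (?M z)) \<le> 2 powr (s * (5 - of_int l))" by (intro powr_mono) auto
        then show ?thesis using True Q0 b0 by (simp add: cc_def mult.assoc) (intro mult_left_mono mult_right_mono, auto)
      qed (use Q0 b0 in \<open>simp add: cc_def\<close>)
      then have le: "norm (cc l z) \<le> Q * 2 powr (s * (5 - of_int l)) * (\<beta> (fst z) * \<gamma> (snd z))" for z
        using cc0 by simp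
      have "(\<lambda>z. \<beta> (fst z) * \<gamma> (snd z)) summable_on UNIV"
        by (rule nn_count_le_imp_summable(1)[OF _ eq_refl[OF nn_count_product]])
           (use b0 besov_leD(4)[OF u] besov_leD(4)[OF v] in \<open>auto intro!: mult_nonneg_nonneg infsum_nonneg\<close>)
      then show ?thesis by (intro summable_on_le(1)[OF le] summable_on_cmult_right)
    qed
    \<comment> \<open>The block of the product is the sum of the blocks of the products of blocks.\<close>
    have conv_sum: "((\<lambda>z. sconv (ker one_symbol l) (P z) x) has_sum conv (ker one_symbol l) (distr_of F) x) UNIV" for l x
      unfolding conv_distr_of[OF schwartz_ker[OF au]] sconv_def
      by (rule has_sum_integral[OF Pm Pc cs PF]) (intro integrable_reflect iK)
    define \<kappa> where "\<kappa> l = 2 powr (s * of_int l) * infsum (cc l) UNIV" for l :: int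
    have \<kappa>0: "\<kappa> l \<ge> 0" for l unfolding \<kappa>_def by (simp add: infsum_nonneg cc0)
    have L\<kappa>: "Lp_le p (conv (ker one_symbol l) (distr_of F)) (2 powr (- (2 / p) * of_int l) * \<kappa> l)" for l
    proof -
      have "2 powr (- (2 / p) * of_int l) * \<kappa> l = infsum (cc l) UNIV"
        unfolding \<kappa>_def s_def by (simp add: mult.assoc[symmetric] powr_add[symmetric])
      then show ?thesis using Lp_le_has_sum[OF p1 Lcc cc_sum conv_sum, of l] by simp
    qed
    have "(\<integral>\<^sup>+l. ennreal (\<kappa> l) \<partial>count_space UNIV) = (\<integral>\<^sup>+l. (\<integral>\<^sup>+z. ennreal (2 powr (s * of_int l) * cc l z) \<partial>count_space UNIV) \<partial>count_space UNIV)"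
      unfolding \<kappa>_def
      by (intro nn_integral_cong) (simp add: ennreal_mult cc0 infsum_nonneg nn_integral_cmult nn_count_infsum[OF cc0 cc_sum])
    also have "\<dots> = (\<integral>\<^sup>+w. ennreal (2 powr (s * of_int (fst w)) * cc (fst w) (snd w)) \<partial>count_space UNIV)"
      using nn_integral_fst_count_space[of "\<lambda>w. ennreal (2 powr (s * of_int (fst w)) * cc (fst w) (snd w))"] by simp
    also have "\<dots> = (\<integral>\<^sup>+z. (\<integral>\<^sup>+l. ennreal (2 powr (s * of_int l) * cc l z) \<partial>count_space UNIV) \<partial>count_space UNIV)"
      using nn_integral_snd_count_space[of "\<lambda>w. ennreal (2 powr (s * of_int (fst w)) * cc (fst w) (snd w))"] by simp
    also have "\<dots> \<le> (\<integral>\<^sup>+z. ennreal (G * Q) * ennreal (\<beta> (fst z) * \<gamma> (snd z)) \<partial>count_space UNIV)"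
    proof (rule nn_integral_mono)
      fix z
      let ?w = "Q * (\<beta> (fst z) * \<gamma> (snd z))"
      have w0: "?w \<ge> 0" using Q0 b0 by simp
      have "(\<integral>\<^sup>+l. ennreal (2 powr (s * of_int l) * cc l z) \<partial>count_space UNIV)
          = (\<integral>\<^sup>+l. ennreal (if l \<le> ?M z + 5 then 2 powr (s * (of_int l - of_int (?M z))) else 0) * ennreal ?w \<partial>count_space UNIV)"
      proof (rule nn_integral_cong)
        fix l :: int
        have "2 powr (s * (of_int l - of_int (?M z))) = 2 powr (s * of_int l) * 2 powr (- s * of_int (?M z))"
          by (simp add: powr_add[symmetric] algebra_simps)
        then have "2 powr (s * of_int l) * cc l z = (if l \<le> ?M z + 5 then 2 powr (s * (of_int l - of_int (?M z))) else 0) * ?w"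
          unfolding cc_def by (simp add: mult_ac)
        then show "ennreal (2 powr (s * of_int l) * cc l z) = ennreal (if l \<le> ?M z + 5 then 2 powr (s * (of_int l - of_int (?M z))) else 0) * ennreal ?w"
          using w0 by (simp add: ennreal_mult[symmetric])
      qed
      also have "\<dots> = (\<integral>\<^sup>+l. ennreal (if l \<le> ?M z + 5 then 2 powr (s * (of_int l - of_int (?M z))) else 0) \<partial>count_space UNIV) * ennreal ?w"
        by (rule nn_integral_multc) simp
      also have "\<dots> \<le> ennreal G * ennreal ?w" by (intro mult_right_mono G(2)) simp
      also have "\<dots> = ennreal (G * Q) * ennreal (\<beta> (fst z) * \<gamma> (snd z))"
        using G(1) Q0 b0 by (simp add: ennreal_mult[symmetric] mult.assoc)
      finally show "(\<integral>\<^sup>+l. ennreal (2 powr (s * of_int l) * cc l z) \<partial>count_space UNIV) \<le> ennreal (G * Q) * ennreal (\<beta> (fst z) * \<gamma> (snd z))" .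
    qed
    also have "\<dots> = ennreal (G * Q) * (\<integral>\<^sup>+z. ennreal (\<beta> (fst z) * \<gamma> (snd z)) \<partial>count_space UNIV)"
      by (rule nn_integral_cmult) simp
    also have "\<dots> = ennreal (G * Q * infsum \<beta> UNIV * infsum \<gamma> UNIV)"
      unfolding nn_count_product[OF b0(1) besov_leD(4)[OF u] b0(2) besov_leD(4)[OF v]]
      using G(1) Q0 b0 by (simp add: ennreal_mult[symmetric] mult.assoc infsum_nonneg)
    finally have tot: "(\<integral>\<^sup>+l. ennreal (\<kappa> l) \<partial>count_space UNIV) \<le> ennreal (G * Q * infsum \<beta> UNIV * infsum \<gamma> UNIV)" .
    have nn: "G * Q * infsum \<beta> UNIV * infsum \<gamma> UNIV \<ge> 0" using G(1) Q0 b0 by (simp add: infsum_nonneg)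
    note \<kappa>s = nn_count_le_imp_summable[OF \<kappa>0 tot nn]
    have "besov_le (2 / p) (distr_of F) \<kappa>"
      unfolding besov_le_def using tempered_distr_of[OF bF] L\<kappa> \<kappa>0 \<kappa>s(1) by blast
    then show ?thesis using \<kappa>s(2) unfolding F_def[abs_def] by blast
  qed
  then show ?thesis using G(1) Q0 by (intro exI[of _ "G * Q"]) auto
qed

end

lemma has_sum_diff:
  fixes f g :: "'i \<Rightarrow> complex"
  assumes "(f has_sum a) A" "(g has_sum b) A"
  shows "((\<lambda>x. f x - g x) has_sum (a - b)) A"
  using has_sum_add[OF assms(1) has_sum_cmult_right[OF assms(2), of "-1"]] by simp

context besov_setting
begin

section \<open>The Besov space as a space of functions\<close>

lemma one_symbol_admissible: "admissible one_symbol" by (rule admissible_const)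
lemma one_symbol_homogeneous: "homogeneous 0 one_symbol" by (rule homogeneous_const)
lemma one_symbol_degree: "2 / p = 0 + 2 / p" by simp

text \<open>For regularity \<open>2/p\<close> each member of the Besov space is given by exactly one bounded function that is
  the pointwise sum of its blocks. Working with these functions makes products available.\<close>

definition besov_fun :: "(plane \<Rightarrow> complex) set" where
  "besov_fun = {F. bdd_meas F \<and> distr_of F \<in> besov \<phi> p (2 / p) \<and> multiplier one_symbol (distr_of F) = F}"

definition fnorm :: "(plane \<Rightarrow> complex) \<Rightarrow> real" where
  "fnorm F = besov_norm \<phi> p (2 / p) (distr_of F)"

definition weighted_block :: "real \<Rightarrow> distr \<Rightarrow> int \<Rightarrow> real" where
  "weighted_block \<sigma> u j = 2 powr (\<sigma> * of_int j) * Lp_norm p (conv (lp_block \<phi> j) u)"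

lemma weighted_block_nonneg: "weighted_block \<sigma> u j \<ge> 0"
  unfolding weighted_block_def by (simp add: Lp_norm_nonneg)

lemma besov_norm_weighted_block: "besov_norm \<phi> p \<sigma> u = infsum (weighted_block \<sigma> u) UNIV"
  unfolding besov_norm_def weighted_block_def ..

lemma besov_norm_nonneg: "besov_norm \<phi> p \<sigma> u \<ge> 0"
  unfolding besov_norm_weighted_block by (rule infsum_nonneg) (rule weighted_block_nonneg)

lemma besov_le_weighted_block: "u \<in> besov \<phi> p \<sigma> \<Longrightarrow> besov_le \<sigma> u (weighted_block \<sigma> u)"
  using besov_imp_besov_le unfolding weighted_block_def[abs_def] .

lemma besov_tempered: "u \<in> besov \<phi> p \<sigma> \<Longrightarrow> tempered u"
  unfolding besov_def by blast

lemma fnorm_nonneg: "fnorm F \<ge> 0"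
  unfolding fnorm_def by (rule besov_norm_nonneg)

text \<open>This is how membership in the Besov space of the statement is obtained: the norm is bounded through
  any dominating sequence, and the reproducing series is checked separately.\<close>

lemma besov_le_imp_besov:
  assumes u: "besov_le \<sigma> u \<beta>" and g: "\<And>g. schwartz g \<Longrightarrow> ((\<lambda>j. pairing (conv (lp_block \<phi> j) u) g) has_sum u g) UNIV"
  shows "u \<in> besov \<phi> p \<sigma>" "besov_norm \<phi> p \<sigma> u \<le> infsum \<beta> UNIV"
proof -
  have L: "in_Lp p (conv (lp_block \<phi> j) u)" "Lp_norm p (conv (lp_block \<phi> j) u) \<le> 2 powr (- \<sigma> * of_int j) * \<beta> j" for j
    using Lp_le_imp_in_Lp[OF p1 besov_leD(2)[OF u, of j]] by (simp_all add: lp_block_eq_ker)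
  have le: "weighted_block \<sigma> u j \<le> \<beta> j" for j
  proof -
    have "weighted_block \<sigma> u j \<le> 2 powr (\<sigma> * of_int j) * (2 powr (- \<sigma> * of_int j) * \<beta> j)"
      unfolding weighted_block_def by (intro mult_left_mono L(2)) simp
    then show ?thesis by (simp add: mult.assoc[symmetric] powr_add[symmetric])
  qed
  have s: "weighted_block \<sigma> u summable_on UNIV"
    by (rule summable_on_le(1)[OF _ besov_leD(4)[OF u]]) (use le weighted_block_nonneg in auto)
  show "u \<in> besov \<phi> p \<sigma>"
    unfolding besov_def using besov_leD(1)[OF u] L(1) s[unfolded weighted_block_def[abs_def]] g by blast
  show "besov_norm \<phi> p \<sigma> u \<le> infsum \<beta> UNIV"
    unfolding besov_norm_weighted_block by (rule infsum_mono[OF s besov_leD(4)[OF u]]) (rule le)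
qed

lemma besov_fun_intro:
  assumes "bdd_meas F" and b: "besov_le (2 / p) (distr_of F) \<beta>" and F: "multiplier one_symbol (distr_of F) = F"
  shows "F \<in> besov_fun" "fnorm F \<le> infsum \<beta> UNIV"
proof -
  have g: "((\<lambda>j. pairing (conv (lp_block \<phi> j) (distr_of F)) g) has_sum distr_of F g) UNIV" if "schwartz g" for g
    using pairing_multiplier[OF one_symbol_admissible one_symbol_homogeneous one_symbol_degree b that] that
    unfolding F lp_block_eq_ker by (simp add: distr_of_def)
  show "F \<in> besov_fun" using assms besov_le_imp_besov(1)[OF b g] unfolding besov_fun_def by blast
  show "fnorm F \<le> infsum \<beta> UNIV" unfolding fnorm_def by (rule besov_le_imp_besov(2)[OF b g])
qed

lemma besov_fun_D:
  assumes "F \<in> besov_fun"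
  shows "bdd_meas F" "distr_of F \<in> besov \<phi> p (2 / p)" "multiplier one_symbol (distr_of F) = F" "besov_le (2 / p) (distr_of F) (weighted_block (2 / p) (distr_of F))"
    "fnorm F = infsum (weighted_block (2 / p) (distr_of F)) UNIV"
  using assms besov_le_weighted_block unfolding besov_fun_def fnorm_def besov_norm_weighted_block by auto

lemma besov_fun_multiplier:
  assumes m: "admissible m" and d: "homogeneous d m" and sd: "\<sigma> = d + 2 / p" and u: "besov_le \<sigma> u \<beta>"
  shows "multiplier m u \<in> besov_fun" "fnorm (multiplier m u) \<le> block_const m d * infsum \<beta> UNIV"
proof -
  note * = besov_fun_intro[OF bdd_meas_multiplier[OF m d sd u] besov_le_multiplier[OF m d sd u] multiplier_one_symbol_multiplier[OF m d sd u]]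
  show "multiplier m u \<in> besov_fun" by (rule *(1))
  show "fnorm (multiplier m u) \<le> block_const m d * infsum \<beta> UNIV"
    using *(2) by (simp add: infsum_cmult_right[OF besov_leD(4)[OF u]])
qed

lemma besov_fun_sup: "F \<in> besov_fun \<Longrightarrow> cmod (F x) \<le> block_const one_symbol 0 * fnorm F"
  using multiplier_sup[OF one_symbol_admissible one_symbol_homogeneous one_symbol_degree besov_fun_D(4), of F x] besov_fun_D(3,5)[of F] by simp

lemma distr_of_multiplier_one_symbol:
  assumes "\<theta> \<in> besov \<phi> p (2 / p)"
  shows "distr_of (multiplier one_symbol \<theta>) = \<theta>"
proof
  fix g
  show "distr_of (multiplier one_symbol \<theta>) g = \<theta> g"
  proof (cases "schwartz g")
    case True
    have "((\<lambda>j. pairing (conv (lp_block \<phi> j) \<theta>) g) has_sum \<theta> g) UNIV"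
      using assms True unfolding besov_def by blast
    then show ?thesis
      using pairing_multiplier[OF one_symbol_admissible one_symbol_homogeneous one_symbol_degree besov_le_weighted_block[OF assms] True] True has_sum_unique
      unfolding distr_of_def lp_block_eq_ker by auto
  next
    case False
    then show ?thesis using tempered_non_schwartz[OF besov_tempered[OF assms]] by (simp add: distr_of_def)
  qed
qed

lemma besov_minus:
  assumes u: "u \<in> besov \<phi> p \<sigma>" and v: "v \<in> besov \<phi> p \<sigma>"
  shows "u - v \<in> besov \<phi> p \<sigma>" "besov_norm \<phi> p \<sigma> (u - v) \<le> besov_norm \<phi> p \<sigma> u + besov_norm \<phi> p \<sigma> v"
proof -
  note lu = besov_le_weighted_block[OF u] and lv = besov_le_weighted_block[OF v]
  have b: "besov_le \<sigma> (u - v) (\<lambda>j. weighted_block \<sigma> u j + weighted_block \<sigma> v j)"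
    unfolding besov_le_def
  proof (intro conjI allI)
    show "tempered (u - v)" by (intro tempered_minus besov_tempered[OF u] besov_tempered[OF v])
    show "Lp_le p (conv (ker one_symbol j) (u - v)) (2 powr (- \<sigma> * of_int j) * (weighted_block \<sigma> u j + weighted_block \<sigma> v j))" for j
      using Lp_le_diff[OF p1 besov_leD(2)[OF lu] besov_leD(2)[OF lv], of j] unfolding conv_minus[abs_def] distrib_left .
    show "0 \<le> weighted_block \<sigma> u j + weighted_block \<sigma> v j" for j by (simp add: weighted_block_nonneg)
  qed (intro summable_on_add besov_leD(4)[OF lu] besov_leD(4)[OF lv])
  have g: "((\<lambda>j. pairing (conv (lp_block \<phi> j) (u - v)) g) has_sum (u - v) g) UNIV" if g: "schwartz g" for g
  proof -
    have "pairing (conv (lp_block \<phi> j) (u - v)) g = pairing (conv (lp_block \<phi> j) u) g - pairing (conv (lp_block \<phi> j) v) g" for j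
      unfolding pairing_def conv_minus
      by (simp add: left_diff_distrib conv_pairing_integrable besov_tempered[OF u] besov_tempered[OF v] schwartz_lp_block g)
    moreover have "((\<lambda>j. pairing (conv (lp_block \<phi> j) u) g - pairing (conv (lp_block \<phi> j) v) g) has_sum (u g - v g)) UNIV"
      by (rule has_sum_diff) (use u v g in \<open>auto simp: besov_def\<close>)
    ultimately show ?thesis by simp
  qed
  show "u - v \<in> besov \<phi> p \<sigma>" by (rule besov_le_imp_besov(1)[OF b g])
  have "besov_norm \<phi> p \<sigma> (u - v) \<le> infsum (\<lambda>j. weighted_block \<sigma> u j + weighted_block \<sigma> v j) UNIV" by (rule besov_le_imp_besov(2)[OF b g])
  also have "\<dots> = besov_norm \<phi> p \<sigma> u + besov_norm \<phi> p \<sigma> v"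
    unfolding besov_norm_weighted_block by (rule infsum_add[OF besov_leD(4)[OF lu] besov_leD(4)[OF lv]])
  finally show "besov_norm \<phi> p \<sigma> (u - v) \<le> besov_norm \<phi> p \<sigma> u + besov_norm \<phi> p \<sigma> v" .
qed

lemma multiplier_minus:
  assumes m: "admissible m" and d: "homogeneous d m" and sd: "\<sigma> = d + 2 / p"
    and u: "besov_le \<sigma> u \<beta>" and v: "besov_le \<sigma> v \<gamma>"
  shows "multiplier m (u - v) = (\<lambda>x. multiplier m u x - multiplier m v x)"
proof
  fix x
  have "((\<lambda>j. conv (ker m j) (u - v) x) has_sum (multiplier m u x - multiplier m v x)) UNIV"
    unfolding conv_minus
    by (rule has_sum_diff[OF multiplier_has_sum[OF m d sd u] multiplier_has_sum[OF m d sd v]])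
  then show "multiplier m (u - v) x = multiplier m u x - multiplier m v x" unfolding multiplier_def[of m "u - v"] by (rule infsumI)
qed

lemma besov_fun_diff:
  assumes F: "F \<in> besov_fun" and G: "G \<in> besov_fun"
  shows "(\<lambda>x. F x - G x) \<in> besov_fun" "fnorm (\<lambda>x. F x - G x) \<le> fnorm F + fnorm G"
    "distr_of (\<lambda>x. F x - G x) = distr_of F - distr_of G"
proof -
  show r: "distr_of (\<lambda>x. F x - G x) = distr_of F - distr_of G" by (rule distr_of_diff[OF besov_fun_D(1)[OF F] besov_fun_D(1)[OF G]])
  have "multiplier one_symbol (distr_of F - distr_of G) = (\<lambda>x. F x - G x)"
    using multiplier_minus[OF one_symbol_admissible one_symbol_homogeneous one_symbol_degree besov_fun_D(4)[OF F] besov_fun_D(4)[OF G]] besov_fun_D(3)[OF F] besov_fun_D(3)[OF G] by simp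
  then show "(\<lambda>x. F x - G x) \<in> besov_fun"
    unfolding besov_fun_def r using besov_minus(1)[OF besov_fun_D(2)[OF F] besov_fun_D(2)[OF G]] bdd_meas_diff[OF besov_fun_D(1)[OF F] besov_fun_D(1)[OF G]] r by simp
  show "fnorm (\<lambda>x. F x - G x) \<le> fnorm F + fnorm G"
    unfolding fnorm_def r by (rule besov_minus(2)[OF besov_fun_D(2)[OF F] besov_fun_D(2)[OF G]])
qed

lemma besov_fun_0: "(\<lambda>x. 0) \<in> besov_fun" "fnorm (\<lambda>x. 0) = 0"
proof -
  have b: "bdd_meas (\<lambda>x. 0)" by (rule bdd_measI[of _ 0]) auto
  have r: "distr_of (\<lambda>x. 0) g = 0" for g unfolding distr_of_def pairing_def by simp
  have c: "conv h (distr_of (\<lambda>x. 0)) = (\<lambda>x. 0)" for h unfolding conv_def r ..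
  have l: "besov_le (2 / p) (distr_of (\<lambda>x. 0)) (\<lambda>j. 0)"
    unfolding besov_le_def c using tempered_distr_of[OF b] Lp_le_0[OF p1] by simp
  have "multiplier one_symbol (distr_of (\<lambda>x. 0)) = (\<lambda>x. 0)" unfolding multiplier_def[abs_def] c by simp
  note * = besov_fun_intro[OF b l this]
  show "(\<lambda>x. 0) \<in> besov_fun" by (rule *(1))
  show "fnorm (\<lambda>x. 0) = 0" using *(2) fnorm_nonneg[of "\<lambda>x. 0"] by simp
qed

lemma besov_fun_add:
  assumes F: "F \<in> besov_fun" and G: "G \<in> besov_fun"
  shows "(\<lambda>x. F x + G x) \<in> besov_fun" "fnorm (\<lambda>x. F x + G x) \<le> fnorm F + fnorm G"
proof -
  note m = besov_fun_diff[OF besov_fun_0(1) G]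
  note d = besov_fun_diff[OF F m(1)]
  show "(\<lambda>x. F x + G x) \<in> besov_fun" using d(1) by simp
  have "fnorm (\<lambda>x. F x + G x) \<le> fnorm F + fnorm (\<lambda>x. 0 - G x)" using d(2) by simp
  then show "fnorm (\<lambda>x. F x + G x) \<le> fnorm F + fnorm G" using m(2) besov_fun_0(2) by simp
qed

lemma fnorm_eq_0:
  assumes "F \<in> besov_fun" "G \<in> besov_fun" "fnorm (\<lambda>x. F x - G x) = 0"
  shows "F = G"
proof
  fix x
  have "cmod (F x - G x) \<le> 0" using besov_fun_sup[OF besov_fun_diff(1)[OF assms(1,2)], of x] assms(3) by simp
  then show "F x = G x" by simp
qed

text \<open>Completeness of the Besov space. The series converges uniformly, hence so do its blocks, whose norms
  are added by the countable triangle inequality in \<open>L\<^sup>p\<close>. Exchanging the sums over \<open>n\<close> and over the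
  frequencies identifies the sum of the blocks.\<close>

lemma besov_fun_series:
  fixes D :: "nat \<Rightarrow> plane \<Rightarrow> complex"
  assumes D: "\<And>n. D n \<in> besov_fun" and S: "(\<lambda>n. fnorm (D n)) summable_on UNIV" and F: "F = (\<lambda>x. \<Sum>\<^sub>\<infinity>n. D n x)"
  shows "\<And>x. ((\<lambda>n. D n x) has_sum F x) UNIV" "F \<in> besov_fun" "fnorm F \<le> infsum (\<lambda>n. fnorm (D n)) UNIV"
proof -
  let ?B = "block_const one_symbol 0"
  have B0: "?B \<ge> 0" by (rule block_const(1)[OF one_symbol_admissible one_symbol_homogeneous])
  note Dm = bdd_measD(1)[OF besov_fun_D(1)[OF D]]
  have sup: "cmod (D n x) \<le> ?B * fnorm (D n)" for n x by (rule besov_fun_sup[OF D])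
  have Ss: "(\<lambda>n. ?B * fnorm (D n)) summable_on UNIV" by (intro summable_on_cmult_right S)
  show hs: "((\<lambda>n. D n x) has_sum F x) UNIV" for x
    unfolding F by (rule has_sum_infsum[OF summable_on_le(1)[OF sup Ss]])
  have bF: "bdd_meas F"
    by (rule bdd_measI[OF has_sum_measurable[OF Dm hs]]) (use summable_on_le(2)[OF sup Ss] in \<open>simp add: F\<close>)
  let ?c = "\<lambda>n j x. conv (ker one_symbol j) (distr_of (D n)) x"
  have iK: "integrable lborel (ker one_symbol j)" for j by (intro schwartz_integrable schwartz_ker one_symbol_admissible)
  have csum: "((\<lambda>n. ?c n j x) has_sum conv (ker one_symbol j) (distr_of F) x) UNIV" for j x
    unfolding conv_distr_of[OF schwartz_ker[OF one_symbol_admissible]] sconv_def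
    by (rule has_sum_integral[OF Dm sup Ss hs]) (intro integrable_reflect iK)
  let ?w = "\<lambda>n j. weighted_block (2 / p) (distr_of (D n)) j"
  note le = besov_fun_D(4)[OF D]
  have w_le: "?w n j \<le> fnorm (D n)" for n j
    using finite_sum_le_infsum[OF besov_leD(4)[OF le[of n]], of "{j}"] weighted_block_nonneg by (simp add: besov_fun_D(5)[OF D])
  have ws: "(\<lambda>n. ?w n j) summable_on UNIV" for j
    by (rule summable_on_le(1)[OF _ S]) (use w_le weighted_block_nonneg in simp)
  define \<gamma> where "\<gamma> j = infsum (\<lambda>n. ?w n j) UNIV" for j
  have \<gamma>0: "\<gamma> j \<ge> 0" for j unfolding \<gamma>_def by (rule infsum_nonneg) (rule weighted_block_nonneg)
  have tot: "(\<integral>\<^sup>+z. ennreal (?w (fst z) (snd z)) \<partial>count_space UNIV) = ennreal (infsum (\<lambda>n. fnorm (D n)) UNIV)"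
  proof -
    have "(\<integral>\<^sup>+z. ennreal (?w (fst z) (snd z)) \<partial>count_space UNIV) = (\<integral>\<^sup>+n. (\<integral>\<^sup>+j. ennreal (?w n j) \<partial>count_space UNIV) \<partial>count_space UNIV)"
      using nn_integral_fst_count_space[of "\<lambda>z. ennreal (?w (fst z) (snd z))"] by simp
    also have "\<dots> = (\<integral>\<^sup>+n. ennreal (fnorm (D n)) \<partial>count_space UNIV)"
      by (simp add: nn_count_infsum[OF weighted_block_nonneg besov_leD(4)[OF le]] besov_fun_D(5)[OF D])
    finally show ?thesis by (simp add: nn_count_infsum[OF fnorm_nonneg S])
  qed
  have "(\<integral>\<^sup>+j. ennreal (\<gamma> j) \<partial>count_space UNIV) = (\<integral>\<^sup>+j. (\<integral>\<^sup>+n. ennreal (?w n j) \<partial>count_space UNIV) \<partial>count_space UNIV)"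
    unfolding \<gamma>_def by (simp add: nn_count_infsum[OF weighted_block_nonneg ws])
  also have "\<dots> = (\<integral>\<^sup>+z. ennreal (?w (fst z) (snd z)) \<partial>count_space UNIV)"
    using nn_integral_snd_count_space[of "\<lambda>z. ennreal (?w (fst z) (snd z))"] by simp
  finally have \<gamma>tot: "(\<integral>\<^sup>+j. ennreal (\<gamma> j) \<partial>count_space UNIV) \<le> ennreal (infsum (\<lambda>n. fnorm (D n)) UNIV)" unfolding tot by simp
  have S0: "infsum (\<lambda>n. fnorm (D n)) UNIV \<ge> 0" by (rule infsum_nonneg) (rule fnorm_nonneg)
  note \<gamma>s = nn_count_le_imp_summable[OF \<gamma>0 \<gamma>tot S0]
  have LF: "Lp_le p (conv (ker one_symbol j) (distr_of F)) (2 powr (- (2 / p) * of_int j) * \<gamma> j)" for j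
  proof -
    have "Lp_le p (conv (ker one_symbol j) (distr_of F)) (infsum (\<lambda>n. 2 powr (- (2 / p) * of_int j) * ?w n j) UNIV)"
      by (rule Lp_le_has_sum[OF p1 besov_leD(2)[OF le] _ csum]) (intro summable_on_cmult_right ws)
    then show ?thesis unfolding \<gamma>_def by (simp add: infsum_cmult_right[OF ws])
  qed
  have bl: "besov_le (2 / p) (distr_of F) \<gamma>"
    unfolding besov_le_def using tempered_distr_of[OF bF] LF \<gamma>0 \<gamma>s(1) by blast
  have "multiplier one_symbol (distr_of F) x = F x" for x
  proof -
    have c_le: "norm (case z of (n, j) \<Rightarrow> ?c n j x) \<le> ?B * ?w (fst z) (snd z)" for z
      using multiplier_block_sup[OF one_symbol_admissible one_symbol_homogeneous one_symbol_degree le] by (auto simp: split_beta)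
    have "(\<lambda>z. ?w (fst z) (snd z)) summable_on UNIV"
      by (rule nn_count_le_imp_summable(1)[OF weighted_block_nonneg eq_refl[OF tot] S0])
    then have "(\<lambda>(n, j). ?c n j x) summable_on (UNIV \<times> UNIV)"
      using summable_on_le(1)[OF c_le summable_on_cmult_right] by simp
    then have "infsum (\<lambda>n. infsum (\<lambda>j. ?c n j x) UNIV) UNIV = infsum (\<lambda>j. infsum (\<lambda>n. ?c n j x) UNIV) UNIV"
      by (rule infsum_swap_banach)
    also have "(\<lambda>n. infsum (\<lambda>j. ?c n j x) UNIV) = (\<lambda>n. D n x)"
      using fun_cong[OF besov_fun_D(3)[OF D]] unfolding multiplier_def by simp
    also have "(\<lambda>j. infsum (\<lambda>n. ?c n j x) UNIV) = (\<lambda>j. conv (ker one_symbol j) (distr_of F) x)"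
      using infsumI[OF csum] by simp
    finally show ?thesis unfolding multiplier_def F by simp
  qed
  then have sF: "multiplier one_symbol (distr_of F) = F" by (rule ext)
  note * = besov_fun_intro[OF bF bl sF]
  show "F \<in> besov_fun" by (rule *(1))
  show "fnorm F \<le> infsum (\<lambda>n. fnorm (D n)) UNIV" using *(2) \<gamma>s(2) by linarith
qed

end

section \<open>Bounded functions are determined by their integrals against Schwartz functions\<close>

text \<open>The function \<open>w * gauss\<close> is approximated by its averages against narrow Gaussians. By Fubini, the
  integral of \<open>h\<close> against such an average is an average of integrals of \<open>h\<close> against Schwartz functions.\<close>

lemma integral_continuous_gauss_0:
  assumes h: "bdd_meas h" and 0: "\<And>g. schwartz g \<Longrightarrow> pairing h g = 0" and w: "bdd_meas w" "continuous_on UNIV w"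
  shows "(\<integral>x. h x * (w x * gauss x) \<partial>lborel) = 0"
proof -
  let ?q = "\<lambda>x. w x * gauss x"
  note sg = schwartz_gauss
  note [measurable] = bdd_measD(1)[OF h] bdd_measD(1)[OF w(1)] schwartz_measurable[OF sg]
  obtain H where H: "H \<ge> 0" "\<And>x. cmod (h x) \<le> H" using bdd_measD(2)[OF h] by blast
  obtain W where W: "W \<ge> 0" "\<And>x. cmod (w x) \<le> W" using bdd_measD(2)[OF w(1)] by blast
  obtain C where C: "C \<ge> 0" "\<And>x. (1 + norm x) ^ 4 * cmod (gauss x) \<le> C" using schwartz_decay[OF sg] by metis
  have iq: "integrable lborel ?q" using bdd_meas_integrable[OF w(1) schwartz_integrable[OF sg]] by (simp add: mult.commute)
  let ?e = "\<lambda>n. 1 / real (Suc n)"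
  define J where "J n x = (\<integral>z. gauss z * ?q (x + ?e n *\<^sub>R z) \<partial>lborel)" for n x
  have qm: "?q \<in> borel_measurable borel" by measurable
  have J_eq: "J n x = (\<integral>y. of_real ((1 / ?e n)\<^sup>2) * gauss ((1 / ?e n) *\<^sub>R (y - x)) * ?q y \<partial>lborel)" for n x
    unfolding J_def by (rule gauss_dilation_integral[OF qm, symmetric]) simp
  have Jm [measurable]: "J n \<in> borel_measurable borel" for n
    unfolding J_def[abs_def] by (rule lborel.borel_measurable_lebesgue_integral) (simp add: split_beta', measurable)
  have zero: "(\<integral>x. h x * J n x \<partial>lborel) = 0" for n
  proof -
    let ?k = "\<lambda>v. of_real ((1 / ?e n)\<^sup>2) * gauss ((1 / ?e n) *\<^sub>R v)"
    have sk: "schwartz ?k" by (intro schwartz_cmult schwartz_scale sg) simp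
    have "(\<integral>y. ?q y * (\<integral>x. ?k (y - x) * h x \<partial>lborel) \<partial>lborel) = (\<integral>x. (\<integral>y. ?q y * ?k (y - x) \<partial>lborel) * h x \<partial>lborel)"
      by (rule Fubini_conv(1)[OF iq schwartz_integrable[OF sk] _ H(2)]) measurable
    also have "\<dots> = (\<integral>x. h x * J n x \<partial>lborel)"
      unfolding J_eq by (simp add: mult_ac)
    finally have e: "(\<integral>x. h x * J n x \<partial>lborel) = (\<integral>y. ?q y * (\<integral>x. ?k (y - x) * h x \<partial>lborel) \<partial>lborel)" ..
    have "(\<integral>x. ?k (y - x) * h x \<partial>lborel) = 0" for y
      using 0[OF schwartz_reflect[OF sk, of y]] unfolding pairing_def by (simp add: mult.commute)
    then show ?thesis unfolding e by simp
  qed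
  have "(\<lambda>n. \<integral>x. h x * J n x \<partial>lborel) \<longlonglongrightarrow> (\<integral>x. h x * (2 * of_real pi * ?q x) \<partial>lborel)"
  proof (rule integral_dominated_convergence[where w="\<lambda>x. H * (W * C * (\<integral>z. (1 + norm z) ^ 4 * cmod (gauss z) \<partial>lborel)) * \<omega> x"])
    show "integrable lborel (\<lambda>x. H * (W * C * (\<integral>z. (1 + norm z) ^ 4 * cmod (gauss z) \<partial>lborel)) * \<omega> x)"
      by (intro integrable_mult_right omega_integrable)
    have bq: "cmod (?q x) \<le> W * C" for x
    proof -
      have "cmod (gauss x) * 1 \<le> cmod (gauss x) * (1 + norm x) ^ 4" by (intro mult_left_mono one_le_power) auto
      then have "cmod (gauss x) \<le> C" using C(2)[of x] by (simp add: mult.commute)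
      then show ?thesis unfolding norm_mult by (intro mult_mono W) auto
    qed
    have cq: "isCont ?q x" for x
      using w(2) schwartz_continuous[OF sg, of UNIV] by (auto simp: continuous_on_eq_continuous_at)
    show "AE x in lborel. (\<lambda>n. h x * J n x) \<longlonglongrightarrow> h x * (2 * of_real pi * ?q x)"
      unfolding J_def by (intro AE_I2 tendsto_mult tendsto_const gauss_mollify[OF _ bq cq]) measurable
    show "AE x in lborel. norm (h x * J n x) \<le> H * (W * C * (\<integral>z. (1 + norm z) ^ 4 * cmod (gauss z) \<partial>lborel)) * \<omega> x" for n
    proof (rule AE_I2)
      fix x
      have e: "0 < ?e n" "?e n \<le> 1" by auto
      have pt: "cmod (gauss z * ?q (x + ?e n *\<^sub>R z)) \<le> W * C * \<omega> x * ((1 + norm z) ^ 4 * cmod (gauss z))" for z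
      proof -
        let ?v = "x + ?e n *\<^sub>R z"
        have "norm x \<le> norm ?v + norm (?e n *\<^sub>R z)" using norm_triangle_ineq4[of ?v "?e n *\<^sub>R z"] by simp
        moreover have "norm (?e n *\<^sub>R z) \<le> 1 * norm z" unfolding norm_scaleR using e by (intro mult_right_mono) auto
        ultimately have "1 + norm x \<le> (1 + norm ?v) + norm z" by linarith
        also have "\<dots> \<le> (1 + norm ?v) * (1 + norm z)"
          using mult_nonneg_nonneg[OF norm_ge_zero[of ?v] norm_ge_zero[of z]] unfolding distrib_left distrib_right by linarith
        finally have "(1 + norm x) ^ 4 \<le> (1 + norm ?v) ^ 4 * (1 + norm z) ^ 4"
          unfolding power_mult_distrib[symmetric] by (intro power_mono) auto
        then have "(1 + norm x) ^ 4 * cmod (gauss ?v) \<le> (1 + norm ?v) ^ 4 * (1 + norm z) ^ 4 * cmod (gauss ?v)"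
          by (rule mult_right_mono) simp
        also have "\<dots> = (1 + norm z) ^ 4 * ((1 + norm ?v) ^ 4 * cmod (gauss ?v))" by simp
        also have "\<dots> \<le> (1 + norm z) ^ 4 * C" by (intro mult_left_mono C(2)) simp
        finally have "cmod (gauss ?v) \<le> C * \<omega> x * (1 + norm z) ^ 4"
          unfolding \<omega>_def using one_plus_norm_pos[of x] by (simp add: pos_le_divide_eq mult_ac)
        then have "cmod (?q ?v) \<le> W * (C * \<omega> x * (1 + norm z) ^ 4)"
          unfolding norm_mult by (intro mult_mono W) auto
        then have "cmod (gauss z) * cmod (?q ?v) \<le> cmod (gauss z) * (W * (C * \<omega> x * (1 + norm z) ^ 4))"
          by (rule mult_left_mono) simp
        then show ?thesis unfolding norm_mult[of "gauss z"] by (simp only: mult_ac)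
      qed
      have "cmod (J n x) \<le> (\<integral>z. W * C * \<omega> x * ((1 + norm z) ^ 4 * cmod (gauss z)) \<partial>lborel)"
        unfolding J_def
      proof (rule Bochner_Integration.integral_norm_bound_integral[OF _ _ pt])
        show i: "integrable lborel (\<lambda>z. W * C * \<omega> x * ((1 + norm z) ^ 4 * cmod (gauss z)))"
          by (intro integrable_mult_right schwartz_poly_integrable sg)
        show "integrable lborel (\<lambda>z. gauss z * ?q (x + ?e n *\<^sub>R z))"
        proof (rule Bochner_Integration.integrable_bound[OF i])
          show "AE z in lborel. norm (gauss z * ?q (x + ?e n *\<^sub>R z)) \<le> norm (W * C * \<omega> x * ((1 + norm z) ^ 4 * cmod (gauss z)))"
            by (intro AE_I2 order_trans[OF pt]) (simp only: real_norm_def abs_ge_self)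
        qed measurable
      qed
      also have "\<dots> = W * C * \<omega> x * (\<integral>z. (1 + norm z) ^ 4 * cmod (gauss z) \<partial>lborel)" by simp
      finally have "cmod (h x) * cmod (J n x) \<le> H * (W * C * \<omega> x * (\<integral>z. (1 + norm z) ^ 4 * cmod (gauss z) \<partial>lborel))"
        by (intro mult_mono H) auto
      then show "norm (h x * J n x) \<le> H * (W * C * (\<integral>z. (1 + norm z) ^ 4 * cmod (gauss z) \<partial>lborel)) * \<omega> x"
        unfolding norm_mult by (simp only: mult_ac)
    qed
  qed measurable
  then have "(\<integral>x. h x * (2 * of_real pi * ?q x) \<partial>lborel) = 0" unfolding zero LIMSEQ_const_iff by (rule sym)
  also have "(\<lambda>x. h x * (2 * of_real pi * ?q x)) = (\<lambda>x. (2 * of_real pi) * (h x * ?q x))" by (simp add: fun_eq_iff)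
  finally show ?thesis by (simp only: integral_mult_right_zero) simp
qed

text \<open>Continuous functions \<open>w n\<close> converging almost everywhere to the conjugate of \<open>h\<close> yield that the integral
  of \<open>\<bar>h\<bar>\<^sup>2 * gauss\<close> vanishes.\<close>

lemma bdd_meas_AE_0:
  assumes h: "bdd_meas h" and 0: "\<And>g. schwartz g \<Longrightarrow> pairing h g = 0"
  shows "AE x in lborel. h x = 0"
proof -
  note [measurable] = bdd_measD(1)[OF h] schwartz_measurable[OF schwartz_gauss]
  obtain H0 where H0: "H0 \<ge> 0" "\<And>x. cmod (h x) \<le> H0" using bdd_measD(2)[OF h] by blast
  define H where "H = H0 + 1"
  have H: "H > 0" "\<And>x. cmod (h x) \<le> H" using H0(1) order_trans[OF H0(2), of "H0 + 1"] by (auto simp: H_def)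
  have cnj_m: "cnj \<in> borel_measurable borel"
    by (intro borel_measurable_continuous_onI continuous_intros)
  have [measurable]: "(\<lambda>x. cnj (h x)) \<in> borel_measurable borel"
    by (rule measurable_compose[OF bdd_measD(1)[OF h] cnj_m])
  have "(\<lambda>x. cnj (h x)) measurable_on UNIV"
    by (rule lebesgue_measurable_imp_measurable_on) (auto intro!: measurable_completion)
  then obtain Z g where Z: "negligible Z" and g: "\<And>n. continuous_on UNIV (g n)"
    and lim: "\<And>x. x \<notin> Z \<Longrightarrow> (\<lambda>n. g n x) \<longlonglongrightarrow> cnj (h x)"
    unfolding measurable_on_def by auto
  \<comment> \<open>The radial truncation to the disc of radius \<open>H\<close> keeps \<open>w n\<close> continuous and fixes the limit.\<close>
  define w where "w n x = g n x * of_real (H / max H (cmod (g n x)))" for n x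
  have max0: "max H (cmod z) \<noteq> 0" for z using H(1) by (auto simp: max_def)
  have wc: "continuous_on UNIV (w n)" for n
    unfolding w_def by (intro continuous_intros g) (use max0 in auto)
  have wb: "cmod (w n x) \<le> H" for n x
  proof -
    have "cmod (w n x) = cmod (g n x) * (H / max H (cmod (g n x)))"
      unfolding w_def norm_mult norm_of_real using H(1) by (simp add: abs_of_nonneg)
    also have "\<dots> \<le> max H (cmod (g n x)) * (H / max H (cmod (g n x)))"
      using H(1) by (intro mult_right_mono) auto
    also have "\<dots> = H" using max0[of "g n x"] by simp
    finally show ?thesis .
  qed
  have bw: "bdd_meas (w n)" for n by (rule bdd_measI[OF borel_measurable_continuous_onI[OF wc] wb])
  note [measurable] = bdd_measD(1)[OF bw]
  obtain Z' where Z': "Z' \<in> null_sets lborel" "Z \<subseteq> Z'"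
    using Z unfolding negligible_iff_null_sets null_sets_completion_iff2 by blast
  have AE: "AE x in lborel. (\<lambda>n. w n x) \<longlonglongrightarrow> cnj (h x)"
  proof (rule AE_I'[OF Z'(1)])
    have "(\<lambda>n. w n x) \<longlonglongrightarrow> cnj (h x)" if "x \<notin> Z" for x
    proof -
      have "(\<lambda>n. w n x) \<longlonglongrightarrow> cnj (h x) * of_real (H / max H (cmod (cnj (h x))))"
        unfolding w_def by (intro tendsto_intros lim[OF that] max0)
      moreover have "max H (cmod (cnj (h x))) = H" using H(2)[of x] by (simp add: max_def)
      ultimately show ?thesis using H(1) by simp
    qed
    then show "{x \<in> space lborel. \<not> (\<lambda>n. w n x) \<longlonglongrightarrow> cnj (h x)} \<subseteq> Z'" using Z'(2) by auto
  qed
  have ig: "integrable lborel (\<lambda>x. cmod (gauss x))" by (intro integrable_norm schwartz_integrable schwartz_gauss)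
  have "(\<lambda>n. \<integral>x. h x * (w n x * gauss x) \<partial>lborel) \<longlonglongrightarrow> (\<integral>x. h x * (cnj (h x) * gauss x) \<partial>lborel)"
  proof (rule integral_dominated_convergence[where w="\<lambda>x. H * (H * cmod (gauss x))"])
    show "integrable lborel (\<lambda>x. H * (H * cmod (gauss x)))" by (intro integrable_mult_right ig)
    show "AE x in lborel. (\<lambda>n. h x * (w n x * gauss x)) \<longlonglongrightarrow> h x * (cnj (h x) * gauss x)"
      using AE by eventually_elim (intro tendsto_intros)
    show "AE x in lborel. norm (h x * (w n x * gauss x)) \<le> H * (H * cmod (gauss x))" for n
      unfolding norm_mult using H wb by (intro AE_I2 mult_mono) (auto intro: less_imp_le)
  qed measurable
  moreover have wz: "(\<integral>x. h x * (w n x * gauss x) \<partial>lborel) = 0" for n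
    by (rule integral_continuous_gauss_0[OF h _ bw wc]) (rule 0)
  ultimately have z: "(\<integral>x. h x * (cnj (h x) * gauss x) \<partial>lborel) = 0"
    unfolding wz LIMSEQ_const_iff by simp
  have e: "h x * (cnj (h x) * gauss x) = of_real ((cmod (h x))\<^sup>2 * cmod (gauss x))" for x
  proof -
    have hh: "h x * cnj (h x) = of_real ((cmod (h x))\<^sup>2)" by (rule complex_norm_square[symmetric])
    have g: "gauss x = of_real (cmod (gauss x))" unfolding gauss_def by simp
    have "h x * (cnj (h x) * gauss x) = of_real ((cmod (h x))\<^sup>2) * gauss x"
      by (simp only: mult.assoc[symmetric] hh)
    also have "\<dots> = of_real ((cmod (h x))\<^sup>2 * cmod (gauss x))"
      by (subst g) (rule of_real_mult[symmetric])
    finally show ?thesis .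
  qed
  have "complex_of_real (\<integral>x. (cmod (h x))\<^sup>2 * cmod (gauss x) \<partial>lborel) = 0"
    using z unfolding e integral_complex_of_real .
  then have z0: "(\<integral>x. (cmod (h x))\<^sup>2 * cmod (gauss x) \<partial>lborel) = 0" by simp
  have "integrable lborel (\<lambda>x. (cmod (h x))\<^sup>2 * cmod (gauss x))"
  proof (rule Bochner_Integration.integrable_bound[OF integrable_mult_right[OF ig, of "H\<^sup>2"]])
    show "AE x in lborel. norm ((cmod (h x))\<^sup>2 * cmod (gauss x)) \<le> norm (H\<^sup>2 * cmod (gauss x))"
      using H by (intro AE_I2) (auto simp: abs_mult intro!: mult_right_mono power_mono)
  qed measurable
  from integral_nonneg_eq_0_iff_AE[OF this] z0
  have "AE x in lborel. (cmod (h x))\<^sup>2 * cmod (gauss x) = 0" by simp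
  then show ?thesis by eventually_elim (simp add: gauss_def)
qed

lemma sconv_L1:
  assumes K: "schwartz K" and g: "schwartz g"
  shows "(\<integral>x. cmod (sconv K g x) \<partial>lborel) \<le> (\<integral>x. cmod (K x) \<partial>lborel) * (\<integral>x. cmod (g x) \<partial>lborel)"
proof -
  have i: "integrable lborel (\<lambda>x. cmod (f x))" if "schwartz f" for f
    by (intro integrable_norm schwartz_integrable that)
  have "Lp_le 1 g (\<integral>x. cmod (g x) \<partial>lborel)"
    unfolding Lp_le_def using nn_integral_eq_integral[OF i[OF g]] schwartz_measurable[OF g] by simp
  from Lp_leD(3)[OF Lp_le_sconv[OF _ schwartz_integrable[OF K] this]]
  show ?thesis
    using nn_integral_eq_integral[OF i[OF schwartz_sconv[OF K g]]] by (simp add: ennreal_le_iff)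
qed

lemma summable_two_sided: "(\<lambda>j::int. 2 powr (- \<bar>real_of_int j\<bar>)) summable_on UNIV"
proof -
  obtain G where G: "G \<ge> 0"
    "\<And>M::int. (\<integral>\<^sup>+l. ennreal (if l \<le> M + 5 then 2 powr (1 * (of_int l - of_int M)) else 0) \<partial>count_space UNIV) \<le> ennreal G"
    using geometric_count[of 1] by auto
  have s: "(\<lambda>l::int. if l \<le> 0 then 2 powr (of_int l + 5) else 0 :: real) summable_on UNIV"
    using nn_count_le_imp_summable(1)[OF _ G(2)[of "-5"] G(1)] by (simp cong: if_cong)
  have "(\<lambda>l::int. if - l \<le> 0 then 2 powr (of_int (- l) + 5) else 0 :: real) summable_on UNIV"
    by (rule summable_on_reindex_bij_betw[where g=uminus and f="\<lambda>l::int. if l \<le> 0 then 2 powr (of_int l + 5) else 0 :: real", THEN iffD2])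
       (auto intro: s bij_uminus)
  from summable_on_add[OF s this] show ?thesis
    by (rule summable_on_le(1)[rotated]) (auto simp: powr_add)
qed

lemma fourier_reflect_0:
  assumes "schwartz K"
  shows "schwartz (\<lambda>w. K (- w))" "fourier (\<lambda>w. K (- w)) \<xi> = fourier K (- \<xi>)"
proof -
  show "schwartz (\<lambda>w. K (- w))" using schwartz_reflect[OF assms, of 0] by simp
  show "fourier (\<lambda>w. K (- w)) \<xi> = fourier K (- \<xi>)"
    using fourier_scale[OF assms, of "-1" \<xi>] by simp
qed

context littlewood_paley_function
begin

lemma hat_0: "hat j 0 = 0"
  using hat_support(1)[of j 0] by (cases "hat j 0 = 0") (auto simp: not_le[symmetric])

lemma ker_cong: "(\<And>\<xi>. \<xi> \<noteq> 0 \<Longrightarrow> m \<xi> = n \<xi>) \<Longrightarrow> ker m j = ker n j"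
  unfolding ker_def by (rule arg_cong[where f=inv_fourier]) (metis hat_0 mult_zero_right)

lemma hat_partial_sum:
  assumes "finite A"
  shows "(\<Sum>j\<in>A. cmod (hat j \<xi>)) \<le> 1"
proof (cases "\<xi> = 0")
  case True
  then show ?thesis by (simp add: hat_0)
next
  case False
  have e: "cmod (hat j \<xi>) = Re (hat j \<xi>)" for j
    using hat_range(2,3)[of j \<xi>] by (metis abs_of_nonneg norm_of_real)
  have "((\<lambda>j. Re (hat j \<xi>)) has_sum Re 1) UNIV" by (rule has_sum_Re[OF hat_has_sum[OF False]])
  then have "(\<Sum>j\<in>A. Re (hat j \<xi>)) \<le> Re 1"
    by (rule finite_sum_le_has_sum) (use assms hat_range(3) in auto)
  then show ?thesis by (simp add: e)
qed

section \<open>The symbols of the equation\<close>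

text \<open>The symbols of \<open>\<partial>\<^sub>k\<close>, of the Riesz transform \<open>\<partial>\<^sub>k (-\<Delta>)\<^bsup>-1/2\<^esup>\<close>, and of component \<open>k\<close> of \<open>\<nabla>\<^sup>\<bottom> (-\<Delta>)\<^bsup>-1/2\<^esup>\<close>.\<close>

definition deriv_symbol :: "2 \<Rightarrow> plane \<Rightarrow> complex" where
  "deriv_symbol k = (\<lambda>\<xi>. \<i> * of_real (\<xi> $ k))"

definition riesz_symbol :: "2 \<Rightarrow> plane \<Rightarrow> complex" where
  "riesz_symbol k = (\<lambda>\<xi>. deriv_symbol k \<xi> * normpow (- 1) \<xi>)"

definition velocity_symbol :: "2 \<Rightarrow> plane \<Rightarrow> complex" where
  "velocity_symbol k = (\<lambda>\<xi>. (if k = 1 then 1 else - 1) * riesz_symbol (if k = 1 then 2 else 1) \<xi>)"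

lemma admissible_deriv_symbol: "admissible (deriv_symbol k)"
  unfolding deriv_symbol_def by (intro admissible_mult admissible_const admissible_coord)

lemma admissible_riesz_symbol: "admissible (riesz_symbol k)"
  unfolding riesz_symbol_def by (intro admissible_mult admissible_deriv_symbol admissible_normpow)

lemma admissible_velocity_symbol: "admissible (velocity_symbol k)"
  unfolding velocity_symbol_def by (intro admissible_mult admissible_const admissible_riesz_symbol)

lemma homogeneous_deriv_symbol: "homogeneous 1 (deriv_symbol k)"
  using homogeneous_mult[OF homogeneous_const homogeneous_coord] unfolding deriv_symbol_def by simp

lemma homogeneous_riesz_symbol: "homogeneous 0 (riesz_symbol k)"
  using homogeneous_mult[OF homogeneous_deriv_symbol homogeneous_normpow[of "- 1"]] unfolding riesz_symbol_def by simp

lemma homogeneous_velocity_symbol: "homogeneous 0 (velocity_symbol k)"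
  using homogeneous_mult[OF homogeneous_const homogeneous_riesz_symbol] unfolding velocity_symbol_def by simp

lemma pd_ker_inv: "pd k (ker (normpow (- 1)) j) = ker (riesz_symbol k) j"
  unfolding riesz_symbol_def deriv_symbol_def by (rule pd_ker[OF admissible_normpow])

lemma velocity_ker: "perp_grad k (frac_lap (- 1 / 2) (lp_block \<phi> j)) = ker (velocity_symbol k) j"
proof -
  have f: "frac_lap (- 1 / 2) (lp_block \<phi> j) = ker (normpow (- 1)) j" by (simp add: frac_lap_lp_block)
  show ?thesis
    unfolding f perp_grad_def pd_ker_inv velocity_symbol_def by (rule ext) (simp add: ker_cmult[of "- 1", simplified] )
qed

lemma dissipation_ker: "frac_lap (1 / 2) (lp_block \<phi> j) = ker (normpow 1) j"
  by (simp add: frac_lap_lp_block)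

lemma ker_normpow_cancel: "ker (\<lambda>\<xi>. normpow (- 1) \<xi> * normpow 1 \<xi>) j = ker one_symbol j" "ker (\<lambda>\<xi>. normpow 1 \<xi> * normpow (- 1) \<xi>) j = ker one_symbol j"
  by (rule ker_cong, simp add: powr_minus flip: of_real_mult)+

lemma ker_normpow_riesz_symbol: "ker (\<lambda>\<xi>. normpow 1 \<xi> * riesz_symbol k \<xi>) j = ker (deriv_symbol k) j"
  by (rule ker_cong) (simp add: riesz_symbol_def powr_minus)

section \<open>Littlewood--Paley decomposition of a divergence\<close>

context
  fixes g :: "plane \<Rightarrow> complex" and k :: 2
  assumes g: "schwartz g"
begin

text \<open>The pairing of \<open>g\<close> with the block at \<open>j\<close> of \<open>\<partial>\<^sub>k F\<close> is the pairing of \<open>F\<close> with this function, obtained by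
  letting the kernel act on \<open>g\<close> instead of \<open>F\<close>.\<close>

definition divker :: "int \<Rightarrow> plane \<Rightarrow> complex" where
  "divker j = sconv (\<lambda>w. ker (deriv_symbol k) j (- w)) g"

lemma schwartz_divker: "schwartz (divker j)"
  unfolding divker_def by (intro schwartz_sconv fourier_reflect_0 schwartz_ker admissible_deriv_symbol g)

lemma fourier_divker: "fourier (divker j) \<xi> = hat j (- \<xi>) * (- fourier (pd k g) \<xi>)"
  unfolding divker_def
  by (simp add: fourier_sconv fourier_reflect_0 schwartz_ker admissible_deriv_symbol g fourier_ker fourier_pd)
     (simp add: deriv_symbol_def)

text \<open>Fourier inversion for \<open>\<partial>\<^sub>k g\<close>, with the cut-offs summed under the integral. The factor \<open>\<xi>\<^sub>k\<close> removes the
  frequency \<open>0\<close>, where the cut-offs do not add up to \<open>1\<close>.\<close>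

lemma divker_has_sum: "((\<lambda>j. divker j z) has_sum (- pd k g z)) UNIV"
proof -
  let ?f = "fourier (pd k g)"
  have sf: "schwartz ?f" by (intro schwartz_fourier schwartz_pd g)
  have sd: "schwartz (fourier (divker j))" for j by (intro schwartz_fourier schwartz_divker)
  let ?F = "\<lambda>j \<xi>. cis (z \<bullet> \<xi>) * fourier (divker j) \<xi>"
  have iF: "integrable lborel (?F j)" for j
    using fourier_integrand_integrable[OF sd, of "- z" j] by (simp add: inner_commute)
  have if': "integrable lborel (\<lambda>\<xi>. cmod (?f \<xi>))" by (intro integrable_norm schwartz_integrable sf)
  let ?c = "\<lambda>j. \<integral>\<xi>. cmod (?F j \<xi>) \<partial>lborel"
  have cs: "?c summable_on UNIV"
  proof (rule nonneg_bdd_above_summable_on)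
    show "bdd_above (sum ?c ` {A. A \<subseteq> UNIV \<and> finite A})"
    proof (rule bdd_aboveI2[where M="\<integral>\<xi>. cmod (?f \<xi>) \<partial>lborel"])
      fix A :: "int set" assume "A \<in> {A. A \<subseteq> UNIV \<and> finite A}"
      then have A: "finite A" by simp
      have "(\<Sum>j\<in>A. ?c j) = (\<integral>\<xi>. (\<Sum>j\<in>A. cmod (?F j \<xi>)) \<partial>lborel)"
        by (rule Bochner_Integration.integral_sum[symmetric]) (intro integrable_norm iF)
      also have "\<dots> \<le> (\<integral>\<xi>. cmod (?f \<xi>) \<partial>lborel)"
      proof (rule integral_mono[OF _ if'])
        show "integrable lborel (\<lambda>\<xi>. \<Sum>j\<in>A. cmod (?F j \<xi>))"
          by (intro Bochner_Integration.integrable_sum integrable_norm iF)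
        fix \<xi>
        have "(\<Sum>j\<in>A. cmod (?F j \<xi>)) = (\<Sum>j\<in>A. cmod (hat j (- \<xi>))) * cmod (?f \<xi>)"
          by (simp add: fourier_divker norm_mult sum_distrib_right)
        also have "\<dots> \<le> 1 * cmod (?f \<xi>)" by (intro mult_right_mono hat_partial_sum A) simp
        finally show "(\<Sum>j\<in>A. cmod (?F j \<xi>)) \<le> cmod (?f \<xi>)" by simp
      qed
      finally show "(\<Sum>j\<in>A. ?c j) \<le> (\<integral>\<xi>. cmod (?f \<xi>) \<partial>lborel)" .
    qed
  qed auto
  have "((\<lambda>j. \<integral>\<xi>. ?F j \<xi> \<partial>lborel) has_sum (\<integral>\<xi>. cis (z \<bullet> \<xi>) * (- ?f \<xi>) \<partial>lborel)) UNIV"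
  proof (rule has_sum_integral_L1[OF iF order_refl cs])
    fix \<xi>
    show "((\<lambda>j. ?F j \<xi>) has_sum (cis (z \<bullet> \<xi>) * (- ?f \<xi>))) UNIV"
    proof (cases "\<xi> = 0")
      case True
      then have "?f \<xi> = 0" by (simp add: fourier_pd[OF g])
      then show ?thesis by (simp add: fourier_divker)
    next
      case False
      then have "((\<lambda>j. hat j (- \<xi>)) has_sum 1) UNIV" by (intro hat_has_sum) simp
      from has_sum_cmult_left[OF this, of "cis (z \<bullet> \<xi>) * (- ?f \<xi>)"] show ?thesis
        unfolding fourier_divker by (simp add: mult_ac)
    qed
  qed
  moreover have "(\<integral>\<xi>. cis (z \<bullet> \<xi>) * (- ?f \<xi>) \<partial>lborel) = (2 * of_real pi)\<^sup>2 * (- pd k g z)"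
    using fourier_inversion_integral[OF schwartz_pd[OF g], of z k] by simp
  ultimately have "((\<lambda>j. (2 * of_real pi)\<^sup>2 * divker j z) has_sum ((2 * of_real pi)\<^sup>2 * (- pd k g z))) UNIV"
    unfolding fourier_inversion_integral[OF schwartz_divker] by simp
  from has_sum_cmult_right[OF this, of "1 / (2 * of_real pi)\<^sup>2"] show ?thesis by simp
qed

text \<open>At low frequencies the derivative on the kernel gains a factor \<open>2\<^sup>j\<close>. At high frequencies the kernel
  is a Laplacian, as \<open>\<phi>\<^sub>j = - \<Delta> ((-\<Delta>)\<^bsup>-1\<^esup> \<phi>\<^sub>j)\<close>; moving it to \<open>g\<close> gains a factor \<open>2\<^bsup>-2j\<^esup>\<close>.\<close>

lemma divker_L1: "\<exists>C\<ge>0. \<forall>j. (\<integral>z. cmod (divker j z) \<partial>lborel) \<le> C * 2 powr (- \<bar>real_of_int j\<bar>)"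
proof -
  define g2 where "g2 = (\<lambda>x. \<Sum>i\<in>UNIV. pd i (pd i (pd k g)) x)"
  have sg2: "schwartz g2" unfolding g2_def by (intro schwartz_sum schwartz_pd g)
  have fg2: "fourier g2 \<xi> = - of_real (\<xi> \<bullet> \<xi>) * fourier (pd k g) \<xi>" for \<xi>
  proof -
    have "fourier g2 \<xi> = (\<Sum>i\<in>UNIV. fourier (pd i (pd i (pd k g))) \<xi>)"
      unfolding g2_def fourier_def using g
      by (simp add: sum_distrib_left fourier_integrand_integrable schwartz_pd)
    also have "\<dots> = (\<Sum>i\<in>UNIV. - of_real (\<xi> $ i * \<xi> $ i) * fourier (pd k g) \<xi>)"
    proof (intro sum.cong refl)
      fix i
      have ii: "\<i> * a * (\<i> * a * X) = - (a * a) * X" for a X :: complex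
      proof -
        have "\<i> * a * (\<i> * a * X) = (\<i> * \<i>) * (a * a * X)" by (simp only: mult_ac)
        then show ?thesis by simp
      qed
      show "fourier (pd i (pd i (pd k g))) \<xi> = - of_real (\<xi> $ i * \<xi> $ i) * fourier (pd k g) \<xi>"
        unfolding fourier_pd[OF schwartz_pd[OF schwartz_pd[OF g]]] fourier_pd[OF schwartz_pd[OF g]] ii by simp
    qed
    also have "\<dots> = - of_real (\<xi> \<bullet> \<xi>) * fourier (pd k g) \<xi>"
      by (simp add: inner_vec_def sum_distrib_right sum_negf)
    finally show ?thesis .
  qed
  let ?K = "ker (normpow (- 2))"
  have sK: "schwartz (\<lambda>w. ?K j (- w))" for j by (intro fourier_reflect_0 schwartz_ker admissible_normpow)
  have alt: "divker j = sconv (\<lambda>w. ?K j (- w)) g2" for j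
  proof (rule fourier_inj[OF schwartz_divker schwartz_sconv[OF sK sg2]])
    fix \<xi>
    have "fourier (sconv (\<lambda>w. ?K j (- w)) g2) \<xi> = (normpow (- 2) (- \<xi>) * hat j (- \<xi>)) * (- of_real (\<xi> \<bullet> \<xi>) * fourier (pd k g) \<xi>)"
      by (simp add: fourier_sconv sK sg2 fourier_reflect_0 schwartz_ker admissible_normpow fourier_ker fg2)
    also have "\<dots> = fourier (divker j) \<xi>"
    proof (cases "\<xi> = 0")
      case False
      have "normpow (- 2) (- \<xi>) * of_real (\<xi> \<bullet> \<xi>) = (1 :: complex)"
        using False by (simp add: powr_minus dot_square_norm flip: of_real_mult)
      then have "(normpow (- 2) (- \<xi>) * of_real (\<xi> \<bullet> \<xi>)) * (hat j (- \<xi>) * (- fourier (pd k g) \<xi>)) = fourier (divker j) \<xi>"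
        unfolding fourier_divker by (simp only: mult_1)
      then show ?thesis by (simp add: mult_ac)
    qed (simp add: fourier_divker hat_0)
    finally show "fourier (divker j) \<xi> = fourier (sconv (\<lambda>w. ?K j (- w)) g2) \<xi>" ..
  qed
  have refl: "(\<integral>w. cmod (f (- w)) \<partial>lborel) = L1 f" if "schwartz f" for f
    using integral_reflect[of "\<lambda>w. of_real (cmod (f w))" 0] schwartz_measurable[OF that] unfolding L1_def by simp
  define A where "A = L1 (ker (deriv_symbol k) 0) * L1 g"
  define B where "B = L1 (?K 0) * L1 g2"
  have AB: "A \<ge> 0" "B \<ge> 0" unfolding A_def B_def by (simp_all add: L1_nonneg)
  have low: "(\<integral>z. cmod (divker j z) \<partial>lborel) \<le> 2 powr (1 * of_int j) * A" for j
  proof -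
    have "(\<integral>z. cmod (divker j z) \<partial>lborel) \<le> L1 (ker (deriv_symbol k) j) * L1 g"
      unfolding divker_def using sconv_L1[OF fourier_reflect_0(1)[OF schwartz_ker[OF admissible_deriv_symbol]] g, of k j]
      by (simp add: refl schwartz_ker admissible_deriv_symbol) (simp add: L1_def)
    then show ?thesis unfolding ker_L1[OF admissible_deriv_symbol homogeneous_deriv_symbol, of k j] A_def by (simp add: mult.assoc)
  qed
  have high: "(\<integral>z. cmod (divker j z) \<partial>lborel) \<le> 2 powr (- 2 * of_int j) * B" for j
  proof -
    have "(\<integral>z. cmod (divker j z) \<partial>lborel) \<le> L1 (?K j) * L1 g2"
      unfolding alt using sconv_L1[OF sK sg2, of j]
      by (simp add: refl schwartz_ker admissible_normpow) (simp add: L1_def)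
    then show ?thesis unfolding ker_L1[OF admissible_normpow homogeneous_normpow, of "- 2" j] B_def by (simp add: mult.assoc)
  qed
  have "(\<integral>z. cmod (divker j z) \<partial>lborel) \<le> (A + B) * 2 powr (- \<bar>real_of_int j\<bar>)" for j
  proof (cases "j \<le> 0")
    case True
    then have "(\<integral>z. cmod (divker j z) \<partial>lborel) \<le> A * 2 powr (- \<bar>real_of_int j\<bar>)" using low[of j] by (simp add: mult.commute)
    also have "\<dots> \<le> (A + B) * 2 powr (- \<bar>real_of_int j\<bar>)" using AB by (intro mult_right_mono) auto
    finally show ?thesis .
  next
    case False
    have "(\<integral>z. cmod (divker j z) \<partial>lborel) \<le> 2 powr (- 2 * of_int j) * B" by (rule high)
    also have "\<dots> \<le> 2 powr (- \<bar>real_of_int j\<bar>) * B" using AB False by (intro mult_right_mono powr_mono) auto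
    also have "\<dots> \<le> (A + B) * 2 powr (- \<bar>real_of_int j\<bar>)" using AB by (simp add: mult.commute)
    finally show ?thesis .
  qed
  then show ?thesis using AB by (intro exI[of _ "A + B"]) auto
qed

text \<open>For a merely bounded \<open>F\<close> the series of blocks may fail to represent \<open>F\<close>, whose low frequencies are
  uncontrolled, but it always represents the derivatives of \<open>F\<close>.\<close>

lemma divergence_pairing:
  assumes F: "bdd_meas F"
  shows "((\<lambda>j. pairing (conv (ker (deriv_symbol k) j) (distr_of F)) g) has_sum (- pairing F (pd k g))) UNIV"
proof -
  obtain B where B: "B \<ge> 0" "\<And>x. cmod (F x) \<le> B" using bdd_measD(2)[OF F] by blast
  obtain C where C: "C \<ge> 0" "\<And>j. (\<integral>z. cmod (divker j z) \<partial>lborel) \<le> C * 2 powr (- \<bar>real_of_int j\<bar>)"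
    using divker_L1 by blast
  have eq: "pairing (conv (ker (deriv_symbol k) j) (distr_of F)) g = (\<integral>z. divker j z * F z \<partial>lborel)" for j
  proof -
    let ?L = "ker (deriv_symbol k) j"
    have sL: "schwartz ?L" by (intro schwartz_ker admissible_deriv_symbol)
    have "pairing (conv ?L (distr_of F)) g = (\<integral>y. g y * (\<integral>z. ?L (y - z) * F z \<partial>lborel) \<partial>lborel)"
      unfolding pairing_def conv_distr_of[OF sL] sconv_def by (simp add: mult.commute)
    also have "\<dots> = (\<integral>z. (\<integral>y. g y * ?L (y - z) \<partial>lborel) * F z \<partial>lborel)"
      by (rule Fubini_conv(1)[OF schwartz_integrable[OF g] schwartz_integrable[OF sL] bdd_measD(1)[OF F] B(2)])
    also have "(\<lambda>z. (\<integral>y. g y * ?L (y - z) \<partial>lborel) * F z) = (\<lambda>z. divker j z * F z)"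
      unfolding divker_def sconv_def by (simp add: mult.commute)
    finally show ?thesis .
  qed
  have i: "integrable lborel (\<lambda>z. divker j z * F z)" for j
    by (rule bdd_meas_integrable[OF F schwartz_integrable[OF schwartz_divker]])
  have "((\<lambda>j. \<integral>z. divker j z * F z \<partial>lborel) has_sum (\<integral>z. (- pd k g z) * F z \<partial>lborel)) UNIV"
  proof (rule has_sum_integral_L1[OF i])
    show "(\<lambda>j::int. B * (C * 2 powr (- \<bar>real_of_int j\<bar>))) summable_on UNIV"
      by (intro summable_on_cmult_right summable_two_sided)
    show "(\<integral>z. cmod (divker j z * F z) \<partial>lborel) \<le> B * (C * 2 powr (- \<bar>real_of_int j\<bar>))" for j
    proof -
      have "(\<integral>z. cmod (divker j z * F z) \<partial>lborel) \<le> (\<integral>z. B * cmod (divker j z) \<partial>lborel)"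
      proof (rule integral_mono)
        show "integrable lborel (\<lambda>z. cmod (divker j z * F z))" by (intro integrable_norm i)
        show "integrable lborel (\<lambda>z. B * cmod (divker j z))"
          by (intro integrable_mult_right integrable_norm schwartz_integrable schwartz_divker)
        show "cmod (divker j z * F z) \<le> B * cmod (divker j z)" for z
          unfolding norm_mult mult.commute[of B] by (intro mult_left_mono B) simp
      qed
      also have "\<dots> = B * (\<integral>z. cmod (divker j z) \<partial>lborel)" by simp
      also have "\<dots> \<le> B * (C * 2 powr (- \<bar>real_of_int j\<bar>))" by (intro mult_left_mono C B)
      finally show ?thesis .
    qed
    show "((\<lambda>j. divker j z * F z) has_sum (- pd k g z) * F z) UNIV" for z
      by (rule has_sum_cmult_left[OF divker_has_sum])
  qed
  moreover have "(\<integral>z. (- pd k g z) * F z \<partial>lborel) = - pairing F (pd k g)"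
    unfolding pairing_def by (simp add: mult.commute)
  ultimately show ?thesis unfolding eq by simp
qed

end

end

lemma pd_reflect:
  assumes "schwartz K"
  shows "pd k (\<lambda>y. K (x - y)) y = - pd k K (x - y)"
  using pd_affine[OF schwartz_differentiable[OF assms], of k "-1" x y] by simp

lemma pairing_minus2: "pairing F (\<lambda>y. - g y) = - pairing F g"
  unfolding pairing_def by simp

context besov_setting
begin

section \<open>The equation as a fixed point problem\<close>

definition velocity_fun :: "2 \<Rightarrow> (plane \<Rightarrow> complex) \<Rightarrow> plane \<Rightarrow> complex" where
  "velocity_fun k \<Theta> = multiplier (velocity_symbol k) (distr_of \<Theta>)"

definition flux :: "2 \<Rightarrow> (plane \<Rightarrow> complex) \<Rightarrow> (plane \<Rightarrow> complex) \<Rightarrow> plane \<Rightarrow> complex" where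
  "flux k \<Theta> \<Psi> = (\<lambda>x. velocity_fun k \<Theta> x * \<Psi> x)"

text \<open>This is \<open>(-\<Delta>)\<^bsup>-1/2\<^esup> div (v \<Psi>)\<close> with the velocity \<open>v\<close> of \<open>\<Theta>\<close>. As a single multiplier of degree \<open>0\<close>,
  \<open>(-\<Delta>)\<^bsup>-1/2\<^esup> div\<close> keeps the regularity \<open>2/p\<close> of the flux.\<close>

definition bilinear :: "(plane \<Rightarrow> complex) \<Rightarrow> (plane \<Rightarrow> complex) \<Rightarrow> plane \<Rightarrow> complex" where
  "bilinear \<Theta> \<Psi> = (\<lambda>x. multiplier (riesz_symbol 1) (distr_of (flux 1 \<Theta> \<Psi>)) x + multiplier (riesz_symbol 2) (distr_of (flux 2 \<Theta> \<Psi>)) x)"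

definition inv_half_lap :: "distr \<Rightarrow> plane \<Rightarrow> complex" where
  "inv_half_lap f = multiplier (normpow (- 1)) f"

definition fixed_point_map :: "distr \<Rightarrow> (plane \<Rightarrow> complex) \<Rightarrow> plane \<Rightarrow> complex" where
  "fixed_point_map f \<Theta> = (\<lambda>x. inv_half_lap f x - bilinear \<Theta> \<Theta> x)"

lemma inv_degree: "2 / p - 1 = - 1 + 2 / p" by simp

lemma bdd_meas_velocity_fun: "\<Theta> \<in> besov_fun \<Longrightarrow> bdd_meas (velocity_fun k \<Theta>)"
  unfolding velocity_fun_def by (rule bdd_meas_multiplier[OF admissible_velocity_symbol homogeneous_velocity_symbol one_symbol_degree besov_fun_D(4)])

lemma bdd_meas_flux: "\<Theta> \<in> besov_fun \<Longrightarrow> \<Psi> \<in> besov_fun \<Longrightarrow> bdd_meas (flux k \<Theta> \<Psi>)"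
  unfolding flux_def by (intro bdd_meas_mult bdd_meas_velocity_fun besov_fun_D(1))

lemma flux_estimate:
  shows "\<exists>C\<ge>0. \<forall>\<Theta>\<in>besov_fun. \<forall>\<Psi>\<in>besov_fun. \<exists>\<kappa>. besov_le (2 / p) (distr_of (flux k \<Theta> \<Psi>)) \<kappa> \<and> infsum \<kappa> UNIV \<le> C * fnorm \<Theta> * fnorm \<Psi>"
proof -
  from product_estimate[OF admissible_velocity_symbol homogeneous_velocity_symbol, of k]
  obtain C where C: "C \<ge> 0" "\<forall>u v \<beta> \<gamma>. besov_le (2 / p) u \<beta> \<longrightarrow> besov_le (2 / p) v \<gamma> \<longrightarrow>
    (\<exists>\<kappa>. besov_le (2 / p) (distr_of (\<lambda>x. multiplier (velocity_symbol k) u x * multiplier one_symbol v x)) \<kappa> \<and> infsum \<kappa> UNIV \<le> C * infsum \<beta> UNIV * infsum \<gamma> UNIV)"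
    by (elim exE conjE) (rule that)
  have "\<exists>\<kappa>. besov_le (2 / p) (distr_of (flux k \<Theta> \<Psi>)) \<kappa> \<and> infsum \<kappa> UNIV \<le> C * fnorm \<Theta> * fnorm \<Psi>" if T: "\<Theta> \<in> besov_fun" and P: "\<Psi> \<in> besov_fun" for \<Theta> \<Psi>
    using C(2)[rule_format, OF besov_fun_D(4)[OF T] besov_fun_D(4)[OF P]] unfolding besov_fun_D(3)[OF P] besov_fun_D(5)[OF T] besov_fun_D(5)[OF P] flux_def velocity_fun_def .
  then show ?thesis using C(1) by blast
qed

lemma flux_besov_le:
  assumes "\<Theta> \<in> besov_fun" "\<Psi> \<in> besov_fun"
  obtains \<kappa> where "besov_le (2 / p) (distr_of (flux k \<Theta> \<Psi>)) \<kappa>"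
  using flux_estimate[of k] assms by blast

lemma besov_fun_flux_term:
  assumes "\<Theta> \<in> besov_fun" "\<Psi> \<in> besov_fun"
  shows "multiplier (riesz_symbol k) (distr_of (flux k \<Theta> \<Psi>)) \<in> besov_fun"
  using flux_besov_le[OF assms, of k] besov_fun_multiplier(1)[OF admissible_riesz_symbol homogeneous_riesz_symbol one_symbol_degree] by metis

lemma besov_fun_bilinear: "\<Theta> \<in> besov_fun \<Longrightarrow> \<Psi> \<in> besov_fun \<Longrightarrow> bilinear \<Theta> \<Psi> \<in> besov_fun"
  unfolding bilinear_def by (intro besov_fun_add(1) besov_fun_flux_term)

lemma bilinear_estimate: "\<exists>C\<ge>0. \<forall>\<Theta>\<in>besov_fun. \<forall>\<Psi>\<in>besov_fun. fnorm (bilinear \<Theta> \<Psi>) \<le> C * fnorm \<Theta> * fnorm \<Psi>"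
proof -
  have "\<exists>C\<ge>0. \<forall>\<Theta>\<in>besov_fun. \<forall>\<Psi>\<in>besov_fun. fnorm (multiplier (riesz_symbol k) (distr_of (flux k \<Theta> \<Psi>))) \<le> C * fnorm \<Theta> * fnorm \<Psi>" for k
  proof -
    obtain C where C: "C \<ge> 0" "\<And>\<Theta> \<Psi>. \<Theta> \<in> besov_fun \<Longrightarrow> \<Psi> \<in> besov_fun \<Longrightarrow> \<exists>\<kappa>. besov_le (2 / p) (distr_of (flux k \<Theta> \<Psi>)) \<kappa> \<and> infsum \<kappa> UNIV \<le> C * fnorm \<Theta> * fnorm \<Psi>"
      using flux_estimate[of k] by blast
    have B: "block_const (riesz_symbol k) 0 \<ge> 0" by (rule block_const(1)[OF admissible_riesz_symbol homogeneous_riesz_symbol])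
    have "fnorm (multiplier (riesz_symbol k) (distr_of (flux k \<Theta> \<Psi>))) \<le> (block_const (riesz_symbol k) 0 * C) * fnorm \<Theta> * fnorm \<Psi>" if T: "\<Theta> \<in> besov_fun" and P: "\<Psi> \<in> besov_fun" for \<Theta> \<Psi>
    proof -
      obtain \<kappa> where \<kappa>: "besov_le (2 / p) (distr_of (flux k \<Theta> \<Psi>)) \<kappa>" "infsum \<kappa> UNIV \<le> C * fnorm \<Theta> * fnorm \<Psi>" using C(2)[OF T P] by blast
      have "fnorm (multiplier (riesz_symbol k) (distr_of (flux k \<Theta> \<Psi>))) \<le> block_const (riesz_symbol k) 0 * infsum \<kappa> UNIV"
        by (rule besov_fun_multiplier(2)[OF admissible_riesz_symbol homogeneous_riesz_symbol one_symbol_degree \<kappa>(1)])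
      also have "\<dots> \<le> block_const (riesz_symbol k) 0 * (C * fnorm \<Theta> * fnorm \<Psi>)" by (rule mult_left_mono[OF \<kappa>(2) B])
      finally show ?thesis by (simp add: mult.assoc)
    qed
    then show ?thesis using B C(1) by (intro exI[of _ "block_const (riesz_symbol k) 0 * C"]) auto
  qed
  then obtain C where C0: "\<And>k. C k \<ge> 0" and C: "\<And>k \<Theta> \<Psi>. \<Theta> \<in> besov_fun \<Longrightarrow> \<Psi> \<in> besov_fun \<Longrightarrow> fnorm (multiplier (riesz_symbol k) (distr_of (flux k \<Theta> \<Psi>))) \<le> C k * fnorm \<Theta> * fnorm \<Psi>"
    by metis
  have "fnorm (bilinear \<Theta> \<Psi>) \<le> (C 1 + C 2) * fnorm \<Theta> * fnorm \<Psi>" if T: "\<Theta> \<in> besov_fun" and P: "\<Psi> \<in> besov_fun" for \<Theta> \<Psi>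
    using besov_fun_add(2)[OF besov_fun_flux_term[OF T P, of 1] besov_fun_flux_term[OF T P, of 2]] C[OF T P, of 1] C[OF T P, of 2]
    unfolding bilinear_def by (simp add: distrib_right)
  then show ?thesis using C0[of 1] C0[of 2] by (intro exI[of _ "C 1 + C 2"]) auto
qed

lemma velocity_fun_diff:
  assumes T: "\<Theta> \<in> besov_fun" and T': "\<Theta>' \<in> besov_fun"
  shows "velocity_fun k (\<lambda>x. \<Theta> x - \<Theta>' x) = (\<lambda>x. velocity_fun k \<Theta> x - velocity_fun k \<Theta>' x)"
  unfolding velocity_fun_def besov_fun_diff(3)[OF T T']
  by (rule multiplier_minus[OF admissible_velocity_symbol homogeneous_velocity_symbol one_symbol_degree besov_fun_D(4)[OF T] besov_fun_D(4)[OF T']])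

lemma flux_term_diff:
  assumes T: "\<Theta> \<in> besov_fun" "\<Psi> \<in> besov_fun" and T': "\<Theta>' \<in> besov_fun" "\<Psi>' \<in> besov_fun" and D: "\<Theta>'' \<in> besov_fun" "\<Psi>'' \<in> besov_fun"
    and e: "flux k \<Theta>'' \<Psi>'' = (\<lambda>x. flux k \<Theta> \<Psi> x - flux k \<Theta>' \<Psi>' x)"
  shows "multiplier (riesz_symbol k) (distr_of (flux k \<Theta>'' \<Psi>'')) = (\<lambda>x. multiplier (riesz_symbol k) (distr_of (flux k \<Theta> \<Psi>)) x - multiplier (riesz_symbol k) (distr_of (flux k \<Theta>' \<Psi>')) x)"
proof -
  obtain \<kappa> \<kappa>' where \<kappa>: "besov_le (2 / p) (distr_of (flux k \<Theta> \<Psi>)) \<kappa>" "besov_le (2 / p) (distr_of (flux k \<Theta>' \<Psi>')) \<kappa>'"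
    using flux_besov_le[OF T] flux_besov_le[OF T'] by metis
  show ?thesis
    unfolding e distr_of_diff[OF bdd_meas_flux[OF T] bdd_meas_flux[OF T']]
    by (rule multiplier_minus[OF admissible_riesz_symbol homogeneous_riesz_symbol one_symbol_degree \<kappa>])
qed

lemma bilinear_diff:
  assumes T: "\<Theta> \<in> besov_fun" and T': "\<Theta>' \<in> besov_fun" and P: "\<Psi> \<in> besov_fun"
  shows "bilinear (\<lambda>x. \<Theta> x - \<Theta>' x) \<Psi> = (\<lambda>x. bilinear \<Theta> \<Psi> x - bilinear \<Theta>' \<Psi> x)"
    and "bilinear \<Psi> (\<lambda>x. \<Theta> x - \<Theta>' x) = (\<lambda>x. bilinear \<Psi> \<Theta> x - bilinear \<Psi> \<Theta>' x)"
proof -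
  note D = besov_fun_diff(1)[OF T T']
  have e1: "flux k (\<lambda>x. \<Theta> x - \<Theta>' x) \<Psi> = (\<lambda>x. flux k \<Theta> \<Psi> x - flux k \<Theta>' \<Psi> x)" for k
    unfolding flux_def velocity_fun_diff[OF T T'] by (simp add: left_diff_distrib)
  have e2: "flux k \<Psi> (\<lambda>x. \<Theta> x - \<Theta>' x) = (\<lambda>x. flux k \<Psi> \<Theta> x - flux k \<Psi> \<Theta>' x)" for k
    unfolding flux_def by (simp add: right_diff_distrib)
  show "bilinear (\<lambda>x. \<Theta> x - \<Theta>' x) \<Psi> = (\<lambda>x. bilinear \<Theta> \<Psi> x - bilinear \<Theta>' \<Psi> x)"
    unfolding bilinear_def flux_term_diff[OF T P T' P D P e1] by (simp add: fun_eq_iff)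
  show "bilinear \<Psi> (\<lambda>x. \<Theta> x - \<Theta>' x) = (\<lambda>x. bilinear \<Psi> \<Theta> x - bilinear \<Psi> \<Theta>' x)"
    unfolding bilinear_def flux_term_diff[OF P T P T' P D e2] by (simp add: fun_eq_iff)
qed

lemma besov_fun_inv_half_lap:
  assumes "f \<in> besov \<phi> p (2 / p - 1)"
  shows "inv_half_lap f \<in> besov_fun" "fnorm (inv_half_lap f) \<le> block_const (normpow (- 1)) (- 1) * besov_norm \<phi> p (2 / p - 1) f"
  using besov_fun_multiplier[OF admissible_normpow homogeneous_normpow inv_degree besov_le_weighted_block[OF assms]]
  unfolding inv_half_lap_def besov_norm_weighted_block .

lemma inv_half_lap_diff:
  assumes "f \<in> besov \<phi> p (2 / p - 1)" "f' \<in> besov \<phi> p (2 / p - 1)"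
  shows "inv_half_lap (f - f') = (\<lambda>x. inv_half_lap f x - inv_half_lap f' x)"
  unfolding inv_half_lap_def
  by (rule multiplier_minus[OF admissible_normpow homogeneous_normpow inv_degree besov_le_weighted_block[OF assms(1)] besov_le_weighted_block[OF assms(2)]])

lemma besov_fun_fixed_point_map: "f \<in> besov \<phi> p (2 / p - 1) \<Longrightarrow> \<Theta> \<in> besov_fun \<Longrightarrow> fixed_point_map f \<Theta> \<in> besov_fun"
  unfolding fixed_point_map_def by (intro besov_fun_diff(1) besov_fun_inv_half_lap besov_fun_bilinear)

lemma fixed_point_map_diff:
  assumes f: "f \<in> besov \<phi> p (2 / p - 1)" "f' \<in> besov \<phi> p (2 / p - 1)" and T: "\<Theta> \<in> besov_fun" and T': "\<Theta>' \<in> besov_fun"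
    and C: "\<And>\<Theta> \<Psi>. \<Theta> \<in> besov_fun \<Longrightarrow> \<Psi> \<in> besov_fun \<Longrightarrow> fnorm (bilinear \<Theta> \<Psi>) \<le> C * fnorm \<Theta> * fnorm \<Psi>"
  shows "fnorm (\<lambda>x. fixed_point_map f \<Theta> x - fixed_point_map f' \<Theta>' x)
    \<le> block_const (normpow (- 1)) (- 1) * besov_norm \<phi> p (2 / p - 1) (f - f') + C * (fnorm \<Theta> + fnorm \<Theta>') * fnorm (\<lambda>x. \<Theta> x - \<Theta>' x)"
proof -
  let ?D = "\<lambda>x. \<Theta> x - \<Theta>' x"
  note D = besov_fun_diff(1)[OF T T']
  note ff = besov_minus(1)[OF f]
  have "(\<lambda>x. fixed_point_map f \<Theta> x - fixed_point_map f' \<Theta>' x) = (\<lambda>x. inv_half_lap (f - f') x - (bilinear ?D \<Theta> x + bilinear \<Theta>' ?D x))"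
    unfolding bilinear_diff(1)[OF T T' T] bilinear_diff(2)[OF T T' T'] inv_half_lap_diff[OF f] fixed_point_map_def by (simp add: fun_eq_iff)
  moreover have "fnorm (\<lambda>x. inv_half_lap (f - f') x - (bilinear ?D \<Theta> x + bilinear \<Theta>' ?D x)) \<le> fnorm (inv_half_lap (f - f')) + (fnorm (bilinear ?D \<Theta>) + fnorm (bilinear \<Theta>' ?D))"
    using besov_fun_diff(2)[OF besov_fun_inv_half_lap(1)[OF ff] besov_fun_add(1)[OF besov_fun_bilinear[OF D T] besov_fun_bilinear[OF T' D]]] besov_fun_add(2)[OF besov_fun_bilinear[OF D T] besov_fun_bilinear[OF T' D]]
    by linarith
  ultimately show ?thesis
    using besov_fun_inv_half_lap(2)[OF ff] C[OF D T] C[OF T' D] by (simp add: algebra_simps)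
qed

section \<open>Equivalence with the equation\<close>

lemma velocity_distr_of:
  assumes T: "\<Theta> \<in> besov_fun" and g: "schwartz g"
  shows "velocity \<phi> (distr_of \<Theta>) k g = pairing (velocity_fun k \<Theta>) g"
  unfolding velocity_def hom_op_def velocity_ker velocity_fun_def
  by (rule infsumI) (rule pairing_multiplier[OF admissible_velocity_symbol homogeneous_velocity_symbol one_symbol_degree besov_fun_D(4)[OF T] g])

lemma represents_velocity: "\<Theta> \<in> besov_fun \<Longrightarrow> represents (velocity_fun k \<Theta>) (velocity \<phi> (distr_of \<Theta>) k)"
  using bdd_meas_velocity_fun[of \<Theta> k] velocity_distr_of unfolding represents_def bdd_meas_def by blast

text \<open>The solution concept allows arbitrary bounded representatives; they agree almost everywhere with the
  continuous ones.\<close>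

lemma pairing_represents_cong:
  assumes T: "\<Theta> \<in> besov_fun" and R: "represents \<Theta>' (distr_of \<Theta>)" and V: "represents V (velocity \<phi> (distr_of \<Theta>) k)" and h: "schwartz h"
  shows "pairing (\<lambda>x. V x * \<Theta>' x) h = pairing (flux k \<Theta> \<Theta>) h"
proof -
  have bT: "bdd_meas \<Theta>'" and bV: "bdd_meas V" using R V unfolding represents_def bdd_meas_def by auto
  have "AE x in lborel. \<Theta>' x - \<Theta> x = 0"
  proof (rule bdd_meas_AE_0[OF bdd_meas_diff[OF bT besov_fun_D(1)[OF T]]])
    fix g assume g: "schwartz g"
    have "distr_of \<Theta> g = pairing \<Theta>' g" using R g unfolding represents_def by blast
    then show "pairing (\<lambda>x. \<Theta>' x - \<Theta> x) g = 0"
      using g pairing_diff1[OF bT besov_fun_D(1)[OF T] g] by (simp add: distr_of_def)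
  qed
  moreover have "AE x in lborel. V x - velocity_fun k \<Theta> x = 0"
  proof (rule bdd_meas_AE_0[OF bdd_meas_diff[OF bV bdd_meas_velocity_fun[OF T]]])
    fix g assume g: "schwartz g"
    have "velocity \<phi> (distr_of \<Theta>) k g = pairing V g" using V g unfolding represents_def by blast
    then show "pairing (\<lambda>x. V x - velocity_fun k \<Theta> x) g = 0"
      using velocity_distr_of[OF T g] pairing_diff1[OF bV bdd_meas_velocity_fun[OF T] g] by simp
  qed
  ultimately have ae: "AE x in lborel. V x * \<Theta>' x * h x = flux k \<Theta> \<Theta> x * h x"
    by eventually_elim (simp add: flux_def)
  note [measurable] = bdd_measD(1)[OF bT] bdd_measD(1)[OF bV] bdd_measD(1)[OF bdd_meas_flux[OF T T, of k]] schwartz_measurable[OF h]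
  show ?thesis unfolding pairing_def by (rule integral_cong_AE[OF _ _ ae]) measurable
qed

text \<open>The equation for the particular representatives that the calculus of multipliers provides.\<close>

definition weak_eq :: "distr \<Rightarrow> (plane \<Rightarrow> complex) \<Rightarrow> bool" where
  "weak_eq f \<Theta> \<longleftrightarrow> (\<forall>g. schwartz g \<longrightarrow>
     hom_op \<phi> (frac_lap (1 / 2)) (distr_of \<Theta>) g - (\<Sum>k\<in>UNIV. pairing (flux k \<Theta> \<Theta>) (pd k g)) = f g)"

lemma qg_solution_iff:
  assumes T: "\<Theta> \<in> besov_fun"
  shows "qg_solution \<phi> f (distr_of \<Theta>) \<longleftrightarrow> weak_eq f \<Theta>"
proof
  assume "qg_solution \<phi> f (distr_of \<Theta>)"
  then obtain \<Theta>' V where R: "represents \<Theta>' (distr_of \<Theta>)" "\<And>k. represents (V k) (velocity \<phi> (distr_of \<Theta>) k)"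
    and e: "\<And>g. schwartz g \<Longrightarrow> hom_op \<phi> (frac_lap (1/2)) (distr_of \<Theta>) g - (\<Sum>k\<in>UNIV. pairing (\<lambda>x. V k x * \<Theta>' x) (pd k g)) = f g"
    unfolding qg_solution_def by blast
  show "weak_eq f \<Theta>"
    unfolding weak_eq_def
  proof (intro allI impI)
    fix g assume g: "schwartz g"
    have "(\<Sum>k\<in>UNIV. pairing (flux k \<Theta> \<Theta>) (pd k g)) = (\<Sum>k\<in>UNIV. pairing (\<lambda>x. V k x * \<Theta>' x) (pd k g))"
      by (intro sum.cong refl pairing_represents_cong[OF T R, symmetric] schwartz_pd g)
    then show "hom_op \<phi> (frac_lap (1/2)) (distr_of \<Theta>) g - (\<Sum>k\<in>UNIV. pairing (flux k \<Theta> \<Theta>) (pd k g)) = f g"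
      using e[OF g] by simp
  qed
next
  assume "weak_eq f \<Theta>"
  then show "qg_solution \<phi> f (distr_of \<Theta>)"
    unfolding qg_solution_def weak_eq_def flux_def
    by (intro exI[of _ \<Theta>] exI[of _ "\<lambda>k. velocity_fun k \<Theta>"] conjI allI represents_distr_of[OF besov_fun_D(1)[OF T]] represents_velocity[OF T]) blast
qed

text \<open>From the equation to the fixed point: tested against the reflected kernel of \<open>(-\<Delta>)\<^bsup>-1/2\<^esup>\<close> at frequency
  \<open>2\<^sup>l\<close>, it expresses the \<open>l\<close>-th block of \<open>\<Theta>\<close> by those of \<open>f\<close> and of the flux, and these identities are summed
  over \<open>l\<close>. Conversely, \<open>(-\<Delta>)\<^bsup>1/2\<^esup>\<close> is applied to the blocks of the fixed point; paired with a Schwartz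
  function, the blocks of \<open>f\<close> add up to \<open>f\<close> by membership in the Besov space, and those of the divergence
  of the flux add up by lemma \<open>divergence_pairing\<close>.\<close>

lemma weak_eq_iff_fixed_point:
  assumes f: "f \<in> besov \<phi> p (2 / p - 1)" and T: "\<Theta> \<in> besov_fun"
  shows "weak_eq f \<Theta> \<longleftrightarrow> fixed_point_map f \<Theta> = \<Theta>"
proof
  note tf = besov_tempered[OF f]
  note tT = tempered_distr_of[OF besov_fun_D(1)[OF T]]
  note bF = bdd_meas_flux[OF T T]
  note tF = tempered_distr_of[OF bF]
  note adi = admissible_normpow[of "- 1"] and ad1 = admissible_normpow[of 1]
  obtain \<kappa> where \<kappa>: "\<And>k. besov_le (2 / p) (distr_of (flux k \<Theta> \<Theta>)) (\<kappa> k)"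
  proof -
    have "\<forall>k. \<exists>\<kappa>. besov_le (2 / p) (distr_of (flux k \<Theta> \<Theta>)) \<kappa>" using flux_besov_le[OF T T] by blast
    from choice[OF this] show ?thesis using that by blast
  qed
  show "fixed_point_map f \<Theta> = \<Theta>" if eq: "weak_eq f \<Theta>"
  proof -
    have block: "conv (ker one_symbol l) (distr_of \<Theta>) x
        = conv (ker (normpow (- 1)) l) f x - (conv (ker (riesz_symbol 1) l) (distr_of (flux 1 \<Theta> \<Theta>)) x + conv (ker (riesz_symbol 2) l) (distr_of (flux 2 \<Theta> \<Theta>)) x)" for l x
    proof -
      let ?K = "ker (normpow (- 1)) l"
      let ?g = "\<lambda>y. ?K (x - y)"
      have sK: "schwartz ?K" by (rule schwartz_ker[OF adi])
      have sg: "schwartz ?g" by (rule schwartz_reflect[OF sK])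
      have "hom_op \<phi> (frac_lap (1/2)) (distr_of \<Theta>) ?g = conv (ker one_symbol l) (distr_of \<Theta>) x"
      proof -
        have "pairing (conv (ker (normpow 1) j) (distr_of \<Theta>)) ?g = sconv ?K (conv (ker (normpow 1) j) (distr_of \<Theta>)) x" for j
          unfolding pairing_def sconv_def by (simp add: mult.commute)
        then show ?thesis
          unfolding hom_op_def dissipation_ker
          using infsumI[OF ker_conv_has_sum(2)[OF tT adi ad1, of l x]] by (simp only: ker_normpow_cancel)
      qed
      moreover have "pairing (flux k \<Theta> \<Theta>) (pd k ?g) = - conv (ker (riesz_symbol k) l) (distr_of (flux k \<Theta> \<Theta>)) x" for k
      proof -
        have "pd k ?g = (\<lambda>y. - ker (riesz_symbol k) l (x - y))"
          by (rule ext) (simp only: pd_reflect[OF sK] pd_ker_inv)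
        moreover have "schwartz (\<lambda>y. ker (riesz_symbol k) l (x - y))" by (intro schwartz_reflect schwartz_ker admissible_riesz_symbol)
        ultimately show ?thesis by (simp add: pairing_minus2 conv_def distr_of_def)
      qed
      moreover have "f ?g = conv ?K f x" unfolding conv_def ..
      moreover have "hom_op \<phi> (frac_lap (1/2)) (distr_of \<Theta>) ?g - (\<Sum>k\<in>UNIV. pairing (flux k \<Theta> \<Theta>) (pd k ?g)) = f ?g"
        using eq sg unfolding weak_eq_def by blast
      ultimately show ?thesis by (simp only: sum_2) (simp add: algebra_simps)
    qed
    show ?thesis
    proof
      fix x
      have "((\<lambda>l. conv (ker (normpow (- 1)) l) f x - (conv (ker (riesz_symbol 1) l) (distr_of (flux 1 \<Theta> \<Theta>)) x + conv (ker (riesz_symbol 2) l) (distr_of (flux 2 \<Theta> \<Theta>)) x))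
          has_sum fixed_point_map f \<Theta> x) UNIV"
        unfolding fixed_point_map_def inv_half_lap_def bilinear_def
        by (intro has_sum_diff has_sum_add multiplier_has_sum[OF admissible_normpow homogeneous_normpow inv_degree besov_le_weighted_block[OF f]]
             multiplier_has_sum[OF admissible_riesz_symbol homogeneous_riesz_symbol one_symbol_degree \<kappa>])
      moreover have "((\<lambda>l. conv (ker one_symbol l) (distr_of \<Theta>) x) has_sum \<Theta> x) UNIV"
        using multiplier_has_sum[OF one_symbol_admissible one_symbol_homogeneous one_symbol_degree besov_fun_D(4)[OF T], of x] unfolding besov_fun_D(3)[OF T] .
      ultimately show "fixed_point_map f \<Theta> x = \<Theta> x" unfolding block using has_sum_unique by blast
    qed
  qed
  show "weak_eq f \<Theta>" if fp: "fixed_point_map f \<Theta> = \<Theta>"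
  proof -
    have block: "conv (ker (normpow 1) j) (distr_of \<Theta>) x
        = conv (ker one_symbol j) f x - (conv (ker (deriv_symbol 1) j) (distr_of (flux 1 \<Theta> \<Theta>)) x + conv (ker (deriv_symbol 2) j) (distr_of (flux 2 \<Theta> \<Theta>)) x)" for j x
    proof -
      let ?R = "\<lambda>k. multiplier (riesz_symbol k) (distr_of (flux k \<Theta> \<Theta>))"
      have bl: "bdd_meas (inv_half_lap f)" by (rule besov_fun_D(1)[OF besov_fun_inv_half_lap(1)[OF f]])
      have bR: "bdd_meas (?R k)" for k by (rule besov_fun_D(1)[OF besov_fun_flux_term[OF T T]])
      have r: "distr_of \<Theta> = distr_of (inv_half_lap f) - distr_of (\<lambda>x. ?R 1 x + ?R 2 x)"
        using distr_of_diff[OF bl bdd_meas_add[OF bR bR], of 1 2] fp unfolding fixed_point_map_def bilinear_def by simp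
      have cR: "conv (ker (normpow 1) j) (distr_of (?R k)) x = conv (ker (deriv_symbol k) j) (distr_of (flux k \<Theta> \<Theta>)) x" for k
        unfolding conv_multiplier[OF admissible_riesz_symbol homogeneous_riesz_symbol one_symbol_degree \<kappa> ad1] ker_normpow_riesz_symbol ..
      have cl: "conv (ker (normpow 1) j) (distr_of (inv_half_lap f)) x = conv (ker one_symbol j) f x"
        unfolding inv_half_lap_def conv_multiplier[OF admissible_normpow homogeneous_normpow inv_degree besov_le_weighted_block[OF f] ad1] ker_normpow_cancel ..
      have ca: "conv (ker (normpow 1) j) (distr_of (\<lambda>x. ?R 1 x + ?R 2 x)) x = conv (ker (normpow 1) j) (distr_of (?R 1)) x + conv (ker (normpow 1) j) (distr_of (?R 2)) x"
        unfolding conv_def distr_of_add[OF bR bR] ..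
      show ?thesis unfolding r conv_minus ca cR cl ..
    qed
    show ?thesis
      unfolding weak_eq_def
    proof (intro allI impI)
      fix g assume g: "schwartz g"
      have i: "integrable lborel (\<lambda>x. conv (ker one_symbol j) f x * g x)" for j
        by (intro conv_pairing_integrable tf schwartz_ker one_symbol_admissible g)
      have iF: "integrable lborel (\<lambda>x. conv (ker (deriv_symbol k) j) (distr_of (flux k \<Theta> \<Theta>)) x * g x)" for j k
        by (intro conv_pairing_integrable tF schwartz_ker admissible_deriv_symbol g)
      have "pairing (conv (ker (normpow 1) j) (distr_of \<Theta>)) g = pairing (conv (ker one_symbol j) f) g
          - (pairing (conv (ker (deriv_symbol 1) j) (distr_of (flux 1 \<Theta> \<Theta>))) g + pairing (conv (ker (deriv_symbol 2) j) (distr_of (flux 2 \<Theta> \<Theta>))) g)" for j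
        unfolding pairing_def block using i iF by (simp add: left_diff_distrib distrib_right)
      moreover have "((\<lambda>j. pairing (conv (ker one_symbol j) f) g
          - (pairing (conv (ker (deriv_symbol 1) j) (distr_of (flux 1 \<Theta> \<Theta>))) g + pairing (conv (ker (deriv_symbol 2) j) (distr_of (flux 2 \<Theta> \<Theta>))) g))
          has_sum (f g - (- pairing (flux 1 \<Theta> \<Theta>) (pd 1 g) + - pairing (flux 2 \<Theta> \<Theta>) (pd 2 g)))) UNIV"
      proof (intro has_sum_diff has_sum_add divergence_pairing[OF g bF])
        show "((\<lambda>j. pairing (conv (ker one_symbol j) f) g) has_sum f g) UNIV"
          using f g unfolding besov_def lp_block_eq_ker by blast
      qed
      ultimately have "hom_op \<phi> (frac_lap (1/2)) (distr_of \<Theta>) g = f g - (- pairing (flux 1 \<Theta> \<Theta>) (pd 1 g) + - pairing (flux 2 \<Theta> \<Theta>) (pd 2 g))"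
        unfolding hom_op_def dissipation_ker using infsumI by simp
      then show "hom_op \<phi> (frac_lap (1/2)) (distr_of \<Theta>) g - (\<Sum>k\<in>UNIV. pairing (flux k \<Theta> \<Theta>) (pd k g)) = f g"
        by (simp only: sum_2) simp
    qed
  qed
qed

lemma small_solution_iff:
  assumes f: "f \<in> besov \<phi> p (2 / p - 1)"
  shows "small_solution \<phi> p \<eta> f \<theta> \<longleftrightarrow> (\<exists>\<Theta>\<in>besov_fun. \<theta> = distr_of \<Theta> \<and> fnorm \<Theta> \<le> \<eta> \<and> fixed_point_map f \<Theta> = \<Theta>)"
proof
  assume s: "small_solution \<phi> p \<eta> f \<theta>"
  then have b: "\<theta> \<in> besov \<phi> p (2 / p)" unfolding small_solution_def by blast
  let ?T = "multiplier one_symbol \<theta>"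
  have T: "?T \<in> besov_fun" by (rule besov_fun_multiplier(1)[OF one_symbol_admissible one_symbol_homogeneous one_symbol_degree besov_le_weighted_block[OF b]])
  have r: "distr_of ?T = \<theta>" by (rule distr_of_multiplier_one_symbol[OF b])
  show "\<exists>\<Theta>\<in>besov_fun. \<theta> = distr_of \<Theta> \<and> fnorm \<Theta> \<le> \<eta> \<and> fixed_point_map f \<Theta> = \<Theta>"
    using s T r qg_solution_iff[OF T, of f] weak_eq_iff_fixed_point[OF f T] unfolding small_solution_def fnorm_def by (intro bexI[of _ ?T]) auto
next
  assume "\<exists>\<Theta>\<in>besov_fun. \<theta> = distr_of \<Theta> \<and> fnorm \<Theta> \<le> \<eta> \<and> fixed_point_map f \<Theta> = \<Theta>"
  then obtain \<Theta> where T: "\<Theta> \<in> besov_fun" "\<theta> = distr_of \<Theta>" "fnorm \<Theta> \<le> \<eta>" "fixed_point_map f \<Theta> = \<Theta>" by blast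
  then show "small_solution \<phi> p \<eta> f \<theta>"
    using qg_solution_iff[OF T(1), of f] weak_eq_iff_fixed_point[OF f T(1)] besov_fun_D(2)[OF T(1)] unfolding small_solution_def fnorm_def by simp
qed

section \<open>Existence, uniqueness and Lipschitz dependence\<close>

text \<open>Picard iteration from \<open>0\<close>; the increments decay geometrically, and completeness enters
  through the convergence of their series.\<close>

lemma fixed_point_exists:
  assumes maps: "\<And>\<Theta>. \<Theta> \<in> besov_fun \<Longrightarrow> fnorm \<Theta> \<le> \<eta> \<Longrightarrow> T \<Theta> \<in> besov_fun \<and> fnorm (T \<Theta>) \<le> \<eta>"
    and contr: "\<And>\<Theta> \<Psi>. \<Theta> \<in> besov_fun \<Longrightarrow> fnorm \<Theta> \<le> \<eta> \<Longrightarrow> \<Psi> \<in> besov_fun \<Longrightarrow> fnorm \<Psi> \<le> \<eta> \<Longrightarrow> fnorm (\<lambda>x. T \<Theta> x - T \<Psi> x) \<le> 1 / 2 * fnorm (\<lambda>x. \<Theta> x - \<Psi> x)"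
    and eta: "\<eta> \<ge> 0"
  shows "\<exists>\<Theta>\<in>besov_fun. fnorm \<Theta> \<le> \<eta> \<and> T \<Theta> = \<Theta>"
proof -
  define it where "it n = (T ^^ n) (\<lambda>x. 0)" for n
  have it: "it n \<in> besov_fun \<and> fnorm (it n) \<le> \<eta>" for n
    by (induction n) (auto simp: it_def besov_fun_0 eta maps)
  have itT: "it (Suc n) = T (it n)" for n unfolding it_def by simp
  define D where "D n = (\<lambda>x. it (Suc n) x - it n x)" for n
  have DE: "D n \<in> besov_fun" for n unfolding D_def using it by (intro besov_fun_diff(1)) auto
  have ND: "fnorm (D n) \<le> \<eta> * (1 / 2) ^ n" for n
  proof (induction n)
    case 0
    have "D 0 = it 1" unfolding D_def it_def by simp
    then show ?case using it[of 1] by simp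
  next
    case (Suc n)
    have "fnorm (D (Suc n)) \<le> 1 / 2 * fnorm (D n)"
      unfolding D_def itT[of "Suc n"] using contr[of "it (Suc n)" "it n"] it[of n] it[of "Suc n"] by (simp add: itT[of n])
    then show ?case using Suc by simp
  qed
  have gs: "((\<lambda>i. \<eta> * (1 / 2) ^ (i + n)) has_sum (\<eta> * 2 * (1 / 2) ^ n)) UNIV" for n
  proof (rule sums_nonneg_imp_has_sum)
    have "(\<lambda>i. (\<eta> * (1 / 2) ^ n) * (1 / 2) ^ i) sums ((\<eta> * (1 / 2) ^ n) * (1 / (1 - 1 / 2)))"
      by (intro sums_mult geometric_sums) simp
    then show "(\<lambda>i. \<eta> * (1 / 2) ^ (i + n)) sums (\<eta> * 2 * (1 / 2) ^ n)"
      by (simp add: power_add mult_ac)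
  qed (use eta in simp)
  have Ns: "(\<lambda>i. fnorm (D (i + n))) summable_on UNIV" for n
    by (rule summable_on_le(1)[OF _ has_sum_imp_summable[OF gs[of n]]]) (use ND fnorm_nonneg in simp)
  define R where "R n = (\<lambda>x. \<Sum>\<^sub>\<infinity>i. D (i + n) x)" for n
  note R = besov_fun_series[OF DE Ns R_def]
  have NR: "fnorm (R n) \<le> \<eta> * 2 * (1 / 2) ^ n" for n
  proof -
    have "infsum (\<lambda>i. fnorm (D (i + n))) UNIV \<le> infsum (\<lambda>i. \<eta> * (1 / 2) ^ (i + n)) UNIV"
      by (rule infsum_mono[OF Ns has_sum_imp_summable[OF gs]]) (rule ND)
    then show ?thesis using R(3)[of n] infsumI[OF gs[of n]] by linarith
  qed
  define F where "F = R 0"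
  have FR: "R n = (\<lambda>x. F x - it n x)" for n
  proof
    fix x
    have "(\<lambda>i. D (i + 0) x) sums F x" unfolding F_def by (rule has_sum_imp_sums[OF R(1)])
    then have "(\<lambda>i. D (i + n) x) sums (F x - (\<Sum>i<n. D i x))"
      using sums_iff_shift[of "\<lambda>i. D i x" n "F x - (\<Sum>i<n. D i x)"] by simp
    moreover have "(\<Sum>i<n. D i x) = it n x"
      unfolding D_def by (subst sum_lessThan_telescope) (simp add: it_def)
    ultimately show "R n x = F x - it n x"
      using has_sum_imp_sums[OF R(1), of n x] sums_unique2 by metis
  qed
  have FE: "F \<in> besov_fun" unfolding F_def by (rule R(2))
  have lim: "(\<lambda>n. \<eta> * 2 * (1 / 2) ^ n) \<longlonglongrightarrow> 0"
    using tendsto_mult[OF tendsto_const LIMSEQ_realpow_zero[of "1 / 2"], of "\<eta> * 2"] by simp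
  have NF: "fnorm F \<le> \<eta>"
  proof (rule LIMSEQ_le_const[where X="\<lambda>n. \<eta> + \<eta> * 2 * (1 / 2) ^ n"])
    show "(\<lambda>n. \<eta> + \<eta> * 2 * (1 / 2) ^ n) \<longlonglongrightarrow> \<eta>" using tendsto_add[OF tendsto_const lim, of \<eta>] by simp
    have "fnorm F \<le> \<eta> + \<eta> * 2 * (1 / 2) ^ n" for n
    proof -
      have e: "F = (\<lambda>x. it n x + R n x)" unfolding FR by simp
      have "fnorm F \<le> fnorm (it n) + fnorm (R n)" by (subst e) (rule besov_fun_add(2), use it R(2) in auto)
      then show ?thesis using it[of n] NR[of n] by linarith
    qed
    then show "\<exists>M. \<forall>n\<ge>M. fnorm F \<le> \<eta> + \<eta> * 2 * (1 / 2) ^ n" by blast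
  qed
  have TF: "T F \<in> besov_fun" using maps[OF FE NF] by blast
  have "fnorm (\<lambda>x. T F x - F x) \<le> 0"
  proof (rule LIMSEQ_le_const[where X="\<lambda>n. 2 * (\<eta> * 2 * (1 / 2) ^ n)"])
    show "(\<lambda>n. 2 * (\<eta> * 2 * (1 / 2) ^ n)) \<longlonglongrightarrow> 0" using tendsto_mult[OF tendsto_const lim, of 2] by simp
    have "fnorm (\<lambda>x. T F x - F x) \<le> 2 * (\<eta> * 2 * (1 / 2) ^ n)" for n
    proof -
      have s: "it (Suc n) = T (it n)" unfolding it_def by simp
      have E1: "(\<lambda>x. T F x - T (it n) x) \<in> besov_fun" using TF it[of "Suc n"] s by (intro besov_fun_diff(1)) auto
      have "(\<lambda>x. T F x - F x) = (\<lambda>x. (T F x - T (it n) x) - R (Suc n) x)" unfolding FR s by simp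
      then have "fnorm (\<lambda>x. T F x - F x) \<le> fnorm (\<lambda>x. T F x - T (it n) x) + fnorm (R (Suc n))"
        using besov_fun_diff(2)[OF E1 R(2)] by simp
      moreover have "fnorm (\<lambda>x. T F x - T (it n) x) \<le> 1 / 2 * fnorm (R n)"
        unfolding FR using contr[OF FE NF] it[of n] by blast
      moreover have "\<eta> * 2 * (1 / 2) ^ Suc n \<le> \<eta> * 2 * (1 / 2) ^ n"
        using eta by (intro mult_left_mono power_decreasing) auto
      ultimately show ?thesis using NR[of n] NR[of "Suc n"] fnorm_nonneg[of "R n"] by linarith
    qed
    then show "\<exists>M. \<forall>n\<ge>M. fnorm (\<lambda>x. T F x - F x) \<le> 2 * (\<eta> * 2 * (1 / 2) ^ n)" by blast
  qed
  then have "fnorm (\<lambda>x. T F x - F x) = 0" using fnorm_nonneg[of "\<lambda>x. T F x - F x"] by linarith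
  then have "T F = F" by (rule fnorm_eq_0[OF TF FE])
  then show ?thesis using FE NF by blast
qed

lemma well_posedness:
  "\<exists>\<delta>>0. \<exists>\<eta>>0.
    (\<forall>f \<in> besov \<phi> p (2 / p - 1). besov_norm \<phi> p (2 / p - 1) f \<le> \<delta> \<longrightarrow>
       (\<exists>!\<theta>. small_solution \<phi> p \<eta> f \<theta>)) \<and>
    (\<exists>L\<ge>0. \<forall>f\<^sub>1 \<in> besov \<phi> p (2 / p - 1). \<forall>f\<^sub>2 \<in> besov \<phi> p (2 / p - 1).
       besov_norm \<phi> p (2 / p - 1) f\<^sub>1 \<le> \<delta> \<longrightarrow> besov_norm \<phi> p (2 / p - 1) f\<^sub>2 \<le> \<delta> \<longrightarrow>
       besov_norm \<phi> p (2 / p) (data_to_solution \<phi> p \<eta> f\<^sub>1 - data_to_solution \<phi> p \<eta> f\<^sub>2)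
         \<le> L * besov_norm \<phi> p (2 / p - 1) (f\<^sub>1 - f\<^sub>2))"
proof -
  obtain C where C0: "C \<ge> 0" and C: "\<And>\<Theta> \<Psi>. \<Theta> \<in> besov_fun \<Longrightarrow> \<Psi> \<in> besov_fun \<Longrightarrow> fnorm (bilinear \<Theta> \<Psi>) \<le> C * fnorm \<Theta> * fnorm \<Psi>"
    using bilinear_estimate by blast
  define A where "A = block_const (normpow (- 1)) (- 1)"
  have A0: "A \<ge> 0" unfolding A_def by (rule block_const(1)[OF admissible_normpow homogeneous_normpow])
  \<comment> \<open>On the ball of radius \<open>\<eta>\<close> the quadratic part has Lipschitz constant \<open>2 C \<eta> \<le> 1/2\<close>; with \<open>A \<delta> \<le> \<eta> / 2\<close> the
    map preserves that ball.\<close>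
  define \<eta> where "\<eta> = 1 / (4 * (C + 1))"
  define \<delta> where "\<delta> = \<eta> / (2 * (A + 1))"
  have \<eta>: "\<eta> > 0" unfolding \<eta>_def using C0 by simp
  have \<delta>: "\<delta> > 0" unfolding \<delta>_def using A0 \<eta> by simp
  have C\<eta>: "C * \<eta> \<le> 1 / 4" unfolding \<eta>_def using C0 by (simp add: field_simps)
  have A\<delta>: "A * \<delta> \<le> \<eta> / 2" unfolding \<delta>_def using A0 \<eta> by (simp add: field_simps)
  let ?B = "besov \<phi> p (2 / p - 1)" and ?n = "besov_norm \<phi> p (2 / p - 1)"
  have diff: "fnorm (\<lambda>x. fixed_point_map f \<Theta> x - fixed_point_map f' \<Psi> x) \<le> A * ?n (f - f') + 1 / 2 * fnorm (\<lambda>x. \<Theta> x - \<Psi> x)"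
    if f: "f \<in> ?B" "f' \<in> ?B" and T: "\<Theta> \<in> besov_fun" "fnorm \<Theta> \<le> \<eta>" and P: "\<Psi> \<in> besov_fun" "fnorm \<Psi> \<le> \<eta>" for f f' \<Theta> \<Psi>
  proof -
    have "C * (fnorm \<Theta> + fnorm \<Psi>) \<le> C * (\<eta> + \<eta>)" using T P C0 by (intro mult_left_mono add_mono) auto
    also have "\<dots> \<le> 1 / 2" using C\<eta> by (simp add: distrib_left)
    finally have "C * (fnorm \<Theta> + fnorm \<Psi>) * fnorm (\<lambda>x. \<Theta> x - \<Psi> x) \<le> 1 / 2 * fnorm (\<lambda>x. \<Theta> x - \<Psi> x)"
      by (rule mult_right_mono) (rule fnorm_nonneg)
    then show ?thesis using fixed_point_map_diff[OF f T(1) P(1) C] unfolding A_def by linarith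
  qed
  have zero: "?n (f - f) = 0" if f: "f \<in> ?B" for f
  proof -
    have c: "conv h (f - f) = (\<lambda>x. 0)" for h unfolding conv_def by simp
    show ?thesis unfolding besov_norm_def c Lp_norm_def by simp
  qed
  have maps: "fixed_point_map f \<Theta> \<in> besov_fun \<and> fnorm (fixed_point_map f \<Theta>) \<le> \<eta>" if f: "f \<in> ?B" "?n f \<le> \<delta>" and T: "\<Theta> \<in> besov_fun" "fnorm \<Theta> \<le> \<eta>" for f \<Theta>
  proof
    show "fixed_point_map f \<Theta> \<in> besov_fun" by (rule besov_fun_fixed_point_map[OF f(1) T(1)])
    have "fnorm (fixed_point_map f \<Theta>) \<le> fnorm (inv_half_lap f) + fnorm (bilinear \<Theta> \<Theta>)"
      unfolding fixed_point_map_def by (rule besov_fun_diff(2)[OF besov_fun_inv_half_lap(1)[OF f(1)] besov_fun_bilinear[OF T(1) T(1)]])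
    moreover have "fnorm (inv_half_lap f) \<le> A * \<delta>"
      using besov_fun_inv_half_lap(2)[OF f(1)] mult_left_mono[OF f(2) A0] unfolding A_def by linarith
    moreover have "fnorm (bilinear \<Theta> \<Theta>) \<le> \<eta> / 4"
    proof -
      have "C * fnorm \<Theta> * fnorm \<Theta> \<le> C * \<eta> * \<eta>" using T(2) C0 \<eta> fnorm_nonneg[of \<Theta>] by (intro mult_mono) auto
      also have "\<dots> \<le> 1 / 4 * \<eta>" using C\<eta> \<eta> by (intro mult_right_mono) auto
      finally show ?thesis using C[OF T(1) T(1)] by simp
    qed
    ultimately show "fnorm (fixed_point_map f \<Theta>) \<le> \<eta>" using A\<delta> \<eta> by linarith
  qed
  have lip: "fnorm (\<lambda>x. \<Theta> x - \<Psi> x) \<le> 2 * A * ?n (f - f')"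
    if f: "f \<in> ?B" "f' \<in> ?B" and T: "\<Theta> \<in> besov_fun" "fnorm \<Theta> \<le> \<eta>" "fixed_point_map f \<Theta> = \<Theta>" and P: "\<Psi> \<in> besov_fun" "fnorm \<Psi> \<le> \<eta>" "fixed_point_map f' \<Psi> = \<Psi>" for f f' \<Theta> \<Psi>
    using diff[OF f T(1,2) P(1,2)] unfolding T(3) P(3) by simp
  have ex: "\<exists>\<Theta>\<in>besov_fun. fnorm \<Theta> \<le> \<eta> \<and> fixed_point_map f \<Theta> = \<Theta>" if f: "f \<in> ?B" "?n f \<le> \<delta>" for f
  proof (rule fixed_point_exists)
    show "fnorm (\<lambda>x. fixed_point_map f \<Theta> x - fixed_point_map f \<Psi> x) \<le> 1 / 2 * fnorm (\<lambda>x. \<Theta> x - \<Psi> x)"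
      if "\<Theta> \<in> besov_fun" "fnorm \<Theta> \<le> \<eta>" "\<Psi> \<in> besov_fun" "fnorm \<Psi> \<le> \<eta>" for \<Theta> \<Psi>
      using diff[OF f(1) f(1) that] zero[OF f(1)] by simp
  qed (use maps[OF f] \<eta> in auto)
  have uniq: "\<exists>!\<theta>. small_solution \<phi> p \<eta> f \<theta>" if f: "f \<in> ?B" "?n f \<le> \<delta>" for f
  proof -
    obtain \<Theta> where T: "\<Theta> \<in> besov_fun" "fnorm \<Theta> \<le> \<eta>" "fixed_point_map f \<Theta> = \<Theta>" using ex[OF f] by blast
    show ?thesis
    proof (rule ex1I[of _ "distr_of \<Theta>"])
      show "small_solution \<phi> p \<eta> f (distr_of \<Theta>)" using T small_solution_iff[OF f(1)] by blast
      fix \<theta> assume "small_solution \<phi> p \<eta> f \<theta>"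
      then obtain \<Psi> where P: "\<Psi> \<in> besov_fun" "fnorm \<Psi> \<le> \<eta>" "fixed_point_map f \<Psi> = \<Psi>" "\<theta> = distr_of \<Psi>" using small_solution_iff[OF f(1)] by blast
      have "fnorm (\<lambda>x. \<Psi> x - \<Theta> x) = 0"
        using lip[OF f(1) f(1) P(1-3) T] zero[OF f(1)] fnorm_nonneg[of "\<lambda>x. \<Psi> x - \<Theta> x"] by simp
      then have "\<Psi> = \<Theta>" by (rule fnorm_eq_0[OF P(1) T(1)])
      then show "\<theta> = distr_of \<Theta>" using P(4) by simp
    qed
  qed
  have "besov_norm \<phi> p (2 / p) (data_to_solution \<phi> p \<eta> f - data_to_solution \<phi> p \<eta> f') \<le> 2 * A * ?n (f - f')"
    if f: "f \<in> ?B" "?n f \<le> \<delta>" and f': "f' \<in> ?B" "?n f' \<le> \<delta>" for f f'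
  proof -
    have "small_solution \<phi> p \<eta> f (data_to_solution \<phi> p \<eta> f)" "small_solution \<phi> p \<eta> f' (data_to_solution \<phi> p \<eta> f')"
      unfolding data_to_solution_def by (rule theI'[OF uniq[OF f]], rule theI'[OF uniq[OF f']])
    note sol = this[unfolded small_solution_iff[OF f(1)] small_solution_iff[OF f'(1)]]
    obtain \<Theta> where T: "\<Theta> \<in> besov_fun" "fnorm \<Theta> \<le> \<eta>" "fixed_point_map f \<Theta> = \<Theta>" "data_to_solution \<phi> p \<eta> f = distr_of \<Theta>"
      using sol(1) by (elim bexE conjE) (rule that)
    obtain \<Psi> where P: "\<Psi> \<in> besov_fun" "fnorm \<Psi> \<le> \<eta>" "fixed_point_map f' \<Psi> = \<Psi>" "data_to_solution \<phi> p \<eta> f' = distr_of \<Psi>"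
      using sol(2) by (elim bexE conjE) (rule that)
    have "besov_norm \<phi> p (2 / p) (distr_of \<Theta> - distr_of \<Psi>) = fnorm (\<lambda>x. \<Theta> x - \<Psi> x)"
      unfolding fnorm_def besov_fun_diff(3)[OF T(1) P(1)] ..
    then show ?thesis unfolding T(4) P(4) using lip[OF f(1) f'(1) T(1-3) P(1-3)] by simp
  qed
  then have lipschitz: "\<exists>L\<ge>0. \<forall>f\<^sub>1 \<in> ?B. \<forall>f\<^sub>2 \<in> ?B. ?n f\<^sub>1 \<le> \<delta> \<longrightarrow> ?n f\<^sub>2 \<le> \<delta> \<longrightarrow>
       besov_norm \<phi> p (2 / p) (data_to_solution \<phi> p \<eta> f\<^sub>1 - data_to_solution \<phi> p \<eta> f\<^sub>2) \<le> L * ?n (f\<^sub>1 - f\<^sub>2)"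
    using A0 by (intro exI[of _ "2 * A"]) auto
  have exu: "\<forall>f \<in> ?B. ?n f \<le> \<delta> \<longrightarrow> (\<exists>!\<theta>. small_solution \<phi> p \<eta> f \<theta>)"
    by (intro ballI impI uniq)
  show ?thesis
    by (rule exI[of _ \<delta>], rule conjI[OF \<delta>], rule exI[of _ \<eta>], rule conjI[OF \<eta> conjI[OF exu lipschitz]])
qed

end

theorem theorem1p6:
  fixes \<phi> :: "real ^ 2 \<Rightarrow> complex" and p :: real
  assumes "littlewood_paley \<phi>" and "1 \<le> p"
  shows "\<exists>\<delta>>0. \<exists>\<eta>>0.
    (\<forall>f \<in> besov \<phi> p (2 / p - 1). besov_norm \<phi> p (2 / p - 1) f \<le> \<delta> \<longrightarrow>
       (\<exists>!\<theta>. small_solution \<phi> p \<eta> f \<theta>)) \<and>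
    (\<exists>L\<ge>0. \<forall>f\<^sub>1 \<in> besov \<phi> p (2 / p - 1). \<forall>f\<^sub>2 \<in> besov \<phi> p (2 / p - 1).
       besov_norm \<phi> p (2 / p - 1) f\<^sub>1 \<le> \<delta> \<longrightarrow> besov_norm \<phi> p (2 / p - 1) f\<^sub>2 \<le> \<delta> \<longrightarrow>
       besov_norm \<phi> p (2 / p) (data_to_solution \<phi> p \<eta> f\<^sub>1 - data_to_solution \<phi> p \<eta> f\<^sub>2)
         \<le> L * besov_norm \<phi> p (2 / p - 1) (f\<^sub>1 - f\<^sub>2))"
proof -
  interpret besov_setting \<phi> p
    using assms by unfold_locales
  show ?thesis by (rule well_posedness)
qed

end
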